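(* Let $p_1$ and $p_2$ be two multiplicatively independent natural numbers. Let $f\in\mathbb{C}[[x]]$ be a $p_1$-Mahler function and let $g\in\mathbb{C}[[x]]$ be a $p_2$-Mahler function. Then $f$ and $g$ are algebraically independent over $\mathbb{C}(x)$, unless one of them is a rational function.
   Context: For an integer $p\ge2$, a power series $f(x)\in\mathbb{C}[[x]]$ is a $p$-Mahler function if there exist polynomials $a_0(x),\dots,a_n(x)\in\mathbb{C}[x]$, not all zero, such that $a_0(x)f(x)+a_1(x)f(x^p)+\cdots+a_n(x)f(x^{p^n})=0$. Two natural numbers $p_1,p_2$ are multiplicatively independent if $p_1^{a}p_2^{b}=1$ with $a,b\in\mathbb{Z}$ implies $a=b=0$. *)

theory Defs
  imports "HOL-Computational_Algebra.Computational_Algebra"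
begin

definition is_mahler :: "nat \<Rightarrow> complex fps \<Rightarrow> bool" where
  "is_mahler p f \<longleftrightarrow> p \<ge> 2 \<and>
     (\<exists>n::nat. \<exists>a :: nat \<Rightarrow> complex poly. (\<exists>i\<le>n. a i \<noteq> 0) \<and>
        (\<Sum>i\<le>n. fps_of_poly (a i) * fps_compose f (fps_X ^ (p ^ i))) = 0)"

definition mult_independent :: "nat \<Rightarrow> nat \<Rightarrow> bool" where
  "mult_independent p1 p2 \<longleftrightarrow>
     (\<forall>a b :: int. (real p1) powi a * (real p2) powi b = 1 \<longrightarrow> a = 0 \<and> b = 0)"

definition is_rational_fps :: "complex fps \<Rightarrow> bool" where
  "is_rational_fps f \<longleftrightarrow> (\<exists>P Q :: complex poly. Q \<noteq> 0 \<and> fps_of_poly Q * f = fps_of_poly P)"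

text \<open>f, g algebraically dependent over C(x): some nonzero bivariate polynomial
  with coefficients in C(x) (denominators cleared, so coefficients in C[x])
  vanishes at (f, g). The polynomial is sum_{i,j\<le>N} c_{ij}(x) Y^i Z^j.\<close>
definition alg_dependent_fps :: "complex fps \<Rightarrow> complex fps \<Rightarrow> bool" where
  "alg_dependent_fps f g \<longleftrightarrow>
     (\<exists>N::nat. \<exists>c :: nat \<Rightarrow> nat \<Rightarrow> complex poly. (\<exists>i\<le>N. \<exists>j\<le>N. c i j \<noteq> 0) \<and>
        (\<Sum>i\<le>N. \<Sum>j\<le>N. fps_of_poly (c i j) * f ^ i * g ^ j) = 0)"

definition alg_independent_fps :: "complex fps \<Rightarrow> complex fps \<Rightarrow> bool" where
  "alg_independent_fps f g \<longleftrightarrow> \<not> alg_dependent_fps f g"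

end

theory Submission
  imports Defs "HOL-Complex_Analysis.Complex_Analysis" "HOL-Real_Asymp.Real_Asymp"
    "HOL-Number_Theory.Number_Theory" "Jordan_Normal_Form.Spectral_Radius"
begin

text \<open>
  After multiplication by an infinite product \<open>H\<close>, a Mahler function becomes a power series \<open>F = H f\<close> converging in the
  unit disc. Near a root of unity \<open>\<zeta>\<close> of large prime order \<open>N\<close>, in the coordinate \<open>x = \<zeta> exp (- e\<^sup>-\<^sup>s)\<close>, the
  functional equation for \<open>x \<mapsto> x\<^sup>P\<close> with \<open>P = p\<^sup>N\<^sup>-\<^sup>1\<close> is a linear difference equation with step \<open>L = ln P\<close>, and \<open>F\<close> is a
  finite sum of terms \<open>h(e\<^sup>-\<^sup>s) e\<^sup>-\<^sup>\<lambda>\<^sup>s s\<^sup>l m(s)\<close> with \<open>h\<close> holomorphic at \<open>0\<close> and \<open>m\<close> periodic with period \<open>L\<close>. For two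
  multiplicatively independent bases the ratio of the periods is irrational, so by Kronecker's theorem an algebraic relation
  between \<open>f\<close> and \<open>g\<close> survives when the periodic factors of \<open>g\<close> alone are translated by \<open>w\<close>. Taking \<open>w = s1 - s\<close> freezes
  these factors, and the relation turns into an algebraic equation for \<open>f\<close> whose coefficients are holomorphic across the unit
  circle near \<open>\<zeta>\<close>; it is not trivial because \<open>g\<close> is transcendental, by the same argument. Therefore \<open>f\<close> extends
  across a dense set of boundary points, and by the functional equation meromorphically to a larger disc. Such a Mahler
  function is rational.
\<close>

subsection \<open>Sections and compositions of power series\<close>

text \<open>Prime order is used because, by Fermat, the map \<open>x ^ (p ^ (N - 1))\<close> fixes
  \<zeta> for both bases with the same exponent; a large \<open>N\<close> avoids the zeros of the
  coefficients that would make the local systems singular. Two obstacles shape the rest. The product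
  \<open>H\<close> may vanish inside the disc, so continuation is always stated as
  \<open>F = H * \<phi>\<close> and algebraic relations are homogenised in \<open>F\<close> and
  \<open>H\<close>. And the exponents \<lambda> are complex: the factor of modulus one that comes
  from Im \<lambda> is almost periodic as well. A twist is therefore governed by a rational-linear
  function \<eta> on all frequencies, zero on the frequency of the first base and the identity on
  that of the second, and its values at Im \<lambda>, over which there is no control, change
  \<open>F\<close> too. What is first seen to continue is a twisted \<open>F\<close>; the true one
  is recovered from several base points \<open>s1\<close> by Lagrange interpolation. For
  \<open>H\<close> a single term suffices, so its twist differs from it by a zero-free exponential.
  Rationality finally comes from the fact that a high power map wraps a small arc around the whole
  circle.\<close>

lemma nth_compose_X_power:
  fixes f :: "complex fps"
  assumes "M > 0"
  shows "fps_nth (f oo fps_X ^ M) k = (if M dvd k then fps_nth f (k div M) else 0)"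
  using assms by (simp add: fps_nth_compose_X_power)

lemma compose_X_power_power:
  fixes f :: "complex fps"
  assumes "M > 0" "N > 0"
  shows "(f oo fps_X ^ M) oo fps_X ^ N = f oo fps_X ^ (M * N)"
proof (rule fps_ext)
  fix k
  show "fps_nth ((f oo fps_X ^ M) oo fps_X ^ N) k = fps_nth (f oo fps_X ^ (M * N)) k"
  proof (cases "N dvd k")
    case True
    then obtain c where "k = N * c" by (elim dvdE)
    then show ?thesis using assms by (simp add: nth_compose_X_power mult.commute)
  next
    case False
    then have "\<not> M * N dvd k" by (metis dvd_mult_right)
    then show ?thesis using False assms by (simp add: nth_compose_X_power)
  qed
qed

text \<open>For \<open>b < M\<close> this is the Cartier operator of the residue class
  \<open>b\<close> modulo \<open>M\<close>; it undoes the substitution of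
  \<open>x ^ M\<close>.\<close>

definition fps_section :: "nat \<Rightarrow> nat \<Rightarrow> complex fps \<Rightarrow> complex fps" where
  "fps_section M b F = Abs_fps (\<lambda>k. fps_nth F (b + M * k))"

lemma fps_section_nth [simp]: "fps_nth (fps_section M b F) k = fps_nth F (b + M * k)"
  by (simp add: fps_section_def)

lemma fps_section_sum: "fps_section M b (\<Sum>i\<in>A. F i) = (\<Sum>i\<in>A. fps_section M b (F i))"
  by (rule fps_ext) (simp add: fps_sum_nth)

lemma fps_section_0 [simp]: "fps_section M b 0 = 0"
  by (rule fps_ext) simp

text \<open>The series \<open>f oo fps_X ^ M\<close> lives on the multiples of \<open>M\<close>, so
  at an index congruent to \<open>b\<close> only coefficients of \<open>U\<close> from the same
  class take part.\<close>

lemma fps_section_mult_compose: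
  assumes "b < M"
  shows "fps_section M b (U * (f oo fps_X ^ M)) = fps_section M b U * f"
proof (rule fps_ext)
  fix k
  have M: "M > 0" using assms by simp
  have "fps_nth (U * (f oo fps_X ^ M)) (b + M * k)
      = (\<Sum>i\<in>{0..b + M * k}. fps_nth U i * (if M dvd (b + M * k - i) then fps_nth f ((b + M * k - i) div M) else 0))"
    using M by (simp add: fps_mult_nth nth_compose_X_power)
  also have "\<dots> = (\<Sum>i\<in>(\<lambda>j. b + M * j) ` {0..k}. fps_nth U i * fps_nth f ((b + M * k - i) div M))"
  proof (rule sum.mono_neutral_cong_right)
    show "(\<lambda>j. b + M * j) ` {0..k} \<subseteq> {0..b + M * k}" by auto
    show "\<forall>i\<in>{0..b + M * k} - (\<lambda>j. b + M * j) ` {0..k}.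
       fps_nth U i * (if M dvd b + M * k - i then fps_nth f ((b + M * k - i) div M) else 0) = 0"
    proof
      fix i assume i: "i \<in> {0..b + M * k} - (\<lambda>j. b + M * j) ` {0..k}"
      have "\<not> M dvd b + M * k - i"
      proof
        assume "M dvd b + M * k - i"
        then obtain c where c: "b + M * k - i = M * c" by (auto simp: dvd_def)
        then have e: "b + M * k = i + M * c" using i by auto
        have "c \<le> k"
        proof (rule ccontr)
          assume "\<not> c \<le> k"
          then have "M * (k + 1) \<le> M * c" by (intro mult_le_mono2) simp
          then show False using e assms by simp
        qed
        then have "i = b + M * (k - c)" using e by (simp add: algebra_simps diff_mult_distrib2)
        then show False using i by auto
      qed
      then show "fps_nth U i * (if M dvd b + M * k - i then fps_nth f ((b + M * k - i) div M) else 0) = 0"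
        by simp
    qed
    fix i assume "i \<in> (\<lambda>j. b + M * j) ` {0..k}"
    then obtain j where "j \<le> k" "i = b + M * j" by auto
    then have "b + M * k - i = M * (k - j)" by (simp add: diff_mult_distrib2)
    then show "fps_nth U i * (if M dvd b + M * k - i then fps_nth f ((b + M * k - i) div M) else 0)
        = fps_nth U i * fps_nth f ((b + M * k - i) div M)" by simp
  qed auto
  also have "\<dots> = (\<Sum>j\<in>{0..k}. fps_nth U (b + M * j) * fps_nth f (k - j))"
  proof (subst sum.reindex)
    show "inj_on (\<lambda>j. b + M * j) {0..k}" using M by (auto simp: inj_on_def)
    have "(b + M * k - (b + M * j)) div M = k - j" if "j \<le> k" for j
      using that M by (simp add: diff_mult_distrib2[symmetric])
    then show "sum ((\<lambda>i. fps_nth U i * fps_nth f ((b + M * k - i) div M)) \<circ> (\<lambda>j. b + M * j)) {0..k} =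
        (\<Sum>j = 0..k. fps_nth U (b + M * j) * fps_nth f (k - j))"
      by (intro sum.cong) auto
  qed
  finally show "fps_nth (fps_section M b (U * (f oo fps_X ^ M))) k = fps_nth (fps_section M b U * f) k"
    by (simp add: fps_mult_nth)
qed

text \<open>The degree drops by the factor \<open>M\<close>. This keeps the denominators in
  \<open>geo_mahler_step\<close> from growing under iteration.\<close>

lemma fps_section_of_poly:
  assumes "M > 0"
  obtains V where "fps_of_poly V = fps_section M b (fps_of_poly U)" "M * degree V \<le> degree U"
    "\<And>k. Polynomial.coeff V k = Polynomial.coeff U (b + M * k)"
proof -
  define V where "V = (\<Sum>k\<le>degree U. Polynomial.monom (Polynomial.coeff U (b + M * k)) k)"
  have c: "Polynomial.coeff V k = Polynomial.coeff U (b + M * k)" for k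
  proof -
    have "Polynomial.coeff V k = (\<Sum>j\<le>degree U. if j = k then Polynomial.coeff U (b + M * k) else 0)"
      unfolding V_def coeff_sum by (intro sum.cong) auto
    also have "\<dots> = (if k \<le> degree U then Polynomial.coeff U (b + M * k) else 0)" by simp
    also have "\<dots> = Polynomial.coeff U (b + M * k)"
    proof (cases "k \<le> degree U")
      case False
      have "k \<le> M * k" using assms by simp
      then have "b + M * k > degree U" using False by linarith
      then show ?thesis by (simp add: coeff_eq_0)
    qed simp
    finally show ?thesis .
  qed
  have "M * degree V \<le> degree U"
  proof (cases "V = 0")
    case False
    then have "Polynomial.coeff U (b + M * degree V) \<noteq> 0" using c[of "degree V"] leading_coeff_0_iff[of V] by metis
    then have "b + M * degree V \<le> degree U" by (rule le_degree)
    then show ?thesis by simp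
  qed simp
  then show thesis using c that[of V] by (auto simp: fps_eq_iff)
qed

lemma is_mahler_minimal:
  assumes "is_mahler p f"
  obtains n a where "p \<ge> 2" "a 0 \<noteq> 0" "a n \<noteq> 0"
    "(\<Sum>i\<le>n. fps_of_poly (a i) * (f oo fps_X ^ (p ^ i))) = 0"
proof -
  define P where "P n \<longleftrightarrow> (\<exists>a :: nat \<Rightarrow> complex poly. (\<exists>i\<le>n. a i \<noteq> 0) \<and>
        (\<Sum>i\<le>n. fps_of_poly (a i) * (f oo fps_X ^ (p ^ i))) = 0)" for n
  have p: "p \<ge> 2" and "\<exists>n. P n" using assms by (auto simp: is_mahler_def P_def)
  then have PL: "P (LEAST n. P n)" by (metis LeastI)
  define n where "n = (LEAST n. P n)"
  obtain a where a: "\<exists>i\<le>n. a i \<noteq> 0" "(\<Sum>i\<le>n. fps_of_poly (a i) * (f oo fps_X ^ (p ^ i))) = 0"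
    using PL by (simp only: n_def[symmetric]) (simp only: P_def, erule exE, erule conjE, rule that)
  have least: "\<not> P k" if "k < n" for k using that not_less_Least unfolding n_def by blast
  have "a n \<noteq> 0"
  proof
    assume 0: "a n = 0"
    then obtain m where n: "n = Suc m" using a(1) by (cases n) auto
    have "P m" unfolding P_def
      using a 0 by (intro exI[of _ a]) (auto simp: n le_Suc_eq)
    then show False using least n by auto
  qed
  moreover have "a 0 \<noteq> 0"
  proof
    assume 0: "a 0 = 0"
    with \<open>a n \<noteq> 0\<close> obtain m where n: "n = Suc m" by (cases n) auto
    have l: "Polynomial.coeff (a n) (degree (a n)) \<noteq> 0" using \<open>a n \<noteq> 0\<close> by simp
    define l where "l = degree (a n)"
    \<comment> \<open>The residue of the degree of the last coefficient: its leading coefficient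
      survives the section, so the shorter equation is not trivial.\<close>
    define b where "b = l mod p"
    have b: "b < p" using p by (simp add: b_def)
    have "\<exists>V. fps_of_poly V = fps_section p b (fps_of_poly (a (Suc i))) \<and> 
        (\<forall>k. Polynomial.coeff V k = Polynomial.coeff (a (Suc i)) (b + p * k))" for i
      using fps_section_of_poly[of p b "a (Suc i)"] p by (metis not_gr0 not_numeral_le_zero)
    then obtain V where V: "\<And>i. fps_of_poly (V i) = fps_section p b (fps_of_poly (a (Suc i)))"
        "\<And>i k. Polynomial.coeff (V i) k = Polynomial.coeff (a (Suc i)) (b + p * k)" by metis
    have "(\<Sum>i\<le>m. fps_of_poly (a (Suc i)) * (f oo fps_X ^ (p ^ Suc i))) = 0"
      using a(2) 0 unfolding n by (simp add: sum.atMost_Suc_shift del: sum.atMost_Suc)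
    then have "fps_section p b (\<Sum>i\<le>m. fps_of_poly (a (Suc i)) * ((f oo fps_X ^ (p ^ i)) oo fps_X ^ p)) = 0"
      using p by (simp add: compose_X_power_power mult.commute)
    then have "(\<Sum>i\<le>m. fps_of_poly (V i) * (f oo fps_X ^ (p ^ i))) = 0"
      by (simp add: fps_section_sum fps_section_mult_compose[OF b] V)
    moreover have "Polynomial.coeff (V m) (l div p) \<noteq> 0"
      using l by (simp add: V n b_def l_def mult.commute)
    then have "V m \<noteq> 0" by auto
    ultimately have "P m" unfolding P_def by blast
    then show False using least n by auto
  qed
  ultimately show thesis using that[OF p, of a n] a(2) by blast
qed

subsection \<open>Geometrically bounded coefficients\<close>

text \<open>A Cauchy estimate at radius \<open>r\<close>, for \<open>r > 0\<close> stronger than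
  convergence in the open disc of that radius. A bound on coefficients is convenient because
  sections and compositions act on it directly.\<close>

definition geo :: "real \<Rightarrow> complex fps \<Rightarrow> bool" where
  "geo r G \<longleftrightarrow> (\<exists>C. \<forall>k. norm (fps_nth G k) * r ^ k \<le> C)"

lemma geoI: "(\<And>k. norm (fps_nth G k) * r ^ k \<le> C) \<Longrightarrow> geo r G"
  by (auto simp: geo_def)

lemma geo_0 [simp]: "geo r 0"
  by (auto simp: geo_def)

lemma geo_add:
  assumes "geo r F" "geo r G" "r \<ge> 0"
  shows "geo r (F + G)"
proof -
  obtain C D where "\<And>k. norm (fps_nth F k) * r ^ k \<le> C" "\<And>k. norm (fps_nth G k) * r ^ k \<le> D"
    using assms by (auto simp: geo_def)
  then have "norm (fps_nth (F + G) k) * r ^ k \<le> C + D" for k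
    using mult_right_mono[OF norm_triangle_ineq[of "fps_nth F k" "fps_nth G k"], of "r ^ k"] assms(3)
    by (smt (verit) distrib_right fps_add_nth zero_le_power)
  then show ?thesis by (rule geoI)
qed

lemma geo_uminus: "geo r G \<Longrightarrow> geo r (- G)"
  by (simp add: geo_def)

lemma geo_sum:
  assumes "\<And>i. i \<in> A \<Longrightarrow> geo r (F i)" "r \<ge> 0"
  shows "geo r (\<Sum>i\<in>A. F i)"
  using assms by (induction A rule: infinite_finite_induct) (auto intro: geo_add)

lemma norm_mult_poly_bound:
  fixes G :: "complex fps"
  assumes r: "r \<ge> 0" and C: "\<And>k. norm (fps_nth G k) * r ^ k \<le> C" "C \<ge> 0"
  shows "norm (fps_nth (fps_of_poly c * G) k) * r ^ k \<le> (\<Sum>j\<le>degree c. norm (Polynomial.coeff c j) * r ^ j) * C"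
proof -
  have "norm (fps_nth (fps_of_poly c * G) k) * r ^ k
      \<le> (\<Sum>j=0..k. norm (Polynomial.coeff c j * fps_nth G (k - j))) * r ^ k"
    unfolding fps_mult_nth fps_of_poly_nth using r by (intro mult_right_mono norm_sum) auto
  also have "\<dots> = (\<Sum>j=0..k. norm (Polynomial.coeff c j) * r ^ j * (norm (fps_nth G (k - j)) * r ^ (k - j)))"
    unfolding sum_distrib_right
  proof (intro sum.cong refl)
    fix j assume "j \<in> {0..k}"
    then have "r ^ k = r ^ j * r ^ (k - j)" by (simp flip: power_add)
    then show "norm (Polynomial.coeff c j * fps_nth G (k - j)) * r ^ k = 
        norm (Polynomial.coeff c j) * r ^ j * (norm (fps_nth G (k - j)) * r ^ (k - j))"
      by (simp add: norm_mult mult_ac)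
  qed
  also have "\<dots> \<le> (\<Sum>j=0..k. norm (Polynomial.coeff c j) * r ^ j * C)"
    using r C by (intro sum_mono mult_left_mono) auto
  also have "\<dots> = (\<Sum>j=0..k. norm (Polynomial.coeff c j) * r ^ j) * C" by (simp add: sum_distrib_right)
  also have "\<dots> \<le> (\<Sum>j\<le>degree c. norm (Polynomial.coeff c j) * r ^ j) * C"
  proof (intro mult_right_mono C(2))
    have "(\<Sum>j=0..k. norm (Polynomial.coeff c j) * r ^ j) = (\<Sum>j\<in>{0..k} \<inter> {..degree c}. norm (Polynomial.coeff c j) * r ^ j)"
      by (intro sum.mono_neutral_right) (auto simp: coeff_eq_0)
    also have "\<dots> \<le> (\<Sum>j\<le>degree c. norm (Polynomial.coeff c j) * r ^ j)"
      using r by (intro sum_mono2) auto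
    finally show "(\<Sum>j=0..k. norm (Polynomial.coeff c j) * r ^ j) \<le> (\<Sum>j\<le>degree c. norm (Polynomial.coeff c j) * r ^ j)" .
  qed
  finally show ?thesis .
qed

lemma geo_bound_nonneg:
  assumes "geo r G" "r \<ge> 0"
  obtains C where "\<And>k. norm (fps_nth G k) * r ^ k \<le> C" "C \<ge> 0"
proof -
  obtain C where C: "\<And>k. norm (fps_nth G k) * r ^ k \<le> C" using assms by (auto simp: geo_def)
  have "0 \<le> norm (fps_nth G 0) * r ^ 0" by simp
  also have "\<dots> \<le> C" by (rule C)
  finally have "C \<ge> 0" .
  with C show thesis by (rule that)
qed

lemma geo_mult_poly:
  assumes "geo r G" "r \<ge> 0"
  shows "geo r (fps_of_poly c * G)"
proof -
  obtain C where "\<And>k. norm (fps_nth G k) * r ^ k \<le> C" "C \<ge> 0" by (rule geo_bound_nonneg[OF assms]) (rule that)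
  then show ?thesis using norm_mult_poly_bound[OF assms(2)] by (intro geoI) blast
qed

lemma geo_mono:
  assumes "geo r G" "0 \<le> r'" "r' \<le> r"
  shows "geo r' G"
proof -
  obtain C where C: "\<And>k. norm (fps_nth G k) * r ^ k \<le> C" using assms by (auto simp: geo_def)
  show ?thesis
  proof (rule geoI)
    fix k show "norm (fps_nth G k) * r' ^ k \<le> C"
      using C[of k] mult_left_mono[OF power_mono[OF assms(3,2)], of "norm (fps_nth G k)" k] by simp
  qed
qed

lemma geo_compose:
  assumes "geo (r ^ M) G" "M > 0" "r \<ge> 0"
  shows "geo r (G oo fps_X ^ M)"
proof -
  obtain C where C: "\<And>k. norm (fps_nth G k) * (r ^ M) ^ k \<le> C" "C \<ge> 0"
    using geo_bound_nonneg[OF assms(1)] assms(3) by auto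
  show ?thesis
  proof (rule geoI)
    fix k show "norm (fps_nth (G oo fps_X ^ M) k) * r ^ k \<le> C"
    proof (cases "M dvd k")
      case True
      then obtain c where "k = M * c" by (elim dvdE)
      then show ?thesis using C(1)[of c] assms(2) by (simp add: nth_compose_X_power power_mult)
    next
      case False
      then show ?thesis using C(2) assms(2) by (simp add: nth_compose_X_power)
    qed
  qed
qed

text \<open>This is where a radius above 1 grows. The shift by \<open>b\<close> costs nothing
  because \<open>r \<ge> 1\<close>.\<close>

lemma geo_section:
  assumes "geo r G" "r \<ge> 1"
  shows "geo (r ^ M) (fps_section M b G)"
proof -
  obtain C where C: "\<And>k. norm (fps_nth G k) * r ^ k \<le> C" using assms by (auto simp: geo_def)
  show ?thesis
  proof (rule geoI)
    fix k
    have "(r ^ M) ^ k \<le> r ^ (b + M * k)" 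
      using assms(2) by (simp flip: power_mult add: power_increasing)
    then have "norm (fps_nth G (b + M * k)) * (r ^ M) ^ k \<le> norm (fps_nth G (b + M * k)) * r ^ (b + M * k)"
      by (intro mult_left_mono) auto
    then show "norm (fps_nth (fps_section M b G) k) * (r ^ M) ^ k \<le> C" using C[of "b + M * k"] by simp
  qed
qed


section \<open>Enlarging the disc of convergence\<close>

lemma compose_X_power_neq_0:
  fixes D :: "complex poly"
  assumes "M > 0" "D \<noteq> 0"
  obtains E where "fps_of_poly E = fps_of_poly D oo fps_X ^ M" "degree E = M * degree D" "E \<noteq> 0"
proof
  define E where "E = pcompose D (Polynomial.monom 1 M)"
  show e: "fps_of_poly E = fps_of_poly D oo fps_X ^ M"
    unfolding E_def by (subst fps_of_poly_pcompose) (use assms in \<open>auto simp: fps_of_poly_monom coeff_monom\<close>)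
  show "degree E = M * degree D" by (simp add: E_def degree_pcompose degree_monom_eq)
  have "Polynomial.coeff E (M * degree D) = Polynomial.coeff D (degree D)"
    using arg_cong[OF e, of "\<lambda>F. fps_nth F (M * degree D)"] assms by (simp add: nth_compose_X_power)
  then show "E \<noteq> 0" using assms by auto
qed

text \<open>The equation is solved for \<open>f oo fps_X ^ (p ^ n)\<close>. The other terms involve
  at most \<open>x ^ (p ^ (n - 1))\<close>, so they are controlled at the radius \<sigma> with
  \<open>\<sigma> ^ (p ^ (n - 1)) = R\<close>; a section modulo \<open>p ^ n\<close> raises \<sigma>
  to the power \<open>p ^ n\<close>, which is \<open>R ^ p\<close>.\<close>

lemma geo_mahler_step:
  fixes p n :: nat
  assumes p: "p \<ge> 2" and n: "n \<ge> 1" and an: "a n \<noteq> 0"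
    and eq: "(\<Sum>i\<le>n. fps_of_poly (a i) * (f oo fps_X ^ (p ^ i))) = 0"
    and D: "D \<noteq> 0" "geo R (fps_of_poly D * f)" and R: "R > 1"
  shows "\<exists>D'. D' \<noteq> 0 \<and> geo (R ^ p) (fps_of_poly D' * f) \<and> degree D' \<le> max (degree D) (degree (a n))"
proof -
  define m where "m = p ^ (n - 1)"
  define M where "M = p ^ n"
  have m: "m > 0" "M = m * p" "M > 0"
    using p n by (simp_all add: m_def M_def flip: power_Suc2)
  define \<sigma> where "\<sigma> = root m R"
  have \<sigma>: "\<sigma> ^ m = R" "\<sigma> \<ge> 1" using R m by (auto simp: \<sigma>_def)
  have "\<exists>E. fps_of_poly E = fps_of_poly D oo fps_X ^ (p ^ i) \<and> degree E = p ^ i * degree D \<and> E \<noteq> 0" for i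
  proof -
    have "p ^ i > 0" using p by simp
    then show ?thesis using D(1) by (rule compose_X_power_neq_0) (intro exI conjI)
  qed
  then obtain E where E: "\<And>i. fps_of_poly (E i) = fps_of_poly D oo fps_X ^ (p ^ i)"
    "\<And>i. degree (E i) = p ^ i * degree D" "\<And>i. E i \<noteq> 0" by metis
  \<comment> \<open>\<open>E i\<close> is \<open>D\<close> at \<open>x ^ (p ^ i)\<close>; the
    product clears the denominators of all lower terms at once.\<close>
  define U where "U = a n * (\<Prod>i<n. E i)"
  have U0: "U \<noteq> 0" using an E by (simp add: U_def)
  \<comment> \<open>A geometric sum below \<open>M\<close>: with it \<open>degree U\<close> is at
    most \<open>M\<close> times the old degree bound, so the section obeys the old bound
    again.\<close>
  have "(\<Sum>i<n. p ^ i) \<le> p ^ n - 1" for n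
  proof (induction n)
    case (Suc n)
    have "(\<Sum>i<Suc n. p ^ i) \<le> (p ^ n - 1) + p ^ n" using Suc by simp
    also have "\<dots> = 2 * p ^ n - 1" using p by simp
    also have "\<dots> \<le> p ^ Suc n - 1" using p by (intro diff_le_mono) simp
    finally show ?case .
  qed simp
  then have sum: "(\<Sum>i<n. p ^ i) \<le> M - 1" by (simp add: M_def)
  have "degree U = degree (a n) + (\<Sum>i<n. p ^ i * degree D)"
    using an E unfolding U_def by (subst degree_mult_eq) (auto simp: degree_prod_eq_sum_degree)
  also have "\<dots> \<le> degree (a n) + (M - 1) * degree D"
    using sum by (simp flip: sum_distrib_right add: mult_right_mono)
  also have "\<dots> \<le> max (degree D) (degree (a n)) + (M - 1) * max (degree D) (degree (a n))"
    by (intro add_mono mult_left_mono) auto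
  also have "\<dots> = M * max (degree D) (degree (a n))"
    using m(3) by (metis One_nat_def mult_eq_if not_gr0)
  finally have dU: "degree U \<le> M * max (degree D) (degree (a n))" .
  have "geo \<sigma> (fps_of_poly U * (f oo fps_X ^ M))"
  proof -
    have s: "(\<Sum>i<n. fps_of_poly (a i) * (f oo fps_X ^ (p ^ i))) = - (fps_of_poly (a n) * (f oo fps_X ^ M))"
      using eq by (simp flip: lessThan_Suc_atMost add: M_def eq_neg_iff_add_eq_0)
    have "fps_of_poly U * (f oo fps_X ^ M) = - ((\<Prod>i<n. fps_of_poly (E i)) * 
       (\<Sum>i<n. fps_of_poly (a i) * (f oo fps_X ^ (p ^ i))))"
      unfolding s by (simp add: U_def fps_of_poly_mult fps_of_poly_prod mult_ac)
    also have "\<dots> = - (\<Sum>i<n. fps_of_poly (a i * (\<Prod>j\<in>{..<n} - {i}. E j)) *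
        ((fps_of_poly D * f) oo fps_X ^ (p ^ i)))"
      unfolding sum_distrib_left neg_equal_iff_equal
    proof (intro sum.cong refl)
      fix i assume i: "i \<in> {..<n}"
      have "(\<Prod>i<n. fps_of_poly (E i)) = fps_of_poly (E i) * (\<Prod>j\<in>{..<n} - {i}. fps_of_poly (E j))"
        using i by (simp add: prod.remove)
      moreover have "(fps_of_poly D * f) oo fps_X ^ (p ^ i) = fps_of_poly (E i) * (f oo fps_X ^ (p ^ i))"
        unfolding E(1) by (rule fps_compose_mult_distrib) (use p in simp)
      ultimately show "(\<Prod>i<n. fps_of_poly (E i)) * (fps_of_poly (a i) * (f oo fps_X ^ p ^ i)) =
        fps_of_poly (a i * (\<Prod>j\<in>{..<n} - {i}. E j)) * (fps_of_poly D * f oo fps_X ^ p ^ i)"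
        by (simp add: fps_of_poly_mult fps_of_poly_prod mult_ac)
    qed
    also have "geo \<sigma> \<dots>"
    proof (intro geo_uminus geo_sum)
      fix i assume i: "i \<in> {..<n}"
      have "p ^ i \<le> m" unfolding m_def using i p by (intro power_increasing) auto
      then have "\<sigma> ^ (p ^ i) \<le> R" using power_increasing[of "p ^ i" m \<sigma>] \<sigma> by simp
      then have "geo (\<sigma> ^ p ^ i) (fps_of_poly D * f)"
        using geo_mono[OF D(2), of "\<sigma> ^ p ^ i"] \<sigma> by simp
      then have "geo \<sigma> (fps_of_poly D * f oo fps_X ^ p ^ i)"
        using \<sigma> p by (intro geo_compose) auto
      then show "geo \<sigma> (fps_of_poly (a i * prod E ({..<n} - {i})) * (fps_of_poly D * f oo fps_X ^ p ^ i))"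
        using \<sigma> by (intro geo_mult_poly) auto
    qed (use \<sigma> in auto)
    finally show ?thesis .
  qed
  note g = this
  \<comment> \<open>The residue of the degree, so that the section of \<open>U\<close> is not
    zero.\<close>
  define b where "b = degree U mod M"
  have b: "b < M" using m by (simp add: b_def)
  obtain D' where D': "fps_of_poly D' = fps_section M b (fps_of_poly U)" "M * degree D' \<le> degree U"
    "\<And>k. Polynomial.coeff D' k = Polynomial.coeff U (b + M * k)"
    using fps_section_of_poly[OF m(3), where U = U and b = b] by blast
  have "Polynomial.coeff D' (degree U div M) = Polynomial.coeff U (degree U)" by (simp add: D' b_def)
  then have "D' \<noteq> 0" using U0 by auto
  moreover have "degree D' \<le> max (degree D) (degree (a n))"
    using dU D'(2) m(3) by (meson le_trans nat_mult_le_cancel1)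
  moreover have "geo (R ^ p) (fps_of_poly D' * f)"
  proof -
    have "geo (\<sigma> ^ M) (fps_of_poly D' * f)"
      using geo_section[OF g \<sigma>(2), of M b] unfolding fps_section_mult_compose[OF b] D'(1) .
    then show ?thesis by (simp add: m(2) power_mult \<sigma>(1))
  qed
  ultimately show ?thesis by blast
qed

text \<open>The denominators produced by iterating the previous lemma have bounded degree; for fixed radius
  the admissible denominators form an ideal, so the ones of minimal degree eventually coincide.\<close>

lemma geo_all_radii:
  fixes p n :: nat
  assumes p: "p \<ge> 2" and n: "n \<ge> 1" and an: "a n \<noteq> 0"
    and eq: "(\<Sum>i\<le>n. fps_of_poly (a i) * (f oo fps_X ^ (p ^ i))) = 0"
    and D: "D \<noteq> 0" "geo R (fps_of_poly D * f)" and R: "R > 1"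
  obtains D' where "D' \<noteq> 0" "\<And>r. r \<ge> 0 \<Longrightarrow> geo r (fps_of_poly D' * f)"
proof -
  define Rk where "Rk k = R ^ (p ^ k)" for k
  have Rk1: "Rk k > 1" for k using R p by (simp add: Rk_def one_less_power)
  have Rk_Suc: "Rk (Suc k) = Rk k ^ p" for k by (simp add: Rk_def mult.commute flip: power_mult)
  have Rk_mono: "Rk k \<le> Rk l" if "k \<le> l" for k l
    unfolding Rk_def using that p R by (intro power_increasing) auto
  define N where "N = max (degree D) (degree (a n))"
  define J where "J k D \<longleftrightarrow> D \<noteq> 0 \<and> geo (Rk k) (fps_of_poly D * f)" for k D
  have ex: "\<exists>D. J k D \<and> degree D \<le> N" for k
  proof (induction k)
    case 0
    show ?case using D by (intro exI[of _ D]) (auto simp: J_def Rk_def N_def)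
  next
    case (Suc k)
    then obtain D where D: "J k D" "degree D \<le> N" by (elim exE conjE)
    then obtain D' where D': "D' \<noteq> 0" "geo (Rk k ^ p) (fps_of_poly D' * f)"
        "degree D' \<le> max (degree D) (degree (a n))"
      using geo_mahler_step[OF p n an eq, of D "Rk k"] Rk1[of k] unfolding J_def by auto
    then have "degree D' \<le> N" using D(2) by (simp add: N_def)
    then show ?case using D' by (intro exI[of _ D']) (simp add: J_def Rk_Suc)
  qed
  define e where "e k = (LEAST d. \<exists>D. J k D \<and> degree D = d)" for k
  have e1: "\<exists>D. J k D \<and> degree D = e k" for k
  proof -
    obtain D where "J k D" using ex[of k] by (elim exE conjE)
    then have "\<exists>d. \<exists>D. J k D \<and> degree D = d" by (intro exI conjI) auto
    then show ?thesis unfolding e_def by (rule LeastI_ex)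
  qed
  have e2: "e k \<le> degree D" if "J k D" for k D
    unfolding e_def using that by (intro Least_le) auto
  have mono_J: "J l D \<Longrightarrow> k \<le> l \<Longrightarrow> J k D" for k l D
    unfolding J_def using geo_mono[of "Rk l" _ "Rk k"] Rk_mono[of k l] Rk1[of k] by auto
  have e_mono: "e k \<le> e l" if "k \<le> l" for k l
  proof -
    obtain D where "J l D" "degree D = e l" using e1[of l] by (elim exE conjE)
    then show ?thesis using e2[OF mono_J[OF _ that]] by metis
  qed
  have e_le: "e k \<le> N" for k
  proof -
    obtain D where "J k D" "degree D \<le> N" using ex[of k] by (elim exE conjE)
    then show ?thesis using e2[of k D] by simp
  qed
  have "range e \<subseteq> {..N}" using e_le by (simp add: image_subset_iff)
  then have "finite (range e)" by (rule finite_subset) simp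
  then have "Max (range e) \<in> range e" by (intro Max_in) auto
  then obtain k0 where k0: "e k0 = Max (range e)" by auto
  have e_const: "e k = e k0" if "k \<ge> k0" for k
    using e_mono[OF that] Max_ge[OF \<open>finite (range e)\<close>, of "e k"] k0 by simp
  obtain D0 where D0: "J k0 D0" "degree D0 = e k0" using e1 by blast
  have all: "J k D0" if k: "k \<ge> k0" for k
  proof -
    obtain D1 where D1: "J k D1" "degree D1 = e k0" using e1[of k] e_const[OF k] by auto
    define c where "c = lead_coeff D0 / lead_coeff D1"
    have nz: "D0 \<noteq> 0" "D1 \<noteq> 0" using D0 D1 by (auto simp: J_def)
    \<comment> \<open>\<open>D1\<close> is admissible at the smaller radius \<open>Rk k0\<close>
      too. Once the leading coefficients match, the difference has lower degree, so by minimality it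
      is zero.\<close>
    have "D0 = Polynomial.smult c D1"
    proof (rule ccontr)
      assume ne: "D0 \<noteq> Polynomial.smult c D1"
      define E where "E = D0 - Polynomial.smult c D1"
      have E0: "E \<noteq> 0" using ne by (simp add: E_def)
      have "Polynomial.coeff D1 (e k0) \<noteq> 0" using nz D1(2) by (metis leading_coeff_0_iff)
      then have "Polynomial.coeff E (e k0) = 0" using D0(2) D1(2) by (simp add: E_def c_def)
      moreover have "degree E \<le> e k0"
        unfolding E_def using D0(2) D1(2) by (intro degree_diff_le) auto
      ultimately have "degree E < e k0" using E0
        by (metis leading_coeff_0_iff le_neq_implies_less)
      moreover have "fps_of_poly E * f = fps_of_poly D0 * f + - (fps_of_poly [:c:] * (fps_of_poly D1 * f))"
        by (simp add: E_def fps_of_poly_diff fps_of_poly_smult algebra_simps)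
      moreover have "geo (Rk k0) \<dots>"
        using D0 mono_J[OF D1(1) k] Rk1[of k0] unfolding J_def
        by (intro geo_add geo_uminus geo_mult_poly[of _ "fps_of_poly D1 * f"]) auto
      ultimately have "J k0 E" using E0 unfolding J_def by metis
      then show False using e2[of k0 E] \<open>degree E < e k0\<close> by simp
    qed
    then have "fps_of_poly D0 * f = fps_of_poly [:c:] * (fps_of_poly D1 * f)"
      by (simp add: fps_of_poly_smult mult.assoc)
    moreover have "geo (Rk k) (fps_of_poly [:c:] * (fps_of_poly D1 * f))"
      using D1 Rk1[of k] by (intro geo_mult_poly[of _ "fps_of_poly D1 * f"]) (auto simp: J_def)
    ultimately show ?thesis using nz by (simp only: J_def simp_thms)
  qed
  have "geo r (fps_of_poly D0 * f)" if "r \<ge> 0" for r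
  proof -
    obtain k where k: "r \<le> R ^ k" using real_arch_pow[OF R, of r] by (auto intro: less_imp_le)
    define l where "l = max k k0"
    have "l \<le> p ^ l" using p by (metis less_exp le_trans less_imp_le power_mono zero_le)
    then have "R ^ k \<le> Rk l" unfolding Rk_def l_def using R by (intro power_increasing) auto
    then show ?thesis using all[of l] geo_mono[of "Rk l" _ r] k that unfolding J_def l_def by auto
  qed
  with D0(1) show thesis using that[of D0] by (auto simp: J_def)
qed


text \<open>With the sup norms \<open>S r = sup |G\<^sub>k| r\<^sup>k\<close> the equation gives \<open>S (r\<^sup>p) \<le> C r\<^sup>d S r\<close>, which
  forces polynomial growth.\<close>

lemma entire_mahler_polynomial:
  fixes p n :: nat and b :: "nat \<Rightarrow> complex poly"
  assumes p: "p \<ge> 2" and n: "n \<ge> 1" and bn: "b n \<noteq> 0"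
    and eq: "(\<Sum>i\<le>n. fps_of_poly (b i) * (G oo fps_X ^ (p ^ i))) = 0"
    and G: "\<And>r. r \<ge> 0 \<Longrightarrow> geo r G"
  shows "\<exists>K. \<forall>m>K. fps_nth G m = 0"
proof -
  define S where "S r = (SUP k. norm (fps_nth G k) * r ^ k)" for r :: real
  have bdd: "bdd_above (range (\<lambda>k. norm (fps_nth G k) * r ^ k))" if "r \<ge> 0" for r
  proof -
    obtain C where "\<forall>k. norm (fps_nth G k) * r ^ k \<le> C" using G[OF \<open>r \<ge> 0\<close>] unfolding geo_def by blast
    then show ?thesis by (intro bdd_aboveI[of _ C]) auto
  qed
  have S: "norm (fps_nth G k) * r ^ k \<le> S r" if "r \<ge> 0" for r k
    unfolding S_def using bdd[OF that] by (intro cSUP_upper) auto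
  have S_least: "S r \<le> C" if "\<And>k. norm (fps_nth G k) * r ^ k \<le> C" for r C
    unfolding S_def using that by (intro cSUP_least) auto
  have S0: "S r \<ge> 0" if "r \<ge> 0" for r
    using S[OF that, of 0] norm_ge_zero[of "fps_nth G 0"] by (simp only: power_0 mult_1_right order.trans)
  have S_mono: "S r \<le> S r'" if "0 \<le> r" "r \<le> r'" for r r'
  proof (rule S_least)
    fix k
    have "norm (fps_nth G k) * r ^ k \<le> norm (fps_nth G k) * r' ^ k"
      using that by (intro mult_left_mono power_mono) auto
    also have "\<dots> \<le> S r'" using that by (intro S) auto
    finally show "norm (fps_nth G k) * r ^ k \<le> S r'" .
  qed
  define m where "m = p ^ (n - 1)"
  define M where "M = p ^ n"
  have m: "m > 0" "M = m * p" "M > 0"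
    using p n by (simp_all add: m_def M_def flip: power_Suc2)
  have comp_bd: "norm (fps_nth (G oo fps_X ^ N) k) * r ^ k \<le> S (r ^ N)" if "r \<ge> 0" "N > 0" for r N k
  proof (cases "N dvd k")
    case True
    then obtain c where "k = N * c" by (elim dvdE)
    then show ?thesis using S[of "r ^ N" c] that by (simp add: nth_compose_X_power power_mult)
  next
    case False
    then show ?thesis using S0[of "r ^ N"] that by (simp add: nth_compose_X_power)
  qed
  define e where "e = degree (b n)"
  define \<beta> where "\<beta> = norm (lead_coeff (b n))"
  have \<beta>: "\<beta> > 0" using bn by (simp add: \<beta>_def)
  define B where "B = (\<Sum>j<e. norm (Polynomial.coeff (b n) j))"
  have B0: "B \<ge> 0" unfolding B_def by (intro sum_nonneg) auto
  define d where "d = (\<Sum>i<n. degree (b i))"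
  define C where "C = (\<Sum>i<n. \<Sum>j\<le>degree (b i). norm (Polynomial.coeff (b i) j))"
  have C0: "C \<ge> 0" unfolding C_def by (intro sum_nonneg) auto
  define W where "W = G oo fps_X ^ M"
  \<comment> \<open>For \<open>r \<ge> 2 * B / \<beta>\<close> the leading term of
    \<open>b n\<close> dominates: the lower terms contribute at most half, are moved to the left
    side, and leave the factor \<open>2 / \<beta>\<close>.\<close>
  have bound: "S (r ^ M) \<le> 2 * C / \<beta> * r ^ d * S (r ^ m)" if r: "r \<ge> 1" "r \<ge> 2 * B / \<beta>" for r
  proof -
    have bW: "norm (fps_nth (fps_of_poly (b n) * W) k) * r ^ k \<le> C * r ^ d * S (r ^ m)" for k
    proof -
      have "fps_of_poly (b n) * W = - (\<Sum>i<n. fps_of_poly (b i) * (G oo fps_X ^ (p ^ i)))"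
        using eq by (simp flip: lessThan_Suc_atMost add: W_def M_def eq_neg_iff_add_eq_0 add.commute)
      then have "norm (fps_nth (fps_of_poly (b n) * W) k) * r ^ k
          \<le> (\<Sum>i<n. norm (fps_nth (fps_of_poly (b i) * (G oo fps_X ^ (p ^ i))) k)) * r ^ k"
        using r by (auto simp: fps_sum_nth intro!: mult_right_mono norm_sum)
      also have "\<dots> = (\<Sum>i<n. norm (fps_nth (fps_of_poly (b i) * (G oo fps_X ^ (p ^ i))) k) * r ^ k)"
        by (rule sum_distrib_right)
      also have "\<dots> \<le> (\<Sum>i<n. (\<Sum>j\<le>degree (b i). norm (Polynomial.coeff (b i) j)) * (r ^ d * S (r ^ m)))"
      proof (intro sum_mono)
        fix i assume i: "i \<in> {..<n}"
        have pi: "p ^ i \<le> m" unfolding m_def using i p by (intro power_increasing) auto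
        have "r ^ (p ^ i) \<le> r ^ m" using r pi by (intro power_increasing) auto
        then have S1: "S (r ^ (p ^ i)) \<le> S (r ^ m)" using r by (intro S_mono) auto
        have "norm (fps_nth (G oo fps_X ^ (p ^ i)) k) * r ^ k \<le> S (r ^ m)" for k
          using comp_bd[of r "p ^ i" k] S1 p r by simp
        then have "norm (fps_nth (fps_of_poly (b i) * (G oo fps_X ^ (p ^ i))) k) * r ^ k
            \<le> (\<Sum>j\<le>degree (b i). norm (Polynomial.coeff (b i) j) * r ^ j) * S (r ^ m)"
          using r S0[of "r ^ m"] by (intro norm_mult_poly_bound) auto
        also have "\<dots> \<le> (\<Sum>j\<le>degree (b i). norm (Polynomial.coeff (b i) j) * r ^ d) * S (r ^ m)"
        proof (intro mult_right_mono sum_mono mult_left_mono)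
          fix j assume "j \<in> {..degree (b i)}"
          moreover have "degree (b i) \<le> d" unfolding d_def using i by (intro member_le_sum) auto
          ultimately show "r ^ j \<le> r ^ d" using r by (intro power_increasing) auto
        qed (use r S0[of "r ^ m"] in auto)
        finally show "norm (fps_nth (fps_of_poly (b i) * (G oo fps_X ^ (p ^ i))) k) * r ^ k
          \<le> (\<Sum>j\<le>degree (b i). norm (Polynomial.coeff (b i) j)) * (r ^ d * S (r ^ m))"
          by (simp add: mult_ac flip: sum_distrib_right sum_distrib_left)
      qed
      also have "\<dots> = C * (r ^ d * S (r ^ m))" unfolding C_def by (rule sum_distrib_right[symmetric])
      also have "\<dots> = C * r ^ d * S (r ^ m)" by simp
      finally show ?thesis .
    qed
    have Wb: "norm (fps_nth W k) * r ^ k \<le> S (r ^ M)" for k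
      unfolding W_def using comp_bd[of r M k] r m by simp
    have T: "(\<Sum>j<e. norm (Polynomial.coeff (b n) j) * r ^ j) \<le> \<beta> / 2 * r ^ e"
    proof (cases e)
      case (Suc e')
      have "(\<Sum>j<e. norm (Polynomial.coeff (b n) j) * r ^ j) \<le> (\<Sum>j<e. norm (Polynomial.coeff (b n) j) * r ^ e')"
        using r Suc by (intro sum_mono mult_left_mono power_increasing) auto
      also have "\<dots> = B * r ^ e'" by (simp add: B_def sum_distrib_right)
      also have "\<dots> \<le> (\<beta> / 2 * r) * r ^ e'"
        using r \<beta> by (intro mult_right_mono) (auto simp: field_simps)
      finally show ?thesis using Suc by simp
    qed (use \<beta> in simp)
    have kb: "\<beta> * r ^ e * (norm (fps_nth W k) * r ^ k) \<le> C * r ^ d * S (r ^ m) + \<beta> / 2 * r ^ e * S (r ^ M)" for k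
    proof -
      have "fps_nth (fps_of_poly (b n) * W) (k + e) = (\<Sum>j\<le>e. Polynomial.coeff (b n) j * fps_nth W (k + e - j))"
      proof -
        have "fps_nth (fps_of_poly (b n) * W) (k + e) = (\<Sum>j=0..k+e. Polynomial.coeff (b n) j * fps_nth W (k + e - j))"
          by (simp add: fps_mult_nth)
        also have "\<dots> = (\<Sum>j\<le>e. Polynomial.coeff (b n) j * fps_nth W (k + e - j))"
          by (intro sum.mono_neutral_right) (auto simp: e_def coeff_eq_0)
        finally show ?thesis .
      qed
      then have "lead_coeff (b n) * fps_nth W k = fps_nth (fps_of_poly (b n) * W) (k + e)
          - (\<Sum>j<e. Polynomial.coeff (b n) j * fps_nth W (k + e - j))"
        by (simp flip: lessThan_Suc_atMost add: e_def)
      then have "\<beta> * norm (fps_nth W k) \<le> norm (fps_nth (fps_of_poly (b n) * W) (k + e))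
          + norm (\<Sum>j<e. Polynomial.coeff (b n) j * fps_nth W (k + e - j))"
        unfolding \<beta>_def by (metis norm_mult norm_triangle_ineq4)
      then have "\<beta> * norm (fps_nth W k) * r ^ (k + e) \<le> (norm (fps_nth (fps_of_poly (b n) * W) (k + e))
          + norm (\<Sum>j<e. Polynomial.coeff (b n) j * fps_nth W (k + e - j))) * r ^ (k + e)"
        using r by (intro mult_right_mono) auto
      also have "\<dots> \<le> C * r ^ d * S (r ^ m) + norm (\<Sum>j<e. Polynomial.coeff (b n) j * fps_nth W (k + e - j)) * r ^ (k + e)"
        using bW[of "k + e"] by (simp add: algebra_simps)
      also have "norm (\<Sum>j<e. Polynomial.coeff (b n) j * fps_nth W (k + e - j)) * r ^ (k + e)
          \<le> (\<Sum>j<e. norm (Polynomial.coeff (b n) j * fps_nth W (k + e - j))) * r ^ (k + e)"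
        using r by (intro mult_right_mono norm_sum) auto
      also have "\<dots> = (\<Sum>j<e. norm (Polynomial.coeff (b n) j) * r ^ j * (norm (fps_nth W (k + e - j)) * r ^ (k + e - j)))"
        unfolding sum_distrib_right
      proof (intro sum.cong refl)
        fix j assume "j \<in> {..<e}"
        then have "r ^ (k + e) = r ^ j * r ^ (k + e - j)" by (simp flip: power_add)
        then show "norm (Polynomial.coeff (b n) j * fps_nth W (k + e - j)) * r ^ (k + e) = 
          norm (Polynomial.coeff (b n) j) * r ^ j * (norm (fps_nth W (k + e - j)) * r ^ (k + e - j))"
          by (simp add: norm_mult mult_ac)
      qed
      also have "\<dots> \<le> (\<Sum>j<e. norm (Polynomial.coeff (b n) j) * r ^ j * S (r ^ M))"
        using r Wb by (intro sum_mono mult_left_mono) auto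
      also have "\<dots> = (\<Sum>j<e. norm (Polynomial.coeff (b n) j) * r ^ j) * S (r ^ M)" by (simp add: sum_distrib_right)
      also have "\<dots> \<le> \<beta> / 2 * r ^ e * S (r ^ M)"
        using T S0[of "r ^ M"] r by (intro mult_right_mono) auto
      finally show ?thesis by (simp add: power_add mult_ac)
    qed
    have "norm (fps_nth W k) * r ^ k \<le> (C * r ^ d * S (r ^ m) + \<beta> / 2 * r ^ e * S (r ^ M)) / (\<beta> * r ^ e)" for k
    proof -
      have "\<beta> * r ^ e > 0" using \<beta> r by simp
      then show ?thesis
        using kb[of k] by (simp add: pos_le_divide_eq mult.commute)
    qed
    then have *: "S (r ^ M) \<le> (C * r ^ d * S (r ^ m) + \<beta> / 2 * r ^ e * S (r ^ M)) / (\<beta> * r ^ e)"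
    proof (intro S_least)
      fix k
      assume a: "\<And>k. norm (fps_nth W k) * r ^ k \<le> (C * r ^ d * S (r ^ m) + \<beta> / 2 * r ^ e * S (r ^ M)) / (\<beta> * r ^ e)"
      show "norm (fps_nth G k) * (r ^ M) ^ k \<le> (C * r ^ d * S (r ^ m) + \<beta> / 2 * r ^ e * S (r ^ M)) / (\<beta> * r ^ e)"
        using a[of "M * k"] m(3) unfolding W_def nth_compose_X_power[OF m(3)]
        by (simp add: power_mult)
    qed
    have "\<beta> * r ^ e * S (r ^ M) \<le> C * r ^ d * S (r ^ m) + \<beta> / 2 * r ^ e * S (r ^ M)"
      using * \<beta> r by (simp add: field_simps)
    then have "\<beta> / 2 * (r ^ e * S (r ^ M)) \<le> C * r ^ d * S (r ^ m)" by (simp add: field_simps)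
    moreover have "1 * S (r ^ M) \<le> r ^ e * S (r ^ M)"
      using r S0[of "r ^ M"] by (intro mult_right_mono) auto
    then have "\<beta> / 2 * S (r ^ M) \<le> \<beta> / 2 * (r ^ e * S (r ^ M))" using \<beta> by simp
    ultimately have "\<beta> / 2 * S (r ^ M) \<le> C * r ^ d * S (r ^ m)" by linarith
    then show ?thesis using \<beta> by (simp add: field_simps)
  qed
  \<comment> \<open>\<open>C'\<close> is made at least 1 so that its powers can be compared and
    cancelled; \<open>r0 \<ge> 2 * C'\<close> supplies the factor \<open>2 ^ k\<close> that kills
    the high coefficients at the end; \<open>\<rho> = r0 ^ m\<close> because the bound relates
    \<open>r ^ M\<close> to \<open>r ^ m\<close>.\<close>
  define C' where "C' = max 1 (2 * C / \<beta>)"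
  define r0 where "r0 = Max {2 * C', 2 * B / \<beta>, 2}"
  define \<rho> where "\<rho> = r0 ^ m"
  have r0: "r0 \<ge> 2 * C'" "r0 \<ge> 2 * B / \<beta>" "r0 \<ge> 2" by (auto simp: r0_def)
  have \<rho>r0: "\<rho> \<ge> r0" unfolding \<rho>_def using r0 m self_le_power[of r0 m] by simp
  have C'1: "C' \<ge> 1" by (simp add: C'_def)
  have step: "S (x ^ p) \<le> C' * x ^ d * S x" if x: "x \<ge> \<rho>" for x
  proof -
    define r where "r = root m x"
    have x0: "x \<ge> 0" using x \<rho>r0 r0 by simp
    have r: "r ^ m = x" using x0 m by (simp add: r_def)
    have "root m \<rho> \<le> root m x" using x m by simp
    then have rr0: "r \<ge> r0" unfolding \<rho>_def r_def using r0 m by (simp add: real_root_power_cancel)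
    have "r \<le> x" using r self_le_power[of r m] rr0 r0 m by simp
    have "S (x ^ p) \<le> 2 * C / \<beta> * r ^ d * S x"
      using bound[of r] rr0 r0 r m(2) by (simp add: power_mult)
    also have "\<dots> \<le> C' * x ^ d * S x"
      using S0[of x] x0 \<open>r \<le> x\<close> rr0 r0 C'1 C0 \<beta>
      by (intro mult_mono power_mono) (auto simp: C'_def)
    finally show ?thesis .
  qed
  have \<rho>1: "\<rho> \<ge> 1" using \<rho>r0 r0 by simp
  \<comment> \<open>Each step doubles the exponent \<open>d * p ^ k\<close> of \<rho>, and the
    result is at most \<open>d * p ^ Suc k\<close> because \<open>p \<ge> 2\<close>.\<close>
  have iter: "S (\<rho> ^ (p ^ k)) \<le> C' ^ k * \<rho> ^ (d * p ^ k) * S \<rho>" for k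
  proof (induction k)
    case 0
    have "1 * S \<rho> \<le> \<rho> ^ d * S \<rho>" using \<rho>1 S0[of \<rho>] by (intro mult_right_mono) auto
    then show ?case by simp
  next
    case (Suc k)
    have "\<rho> ^ 1 \<le> \<rho> ^ (p ^ k)" using \<rho>1 p by (intro power_increasing) auto
    then have "S ((\<rho> ^ (p ^ k)) ^ p) \<le> C' * (\<rho> ^ (p ^ k)) ^ d * S (\<rho> ^ (p ^ k))" by (intro step) simp
    also have "\<dots> \<le> C' * (\<rho> ^ (p ^ k)) ^ d * (C' ^ k * \<rho> ^ (d * p ^ k) * S \<rho>)"
      using Suc C'1 \<rho>1 by (intro mult_left_mono) auto
    also have "\<dots> = C' ^ Suc k * \<rho> ^ (2 * (d * p ^ k)) * S \<rho>"
    proof -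
      have "(\<rho> ^ (p ^ k)) ^ d * \<rho> ^ (d * p ^ k) = \<rho> ^ (2 * (d * p ^ k))"
        unfolding mult_2 power_add by (simp add: mult.commute flip: power_mult)
      then show ?thesis by (simp add: mult_ac)
    qed
    also have "\<dots> \<le> C' ^ Suc k * \<rho> ^ (d * p ^ Suc k) * S \<rho>"
    proof (intro mult_right_mono mult_left_mono power_increasing)
      show "2 * (d * p ^ k) \<le> d * p ^ Suc k" using p by simp
    qed (use C'1 \<rho>1 S0[of \<rho>] in auto)
    finally show ?case by (simp add: power_mult mult.commute flip: power_mult)
  qed
  have "fps_nth G l = 0" if l: "l > d" for l
  proof (rule ccontr)
    assume nz: "fps_nth G l \<noteq> 0"
    \<comment> \<open>Comparing the exponents \<open>l \<ge> d + 1\<close> and \<open>d\<close>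
      leaves one factor \<open>\<rho> ^ (p ^ k)\<close>, which exceeds \<open>C' ^ k\<close> by at
      least \<open>2 ^ k\<close>.\<close>
    have *: "norm (fps_nth G l) * 2 ^ k \<le> S \<rho>" for k
    proof -
      have "norm (fps_nth G l) * (\<rho> ^ (p ^ k)) ^ (d + 1) \<le> norm (fps_nth G l) * (\<rho> ^ (p ^ k)) ^ l"
        using l \<rho>1 by (intro mult_left_mono power_increasing) auto
      also have "\<dots> \<le> S (\<rho> ^ (p ^ k))" using \<rho>1 by (intro S) auto
      also have "\<dots> \<le> C' ^ k * \<rho> ^ (d * p ^ k) * S \<rho>" by (rule iter)
      finally have "(norm (fps_nth G l) * \<rho> ^ (p ^ k)) * \<rho> ^ (d * p ^ k) \<le> (C' ^ k * S \<rho>) * \<rho> ^ (d * p ^ k)"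
        by (simp add: mult_ac flip: power_mult)
      then have 1: "norm (fps_nth G l) * \<rho> ^ (p ^ k) \<le> C' ^ k * S \<rho>"
        using \<rho>1 by (simp add: mult_le_cancel_right)
      have "k \<le> p ^ k" using p by (metis less_exp le_trans less_imp_le power_mono zero_le)
      have "2 ^ k * C' ^ k = (2 * C') ^ k" by (simp add: power_mult_distrib)
      also have "\<dots> \<le> \<rho> ^ k" using r0 \<rho>r0 C'1 by (intro power_mono) auto
      also have "\<dots> \<le> \<rho> ^ (p ^ k)" using \<open>k \<le> p ^ k\<close> \<rho>1 by (intro power_increasing) auto
      finally have "norm (fps_nth G l) * (2 ^ k * C' ^ k) \<le> norm (fps_nth G l) * \<rho> ^ (p ^ k)"
        by (intro mult_left_mono) auto
      then have "(norm (fps_nth G l) * 2 ^ k) * C' ^ k \<le> S \<rho> * C' ^ k"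
        using 1 by (simp add: mult_ac)
      then show ?thesis using C'1 by (simp add: mult_le_cancel_right)
    qed
    obtain k where "S \<rho> / norm (fps_nth G l) < 2 ^ k" using real_arch_pow[of 2] by auto
    then show False using *[of k] nz by (simp add: field_simps)
  qed
  then show ?thesis by blast
qed

text \<open>Convergence of \<open>fps_of_poly D * f\<close> slightly beyond the unit disc suffices:
  the Mahler equation spreads it to all radii at the cost of another denominator, and an entire
  solution of a Mahler equation is a polynomial.\<close>

theorem mahler_rational:
  fixes p n :: nat
  assumes p: "p \<ge> 2" and n: "n \<ge> 1" and an: "a n \<noteq> 0"
    and eq: "(\<Sum>i\<le>n. fps_of_poly (a i) * (f oo fps_X ^ (p ^ i))) = 0"
    and D: "D \<noteq> 0" "geo R (fps_of_poly D * f)" and R: "R > 1"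
  shows "is_rational_fps f"
proof -
  obtain D' where D': "D' \<noteq> 0" "\<And>r. r \<ge> 0 \<Longrightarrow> geo r (fps_of_poly D' * f)"
    by (rule geo_all_radii[OF assms]) (rule that)
  define G where "G = fps_of_poly D' * f"
  have "\<exists>E. fps_of_poly E = fps_of_poly D' oo fps_X ^ (p ^ i) \<and> E \<noteq> 0" for i
  proof -
    have "p ^ i > 0" using p by simp
    then show ?thesis using D'(1) by (rule compose_X_power_neq_0) (intro exI conjI)
  qed
  then obtain E where E: "\<And>i. fps_of_poly (E i) = fps_of_poly D' oo fps_X ^ (p ^ i)" "\<And>i. E i \<noteq> 0" by metis
  \<comment> \<open>The equation for \<open>f\<close> multiplied by all \<open>E j\<close>; the
    factor \<open>E i\<close> is absorbed into \<open>G\<close> at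
    \<open>x ^ (p ^ i)\<close>.\<close>
  define b where "b i = a i * (\<Prod>j\<in>{..n} - {i}. E j)" for i
  have "(\<Sum>i\<le>n. fps_of_poly (b i) * (G oo fps_X ^ (p ^ i)))
      = (\<Sum>i\<le>n. (\<Prod>j\<le>n. fps_of_poly (E j)) * (fps_of_poly (a i) * (f oo fps_X ^ (p ^ i))))"
  proof (intro sum.cong refl)
    fix i assume i: "i \<in> {..n}"
    have "(\<Prod>j\<le>n. fps_of_poly (E j)) = fps_of_poly (E i) * (\<Prod>j\<in>{..n} - {i}. fps_of_poly (E j))"
      using i by (simp add: prod.remove)
    moreover have "G oo fps_X ^ (p ^ i) = fps_of_poly (E i) * (f oo fps_X ^ (p ^ i))"
      unfolding E(1) G_def by (rule fps_compose_mult_distrib) (use p in simp)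
    ultimately show "fps_of_poly (b i) * (G oo fps_X ^ (p ^ i)) = 
        (\<Prod>j\<le>n. fps_of_poly (E j)) * (fps_of_poly (a i) * (f oo fps_X ^ (p ^ i)))"
      by (simp add: b_def fps_of_poly_mult fps_of_poly_prod mult_ac)
  qed
  also have "\<dots> = 0" by (simp add: eq flip: sum_distrib_left)
  finally have "\<exists>K. \<forall>m>K. fps_nth G m = 0"
    using D'(2) an E(2) unfolding G_def
    by (intro entire_mahler_polynomial[OF p n, of b]) (auto simp: b_def)
  then obtain K where K: "\<And>m. m > K \<Longrightarrow> fps_nth G m = 0" by blast
  define P where "P = (\<Sum>k\<le>K. Polynomial.monom (fps_nth G k) k)"
  have "fps_of_poly P = G"
  proof (rule fps_ext)
    fix k
    have "Polynomial.coeff P k = (\<Sum>j\<le>K. if j = k then fps_nth G k else 0)"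
      unfolding P_def coeff_sum by (intro sum.cong) auto
    then show "fps_nth (fps_of_poly P) k = fps_nth G k" using K[of k] by auto
  qed
  then show ?thesis using D'(1) unfolding is_rational_fps_def G_def by metis
qed


subsection \<open>Normalised Mahler equations and convergence in the unit disc\<close>

lemma poly_bound_conv_radius:
  assumes "\<And>k. norm (fps_nth G k) \<le> A * real (k + 1) ^ a"
  shows "fps_conv_radius (G :: complex fps) \<ge> 1"
  unfolding fps_conv_radius_def one_ereal_def
proof (rule conv_radius_geI_ex')
  fix r :: real assume r: "0 < r" "ereal r < ereal 1"
  have "(\<lambda>k. real (k + 1) ^ a * sqrt r ^ k) \<longlonglongrightarrow> 0"
  proof -
    have "sqrt r > 0" "sqrt r < 1" using r by auto
    then show ?thesis by real_asymp
  qed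
  then have "eventually (\<lambda>k. real (k + 1) ^ a * sqrt r ^ k < 1) sequentially"
    by (rule order_tendstoD) simp
  then have "eventually (\<lambda>k. norm (fps_nth G k * of_real r ^ k) \<le> \<bar>A\<bar> * sqrt r ^ k) sequentially"
  proof eventually_elim
    case (elim k)
    have "norm (fps_nth G k * of_real r ^ k) = norm (fps_nth G k) * (sqrt r ^ k * sqrt r ^ k)"
      using r by (simp add: norm_mult norm_power flip: power_mult_distrib)
    also have "\<dots> \<le> (A * real (k + 1) ^ a) * (sqrt r ^ k * sqrt r ^ k)"
      using assms[of k] r by (intro mult_right_mono) auto
    also have "\<dots> \<le> (\<bar>A\<bar> * real (k + 1) ^ a) * (sqrt r ^ k * sqrt r ^ k)"
      using r by (intro mult_right_mono) auto
    also have "\<dots> = \<bar>A\<bar> * sqrt r ^ k * (real (k + 1) ^ a * sqrt r ^ k)" by (simp add: mult_ac)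
    also have "\<dots> \<le> \<bar>A\<bar> * sqrt r ^ k * 1" using elim r by (intro mult_left_mono) auto
    finally show ?case by simp
  qed
  moreover have "summable (\<lambda>k. \<bar>A\<bar> * sqrt r ^ k)"
    using r by (intro summable_mult summable_geometric) auto
  ultimately show "summable (\<lambda>n. fps_nth G n * of_real r ^ n)"
    by (rule summable_comparison_test_ev)
qed

text \<open>Coefficient \<open>k\<close> of \<open>G\<close> is a combination of coefficients with
  index at most \<open>(k + m) / 2\<close>, since \<open>p \<ge> 2\<close>. Such a halving recursion
  allows only polynomial growth.\<close>

lemma mahler_conv_radius:
  fixes p n m :: nat and c :: "nat \<Rightarrow> complex poly"
  assumes p: "p \<ge> 2"
    and eq: "fps_X ^ m * G = (\<Sum>i=1..n. fps_of_poly (c i) * (G oo fps_X ^ (p ^ i)))"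
  shows "fps_conv_radius G \<ge> 1"
proof -
  define C where "C = (\<Sum>i=1..n. \<Sum>j\<le>degree (c i). norm (Polynomial.coeff (c i) j))"
  have C0: "C \<ge> 0" unfolding C_def by (intro sum_nonneg) auto
  \<comment> \<open>For \<open>k \<ge> 2 * m + 2\<close> the indices \<open>l\<close> on the right
    satisfy \<open>l + 1 \<le> 7/8 * (k + 1)\<close>. The exponent \<open>a\<close> makes the gain
    \<open>(7/8) ^ a\<close> beat the total size \<open>C\<close> of the coefficients; the smaller
    indices go into \<open>A\<close>.\<close>
  obtain a where a: "(7 / 8 :: real) ^ a * C \<le> 1"
  proof -
    have "(\<lambda>a. (7 / 8 :: real) ^ a * C) \<longlonglongrightarrow> 0" by (auto intro!: tendsto_mult_left_zero LIMSEQ_power_zero)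
    then have "eventually (\<lambda>a. (7 / 8 :: real) ^ a * C < 1) sequentially" by (rule order_tendstoD) simp
    then obtain a where "(7 / 8 :: real) ^ a * C < 1" by (auto simp: eventually_sequentially)
    then show thesis by (intro that[of a]) simp
  qed
  define A where "A = (\<Sum>k\<le>2 * m + 1. norm (fps_nth G k))"
  have A0: "A \<ge> 0" unfolding A_def by (intro sum_nonneg) auto
  have "norm (fps_nth G k) \<le> A * real (k + 1) ^ a" for k
  proof (induction k rule: less_induct)
    case (less k)
    show ?case
    proof (cases "k \<le> 2 * m + 1")
      case True
      then have "norm (fps_nth G k) \<le> A" unfolding A_def by (intro member_le_sum) auto
      also have "\<dots> \<le> A * real (k + 1) ^ a" using A0 by (simp add: mult_le_cancel_left1)
      finally show ?thesis .
    next
      case False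
      define Y where "Y = A * ((7/8) * real (k + 1)) ^ a"
      have Y0: "Y \<ge> 0" using A0 by (simp add: Y_def)
      have idx: "norm (fps_nth (G oo fps_X ^ (p ^ i)) (k + m - j)) \<le> Y" if i: "i \<in> {1..n}" for i j
      proof (cases "p ^ i dvd k + m - j")
        case True
        then obtain l where l: "k + m - j = p ^ i * l" by (elim dvdE)
        have "p ^ 1 \<le> p ^ i" using i p by (intro power_increasing) auto
        then have "2 \<le> p ^ i" using p by simp
        then have "2 * l \<le> k + m" using l by (metis diff_le_self mult_le_mono1 le_trans)
        then have "4 * l \<le> 3 * k" using False by simp
        then have "l < k" and 1: "real (l + 1) \<le> 7/8 * real (k + 1)" using False by auto
        have "norm (fps_nth G l) \<le> A * real (l + 1) ^ a" using less \<open>l < k\<close> by blast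
        also have "\<dots> \<le> Y" unfolding Y_def using 1 A0 by (intro mult_left_mono power_mono) auto
        finally show ?thesis using l p by (simp add: nth_compose_X_power)
      qed (use Y0 p in \<open>simp add: nth_compose_X_power\<close>)
      have "fps_nth G k = fps_nth (fps_X ^ m * G) (k + m)" by (simp add: fps_X_power_mult_nth)
      also have "norm \<dots> \<le> (\<Sum>i=1..n. norm (fps_nth (fps_of_poly (c i) * (G oo fps_X ^ (p ^ i))) (k + m)))"
        unfolding eq fps_sum_nth by (rule norm_sum)
      also have "\<dots> \<le> (\<Sum>i=1..n. (\<Sum>j\<le>degree (c i). norm (Polynomial.coeff (c i) j)) * Y)"
      proof (intro sum_mono)
        fix i assume i: "i \<in> {1..n}"
        have "norm (fps_nth (fps_of_poly (c i) * (G oo fps_X ^ (p ^ i))) (k + m))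
           \<le> (\<Sum>j=0..k+m. norm (Polynomial.coeff (c i) j * fps_nth (G oo fps_X ^ (p ^ i)) (k + m - j)))"
          unfolding fps_mult_nth fps_of_poly_nth by (rule norm_sum)
        also have "\<dots> \<le> (\<Sum>j=0..k+m. norm (Polynomial.coeff (c i) j) * Y)"
          unfolding norm_mult by (intro sum_mono mult_left_mono idx i) auto
        also have "\<dots> = (\<Sum>j\<in>{0..k+m} \<inter> {..degree (c i)}. norm (Polynomial.coeff (c i) j) * Y)"
          by (intro sum.mono_neutral_right) (auto simp: coeff_eq_0)
        also have "\<dots> \<le> (\<Sum>j\<le>degree (c i). norm (Polynomial.coeff (c i) j) * Y)"
          using Y0 by (intro sum_mono2) auto
        finally show "norm (fps_nth (fps_of_poly (c i) * (G oo fps_X ^ (p ^ i))) (k + m)) \<le>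
            (\<Sum>j\<le>degree (c i). norm (Polynomial.coeff (c i) j)) * Y" by (simp add: sum_distrib_right)
      qed
      also have "\<dots> = C * Y" by (simp add: C_def sum_distrib_right)
      also have "\<dots> = (7/8) ^ a * C * (A * real (k + 1) ^ a)" unfolding Y_def power_mult_distrib by (simp only: mult_ac)
      also have "\<dots> \<le> 1 * (A * real (k + 1) ^ a)" using a A0 by (intro mult_right_mono) auto
      finally show ?thesis by simp
    qed
  qed
  then show ?thesis by (rule poly_bound_conv_radius)
qed

text \<open>Comparison of coefficients in \<open>H = fps_of_poly b * (H oo fps_X ^ p)\<close> with
  constant term 1. For \<open>p < 2\<close> a default value is given, so that
  \<open>k div p < k\<close> at every recursive call.\<close>

function mahler_prod_coeff :: "nat \<Rightarrow> complex poly \<Rightarrow> nat \<Rightarrow> complex" where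
  "mahler_prod_coeff p b k = (if k = 0 \<or> p < 2 then 1 else
     sum_list (map (\<lambda>l. Polynomial.coeff b (k - p * l) * mahler_prod_coeff p b l) [0..<Suc (k div p)]))"
  by auto
termination
proof (relation "Wellfounded.measure (\<lambda>(p, b, k). k)")
  fix p k l :: nat and b :: "complex poly"
  assume "\<not> (k = 0 \<or> p < 2)" "l \<in> set [0..<Suc (k div p)]"
  then have "l \<le> k div p" "k div p < k" by auto
  then show "((p, b, l), p, b, k) \<in> Wellfounded.measure (\<lambda>(p, b, k). k)" by simp
qed simp
declare mahler_prod_coeff.simps [simp del]

text \<open>The power series of the infinite product of all \<open>b(x\<^sup>q)\<close> with \<open>q\<close> a power of \<open>p\<close>.\<close>

lemma mahler_product_exists:
  fixes b :: "complex poly"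
  assumes p: "p \<ge> 2" and b: "Polynomial.coeff b 0 = 1"
  shows "\<exists>H. H = fps_of_poly b * (H oo fps_X ^ p) \<and> fps_nth H 0 = 1"
proof -
  define H where "H = Abs_fps (mahler_prod_coeff p b)"
  have 0: "fps_nth H 0 = 1" by (simp add: H_def mahler_prod_coeff.simps)
  have "fps_nth H k = fps_nth (fps_of_poly b * (H oo fps_X ^ p)) k" for k
  proof (cases "k = 0")
    case True
    then show ?thesis using 0 b p by (simp add: nth_compose_X_power)
  next
    case False
    have "fps_nth (fps_of_poly b * (H oo fps_X ^ p)) k
        = fps_nth ((H oo fps_X ^ p) * fps_of_poly b) k" by (simp add: mult.commute)
    also have "\<dots> = (\<Sum>i=0..k. (if p dvd i then fps_nth H (i div p) else 0) * Polynomial.coeff b (k - i))"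
      unfolding fps_mult_nth using p by (simp add: nth_compose_X_power)
    also have "\<dots> = (\<Sum>i\<in>(\<lambda>l. p * l) ` {0..<Suc (k div p)}. fps_nth H (i div p) * Polynomial.coeff b (k - i))"
    proof (rule sum.mono_neutral_cong_right)
      show "(\<lambda>l. p * l) ` {0..<Suc (k div p)} \<subseteq> {0..k}"
        using p by (auto simp: less_Suc_eq_le) (metis le_trans mult_le_mono2 times_div_less_eq_dividend)
      show "\<forall>i\<in>{0..k} - (\<lambda>l. p * l) ` {0..<Suc (k div p)}.
         (if p dvd i then fps_nth H (i div p) else 0) * Polynomial.coeff b (k - i) = 0"
        using p by (auto simp: image_iff less_Suc_eq_le less_eq_div_iff_mult_less_eq mult.commute elim!: dvdE)
    qed auto
    also have "\<dots> = (\<Sum>l\<in>{0..<Suc (k div p)}. fps_nth H l * Polynomial.coeff b (k - p * l))"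
      using p by (subst sum.reindex) (auto simp: inj_on_def)
    also have "\<dots> = fps_nth H k" using False p
      unfolding H_def fps_nth_Abs_fps
      by (subst (2) mahler_prod_coeff.simps) (simp add: interv_sum_list_conv_sum_set_nat mult.commute del: upt_Suc sum.op_ivl_Suc)
    finally show ?thesis ..
  qed
  then have "H = fps_of_poly b * (H oo fps_X ^ p)" by (rule fps_ext)
  with 0 show ?thesis by blast
qed

text \<open>The first coefficient is \<open>k * x ^ m * b\<close> with \<open>b\<close> of constant
  term 1. The infinite product \<open>H\<close> absorbs \<open>b\<close>, so the equation of
  \<open>F\<close> starts with the monomial \<open>k * x ^ m\<close>, and its coefficients obey the
  recursion that forces convergence in the disc.\<close>

lemma mahler_normal_form:
  assumes "is_mahler p f" "\<not> is_rational_fps f"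
  obtains n a b c F H where "p \<ge> 2" "n \<ge> 1" "a n \<noteq> 0"
    "(\<Sum>i\<le>n. fps_of_poly (a i) * (f oo fps_X ^ (p ^ i))) = 0"
    "b \<noteq> 0" "H = fps_of_poly b * (H oo fps_X ^ p)" "fps_nth H 0 = 1" "F = H * f"
    "c 0 \<noteq> 0" "c n \<noteq> 0" "(\<Sum>i\<le>n. fps_of_poly (c i) * (F oo fps_X ^ (p ^ i))) = 0"
    "fps_conv_radius F \<ge> 1" "fps_conv_radius H \<ge> 1"
proof -
  obtain n a where p: "p \<ge> 2" and a: "a 0 \<noteq> 0" "a n \<noteq> 0"
    and eq: "(\<Sum>i\<le>n. fps_of_poly (a i) * (f oo fps_X ^ (p ^ i))) = 0"
    by (rule is_mahler_minimal[OF assms(1)]) (rule that)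
  have n: "n \<ge> 1"
  proof (rule ccontr)
    assume "\<not> n \<ge> 1"
    then have "n = 0" by simp
    then have "fps_of_poly (a 0) * f = 0" using eq by simp
    then have "fps_of_poly (a 0) * f = fps_of_poly 0" by simp
    then show False using assms(2) a(1) unfolding is_rational_fps_def by blast
  qed
  obtain q where q: "a 0 = [:- 0, 1:] ^ Polynomial.order 0 (a 0) * q" "\<not> [:- 0, 1:] dvd q"
    using order_decomp[OF a(1), of 0] by blast
  define m where "m = Polynomial.order 0 (a 0)"
  have "poly q 0 \<noteq> 0" using q(2) poly_eq_0_iff_dvd[of q 0] by metis
  then have q0: "Polynomial.coeff q 0 \<noteq> 0" by (simp add: poly_0_coeff_0)
  define k where "k = Polynomial.coeff q 0"
  define b where "b = Polynomial.smult (1 / k) q"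
  have b0: "Polynomial.coeff b 0 = 1" using q0 by (simp add: b_def k_def)
  then have b: "b \<noteq> 0" by auto
  have a0: "fps_of_poly (a 0) = fps_const k * fps_X ^ m * fps_of_poly b"
  proof -
    have "a 0 = Polynomial.smult k (Polynomial.monom 1 m * b)"
      using q(1) q0 by (simp add: b_def k_def m_def monom_altdef)
    then show ?thesis by (simp add: fps_of_poly_mult fps_of_poly_smult fps_of_poly_monom mult_ac)
  qed
  obtain H where H: "H = fps_of_poly b * (H oo fps_X ^ p)" "fps_nth H 0 = 1"
    using mahler_product_exists[OF p b0] by (elim exE conjE) (rule that)
  have "\<exists>E. fps_of_poly E = fps_of_poly b oo fps_X ^ (p ^ i) \<and> E \<noteq> 0" for i
  proof -
    have "p ^ i > 0" using p by simp
    then show ?thesis using b by (rule compose_X_power_neq_0) (intro exI conjI)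
  qed
  then obtain B where B: "\<And>i. fps_of_poly (B i) = fps_of_poly b oo fps_X ^ (p ^ i)" "\<And>i. B i \<noteq> 0" by metis
  have B0: "B 0 = b" using B(1)[of 0] by (simp add: fps_of_poly_eq_iff)
  have Hi: "H = fps_of_poly (\<Prod>j<i. B j) * (H oo fps_X ^ (p ^ i))" for i
  proof (induction i)
    case (Suc i)
    have "H oo fps_X ^ (p ^ i) = (fps_of_poly b * (H oo fps_X ^ p)) oo fps_X ^ (p ^ i)"
      by (subst H(1)) (rule refl)
    also have "\<dots> = (fps_of_poly b oo fps_X ^ (p ^ i)) * ((H oo fps_X ^ p) oo fps_X ^ (p ^ i))"
      using p by (intro fps_compose_mult_distrib) simp
    also have "(H oo fps_X ^ p) oo fps_X ^ (p ^ i) = H oo fps_X ^ (p ^ Suc i)"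
      using p by (subst compose_X_power_power) auto
    finally have "H oo fps_X ^ (p ^ i) = fps_of_poly (B i) * (H oo fps_X ^ (p ^ Suc i))" by (simp add: B)
    then have "fps_of_poly (\<Prod>j<i. B j) * (H oo fps_X ^ (p ^ i))
      = fps_of_poly (\<Prod>j<Suc i. B j) * (H oo fps_X ^ (p ^ Suc i))"
      by (simp only: prod.lessThan_Suc fps_of_poly_mult mult.assoc)
    with Suc show ?case by (rule trans)
  qed simp
  define F where "F = H * f"
  \<comment> \<open>By \<open>Hi\<close>, multiplying the old equation by \<open>H\<close> puts all
    \<open>B j\<close> with \<open>j < i\<close> in front of term \<open>i\<close>; the common
    factor \<open>B 0 = b\<close> is then divided out, hence the product over
    \<open>{1..<i}\<close>.\<close>
  define c where "c i = (if i = 0 then Polynomial.smult k (Polynomial.monom 1 m) else a i * (\<Prod>j\<in>{1..<i}. B j))" for i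
  have Fi: "F oo fps_X ^ (p ^ i) = (H oo fps_X ^ (p ^ i)) * (f oo fps_X ^ (p ^ i))" for i
    unfolding F_def using p by (intro fps_compose_mult_distrib) simp
  have "fps_of_poly b * (\<Sum>i\<le>n. fps_of_poly (c i) * (F oo fps_X ^ (p ^ i)))
     = H * (\<Sum>i\<le>n. fps_of_poly (a i) * (f oo fps_X ^ (p ^ i)))"
    unfolding sum_distrib_left
  proof (intro sum.cong refl)
    fix i assume "i \<in> {..n}"
    show "fps_of_poly b * (fps_of_poly (c i) * (F oo fps_X ^ p ^ i)) = H * (fps_of_poly (a i) * (f oo fps_X ^ p ^ i))"
    proof (cases "i = 0")
      case True
      then show ?thesis
        by (simp add: c_def a0 F_def fps_of_poly_smult fps_of_poly_monom mult_ac)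
    next
      case False
      have bc: "fps_of_poly b * fps_of_poly (c i) = fps_of_poly (a i) * fps_of_poly (\<Prod>j<i. B j)"
      proof -
        have "{..<i} = insert 0 {1..<i}" using False by auto
        then have "(\<Prod>j<i. B j) = b * (\<Prod>j\<in>{1..<i}. B j)" by (simp add: B0)
        then show ?thesis using False by (simp add: c_def fps_of_poly_mult mult_ac)
      qed
      have "fps_of_poly b * (fps_of_poly (c i) * (F oo fps_X ^ p ^ i)) = 
         (fps_of_poly (\<Prod>j<i. B j) * (H oo fps_X ^ (p ^ i))) * (fps_of_poly (a i) * (f oo fps_X ^ (p ^ i)))"
      proof -
        have "fps_of_poly b * (fps_of_poly (c i) * (X * Y)) = (fps_of_poly (\<Prod>j<i. B j) * X) * (fps_of_poly (a i) * Y)"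
          if "fps_of_poly b * fps_of_poly (c i) = fps_of_poly (a i) * fps_of_poly (\<Prod>j<i. B j)" for X Y
        proof -
          have "fps_of_poly b * (fps_of_poly (c i) * (X * Y)) = (fps_of_poly b * fps_of_poly (c i)) * (X * Y)"
            by (simp only: mult.assoc)
          then show ?thesis unfolding that by (simp only: mult_ac)
        qed
        then show ?thesis using bc unfolding Fi by blast
      qed
      then show ?thesis by (simp only: Hi[of i, symmetric])
    qed
  qed
  then have Feq: "(\<Sum>i\<le>n. fps_of_poly (c i) * (F oo fps_X ^ (p ^ i))) = 0"
  proof -
    have "fps_of_poly b \<noteq> 0" using b by (metis fps_of_poly_0 fps_of_poly_eq_iff)
    then show ?thesis
      using \<open>fps_of_poly b * _ = H * _\<close> unfolding eq by simp
  qed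
  have "fps_conv_radius F \<ge> 1"
  proof (rule mahler_conv_radius[OF p, where m = m and c = "\<lambda>i. Polynomial.smult (- 1 / k) (c i)"])
    have k: "k \<noteq> 0" using q0 by (simp add: k_def)
    have "{..n} = insert 0 {1..n}" by auto
    then have "fps_const k * (fps_X ^ m * F) + (\<Sum>i=1..n. fps_of_poly (c i) * (F oo fps_X ^ (p ^ i))) = 0"
      using Feq by (simp add: c_def fps_of_poly_smult fps_of_poly_monom mult_ac)
    then have T: "fps_const k * (fps_X ^ m * F) = - (\<Sum>i=1..n. fps_of_poly (c i) * (F oo fps_X ^ (p ^ i)))"
      by (simp add: eq_neg_iff_add_eq_0)
    have "fps_X ^ m * F = fps_const (1 / k) * (fps_const k * (fps_X ^ m * F))"
      using k by (simp flip: mult.assoc)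
    also have "\<dots> = fps_const (- 1 / k) * (\<Sum>i=1..n. fps_of_poly (c i) * (F oo fps_X ^ (p ^ i)))"
      unfolding T by (simp flip: fps_const_neg)
    also have "\<dots> = (\<Sum>i = 1..n. fps_of_poly (Polynomial.smult (- 1 / k) (c i)) * (F oo fps_X ^ p ^ i))"
      unfolding sum_distrib_left fps_of_poly_smult mult.assoc by (rule refl)
    finally show "fps_X ^ m * F = (\<Sum>i = 1..n. fps_of_poly (Polynomial.smult (- 1 / k) (c i)) * (F oo fps_X ^ p ^ i))" .
  qed
  moreover have "fps_conv_radius H \<ge> 1"
    by (rule mahler_conv_radius[OF p, where m = 0 and c = "\<lambda>_. b" and n = 1]) (simp, rule H(1))
  moreover have "c 0 \<noteq> 0" "c n \<noteq> 0" using a n B q0 by (auto simp: c_def k_def)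
  ultimately show thesis
    by (intro that[OF p n a(2) eq b H F_def _ _ Feq])
qed

subsection \<open>Simultaneous approximation\<close>

text \<open>Linearity over the rationals makes the prescribed phases compatible with every rational
  relation between frequencies, which is what Kronecker's theorem asks for.\<close>

definition ratlin :: "(real \<Rightarrow> real) \<Rightarrow> bool" where
  "ratlin \<eta> \<longleftrightarrow> (\<forall>x y. \<eta> (x + y) = \<eta> x + \<eta> y) \<and> (\<forall>(q::rat) x. \<eta> (of_rat q * x) = of_rat q * \<eta> x)"

text \<open>Convergence to \<open>c\<close> on the circle of length \<open>2 * pi\<close>, written
  with explicit integers.\<close>

definition conv_mod :: "(nat \<Rightarrow> real) \<Rightarrow> real \<Rightarrow> real \<Rightarrow> bool" where
  "conv_mod t \<nu> c \<longleftrightarrow> (\<exists>k :: nat \<Rightarrow> int. (\<lambda>j. t j * \<nu> - 2 * pi * of_int (k j)) \<longlonglongrightarrow> c)"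

interpretation rat_real: vector_space "\<lambda>(q::rat) (x::real). of_rat q * x"
  by unfold_locales (auto simp: of_rat_add of_rat_mult algebra_simps)

interpretation rat_real_pair: vector_space_pair "\<lambda>(q::rat) (x::real). of_rat q * x" "\<lambda>(q::rat) (x::real). of_rat q * x"
  by unfold_locales

lemma ratlin_sum:
  assumes "ratlin \<eta>"
  shows "\<eta> (\<Sum>i\<in>A. of_rat (q i) * x i) = (\<Sum>i\<in>A. of_rat (q i) * \<eta> (x i))"
proof (induction A rule: infinite_finite_induct)
  case empty
  have "\<eta> (of_rat 0 * 0) = of_rat 0 * \<eta> 0" using assms unfolding ratlin_def by blast
  then show ?case by simp
next
  case (infinite A)
  have "\<eta> (of_rat 0 * 0) = of_rat 0 * \<eta> 0" using assms unfolding ratlin_def by blast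
  then show ?case using infinite by simp
qed (use assms in \<open>auto simp: ratlin_def\<close>)

lemma ratlin_mult: "ratlin \<eta> \<Longrightarrow> ratlin (\<lambda>x. \<eta> x * w)"
  by (auto simp: ratlin_def algebra_simps)

text \<open>\<open>a\<close> and \<open>b\<close> are independent over the rationals, so the values
  on them are free; the extension to all reals goes through a Hamel basis.\<close>

lemma ratlin_exists:
  fixes a b :: real
  assumes "a \<noteq> 0" "b / a \<notin> \<rat>"
  obtains \<eta> where "ratlin \<eta>" "\<eta> a = 0" "\<eta> b = c"
proof -
  have ne: "a \<noteq> b" using assms by auto
  have "rat_real.independent {a, b}"
  proof (rule ccontr)
    assume "\<not> rat_real.independent {a, b}"
    then have d: "rat_real.dependent {a, b}" by simp
    have "b \<notin> rat_real.span {a}"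
    proof
      assume "b \<in> rat_real.span {a}"
      then obtain q where "b = of_rat q * a" by (auto simp: rat_real.span_singleton)
      then show False using assms by (simp add: Rats_of_rat)
    qed
    moreover have "rat_real.independent {a}" using assms(1) by (simp add: rat_real.dependent_single)
    ultimately have "rat_real.independent (insert b {a})" by (rule rat_real.independent_insertI)
    then show False using d by (simp add: insert_commute)
  qed
  from rat_real_pair.linear_independent_extend[OF this, of "\<lambda>x. if x = a then 0 else c"]
  obtain g where g: "Vector_Spaces.linear (\<lambda>(q::rat) (x::real). of_rat q * x) (\<lambda>q x. of_rat q * x) g"
    "\<forall>x\<in>{a, b}. g x = (if x = a then 0 else c)" by blast
  interpret g: Vector_Spaces.linear "\<lambda>(q::rat) (x::real). of_rat q * x" "\<lambda>(q::rat) (x::real). of_rat q * x" g by fact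
  have "ratlin g" unfolding ratlin_def by (auto simp: g.add g.scale)
  then show thesis using that[of g] g(2) ne by auto
qed

lemma common_denominator:
  fixes q :: "'a \<Rightarrow> rat"
  assumes "finite A"
  shows "\<exists>D :: int. D > 0 \<and> (\<forall>x\<in>A. \<exists>z :: int. of_int z = of_int D * q x)"
  using assms
proof (induction A rule: finite_induct)
  case empty
  show ?case by (intro exI[of _ 1]) auto
next
  case (insert y A)
  then obtain D :: int where D: "D > 0" "\<forall>x\<in>A. \<exists>z :: int. of_int z = of_int D * q x" by blast
  obtain n d where nd: "quotient_of (q y) = (n, d)" by force
  then have d: "d > 0" "q y = of_int n / of_int d" by (auto simp: quotient_of_denom_pos quotient_of_div)
  have "\<exists>z :: int. of_int z = of_int (D * d) * q x" if xy: "x \<in> insert y A" for x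
  proof (cases "x = y")
    case True
    then show ?thesis using d by (intro exI[of _ "D * n"]) (simp add: field_simps)
  next
    case False
    then have xA: "x \<in> A" using xy by simp
    then obtain z :: int where "of_int z = of_int D * q x" using bspec[OF D(2) xA] by (elim exE) (rule that)
    then show ?thesis by (intro exI[of _ "z * d"]) (simp add: field_simps)
  qed
  then show ?case using D(1) d(1) by (intro exI[of _ "D * d"]) auto
qed

text \<open>Kronecker's theorem needs independent numbers, so it is applied to a maximal independent
  subset \<open>B\<close> of the frequencies; the others are rational combinations of
  \<open>B\<close> and follow by the rational linearity of \<eta>.\<close>

lemma kronecker_ratlin_approx:
  assumes N: "finite N" and \<eta>: "ratlin \<eta>" and \<epsilon>: "\<epsilon> > 0"
  shows "\<exists>t. \<forall>\<nu>\<in>N. \<exists>k::int. \<bar>t * \<nu> - 2 * pi * of_int k - \<eta> \<nu>\<bar> < \<epsilon>"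
proof -
  obtain B where B: "B \<subseteq> N" "rat_real.independent B" "N \<subseteq> rat_real.span B"
    using rat_real.maximal_independent_subset[of N] by blast
  have fB: "finite B" using B(1) N finite_subset by blast
  have "\<forall>\<nu>\<in>N. \<exists>q. \<nu> = (\<Sum>b\<in>B. of_rat (q b) * b)"
    using B(3) rat_real.span_finite[OF fB] by auto
  from bchoice[OF this] obtain Q where Q: "\<And>\<nu>. \<nu> \<in> N \<Longrightarrow> \<nu> = (\<Sum>b\<in>B. of_rat (Q \<nu> b) * b)" by blast
  obtain D :: int where D: "D > 0" "\<forall>x\<in>N \<times> B. \<exists>z :: int. of_int z = of_int D * (\<lambda>(\<nu>, b). Q \<nu> b) x"
    using common_denominator[of "N \<times> B" "\<lambda>(\<nu>, b). Q \<nu> b"] N fB by auto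
  from bchoice[OF D(2)] obtain Z' where Z': "\<forall>x\<in>N \<times> B. of_int (Z' x :: int) = of_int D * (\<lambda>(\<nu>, b). Q \<nu> b) x" ..
  define Z where "Z \<nu> b = Z' (\<nu>, b)" for \<nu> b
  have Z: "of_int (Z \<nu> b) = of_int D * Q \<nu> b" if "\<nu> \<in> N" "b \<in> B" for \<nu> b
    using bspec[OF Z', of "(\<nu>, b)"] that by (simp add: Z_def)
  have QZ: "real_of_rat (Q \<nu> b) = of_int (Z \<nu> b) / of_int D" if "\<nu> \<in> N" "b \<in> B" for \<nu> b
  proof -
    have "Q \<nu> b = of_int (Z \<nu> b) / of_int D" using Z[OF that] D(1) by (simp add: field_simps)
    then show ?thesis by (simp add: of_rat_divide)
  qed
  obtain e where e: "bij_betw e {0..<card B} B" using ex_bij_betw_nat_finite[OF fB] by blast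
  define n where "n = card B"
  have eB: "e i \<in> B" if "i < n" for i using e that by (auto simp: bij_betw_def n_def)
  \<comment> \<open>Division by the common denominator \<open>D\<close> makes every frequency an
    integer combination, which respects congruences; the factor \<open>2 * pi\<close> passes from
    the modulus \<open>2 * pi\<close> to the modulus 1.\<close>
  define \<theta> where "\<theta> i = e i / (2 * pi * of_int D)" for i
  define \<alpha> where "\<alpha> i = \<eta> (e i) / (2 * pi * of_int D)" for i
  \<comment> \<open>The factor by which errors can grow in the integer combinations; the added 1
    keeps it positive and the final inequality strict.\<close>
  define M where "M = (\<Sum>\<nu>\<in>N. \<Sum>b\<in>B. \<bar>real_of_int (Z \<nu> b)\<bar>) + 1"
  have M: "M > 0" unfolding M_def by (intro add_nonneg_pos sum_nonneg) auto
  have inj: "inj_on \<theta> {..<n}"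
    using e D(1) by (auto simp: inj_on_def bij_betw_def \<theta>_def n_def atLeast0LessThan)
  have indep: "module.independent (\<lambda>r x. of_int r * x) (\<theta> ` {..<n})"
  proof -
    interpret ZM: Modules.module "(\<lambda>r. (*) (real_of_int r))"
      by (simp add: Modules.module.intro distrib_left mult.commute)
    have "\<not> ZM.dependent (\<theta> ` {..<n})"
    proof
      assume "ZM.dependent (\<theta> ` {..<n})"
      then obtain u where u: "(\<Sum>v\<in>\<theta> ` {..<n}. of_int (u v) * v) = 0" "\<exists>v\<in>\<theta> ` {..<n}. u v \<noteq> 0"
        by (auto simp: ZM.dependent_finite)
      have "(\<Sum>i<n. of_int (u (\<theta> i)) * e i) = 0"
      proof -
        have "(\<Sum>i<n. of_int (u (\<theta> i)) * \<theta> i) = 0" using u(1) inj by (simp add: sum.reindex)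
        then have "(\<Sum>i<n. of_int (u (\<theta> i)) * e i) / (2 * pi * of_int D) = 0"
          by (simp add: \<theta>_def sum_divide_distrib)
        then show ?thesis using D(1) by simp
      qed
      moreover have "(\<Sum>b\<in>B. of_rat (of_int (u (\<theta> (inv_into {0..<card B} e b)))) * b) = 
         (\<Sum>i<n. of_int (u (\<theta> i)) * e i)"
      proof -
        have "(\<Sum>b\<in>B. of_rat (of_int (u (\<theta> (inv_into {0..<card B} e b)))) * b)
          = (\<Sum>i\<in>{0..<card B}. of_rat (of_int (u (\<theta> (inv_into {0..<card B} e (e i))))) * e i)"
          by (rule sum.reindex_bij_betw[OF e, symmetric])
        also have "\<dots> = (\<Sum>i<n. of_int (u (\<theta> i)) * e i)"
          using e by (intro sum.cong) (auto simp: n_def bij_betw_def inv_into_f_f)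
        finally show ?thesis .
      qed
      moreover obtain i where i: "i < n" "u (\<theta> i) \<noteq> 0" using u(2) by auto
      then have "e i \<in> B" "of_int (u (\<theta> (inv_into {0..<card B} e (e i)))) \<noteq> (0::rat)"
        using e eB by (auto simp: n_def bij_betw_def inv_into_f_f)
      ultimately have "rat_real.dependent B" unfolding rat_real.dependent_finite[OF fB] 
        by (intro exI[of _ "\<lambda>b. of_int (u (\<theta> (inv_into {0..<card B} e b)))"]) auto
      then show False using B(2) by simp
    qed
    then show ?thesis .
  qed
  have "\<epsilon> / (2 * pi * M) > 0" using \<epsilon> M by simp
  then obtain t h where
    th: "\<And>i. i < n \<Longrightarrow> \<bar>t * \<theta> i - of_int (h i) - \<alpha> i\<bar> < \<epsilon> / (2 * pi * M)"
    by (rule Kronecker_thm_1[OF indep inj, of _ \<alpha>]) (rule that)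
  show ?thesis
  proof (intro exI[of _ t] ballI)
    fix \<nu> assume \<nu>: "\<nu> \<in> N"
    define k where "k = (\<Sum>i<n. Z \<nu> (e i) * h i)"
    have reB: "(\<Sum>b\<in>B. F b) = (\<Sum>i<n. F (e i))" for F :: "real \<Rightarrow> real"
      using sum.reindex_bij_betw[OF e, of F] by (simp add: n_def atLeast0LessThan)
    have 1: "\<nu> = (\<Sum>i<n. of_int (Z \<nu> (e i)) / of_int D * e i)"
      using Q[OF \<nu>] QZ[OF \<nu>] eB unfolding reB by simp
    have 2: "\<eta> \<nu> = (\<Sum>i<n. of_int (Z \<nu> (e i)) / of_int D * \<eta> (e i))"
    proof -
      have "\<eta> \<nu> = (\<Sum>b\<in>B. of_rat (Q \<nu> b) * \<eta> b)"
        by (subst Q[OF \<nu>]) (rule ratlin_sum[OF \<eta>])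
      then show ?thesis using QZ[OF \<nu>] eB unfolding reB by simp
    qed
    have "t * \<nu> - 2 * pi * of_int k - \<eta> \<nu> = 
       (\<Sum>i<n. 2 * pi * of_int (Z \<nu> (e i)) * (t * \<theta> i - of_int (h i) - \<alpha> i))"
    proof -
      have "t * \<nu> = (\<Sum>i<n. t * (of_int (Z \<nu> (e i)) / of_int D * e i))"
        by (subst 1) (rule sum_distrib_left)
      moreover have "2 * pi * of_int k = (\<Sum>i<n. 2 * pi * (of_int (Z \<nu> (e i)) * of_int (h i)))"
        by (simp add: k_def sum_distrib_left)
      ultimately have "t * \<nu> - 2 * pi * of_int k - \<eta> \<nu> = (\<Sum>i<n. t * (of_int (Z \<nu> (e i)) / of_int D * e i)
          - 2 * pi * (of_int (Z \<nu> (e i)) * of_int (h i)) - of_int (Z \<nu> (e i)) / of_int D * \<eta> (e i))"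
        using 2 by (simp only: sum_subtractf)
      also have "\<dots> = (\<Sum>i<n. 2 * pi * of_int (Z \<nu> (e i)) * (t * \<theta> i - of_int (h i) - \<alpha> i))"
        using D(1) by (intro sum.cong refl) (simp add: \<theta>_def \<alpha>_def field_simps)
      finally show ?thesis .
    qed
    also have "\<bar>\<dots>\<bar> \<le> (\<Sum>i<n. \<bar>2 * pi * of_int (Z \<nu> (e i)) * (t * \<theta> i - of_int (h i) - \<alpha> i)\<bar>)"
      by (rule sum_abs)
    also have "\<dots> \<le> (\<Sum>i<n. 2 * pi * \<bar>of_int (Z \<nu> (e i))\<bar> * (\<epsilon> / (2 * pi * M)))"
      unfolding abs_mult using th by (intro sum_mono mult_mono) (auto intro: less_imp_le)
    also have "\<dots> = (\<Sum>b\<in>B. \<bar>of_int (Z \<nu> b)\<bar>) * (\<epsilon> / M)"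
      unfolding reB sum_distrib_right by (intro sum.cong) auto
    also have "\<dots> < M * (\<epsilon> / M)"
    proof (rule mult_strict_right_mono)
      have "(\<Sum>b\<in>B. \<bar>real_of_int (Z \<nu> b)\<bar>) \<le> (\<Sum>\<nu>\<in>N. \<Sum>b\<in>B. \<bar>real_of_int (Z \<nu> b)\<bar>)"
        using \<nu> N by (intro member_le_sum[of _ _ "\<lambda>\<nu>. \<Sum>b\<in>B. \<bar>real_of_int (Z \<nu> b)\<bar>"] sum_nonneg) auto
      then show "(\<Sum>b\<in>B. \<bar>real_of_int (Z \<nu> b)\<bar>) < M" by (simp add: M_def)
    qed (use \<epsilon> M in simp)
    finally show "\<exists>k::int. \<bar>t * \<nu> - 2 * pi * of_int k - \<eta> \<nu>\<bar> < \<epsilon>" using M by auto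
  qed
qed

lemma kronecker_ratlin:
  assumes N: "finite N" and \<eta>: "ratlin \<eta>"
  obtains t where "\<And>\<nu>. \<nu> \<in> N \<Longrightarrow> conv_mod t \<nu> (\<eta> \<nu>)"
proof -
  have "\<forall>j::nat. \<exists>t. \<forall>\<nu>\<in>N. \<exists>k::int. \<bar>t * \<nu> - 2 * pi * of_int k - \<eta> \<nu>\<bar> < inverse (real (Suc j))"
    by (intro allI kronecker_ratlin_approx[OF N \<eta>]) simp
  from choice[OF this] obtain t where
    t: "\<forall>j. \<forall>\<nu>\<in>N. \<exists>k::int. \<bar>t j * \<nu> - 2 * pi * of_int k - \<eta> \<nu>\<bar> < inverse (real (Suc j))" ..
  have *: "\<forall>\<nu>\<in>N. \<exists>k. \<forall>j. \<bar>t j * \<nu> - 2 * pi * of_int (k j :: int) - \<eta> \<nu>\<bar> < inverse (real (Suc j))"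
    by (intro ballI choice allI) (use t in blast)
  show thesis
  proof (rule that[of t])
    fix \<nu> assume "\<nu> \<in> N"
    then obtain k where k: "\<And>j. \<bar>t j * \<nu> - 2 * pi * of_int (k j :: int) - \<eta> \<nu>\<bar> < inverse (real (Suc j))"
      using * by blast
    have "(\<lambda>j. t j * \<nu> - 2 * pi * of_int (k j) - \<eta> \<nu>) \<longlonglongrightarrow> 0"
      by (rule Lim_null_comparison[OF _ LIMSEQ_inverse_real_of_nat])
         (use k in \<open>auto intro!: always_eventually less_imp_le\<close>)
    then show "conv_mod t \<nu> (\<eta> \<nu>)" unfolding conv_mod_def
      by (intro exI[of _ k]) (simp add: LIM_zero_iff)
  qed
qed

text \<open>Dirichlet's theorem alone only yields positive multipliers \<open>q j\<close>. The
  numbers approximated at stage \<open>j\<close> carry a factor \<open>j\<close>, so the times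
  \<open>q j * j\<close> tend to infinity.\<close>

lemma dirichlet_recurrence:
  assumes N: "finite (N :: real set)"
  obtains t where "filterlim t at_top sequentially" "\<And>\<nu>. \<nu> \<in> N \<Longrightarrow> conv_mod t \<nu> 0"
proof -
  obtain e where e: "bij_betw e {0..<card N} N" using ex_bij_betw_nat_finite[OF N] by blast
  have "\<exists>q p. 0 < q \<and> (\<forall>i<card N. \<bar>of_int q * (e i * real j / (2 * pi)) - of_int (p i :: int)\<bar> < 1 / Suc j)" for j
    using Dirichlet_approx_simult[of "Suc j" "card N" "\<lambda>i. e i * real j / (2 * pi)"] by (metis zero_less_Suc)
  then obtain q :: "nat \<Rightarrow> int" and p where qp: "\<And>j. 0 < q j"
    "\<And>j i. i < card N \<Longrightarrow> \<bar>of_int (q j) * (e i * real j / (2 * pi)) - of_int (p j i :: int)\<bar> < 1 / Suc j"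
    by metis
  define t where "t j = real_of_int (q j) * real j" for j
  show thesis
  proof (rule that[of t])
    have "real j \<le> t j" for j
      using qp(1)[of j] mult_right_mono[of 1 "real_of_int (q j)" "real j"] by (simp add: t_def)
    then show "filterlim t at_top sequentially"
      by (intro filterlim_at_top_mono[OF filterlim_real_sequentially]) auto
  next
    fix \<nu> assume "\<nu> \<in> N"
    moreover have "e ` {0..<card N} = N" using e by (simp add: bij_betw_def)
    ultimately obtain i where i: "i < card N" "e i = \<nu>" by (metis atLeastLessThan_iff imageE)
    have "(\<lambda>j. t j * \<nu> - 2 * pi * of_int (p j i)) \<longlonglongrightarrow> 0"
    proof (rule Lim_null_comparison)
      show "eventually (\<lambda>j. norm (t j * \<nu> - 2 * pi * of_int (p j i)) \<le> 2 * pi * inverse (real (Suc j))) sequentially"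
      proof (intro always_eventually allI)
        fix j
        have "t j * \<nu> - 2 * pi * of_int (p j i) = 2 * pi * (of_int (q j) * (e i * real j / (2 * pi)) - of_int (p j i))"
          using i by (simp add: t_def field_simps)
        then show "norm (t j * \<nu> - 2 * pi * of_int (p j i)) \<le> 2 * pi * inverse (real (Suc j))"
          using mult_left_mono[OF less_imp_le[OF qp(2)[OF i(1), of j]], of "2 * pi"]
          by (simp only: real_norm_def abs_mult inverse_eq_divide) simp
      qed
      show "(\<lambda>j. 2 * pi * inverse (real (Suc j))) \<longlonglongrightarrow> 0"
        by (intro tendsto_mult_right_zero LIMSEQ_inverse_real_of_nat)
    qed
    then show "conv_mod t \<nu> 0" unfolding conv_mod_def by (intro exI[of _ "\<lambda>j. p j i"])
  qed
qed

lemma conv_mod_exp: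
  assumes "conv_mod t \<nu> c"
  shows "(\<lambda>j. exp (- \<i> * of_real (\<nu> * (s + t j)))) \<longlonglongrightarrow> exp (- \<i> * of_real c) * exp (- \<i> * of_real (\<nu> * s))"
proof -
  obtain k :: "nat \<Rightarrow> int" where k: "(\<lambda>j. t j * \<nu> - 2 * pi * of_int (k j)) \<longlonglongrightarrow> c"
    using assms by (auto simp: conv_mod_def)
  have "exp (- \<i> * of_real (\<nu> * (s + t j))) = exp (- \<i> * of_real (t j * \<nu> - 2 * pi * of_int (k j))) * exp (- \<i> * of_real (\<nu> * s))" for j
  proof -
    have "- \<i> * of_real (\<nu> * (s + t j)) = (- \<i> * of_real (t j * \<nu> - 2 * pi * of_int (k j)) + - \<i> * of_real (\<nu> * s)) + \<i> * (of_int (- k j) * (of_real pi * 2))"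
      by (simp add: algebra_simps)
    then show ?thesis by (simp only: exp_plus_2pin exp_add[symmetric])
  qed
  moreover have "(\<lambda>j. exp (- \<i> * of_real (t j * \<nu> - 2 * pi * of_int (k j))) * exp (- \<i> * of_real (\<nu> * s))) 
     \<longlonglongrightarrow> exp (- \<i> * of_real c) * exp (- \<i> * of_real (\<nu> * s))"
    by (intro tendsto_intros k)
  ultimately show ?thesis by simp
qed

section \<open>Translates of periodic functions\<close>

lemma periodic_int:
  fixes q :: "real \<Rightarrow> 'a"
  assumes "\<And>s. q (s + L) = q s"
  shows "q (s + of_int k * L) = q s"
proof -
  have n: "q (s + of_nat n * L) = q s" for n s
  proof (induction n)
    case (Suc n)
    have "q (s + of_nat (Suc n) * L) = q ((s + of_nat n * L) + L)" by (simp add: algebra_simps)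
    then show ?case using Suc assms by simp
  qed simp
  show ?thesis
  proof (cases "k \<ge> 0")
    case True
    then obtain n where "k = int n" by (rule nonneg_int_cases)
    then show ?thesis using n by simp
  next
    case False
    define n where "n = nat (- k)"
    have "k = - int n" using False by (simp add: n_def)
    then show ?thesis using n[of "s + of_int k * L" n] by simp
  qed
qed

lemma conv_mod_periodic:
  fixes q :: "real \<Rightarrow> complex"
  assumes q: "continuous_on UNIV q" "\<And>s. q (s + L) = q s" and L: "L > 0"
    and t: "conv_mod t (2 * pi / L) c"
  shows "(\<lambda>j. q (s + t j)) \<longlonglongrightarrow> q (s + c * L / (2 * pi))"
proof -
  obtain k :: "nat \<Rightarrow> int" where k: "(\<lambda>j. t j * (2 * pi / L) - 2 * pi * of_int (k j)) \<longlonglongrightarrow> c"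
    using t by (auto simp: conv_mod_def)
  have "(\<lambda>j. s + (t j * (2 * pi / L) - 2 * pi * of_int (k j)) * L / (2 * pi)) \<longlonglongrightarrow> s + c * L / (2 * pi)"
    by (intro tendsto_intros k) auto
  then have "(\<lambda>j. q (s + (t j * (2 * pi / L) - 2 * pi * of_int (k j)) * L / (2 * pi))) \<longlonglongrightarrow> q (s + c * L / (2 * pi))"
    using q(1) by (intro isCont_tendsto_compose[of _ q]) (auto simp: continuous_on_eq_continuous_at)
  moreover have "s + (t j * (2 * pi / L) - 2 * pi * of_int (k j)) * L / (2 * pi) = (s + t j) + of_int (- k j) * L" for j
    using L by (simp add: field_simps)
  ultimately show ?thesis by (simp only: periodic_int[of q L, OF q(2)])
qed

lemma periodic_bounded:
  fixes q :: "real \<Rightarrow> complex"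
  assumes q: "continuous_on UNIV q" "\<And>s. q (s + L) = q s" and L: "L > 0"
  shows "bounded (range q)"
proof -
  have "range q \<subseteq> q ` {0..L}"
  proof
    fix y assume "y \<in> range q"
    then obtain s where s: "y = q s" by blast
    define k where "k = \<lfloor>s / L\<rfloor>"
    have "of_int k \<le> s / L" "s / L < of_int k + 1" by (auto simp: k_def)
    then have "s + of_int (- k) * L \<in> {0..L}" using L by (auto simp: field_simps)
    moreover have "q (s + of_int (- k) * L) = y" using periodic_int[of q L s "- k", OF q(2)] s by simp
    ultimately show "y \<in> q ` {0..L}" by (metis imageI)
  qed
  moreover have "compact (q ` {0..L})"
    by (intro compact_continuous_image continuous_on_subset[OF q(1)]) auto
  ultimately show ?thesis by (meson bounded_subset compact_imp_bounded)
qed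

subsection \<open>Twisting periodic factors\<close>

text \<open>\<open>adm Fr \<eta> \<theta> \<theta>'\<close>: the function \<open>\<theta>\<close> is recurrent, and \<open>\<theta>'\<close> is the limit of its translates along any sequence
  that approximates the character \<open>\<eta>\<close> on the frequencies \<open>Fr\<close>.\<close>

definition adm :: "real set \<Rightarrow> (real \<Rightarrow> real) \<Rightarrow> (real \<Rightarrow> complex) \<Rightarrow> (real \<Rightarrow> complex) \<Rightarrow> bool" where
  "adm Fr \<eta> \<theta> \<theta>' \<longleftrightarrow> bounded (range \<theta>) \<and>
     (\<forall>t. (\<forall>\<nu>\<in>Fr. conv_mod t \<nu> (\<eta> \<nu>)) \<longrightarrow> (\<forall>s. (\<lambda>j. \<theta> (s + t j)) \<longlonglongrightarrow> \<theta>' s)) \<and>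
     (\<forall>t. (\<forall>\<nu>\<in>Fr. conv_mod t \<nu> 0) \<longrightarrow> (\<forall>s. (\<lambda>j. \<theta> (s + t j)) \<longlonglongrightarrow> \<theta> s))"

lemma adm_mono: "adm Fr \<eta> \<theta> \<theta>' \<Longrightarrow> Fr \<subseteq> Fr' \<Longrightarrow> adm Fr' \<eta> \<theta> \<theta>'"
  unfolding adm_def by blast

lemma adm_const: "adm Fr \<eta> (\<lambda>_. c) (\<lambda>_. c)"
  unfolding adm_def by auto

lemma adm_mult:
  assumes "adm Fr \<eta> \<theta> \<theta>'" "adm Fr \<eta> \<phi> \<phi>'"
  shows "adm Fr \<eta> (\<lambda>s. \<theta> s * \<phi> s) (\<lambda>s. \<theta>' s * \<phi>' s)"
proof -
  obtain A B where "\<And>s. norm (\<theta> s) \<le> A" "\<And>s. norm (\<phi> s) \<le> B"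
    using assms unfolding adm_def by (meson bounded_iff rangeI)
  then have "norm (\<theta> s * \<phi> s) \<le> A * B" for s
    unfolding norm_mult by (intro mult_mono) (auto intro: order_trans[OF norm_ge_zero])
  then have "bounded (range (\<lambda>s. \<theta> s * \<phi> s))" by (auto simp: bounded_iff)
  then show ?thesis using assms unfolding adm_def by (auto intro!: tendsto_mult)
qed

lemma adm_exp: "adm {\<nu>} \<eta> (\<lambda>s. exp (- \<i> * of_real (\<nu> * s))) (\<lambda>s. exp (- \<i> * of_real (\<eta> \<nu>)) * exp (- \<i> * of_real (\<nu> * s)))"
proof -
  have "norm (exp (- \<i> * of_real (\<nu> * s))) = 1" for s by (simp add: norm_exp_eq_Re)
  then have "bounded (range (\<lambda>s. exp (- \<i> * of_real (\<nu> * s))))" by (intro boundedI[of _ 1]) auto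
  then show ?thesis
    unfolding adm_def using conv_mod_exp[of _ \<nu> "\<eta> \<nu>"] conv_mod_exp[of _ \<nu> 0] by simp
qed

text \<open>A continuous \<open>L\<close>-periodic function has the single frequency
  \<open>2 * pi / L\<close>, and its twist is a genuine translation: the phase at this frequency
  converted into a length.\<close>

lemma adm_periodic:
  fixes q :: "real \<Rightarrow> complex"
  assumes q: "continuous_on UNIV q" "\<And>s. q (s + L) = q s" and L: "L > 0"
  shows "adm {2 * pi / L} \<eta> q (\<lambda>s. q (s + \<eta> (2 * pi / L) * L / (2 * pi)))"
  unfolding adm_def using periodic_bounded[OF assms] conv_mod_periodic[OF assms, of _ "\<eta> (2 * pi / L)"]
    conv_mod_periodic[OF assms, of _ 0] by simp

section \<open>Separation of growth rates\<close>

lemma exp_power_tendsto_0: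
  fixes c :: real
  assumes "c > 0"
  shows "((\<lambda>s. exp (- c * s) * s ^ l) \<longlongrightarrow> 0) at_top"
proof -
  have "filterlim (\<lambda>s. c * s) at_top at_top"
    using assms by (intro filterlim_tendsto_pos_mult_at_top[OF tendsto_const]) (auto simp: filterlim_ident)
  then have "((\<lambda>s. (c * s) ^ l / exp (c * s)) \<longlongrightarrow> 0) at_top"
    by (rule filterlim_compose[OF tendsto_power_div_exp_0])
  then have "((\<lambda>s. (1 / c ^ l) * ((c * s) ^ l / exp (c * s))) \<longlongrightarrow> 0) at_top"
    by (intro tendsto_mult_right_zero)
  then show ?thesis using assms by (simp add: power_mult_distrib exp_minus field_simps)
qed

lemma bounded_mult_tendsto_0:
  fixes f g :: "real \<Rightarrow> complex"
  assumes "(f \<longlongrightarrow> 0) F" "bounded (range g)"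
  shows "((\<lambda>s. f s * g s) \<longlongrightarrow> 0) F"
proof -
  obtain B where B: "\<And>s. norm (g s) \<le> B" using assms(2) by (meson bounded_iff rangeI)
  have "((\<lambda>s. norm (f s) * B) \<longlongrightarrow> 0) F"
    using assms(1) by (intro tendsto_mult_left_zero tendsto_norm_zero)
  then show ?thesis
    by (rule Lim_null_comparison[rotated]) (auto intro!: always_eventually mult_left_mono B simp: norm_mult)
qed

text \<open>Comparing growth rates, the dominant almost periodic coefficient tends to \<open>0\<close>; by recurrence it vanishes.\<close>

lemma recurrent_sum_zero:
  fixes b :: "real \<times> nat \<Rightarrow> real \<Rightarrow> complex"
  assumes "finite \<Xi>" and t: "filterlim t at_top sequentially"
    and "\<And>\<xi>. \<xi> \<in> \<Xi> \<Longrightarrow> bounded (range (b \<xi>))"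
    and "\<And>\<xi> s. \<xi> \<in> \<Xi> \<Longrightarrow> (\<lambda>j. b \<xi> (s + t j)) \<longlonglongrightarrow> b \<xi> s"
    and "\<And>\<xi>. \<xi> \<in> \<Xi> \<Longrightarrow> ((\<lambda>s. of_real (exp (fst \<xi> * s)) * Err s) \<longlongrightarrow> 0) at_top"
    and "eventually (\<lambda>s. Err s = (\<Sum>\<xi>\<in>\<Xi>. of_real (exp (- fst \<xi> * s) * s ^ snd \<xi>) * b \<xi> s)) at_top"
  shows "\<xi> \<in> \<Xi> \<Longrightarrow> b \<xi> s = 0"
  using assms(1,3-)
proof (induction "card \<Xi>" arbitrary: \<Xi> \<xi> s rule: less_induct)
  case (less \<Xi>)
  define r0 where "r0 = Min (fst ` \<Xi>)"
  have fin: "finite (fst ` \<Xi>)" "fst ` \<Xi> \<noteq> {}" using less by auto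
  have r0: "r0 \<in> fst ` \<Xi>" "\<And>\<xi>. \<xi> \<in> \<Xi> \<Longrightarrow> r0 \<le> fst \<xi>"
    using Min_in[OF fin] Min_le[OF fin(1)] by (auto simp: r0_def)
  define Ls where "Ls = {l. (r0, l) \<in> \<Xi>}"
  have "Ls \<subseteq> snd ` \<Xi>" unfolding Ls_def by force
  then have "finite Ls" using less by (meson finite_imageI finite_subset)
  moreover have "Ls \<noteq> {}" using r0(1) by (force simp: Ls_def)
  ultimately obtain l0 where l0: "(r0, l0) \<in> \<Xi>" "\<And>l. (r0, l) \<in> \<Xi> \<Longrightarrow> l \<le> l0"
    using Max_in[of Ls] Max_ge[of Ls] unfolding Ls_def by blast
  \<comment> \<open>The dominant scale: the least exponential rate, and among its terms the highest
    power of \<open>s\<close>.\<close>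
  define \<xi>0 where "\<xi>0 = (r0, l0)"
  have \<xi>0: "\<xi>0 \<in> \<Xi>" using l0 by (simp add: \<xi>0_def)
  have other: "((\<lambda>s. of_real (exp (r0 * s) / s ^ l0) * (of_real (exp (- fst \<xi> * s) * s ^ snd \<xi>) * b \<xi> s)) \<longlongrightarrow> 0) at_top"
    if \<xi>: "\<xi> \<in> \<Xi> - {\<xi>0}" for \<xi>
  proof -
    have lim: "((\<lambda>s. exp (- (fst \<xi> - r0) * s) * (s ^ snd \<xi> / s ^ l0)) \<longlongrightarrow> 0) at_top"
    proof (cases "fst \<xi> = r0")
      case True
      then have "snd \<xi> < l0" using l0(2)[of "snd \<xi>"] \<xi> by (cases \<xi>) (auto simp: \<xi>0_def order_le_less)
      then have "((\<lambda>s. inverse (s ^ (l0 - snd \<xi>))) \<longlongrightarrow> (0::real)) at_top"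
        by (intro tendsto_inverse_0_at_top filterlim_pow_at_top filterlim_ident) auto
      moreover have "eventually (\<lambda>s. inverse (s ^ (l0 - snd \<xi>)) = exp (- (fst \<xi> - r0) * s) * (s ^ snd \<xi> / s ^ l0)) at_top"
        using eventually_gt_at_top[of "0::real"]
      proof eventually_elim
        case (elim s)
        then show ?case using True \<open>snd \<xi> < l0\<close> by (simp add: power_diff field_simps)
      qed
      ultimately show ?thesis by (rule Lim_transform_eventually)
    next
      case False
      then have c: "fst \<xi> - r0 > 0" using r0(2)[of \<xi>] \<xi> by auto
      show ?thesis
      proof (rule Lim_null_comparison[OF _ exp_power_tendsto_0[OF c, of "snd \<xi>"]])
        show "eventually (\<lambda>s. norm (exp (- (fst \<xi> - r0) * s) * (s ^ snd \<xi> / s ^ l0)) \<le> exp (- (fst \<xi> - r0) * s) * s ^ snd \<xi>) at_top"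
          using eventually_ge_at_top[of "1::real"]
        proof eventually_elim
          case (elim s)
          then have "s ^ l0 \<ge> 1" by simp
          then have "s ^ snd \<xi> / s ^ l0 \<le> s ^ snd \<xi>" using elim by (simp add: divide_le_eq mult_le_cancel_left1)
          then have e: "exp (- (fst \<xi> - r0) * s) * (s ^ snd \<xi> / s ^ l0) \<le> exp (- (fst \<xi> - r0) * s) * s ^ snd \<xi>"
            by (rule mult_left_mono) simp
          have "exp (- (fst \<xi> - r0) * s) * (s ^ snd \<xi> / s ^ l0) \<ge> 0" using elim by simp
          with e show ?case by (simp only: real_norm_def abs_of_nonneg)
        qed
      qed
    qed
    then have "((\<lambda>s. complex_of_real (exp (- (fst \<xi> - r0) * s) * (s ^ snd \<xi> / s ^ l0))) \<longlongrightarrow> of_real 0) at_top"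
      by (intro tendsto_of_real)
    then have "((\<lambda>s. complex_of_real (exp (- (fst \<xi> - r0) * s) * (s ^ snd \<xi> / s ^ l0)) * b \<xi> s) \<longlongrightarrow> 0) at_top"
      using less(4) \<xi> by (intro bounded_mult_tendsto_0) auto
    moreover have "exp (- (fst \<xi> - r0) * s) * (s ^ snd \<xi> / s ^ l0) = exp (r0 * s) / s ^ l0 * (exp (- fst \<xi> * s) * s ^ snd \<xi>)" for s
    proof -
      have "- (fst \<xi> - r0) * s = r0 * s + - fst \<xi> * s" by (simp add: algebra_simps)
      then show ?thesis by (simp only: exp_add) simp
    qed
    ultimately show ?thesis by (simp only: of_real_mult mult.assoc)
  qed
  have "((\<lambda>s. of_real (exp (r0 * s) / s ^ l0) * Err s) \<longlongrightarrow> 0) at_top"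
  proof (rule Lim_null_comparison)
    have "((\<lambda>s. of_real (exp (r0 * s)) * Err s) \<longlongrightarrow> 0) at_top" using less(6)[OF \<xi>0] by (simp add: \<xi>0_def)
    then show "((\<lambda>s. norm (of_real (exp (r0 * s)) * Err s)) \<longlongrightarrow> 0) at_top" by (rule tendsto_norm_zero)
    show "eventually (\<lambda>s. norm (of_real (exp (r0 * s) / s ^ l0) * Err s) \<le> norm (of_real (exp (r0 * s)) * Err s)) at_top"
      using eventually_ge_at_top[of "1::real"]
    proof eventually_elim
      case (elim s)
      then have "s ^ l0 \<ge> 1" by simp
      then have "exp (r0 * s) / s ^ l0 \<le> exp (r0 * s)" using elim by (simp add: divide_le_eq mult_le_cancel_left1)
      moreover have "exp (r0 * s) / s ^ l0 \<ge> 0" using elim by simp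
      ultimately have "\<bar>exp (r0 * s) / s ^ l0\<bar> * norm (Err s) \<le> \<bar>exp (r0 * s)\<bar> * norm (Err s)"
        by (intro mult_right_mono) auto
      then show ?case by (simp only: norm_mult norm_of_real)
    qed
  qed
  then have "((\<lambda>s. of_real (exp (r0 * s) / s ^ l0) * Err s - 
     (\<Sum>\<xi>\<in>\<Xi>-{\<xi>0}. of_real (exp (r0 * s) / s ^ l0) * (of_real (exp (- fst \<xi> * s) * s ^ snd \<xi>) * b \<xi> s))) \<longlongrightarrow> 0 - (\<Sum>\<xi>\<in>\<Xi>-{\<xi>0}. 0)) at_top"
    by (intro tendsto_diff tendsto_sum other)
  moreover have "eventually (\<lambda>s. of_real (exp (r0 * s) / s ^ l0) * Err s - 
     (\<Sum>\<xi>\<in>\<Xi>-{\<xi>0}. of_real (exp (r0 * s) / s ^ l0) * (of_real (exp (- fst \<xi> * s) * s ^ snd \<xi>) * b \<xi> s)) = b \<xi>0 s) at_top"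
    using less(7) eventually_gt_at_top[of "0::real"]
  proof eventually_elim
    case (elim s)
    define c where "c = complex_of_real (exp (r0 * s) / s ^ l0)"
    have "Err s = of_real (exp (- r0 * s) * s ^ l0) * b \<xi>0 s + (\<Sum>\<xi>\<in>\<Xi>-{\<xi>0}. of_real (exp (- fst \<xi> * s) * s ^ snd \<xi>) * b \<xi> s)"
      unfolding elim(1) using \<xi>0 less(3) by (subst sum.remove) (auto simp: \<xi>0_def)
    then have "c * Err s = c * of_real (exp (- r0 * s) * s ^ l0) * b \<xi>0 s + 
        (\<Sum>\<xi>\<in>\<Xi>-{\<xi>0}. c * (of_real (exp (- fst \<xi> * s) * s ^ snd \<xi>) * b \<xi> s))"
      by (simp only: distrib_left sum_distrib_left mult.assoc)
    moreover have "c * of_real (exp (- r0 * s) * s ^ l0) = 1"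
    proof -
      have "exp (r0 * s) / s ^ l0 * (exp (- r0 * s) * s ^ l0) = 1" using elim(2) by (simp add: exp_minus)
      then show ?thesis unfolding c_def by (metis of_real_1 of_real_mult)
    qed
    ultimately show ?case unfolding c_def by simp
  qed
  ultimately have "(b \<xi>0 \<longlongrightarrow> 0 - (\<Sum>\<xi>\<in>\<Xi>-{\<xi>0}. 0)) at_top"
    by (rule Lim_transform_eventually)
  then have lim0: "(b \<xi>0 \<longlongrightarrow> 0) at_top" by simp
  have b0: "b \<xi>0 s = 0" for s
  proof -
    have "filterlim (\<lambda>j. s + t j) at_top sequentially"
      by (intro filterlim_tendsto_add_at_top[OF tendsto_const t])
    then have "(\<lambda>j. b \<xi>0 (s + t j)) \<longlonglongrightarrow> 0" by (rule filterlim_compose[OF lim0])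
    then show ?thesis using less(5)[OF \<xi>0, of s] LIMSEQ_unique by blast
  qed
  show ?case
  proof (cases "\<xi> = \<xi>0")
    case False
    show ?thesis
    proof (rule less(1)[of "\<Xi> - {\<xi>0}"])
      show "card (\<Xi> - {\<xi>0}) < card \<Xi>" using \<xi>0 less(3) by (intro psubset_card_mono) auto
      show "eventually (\<lambda>s. Err s = (\<Sum>\<xi>\<in>\<Xi> - {\<xi>0}. of_real (exp (- fst \<xi> * s) * s ^ snd \<xi>) * b \<xi> s)) at_top"
        using less(7) by eventually_elim (use \<xi>0 less(3) b0 in \<open>simp add: sum.remove\<close>)
    qed (use less False in auto)
  qed (use b0 in simp)
qed


text \<open>The remainder constant has to be uniform in \<open>z\<close>: for
  \<open>norm z \<le> r / 2\<close> the tail divided by \<open>z ^ K\<close> is dominated by its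
  series of absolute values at \<open>r / 2\<close>.\<close>

lemma holomorphic_taylor_remainder:
  assumes h: "h holomorphic_on ball 0 r" and r: "r > 0"
  obtains c :: "nat \<Rightarrow> complex" and C where "\<And>z. norm z < r \<Longrightarrow> (\<lambda>k. c k * z ^ k) sums h z"
    "\<And>K z. norm z \<le> r / 2 \<Longrightarrow> norm (h z - (\<Sum>k<K. c k * z ^ k)) \<le> C K * norm z ^ K"
proof -
  define c where "c k = (deriv ^^ k) h 0 / fact k" for k
  have s: "(\<lambda>k. c k * z ^ k) sums h z" if "norm z < r" for z
    using holomorphic_power_series[OF h, of z] that by (simp add: c_def)
  have sm: "summable (\<lambda>k. norm (c k * (of_real (r / 2)) ^ k))"
  proof (rule powser_insidea)
    show "summable (\<lambda>k. c k * (of_real (3 * r / 4)) ^ k)"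
      using r by (intro sums_summable[OF s]) simp
  qed (use r in simp)
  define C where "C K = (\<Sum>k. norm (c (k + K)) * (r / 2) ^ k)" for K
  have "norm (h z - (\<Sum>k<K. c k * z ^ k)) \<le> C K * norm z ^ K" if z: "norm z \<le> r / 2" for K z
  proof -
    have "summable (\<lambda>k. norm (c (k + K) * (of_real (r / 2)) ^ (k + K)))" using summable_ignore_initial_segment[OF sm] .
    then have "summable (\<lambda>k. (norm (c (k + K)) * (r / 2) ^ k) * (r / 2) ^ K)"
      using r by (simp add: norm_mult norm_power norm_divide power_add mult_ac)
    then have smC: "summable (\<lambda>k. norm (c (k + K)) * (r / 2) ^ k)"
      using summable_mult_D[of "(r / 2) ^ K" "\<lambda>k. norm (c (k + K)) * (r / 2) ^ k"] r by (simp add: mult.commute)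
    have zr: "norm z < r" using z r by simp
    have "(\<lambda>k. c (k + K) * z ^ (k + K)) sums (h z - (\<Sum>k<K. c k * z ^ k))"
      using s[OF zr] by (rule sums_split_initial_segment)
    then have "h z - (\<Sum>k<K. c k * z ^ k) = (\<Sum>k. c (k + K) * z ^ (k + K))" by (simp add: sums_iff)
    moreover have b: "norm (c (k + K) * z ^ (k + K)) \<le> (norm (c (k + K)) * (r / 2) ^ k) * norm z ^ K" for k
      using z by (simp add: norm_mult norm_power power_add mult.assoc mult_left_mono mult_right_mono power_mono)
    have "norm (\<Sum>k. c (k + K) * z ^ (k + K)) \<le> (\<Sum>k. (norm (c (k + K)) * (r / 2) ^ k) * norm z ^ K)"
      by (intro norm_suminf_le b summable_mult2 smC)
    moreover have "\<dots> = C K * norm z ^ K" unfolding C_def using smC by (rule suminf_mult2[symmetric])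
    ultimately show ?thesis by simp
  qed
  with s show thesis by (rule that)
qed

text \<open>A relation rather than an operation: \<open>A\<close> can be written in several ways as
  a sum of terms, and \<open>twist_zero\<close>, applied to differences, is what makes the twist
  well defined. In each term the holomorphic factor in \<open>exp (- s)\<close> and the scale
  \<open>exp (- \<rho> * s) * s ^ l\<close> stay, and only the almost periodic factor is
  exchanged.\<close>

inductive twist :: "real \<Rightarrow> (real \<Rightarrow> real) \<Rightarrow> (real \<Rightarrow> complex) \<Rightarrow> (real \<Rightarrow> complex) \<Rightarrow> bool" for \<sigma> \<eta> where
  twist_base: "h holomorphic_on ball 0 (exp (- \<sigma>)) \<Longrightarrow> finite Fr \<Longrightarrow> adm Fr \<eta> \<theta> \<theta>' \<Longrightarrow>
     (\<And>s. s > \<sigma> \<Longrightarrow> A s = h (of_real (exp (- s))) * of_real (exp (- \<rho> * s) * s ^ l) * \<theta> s) \<Longrightarrow>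
     (\<And>s. s > \<sigma> \<Longrightarrow> A' s = h (of_real (exp (- s))) * of_real (exp (- \<rho> * s) * s ^ l) * \<theta>' s) \<Longrightarrow> twist \<sigma> \<eta> A A'"
| twist_add: "twist \<sigma> \<eta> A A' \<Longrightarrow> twist \<sigma> \<eta> B B' \<Longrightarrow> (\<And>s. s > \<sigma> \<Longrightarrow> C s = A s + B s) \<Longrightarrow>
     (\<And>s. s > \<sigma> \<Longrightarrow> C' s = A' s + B' s) \<Longrightarrow> twist \<sigma> \<eta> C C'"

lemma twist_cong:
  assumes "twist \<sigma> \<eta> A A'" "\<And>s. s > \<sigma> \<Longrightarrow> A s = B s" "\<And>s. s > \<sigma> \<Longrightarrow> A' s = B' s"
  shows "twist \<sigma> \<eta> B B'"
  using assms
proof (cases rule: twist.cases)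
  case (twist_base h Fr \<theta> \<theta>' \<rho> l)
  then show ?thesis using assms(2,3) by (rule_tac twist.twist_base[of h \<sigma> Fr \<eta> \<theta> \<theta>' B \<rho> l B']) auto
next
  case (twist_add A1 A1' B1 B1')
  then show ?thesis using assms(2,3) by (rule_tac twist.twist_add[of \<sigma> \<eta> A1 A1' B1 B1']) auto
qed

lemma twist_mult_base:
  assumes "twist \<sigma> \<eta> B B'" "h holomorphic_on ball 0 (exp (- \<sigma>))" "finite Fr" "adm Fr \<eta> \<theta> \<theta>'"
     "\<And>s. s > \<sigma> \<Longrightarrow> A s = h (of_real (exp (- s))) * of_real (exp (- \<rho> * s) * s ^ l) * \<theta> s"
     "\<And>s. s > \<sigma> \<Longrightarrow> A' s = h (of_real (exp (- s))) * of_real (exp (- \<rho> * s) * s ^ l) * \<theta>' s"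
  shows "twist \<sigma> \<eta> (\<lambda>s. A s * B s) (\<lambda>s. A' s * B' s)"
  using assms(1)
proof (induction rule: twist.induct)
  case (twist_base h2 Fr2 \<theta>2 \<theta>2' B \<rho>2 l2 B')
  show ?case
  proof (rule twist.twist_base[where h = "\<lambda>z. h z * h2 z" and Fr = "Fr \<union> Fr2" and \<rho> = "\<rho> + \<rho>2" and l = "l + l2"])
    show "adm (Fr \<union> Fr2) \<eta> (\<lambda>s. \<theta> s * \<theta>2 s) (\<lambda>s. \<theta>' s * \<theta>2' s)"
      using adm_mono[OF assms(4), of "Fr \<union> Fr2"] adm_mono[OF twist_base(3), of "Fr \<union> Fr2"] by (intro adm_mult) auto
    have "exp (- (\<rho> + \<rho>2) * s) = exp (- \<rho> * s) * exp (- \<rho>2 * s)" for s by (simp flip: exp_add add: algebra_simps)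
    then have "exp (- (\<rho> + \<rho>2) * s) * s ^ (l + l2) = (exp (- \<rho> * s) * s ^ l) * (exp (- \<rho>2 * s) * s ^ l2)" for s
      by (simp add: power_add)
    then show "A s * B s = h (of_real (exp (- s))) * h2 (of_real (exp (- s))) * 
        of_real (exp (- (\<rho> + \<rho>2) * s) * s ^ (l + l2)) * (\<theta> s * \<theta>2 s)"
      "A' s * B' s = h (of_real (exp (- s))) * h2 (of_real (exp (- s))) * 
        of_real (exp (- (\<rho> + \<rho>2) * s) * s ^ (l + l2)) * (\<theta>' s * \<theta>2' s)" if "s > \<sigma>" for s
      using that assms(5,6) twist_base(4,5) by (simp_all only: of_real_mult) (simp_all add: mult_ac)
  qed (use assms twist_base in \<open>auto intro: holomorphic_intros\<close>)
next
  case (twist_add A1 A1' B1 B1' C C')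
  show ?case
    by (rule twist.twist_add[OF twist_add(5,6)]) (use twist_add in \<open>auto simp: algebra_simps\<close>)
qed

lemma twist_mult:
  assumes "twist \<sigma> \<eta> A A'" "twist \<sigma> \<eta> B B'"
  shows "twist \<sigma> \<eta> (\<lambda>s. A s * B s) (\<lambda>s. A' s * B' s)"
  using assms(1)
proof (induction rule: twist.induct)
  case (twist_base h Fr \<theta> \<theta>' A \<rho> l A')
  then show ?case by (intro twist_mult_base[OF assms(2)])
next
  case (twist_add A1 A1' B1 B1' C C')
  show ?case
    by (rule twist.twist_add[OF twist_add(5,6)]) (use twist_add in \<open>auto simp: algebra_simps\<close>)
qed

lemma twist_holomorphic:
  assumes "h holomorphic_on ball 0 (exp (- \<sigma>))"
  shows "twist \<sigma> \<eta> (\<lambda>s. h (of_real (exp (- s)))) (\<lambda>s. h (of_real (exp (- s))))"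
  by (rule twist_base[OF assms _ adm_const[of "{}" \<eta> 1], of _ 0 0]) auto

lemma twist_const: "twist \<sigma> \<eta> (\<lambda>_. c) (\<lambda>_. c)"
  using twist_holomorphic[of "\<lambda>_. c"] by (auto intro: holomorphic_intros)

lemma twist_sum:
  assumes "\<And>i. i \<in> I \<Longrightarrow> twist \<sigma> \<eta> (A i) (A' i)"
  shows "twist \<sigma> \<eta> (\<lambda>s. \<Sum>i\<in>I. A i s) (\<lambda>s. \<Sum>i\<in>I. A' i s)"
  using assms
proof (induction I rule: infinite_finite_induct)
  case (insert i I)
  show ?case
    by (rule twist_add[of _ _ "A i" "A' i" "\<lambda>s. \<Sum>i\<in>I. A i s" "\<lambda>s. \<Sum>i\<in>I. A' i s"]) (use insert in auto)
qed (use twist_const[of _ _ 0] in auto)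

lemma twist_power:
  assumes "twist \<sigma> \<eta> A A'"
  shows "twist \<sigma> \<eta> (\<lambda>s. A s ^ n) (\<lambda>s. A' s ^ n)"
  by (induction n) (use twist_const[of _ _ 1] twist_mult[OF assms] in auto)

lemma twist_representation:
  assumes "twist \<sigma> \<eta> A A'"
  obtains Fr and n :: nat and h \<rho> l \<theta> \<theta>' where "finite Fr"
    "\<And>i. i < n \<Longrightarrow> h i holomorphic_on ball 0 (exp (- \<sigma>))" "\<And>i. i < n \<Longrightarrow> adm Fr \<eta> (\<theta> i) (\<theta>' i)"
    "\<And>s. s > \<sigma> \<Longrightarrow> A s = (\<Sum>i<n. h i (of_real (exp (- s))) * of_real (exp (- \<rho> i * s) * s ^ l i) * \<theta> i s)"
    "\<And>s. s > \<sigma> \<Longrightarrow> A' s = (\<Sum>i<n. h i (of_real (exp (- s))) * of_real (exp (- \<rho> i * s) * s ^ l i) * \<theta>' i s)"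
proof -
  have "\<exists>Fr (n::nat) h \<rho> l \<theta> \<theta>'. finite Fr \<and> (\<forall>i<n. h i holomorphic_on ball 0 (exp (- \<sigma>)) \<and> adm Fr \<eta> (\<theta> i) (\<theta>' i)) \<and>
    (\<forall>s>\<sigma>. A s = (\<Sum>i<n. h i (of_real (exp (- s))) * of_real (exp (- \<rho> i * s) * s ^ l i) * \<theta> i s) \<and>
           A' s = (\<Sum>i<n. h i (of_real (exp (- s))) * of_real (exp (- \<rho> i * s) * s ^ l i) * \<theta>' i s))"
    using assms
  proof (induction rule: twist.induct)
    case (twist_base h Fr \<theta> \<theta>' A \<rho> l A')
    show ?case
      by (rule exI[of _ Fr], rule exI[of _ 1], rule exI[of _ "\<lambda>_. h"], rule exI[of _ "\<lambda>_. \<rho>"], rule exI[of _ "\<lambda>_. l"],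
          rule exI[of _ "\<lambda>_. \<theta>"], rule exI[of _ "\<lambda>_. \<theta>'"]) (use twist_base in auto)
  next
    case (twist_add A A' B B' C C')
    obtain Fr and n :: nat and h \<rho> l \<theta> \<theta>' where 1: "finite Fr" 
       "\<forall>i<n. h i holomorphic_on ball 0 (exp (- \<sigma>)) \<and> adm Fr \<eta> (\<theta> i) (\<theta>' i)"
       "\<forall>s>\<sigma>. A s = (\<Sum>i<n. h i (of_real (exp (- s))) * of_real (exp (- \<rho> i * s) * s ^ l i) * \<theta> i s) \<and>
           A' s = (\<Sum>i<n. h i (of_real (exp (- s))) * of_real (exp (- \<rho> i * s) * s ^ l i) * \<theta>' i s)"
      using twist_add(5) by (elim exE conjE) (rule that)
    obtain Fr2 and n2 :: nat and h2 \<rho>2 l2 \<theta>2 \<theta>2' where 2: "finite Fr2" 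
       "\<forall>i<n2. h2 i holomorphic_on ball 0 (exp (- \<sigma>)) \<and> adm Fr2 \<eta> (\<theta>2 i) (\<theta>2' i)"
       "\<forall>s>\<sigma>. B s = (\<Sum>i<n2. h2 i (of_real (exp (- s))) * of_real (exp (- \<rho>2 i * s) * s ^ l2 i) * \<theta>2 i s) \<and>
           B' s = (\<Sum>i<n2. h2 i (of_real (exp (- s))) * of_real (exp (- \<rho>2 i * s) * s ^ l2 i) * \<theta>2' i s)"
      using twist_add(6) by (elim exE conjE) (rule that)
    define Jh where "Jh i = (if i < n then h i else h2 (i - n))" for i
    define J\<rho> where "J\<rho> i = (if i < n then \<rho> i else \<rho>2 (i - n))" for i
    define Jl where "Jl i = (if i < n then l i else l2 (i - n))" for i
    define J\<theta> where "J\<theta> i = (if i < n then \<theta> i else \<theta>2 (i - n))" for i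
    define J\<theta>' where "J\<theta>' i = (if i < n then \<theta>' i else \<theta>2' (i - n))" for i
    note Js = Jh_def J\<rho>_def Jl_def J\<theta>_def J\<theta>'_def
    have split: "(\<Sum>i<n + n2. F i) = (\<Sum>i<n. F i) + (\<Sum>i<n2. F (n + i))" for F :: "nat \<Rightarrow> complex"
      by (induction n2) (auto simp: algebra_simps)
    show ?case
    proof (rule exI[of _ "Fr \<union> Fr2"], rule exI[of _ "n + n2"], rule exI[of _ Jh], rule exI[of _ J\<rho>], rule exI[of _ Jl],
          rule exI[of _ J\<theta>], rule exI[of _ J\<theta>'], intro conjI allI impI)
      show "finite (Fr \<union> Fr2)" using 1 2 by simp
      show "Jh i holomorphic_on ball 0 (exp (- \<sigma>))" if "i < n + n2" for i
        using 1(2) 2(2) that by (auto simp: Js)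
      show "adm (Fr \<union> Fr2) \<eta> (J\<theta> i) (J\<theta>' i)" if "i < n + n2" for i
      proof (cases "i < n")
        case True
        then show ?thesis using 1(2) adm_mono[of Fr \<eta> _ _ "Fr \<union> Fr2"] by (simp add: Js)
      next
        case False
        then have "i - n < n2" using that by simp
        then show ?thesis using False 2(2) adm_mono[of Fr2 \<eta> _ _ "Fr \<union> Fr2"] by (simp add: Js)
      qed
      show "C s = (\<Sum>i<n + n2. Jh i (of_real (exp (- s))) * of_real (exp (- J\<rho> i * s) * s ^ Jl i) * J\<theta> i s)"
        "C' s = (\<Sum>i<n + n2. Jh i (of_real (exp (- s))) * of_real (exp (- J\<rho> i * s) * s ^ Jl i) * J\<theta>' i s)" if "s > \<sigma>" for s
        unfolding split using that 1(3) 2(3) twist_add(3,4) by (simp_all add: Js)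
    qed
  qed
  then obtain Fr and n :: nat and h \<rho> l \<theta> \<theta>' where *: "finite Fr"
    "\<forall>i<n. h i holomorphic_on ball 0 (exp (- \<sigma>)) \<and> adm Fr \<eta> (\<theta> i) (\<theta>' i)"
    "\<forall>s>\<sigma>. A s = (\<Sum>i<n. h i (of_real (exp (- s))) * of_real (exp (- \<rho> i * s) * s ^ l i) * \<theta> i s) \<and>
           A' s = (\<Sum>i<n. h i (of_real (exp (- s))) * of_real (exp (- \<rho> i * s) * s ^ l i) * \<theta>' i s)"
    by (elim exE conjE) (rule that)
  show thesis by (rule that[of Fr n h \<theta> \<theta>' \<rho> l]) (use * in blast)+
qed

text \<open>If a finite combination vanishes, so does its twist: the almost periodic coefficients of all the
  scales \<open>e\<^sup>-\<^sup>\<rho>\<^sup>s s\<^sup>l\<close> vanish separately, and vanishing is preserved by limits of translates.\<close>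

lemma twist_zero:
  assumes tw: "twist \<sigma> \<eta> A A'" and \<eta>: "ratlin \<eta>" and zero: "\<And>s. s > \<sigma> \<Longrightarrow> A s = 0" and s: "s > \<sigma>"
  shows "A' s = 0"
proof -
  obtain Fr and n :: nat and h \<rho> l \<theta> \<theta>' where Fr: "finite Fr"
    and h: "\<And>i. i < n \<Longrightarrow> h i holomorphic_on ball 0 (exp (- \<sigma>))" and ad: "\<And>i. i < n \<Longrightarrow> adm Fr \<eta> (\<theta> i) (\<theta>' i)"
    and A: "\<And>s. s > \<sigma> \<Longrightarrow> A s = (\<Sum>i<n. h i (of_real (exp (- s))) * of_real (exp (- \<rho> i * s) * s ^ l i) * \<theta> i s)"
    and A': "\<And>s. s > \<sigma> \<Longrightarrow> A' s = (\<Sum>i<n. h i (of_real (exp (- s))) * of_real (exp (- \<rho> i * s) * s ^ l i) * \<theta>' i s)"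
    by (rule twist_representation[OF tw]) (rule that)
  define r where "r = exp (- \<sigma>)"
  have r: "r > 0" by (simp add: r_def)
  have "\<exists>c C. (\<forall>z. norm z < r \<longrightarrow> (\<lambda>k. c k * z ^ k) sums h i z) \<and>
    (\<forall>K z. norm z \<le> r / 2 \<longrightarrow> norm (h i z - (\<Sum>k<K. c k * z ^ k)) \<le> C K * norm z ^ K)" if "i < n" for i
    by (rule holomorphic_taylor_remainder[OF h[OF that, folded r_def] r]) blast
  then have "\<forall>i. \<exists>c C. i < n \<longrightarrow> (\<forall>z. norm z < r \<longrightarrow> (\<lambda>k. c k * z ^ k) sums h i z) \<and>
    (\<forall>K z. norm z \<le> r / 2 \<longrightarrow> norm (h i z - (\<Sum>k<K. c k * z ^ k)) \<le> C K * norm z ^ K)" by blast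
  from choice[OF this] obtain c where "\<forall>i. \<exists>C. i < n \<longrightarrow> (\<forall>z. norm z < r \<longrightarrow> (\<lambda>k. c i k * z ^ k) sums h i z) \<and>
    (\<forall>K z. norm z \<le> r / 2 \<longrightarrow> norm (h i z - (\<Sum>k<K. c i k * z ^ k)) \<le> C K * norm z ^ K)" ..
  from choice[OF this] obtain C where cC: "\<forall>i. i < n \<longrightarrow> (\<forall>z. norm z < r \<longrightarrow> (\<lambda>k. c i k * z ^ k) sums h i z) \<and>
    (\<forall>K z. norm z \<le> r / 2 \<longrightarrow> norm (h i z - (\<Sum>k<K. c i k * z ^ k)) \<le> C i K * norm z ^ K)" ..
  obtain t where t: "\<And>\<nu>. \<nu> \<in> Fr \<Longrightarrow> conv_mod t \<nu> (\<eta> \<nu>)"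
    by (rule kronecker_ratlin[OF Fr \<eta>]) (rule that)
  obtain u where u: "filterlim u at_top sequentially" "\<And>\<nu>. \<nu> \<in> Fr \<Longrightarrow> conv_mod u \<nu> 0"
    by (rule dirichlet_recurrence[OF Fr]) (rule that)
  \<comment> \<open>The number of Taylor terms of \<open>h i\<close> kept at level \<open>X\<close>:
    the kept rates \<open>\<rho> i + k\<close> are below \<open>X\<close>, and the remainder decays
    at rate at least \<open>X\<close>, up to powers of \<open>s\<close>.\<close>
  define Kf where "Kf X i = nat \<lceil>X - \<rho> i\<rceil>" for X i
  have main: "(\<Sum>i<n. (\<Sum>k<Kf X i. c i k * of_real (exp (- s)) ^ k) * of_real (exp (- \<rho> i * s) * s ^ l i) * \<theta>' i s) = 0" for X s
  proof -
    define J where "J = (SIGMA i:{..<n}. {..<Kf X i})"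
    have fJ: "finite J" by (simp add: J_def)
    \<comment> \<open>The scale of a term. Different pairs may share a scale, so their coefficients
      are added before scales are compared.\<close>
    define g where "g = (\<lambda>(i, k). (\<rho> i + real k, l i))"
    define b where "b \<xi> s = (\<Sum>(i, k)\<in>{j \<in> J. g j = \<xi>}. c i k * \<theta> i s)" for \<xi> s
    define b' where "b' \<xi> s = (\<Sum>(i, k)\<in>{j \<in> J. g j = \<xi>}. c i k * \<theta>' i s)" for \<xi> s
    have regroup: "(\<Sum>i<n. (\<Sum>k<Kf X i. c i k * of_real (exp (- s)) ^ k) * of_real (exp (- \<rho> i * s) * s ^ l i) * \<phi> i s)
      = (\<Sum>\<xi>\<in>g ` J. of_real (exp (- fst \<xi> * s) * s ^ snd \<xi>) * (\<Sum>(i, k)\<in>{j \<in> J. g j = \<xi>}. c i k * \<phi> i s))" for \<phi> s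
    proof -
      have "(\<Sum>i<n. (\<Sum>k<Kf X i. c i k * of_real (exp (- s)) ^ k) * of_real (exp (- \<rho> i * s) * s ^ l i) * \<phi> i s)
        = (\<Sum>i<n. \<Sum>k<Kf X i. of_real (exp (- (\<rho> i + real k) * s) * s ^ l i) * (c i k * \<phi> i s))"
        unfolding sum_distrib_right
      proof (intro sum.cong refl)
        fix i k
        have "exp (- (\<rho> i + real k) * s) = exp (- s) ^ k * exp (- \<rho> i * s)"
          by (simp flip: exp_add exp_of_nat_mult add: algebra_simps)
        then show "c i k * of_real (exp (- s)) ^ k * of_real (exp (- \<rho> i * s) * s ^ l i) * \<phi> i s = 
            of_real (exp (- (\<rho> i + real k) * s) * s ^ l i) * (c i k * \<phi> i s)" by simp
      qed
      also have "\<dots> = (\<Sum>j\<in>J. of_real (exp (- fst (g j) * s) * s ^ snd (g j)) * (c (fst j) (snd j) * \<phi> (fst j) s))"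
      proof -
        have "(\<Sum>i<n. \<Sum>k<Kf X i. of_real (exp (- (\<rho> i + real k) * s) * s ^ l i) * (c i k * \<phi> i s))
          = (\<Sum>(i, k)\<in>J. of_real (exp (- (\<rho> i + real k) * s) * s ^ l i) * (c i k * \<phi> i s))"
          unfolding J_def by (rule sum.Sigma) auto
        also have "\<dots> = (\<Sum>j\<in>J. of_real (exp (- fst (g j) * s) * s ^ snd (g j)) * (c (fst j) (snd j) * \<phi> (fst j) s))"
          by (rule sum.cong[OF refl]) (simp only: g_def case_prod_unfold fst_conv snd_conv)
        finally show ?thesis .
      qed
      also have "\<dots> = (\<Sum>\<xi>\<in>g ` J. \<Sum>j\<in>{j \<in> J. g j = \<xi>}. of_real (exp (- fst (g j) * s) * s ^ snd (g j)) * (c (fst j) (snd j) * \<phi> (fst j) s))"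
        by (rule sum.image_gen[OF fJ])
      also have "\<dots> = (\<Sum>\<xi>\<in>g ` J. of_real (exp (- fst \<xi> * s) * s ^ snd \<xi>) * (\<Sum>(i, k)\<in>{j \<in> J. g j = \<xi>}. c i k * \<phi> i s))"
        unfolding sum_distrib_left by (intro sum.cong) (auto simp: case_prod_beta)
      finally show ?thesis .
    qed
    define Err where "Err s = (\<Sum>\<xi>\<in>g ` J. of_real (exp (- fst \<xi> * s) * s ^ snd \<xi>) * b \<xi> s)" for s
    have bz: "b \<xi> s = 0" if "\<xi> \<in> g ` J" for \<xi> s
    proof (rule recurrent_sum_zero[OF _ u(1), of "g ` J" b Err])
      show "bounded (range (b \<xi>))" for \<xi>
      proof -
        have "bounded (range (\<theta> i))" if "i < n" for i using ad[OF that] by (simp add: adm_def)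
        then have "\<forall>i. \<exists>B. i < n \<longrightarrow> (\<forall>s. norm (\<theta> i s) \<le> B)" by (metis bounded_iff rangeI)
        from choice[OF this] obtain B where B: "\<forall>i. i < n \<longrightarrow> (\<forall>s. norm (\<theta> i s) \<le> B i)" ..
        have "norm (b \<xi> s) \<le> (\<Sum>(i, k)\<in>{j \<in> J. g j = \<xi>}. norm (c i k) * B i)" for s
          unfolding b_def using B by (intro order_trans[OF norm_sum] sum_mono) (auto simp: J_def norm_mult intro!: mult_left_mono)
        then show ?thesis by (auto simp: bounded_iff)
      qed
      show "(\<lambda>j. b \<xi> (s + u j)) \<longlonglongrightarrow> b \<xi> s" for \<xi> s
        unfolding b_def
        by (intro tendsto_sum) (use ad u(2) in \<open>auto simp: J_def adm_def case_prod_beta intro!: tendsto_mult_left\<close>)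
      fix \<xi> assume "\<xi> \<in> g ` J"
      then obtain i0 k0 where \<xi>: "\<xi> = (\<rho> i0 + real k0, l i0)" "i0 < n" "k0 < Kf X i0" by (auto simp: J_def g_def)
      then have "int k0 < \<lceil>X - \<rho> i0\<rceil>" by (simp add: Kf_def)
      then have \<xi>X: "fst \<xi> < X" using \<xi>(1) by (simp add: less_ceiling_iff)
      \<comment> \<open>As \<open>A\<close> vanishes, the truncated sum is minus the sum of the
        Taylor remainders.\<close>
      define T where "T i s = - (h i (of_real (exp (- s))) - (\<Sum>k<Kf X i. c i k * of_real (exp (- s)) ^ k)) * of_real (exp (- \<rho> i * s) * s ^ l i)" for i s
      have ErrT: "eventually (\<lambda>s. (\<Sum>i<n. of_real (exp (fst \<xi> * s)) * T i s * \<theta> i s) = of_real (exp (fst \<xi> * s)) * Err s) at_top"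
        using eventually_gt_at_top[of \<sigma>]
      proof eventually_elim
        case (elim s)
        have "Err s = (\<Sum>i<n. (\<Sum>k<Kf X i. c i k * of_real (exp (- s)) ^ k) * of_real (exp (- \<rho> i * s) * s ^ l i) * \<theta> i s)"
          unfolding Err_def b_def by (rule regroup[symmetric])
        also have "\<dots> = (\<Sum>i<n. (\<Sum>k<Kf X i. c i k * of_real (exp (- s)) ^ k) * of_real (exp (- \<rho> i * s) * s ^ l i) * \<theta> i s) - A s"
          using zero[OF elim] by simp
        also have "\<dots> = (\<Sum>i<n. T i s * \<theta> i s)"
          unfolding A[OF elim] T_def by (simp only: sum_subtractf[symmetric]) (intro sum.cong refl, simp add: algebra_simps)
        finally show ?case by (simp only: sum_distrib_left mult.assoc)
      qed
      have "((\<lambda>s. \<Sum>i<n. of_real (exp (fst \<xi> * s)) * T i s * \<theta> i s) \<longlongrightarrow> (\<Sum>i<n. 0)) at_top"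
      proof (rule tendsto_sum, rule bounded_mult_tendsto_0)
        fix i assume i: "i \<in> {..<n}"
        then show "bounded (range (\<theta> i))" using ad[of i] by (simp add: adm_def)
        define d where "d = \<rho> i + real (Kf X i) - fst \<xi>"
        have d: "d > 0" unfolding d_def Kf_def using \<xi>X by linarith
        show "((\<lambda>s. of_real (exp (fst \<xi> * s)) * T i s) \<longlongrightarrow> 0) at_top"
        proof (rule Lim_null_comparison)
          show "((\<lambda>s. C i (Kf X i) * (exp (- d * s) * s ^ l i)) \<longlongrightarrow> 0) at_top"
            by (intro tendsto_mult_right_zero exp_power_tendsto_0 d)
          have "((\<lambda>s::real. exp (- s)) \<longlongrightarrow> 0) at_top" by real_asymp
          then have "eventually (\<lambda>s. exp (- s) < r / 2) at_top" using r by (intro order_tendstoD) auto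
          then show "eventually (\<lambda>s. norm (of_real (exp (fst \<xi> * s)) * T i s) \<le> C i (Kf X i) * (exp (- d * s) * s ^ l i)) at_top"
            using eventually_gt_at_top[of "0::real"]
          proof eventually_elim
            case (elim s)
            define z where "z = complex_of_real (exp (- s))"
            have nz: "norm z = exp (- s)" by (simp add: z_def)
            have "norm (h i z - (\<Sum>k<Kf X i. c i k * z ^ k)) \<le> C i (Kf X i) * norm z ^ Kf X i"
              using cC[rule_format, of i, THEN conjunct2, rule_format, of z "Kf X i"] i elim(1) by (simp add: nz)
            then have "norm (h i z - (\<Sum>k<Kf X i. c i k * z ^ k)) * (exp (fst \<xi> * s) * exp (- \<rho> i * s) * s ^ l i) \<le> 
                C i (Kf X i) * exp (- s) ^ Kf X i * (exp (fst \<xi> * s) * exp (- \<rho> i * s) * s ^ l i)"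
              using elim by (intro mult_right_mono) (auto simp: nz)
            moreover have "norm (of_real (exp (fst \<xi> * s)) * T i s) = 
               norm (h i z - (\<Sum>k<Kf X i. c i k * z ^ k)) * (exp (fst \<xi> * s) * exp (- \<rho> i * s) * s ^ l i)"
              using elim unfolding T_def z_def[symmetric] norm_mult norm_minus_cancel norm_of_real by (simp add: abs_mult)
            moreover have "exp (- s) ^ Kf X i * (exp (fst \<xi> * s) * exp (- \<rho> i * s)) = exp (- d * s)"
              unfolding d_def by (simp flip: exp_add exp_of_nat_mult add: algebra_simps)
            moreover have "C i (Kf X i) * exp (- s) ^ Kf X i * (exp (fst \<xi> * s) * exp (- \<rho> i * s) * s ^ l i)
               = C i (Kf X i) * ((exp (- s) ^ Kf X i * (exp (fst \<xi> * s) * exp (- \<rho> i * s))) * s ^ l i)"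
              by (simp only: mult.assoc)
            ultimately show ?case by metis
          qed
        qed
      qed
      then show "((\<lambda>s. of_real (exp (fst \<xi> * s)) * Err s) \<longlongrightarrow> 0) at_top"
        using Lim_transform_eventually[OF _ ErrT] by simp
    next
      show "eventually (\<lambda>s. Err s = (\<Sum>\<xi>\<in>g ` J. of_real (exp (- fst \<xi> * s) * s ^ snd \<xi>) * b \<xi> s)) at_top"
        by (simp add: Err_def)
    qed (use fJ that in auto)
    have "b' \<xi> s = 0" if "\<xi> \<in> g ` J" for \<xi> s
    proof -
      have "(\<lambda>j. b \<xi> (s + t j)) \<longlonglongrightarrow> b' \<xi> s"
        unfolding b_def b'_def
        by (intro tendsto_sum) (use ad t in \<open>auto simp: J_def adm_def case_prod_beta intro!: tendsto_mult_left\<close>)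
      then show ?thesis using bz[OF that] by (simp add: LIMSEQ_const_iff)
    qed
    then show ?thesis unfolding regroup b'_def[symmetric] by simp
  qed
  \<comment> \<open>The truncations converge to \<open>A' s\<close> as the level grows, because for
    \<open>s > \<sigma>\<close> the point \<open>exp (- s)\<close> lies in the disc of the power
    series of \<open>h i\<close>.\<close>
  have "(\<lambda>X. \<Sum>i<n. (\<Sum>k<Kf (real X) i. c i k * of_real (exp (- s)) ^ k) * of_real (exp (- \<rho> i * s) * s ^ l i) * \<theta>' i s)
    \<longlonglongrightarrow> (\<Sum>i<n. h i (of_real (exp (- s))) * of_real (exp (- \<rho> i * s) * s ^ l i) * \<theta>' i s)"
  proof (intro tendsto_sum tendsto_mult tendsto_const)
    fix i assume i: "i \<in> {..<n}"
    have "exp (- s) < exp (- \<sigma>)" using s by simp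
    then have "norm (complex_of_real (exp (- s))) < r" by (simp add: r_def)
    then have "(\<lambda>K. \<Sum>k<K. c i k * of_real (exp (- s)) ^ k) \<longlonglongrightarrow> h i (of_real (exp (- s)))"
      using cC i unfolding sums_def by blast
    moreover have "filterlim (\<lambda>X. Kf (real X) i) at_top sequentially"
      unfolding filterlim_at_top
    proof
      fix Z :: nat
      show "eventually (\<lambda>X. Kf (real X) i \<ge> Z) sequentially"
        using eventually_ge_at_top[of "nat \<lceil>\<bar>\<rho> i\<bar>\<rceil> + Z"]
      proof eventually_elim
        case (elim X)
        then have "real Z \<le> real X - \<rho> i" by linarith
        then show ?case unfolding Kf_def by linarith
      qed
    qed
    ultimately show "(\<lambda>X. \<Sum>k<Kf (real X) i. c i k * of_real (exp (- s)) ^ k) \<longlonglongrightarrow> h i (of_real (exp (- s)))"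
      by (rule filterlim_compose)
  qed
  then show ?thesis unfolding main A'[OF s] by (simp add: LIMSEQ_const_iff)
qed

subsection \<open>Linear algebra\<close>

text \<open>Matrices are functions \<open>B i j\<close> acting on row vectors from the right.\<close>

lemma mat_transpose_mult:
  fixes B :: "nat \<Rightarrow> nat \<Rightarrow> complex"
  shows "mat n n (\<lambda>(j, i). B i j) *\<^sub>v vec n w = vec n (\<lambda>j. \<Sum>i<n. w i * B i j)"
  by (rule eq_vecI) (auto simp: scalar_prod_def atLeast0LessThan mult.commute intro!: sum.cong)

text \<open>\<open>C\<close> is the inverse matrix. Both identities are recorded because one serves
  to solve equations and the other to bound a vector by its image.\<close>

lemma injective_inverse:
  fixes B :: "nat \<Rightarrow> nat \<Rightarrow> complex"
  assumes inj: "\<And>w. (\<And>j. j < n \<Longrightarrow> (\<Sum>i<n. w i * B i j) = 0) \<Longrightarrow> \<forall>i<n. w i = 0"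
  obtains C where "\<And>r j. j < n \<Longrightarrow> (\<Sum>i<n. (\<Sum>k<n. r k * C k i) * B i j) = r j"
    "\<And>w i. i < n \<Longrightarrow> w i = (\<Sum>k<n. (\<Sum>i'<n. w i' * B i' k) * C k i)"
proof -
  define T where "T = mat n n (\<lambda>(j, i). B i j)"
  have T: "T \<in> carrier_mat n n" by (simp add: T_def)
  have "det T \<noteq> 0"
  proof
    assume "det T = 0"
    then obtain v where v: "v \<in> carrier_vec n" "v \<noteq> 0\<^sub>v n" "T *\<^sub>v v = 0\<^sub>v n"
      using det_0_iff_vec_prod_zero[OF T] by blast
    define w where "w i = vec_index v i" for i
    have vw: "v = vec n w" using v(1) by (intro eq_vecI) (auto simp: w_def)
    have "vec n (\<lambda>j. \<Sum>i<n. w i * B i j) = 0\<^sub>v n" using v(3) unfolding vw T_def mat_transpose_mult .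
    have "(\<Sum>i<n. w i * B i j) = 0" if "j < n" for j
      using arg_cong[OF \<open>vec n (\<lambda>j. \<Sum>i<n. w i * B i j) = 0\<^sub>v n\<close>, of "\<lambda>x. vec_index x j"] that by simp
    then have "\<forall>i<n. w i = 0" by (rule inj)
    then show False using v(2) unfolding vw by auto
  qed
  then have "T \<in> Units (ring_mat TYPE(complex) n ())" by (rule det_non_zero_imp_unit[OF T])
  then obtain X where X: "X \<in> carrier_mat n n" "X * T = 1\<^sub>m n" "T * X = 1\<^sub>m n"
    unfolding Units_def ring_mat_def by auto
  define C where "C k i = X $$ (i, k)" for k i
  have Xm: "X *\<^sub>v vec n r = vec n (\<lambda>i. \<Sum>k<n. r k * C k i)" for r
  proof -
    have "X = mat n n (\<lambda>(i, k). C k i)" using X(1) by (intro eq_matI) (auto simp: C_def)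
    then show ?thesis using mat_transpose_mult[of n C r] by simp
  qed
  have Tm: "T *\<^sub>v vec n w = vec n (\<lambda>j. \<Sum>i<n. w i * B i j)" for w unfolding T_def by (rule mat_transpose_mult)
  show thesis
  proof (rule that[of C])
    fix r :: "nat \<Rightarrow> complex" and j assume j: "j < n"
    have "T *\<^sub>v (X *\<^sub>v vec n r) = vec n r"
      using assoc_mult_mat_vec[OF T X(1), of "vec n r"] X(3) by simp
    then have "vec n (\<lambda>j. \<Sum>i<n. (\<Sum>k<n. r k * C k i) * B i j) = vec n r" unfolding Xm Tm .
    from arg_cong[OF this, of "\<lambda>x. vec_index x j"] show "(\<Sum>i<n. (\<Sum>k<n. r k * C k i) * B i j) = r j"
      using j by simp
  next
    fix w :: "nat \<Rightarrow> complex" and i assume i: "i < n"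
    have "X *\<^sub>v (T *\<^sub>v vec n w) = vec n w"
      using assoc_mult_mat_vec[OF X(1) T, of "vec n w"] X(2) by simp
    then have "vec n (\<lambda>i. \<Sum>k<n. (\<Sum>i'<n. w i' * B i' k) * C k i) = vec n w" unfolding Tm Xm .
    from arg_cong[OF this, of "\<lambda>x. vec_index x i"] show "w i = (\<Sum>k<n. (\<Sum>i'<n. w i' * B i' k) * C k i)"
      using i by simp
  qed
qed

text \<open>The eigenvalue is taken of least modulus, so that no \<open>lam / P ^ k\<close> with
  \<open>k \<ge> 1\<close> is an eigenvalue and the recursion in
  \<open>holomorphic_left_eigen\<close> meets no resonance.\<close>

lemma left_eigen_minimal:
  fixes B :: "nat \<Rightarrow> nat \<Rightarrow> complex"
  assumes n: "n \<ge> 1"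
    and inj: "\<And>w. (\<And>j. j < n \<Longrightarrow> (\<Sum>i<n. w i * B i j) = 0) \<Longrightarrow> \<forall>i<n. w i = 0"
  obtains lam v where "lam \<noteq> 0" "\<exists>i<n. v i \<noteq> 0" "\<And>j. j < n \<Longrightarrow> (\<Sum>i<n. v i * B i j) = lam * v j"
    "\<forall>\<mu> w. norm \<mu> < norm lam \<longrightarrow> (\<forall>j<n. (\<Sum>i<n. w i * B i j) = \<mu> * w j) \<longrightarrow> (\<forall>i<n. w i = 0)"
proof -
  define T where "T = mat n n (\<lambda>(j, i). B i j)"
  have T: "T \<in> carrier_mat n n" by (simp add: T_def)
  have Tm: "T *\<^sub>v vec n w = vec n (\<lambda>j. \<Sum>i<n. w i * B i j)" for w unfolding T_def by (rule mat_transpose_mult)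
  have fin: "finite (spectrum T)" by (rule card_finite_spectrum(1)[OF T])
  have ne: "spectrum T \<noteq> {}" using spectrum_non_empty[OF T] n by simp
  have "Min (norm ` spectrum T) \<in> norm ` spectrum T" using fin ne by (intro Min_in) auto
  then obtain lam where lam: "lam \<in> spectrum T" "norm lam = Min (norm ` spectrum T)" by auto
  have min: "norm lam \<le> norm \<mu>" if "\<mu> \<in> spectrum T" for \<mu>
    unfolding lam(2) using fin that by (intro Min_le) auto
  obtain u where u: "u \<in> carrier_vec n" "u \<noteq> 0\<^sub>v n" "T *\<^sub>v u = lam \<cdot>\<^sub>v u"
    using lam(1) T by (auto simp: spectrum_def eigenvalue_def eigenvector_def)
  define v where "v i = vec_index u i" for i
  have uv: "u = vec n v" using u(1) by (intro eq_vecI) (auto simp: v_def)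
  have ev: "(\<Sum>i<n. v i * B i j) = lam * v j" if "j < n" for j
  proof -
    have "vec n (\<lambda>j. \<Sum>i<n. v i * B i j) = lam \<cdot>\<^sub>v vec n v" using u(3) unfolding uv Tm .
    from arg_cong[OF this, of "\<lambda>x. vec_index x j"] show ?thesis using that by simp
  qed
  have nz: "\<exists>i<n. v i \<noteq> 0"
  proof (rule ccontr)
    assume "\<not> (\<exists>i<n. v i \<noteq> 0)"
    then have "u = 0\<^sub>v n" unfolding uv by (intro eq_vecI) auto
    then show False using u(2) by simp
  qed
  have "lam \<noteq> 0"
  proof
    assume "lam = 0"
    then have "(\<Sum>i<n. v i * B i j) = 0" if "j < n" for j using ev[OF that] by simp
    then have "\<forall>i<n. v i = 0" by (rule inj)
    then show False using nz by blast
  qed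
  moreover have "\<forall>i<n. w i = 0" if small: "norm \<mu> < norm lam" and w: "\<And>j. j < n \<Longrightarrow> (\<Sum>i<n. w i * B i j) = \<mu> * w j" for \<mu> w
  proof (rule ccontr)
    assume "\<not> (\<forall>i<n. w i = 0)"
    then obtain i where i: "i < n" "w i \<noteq> 0" by blast
    have "vec n w \<noteq> 0\<^sub>v n"
    proof
      assume "vec n w = 0\<^sub>v n"
      from arg_cong[OF this, of "\<lambda>x. vec_index x i"] show False using i by simp
    qed
    moreover have "T *\<^sub>v vec n w = \<mu> \<cdot>\<^sub>v vec n w" unfolding Tm by (rule eq_vecI) (use w in auto)
    ultimately have "eigenvector T (vec n w) \<mu>" using T by (simp add: eigenvector_def)
    then have "\<mu> \<in> spectrum T" by (auto simp: spectrum_def eigenvalue_def)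
    then show False using min small by fastforce
  qed
  ultimately show thesis using that[of lam v] nz ev by blast
qed

text \<open>Course-of-values recursion in which a value only has to satisfy a relation to the
  earlier ones.\<close>

lemma nat_rec_choice:
  fixes R :: "nat \<Rightarrow> (nat \<Rightarrow> 'a) \<Rightarrow> 'a \<Rightarrow> bool"
  assumes ex: "\<And>k g. \<exists>x. R k g x" and cong: "\<And>k g h x. (\<And>l. l < k \<Longrightarrow> g l = h l) \<Longrightarrow> R k g x = R k h x"
  shows "\<exists>f. \<forall>k. R k f (f k)"
proof -
  define f where "f = wfrec less_than (\<lambda>g k. SOME x. R k g x)"
  have "R k f (f k)" for k
  proof -
    have "f k = (SOME x. R k (cut f less_than k) x)"
      unfolding f_def by (subst wfrec[OF wf_less_than]) simp
    moreover have "R k (cut f less_than k) (SOME x. R k (cut f less_than k) x)"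
      using ex by (rule someI_ex)
    moreover have "R k (cut f less_than k) x = R k f x" for x
      by (rule cong) (simp add: cut_apply)
    ultimately show ?thesis by simp
  qed
  then show ?thesis by blast
qed

lemma eval_fps_scale:
  fixes f :: "complex fps"
  shows "eval_fps f (c * z) = eval_fps (Abs_fps (\<lambda>k. fps_nth f k * c ^ k)) z"
  by (simp add: eval_fps_def power_mult_distrib mult.assoc)

lemma conv_radius_geometric_bound:
  fixes f :: "complex fps"
  assumes "R > 0" "\<And>k. norm (fps_nth f k) * R ^ k \<le> C"
  shows "fps_conv_radius f \<ge> ereal R"
  unfolding fps_conv_radius_def
proof (rule conv_radius_geI_ex')
  fix r :: real assume r: "0 < r" "ereal r < ereal R"
  show "summable (\<lambda>n. fps_nth f n * of_real r ^ n)"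
  proof (rule summable_comparison_test')
    show "summable (\<lambda>k. C * (r / R) ^ k)"
      using r by (intro summable_mult summable_geometric) auto
    fix k
    have "norm (fps_nth f k * of_real r ^ k) = (norm (fps_nth f k) * R ^ k) * (r / R) ^ k"
      using r assms(1) by (simp add: norm_mult norm_power power_divide)
    also have "\<dots> \<le> C * (r / R) ^ k" using assms r by (intro mult_right_mono) auto
    finally show "norm (fps_nth f k * of_real r ^ k) \<le> C * (r / R) ^ k" .
  qed
qed

text \<open>Comparing coefficients of \<open>\<tau> ^ k\<close> gives a linear equation for the
  \<open>k\<close>-th coefficient of \<open>v\<close>, with \<open>B\<close> at 0 multiplied by
  \<open>P ^ k\<close> and diminished by \<open>lam\<close> as its matrix; this is invertible by the
  minimality of \<open>lam\<close>. Convergence follows since \<open>P ^ k\<close> dominates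
  \<open>lam\<close> for large \<open>k\<close>.\<close>

lemma holomorphic_left_eigen:
  fixes B :: "nat \<Rightarrow> nat \<Rightarrow> complex \<Rightarrow> complex" and P :: real
  assumes n: "n \<ge> 1" and r: "r > 0" and P: "P > 1"
    and B: "\<And>i j. i < n \<Longrightarrow> j < n \<Longrightarrow> B i j holomorphic_on ball 0 r"
    and inj: "\<And>w. (\<And>j. j < n \<Longrightarrow> (\<Sum>i<n. w i * B i j 0) = 0) \<Longrightarrow> \<forall>i<n. w i = 0"
  obtains lam v r' where "lam \<noteq> 0" "r' > 0" "r' \<le> r" "\<And>i. v i holomorphic_on ball 0 r'" "\<exists>i<n. v i 0 \<noteq> 0"
    "\<And>\<tau> j. j < n \<Longrightarrow> norm \<tau> < r' / P \<Longrightarrow> (\<Sum>i<n. v i (of_real P * \<tau>) * B i j \<tau>) = lam * v j \<tau>"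
proof -
  obtain lam v0 where lam: "lam \<noteq> 0" and v0: "\<exists>i<n. v0 i \<noteq> 0" "\<And>j. j < n \<Longrightarrow> (\<Sum>i<n. v0 i * B i j 0) = lam * v0 j"
    and minimal: "\<forall>\<mu> w. norm \<mu> < norm lam \<longrightarrow> (\<forall>j<n. (\<Sum>i<n. w i * B i j 0) = \<mu> * w j) \<longrightarrow> (\<forall>i<n. w i = 0)"
    by (rule left_eigen_minimal[of n "\<lambda>i j. B i j 0", OF n inj]) (assumption, rule that)
  define b where "b i j = fps_expansion (B i j) 0" for i j
  have b_conv: "fps_conv_radius (b i j) \<ge> ereal r" and b_eval: "norm z < r \<Longrightarrow> eval_fps (b i j) z = B i j z"
    if "i < n" "j < n" for i j z
    using conv_radius_fps_expansion[of "B i j" 0 "ereal r"] eval_fps_expansion[of "B i j" 0 "ereal r" z] B[OF that]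
    by (auto simp: b_def)
  have b0: "fps_nth (b i j) 0 = B i j 0" if "i < n" "j < n" for i j
    using b_eval[OF that, of 0] r by (simp add: eval_fps_at_0)
  define \<rho> where "\<rho> = r / 2"
  have \<rho>: "\<rho> > 0" "\<rho> < r" using r by (auto simp: \<rho>_def)
  have "\<exists>M. \<forall>k. norm (fps_nth (b i j) k) * \<rho> ^ k \<le> M" if "i < n" "j < n" for i j
  proof -
    have "summable (\<lambda>k. norm (fps_nth (b i j) k * of_real \<rho> ^ k))"
      using b_conv[OF that] \<rho> by (intro norm_summable_fps) (auto intro: less_le_trans[of _ "ereal r"])
    then have "Bseq (\<lambda>k. norm (fps_nth (b i j) k * of_real \<rho> ^ k))"
      by (intro convergent_imp_Bseq) (auto simp: convergent_def dest: summable_LIMSEQ_zero)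
    then show ?thesis using \<rho> by (auto simp: Bseq_def norm_mult norm_power)
  qed
  then have "\<forall>x. \<exists>M. fst x < n \<longrightarrow> snd x < n \<longrightarrow> (\<forall>k. norm (fps_nth (b (fst x) (snd x)) k) * \<rho> ^ k \<le> M)" by blast
  from choice[OF this] obtain Mx where
    Mx: "\<forall>x. fst x < n \<longrightarrow> snd x < n \<longrightarrow> (\<forall>k. norm (fps_nth (b (fst x) (snd x)) k) * \<rho> ^ k \<le> Mx x)" ..
  define Mf where "Mf i j = Mx (i, j)" for i j
  have Mf: "norm (fps_nth (b i j) k) * \<rho> ^ k \<le> Mf i j" if "i < n" "j < n" for i j k
    using spec[OF Mx, of "(i, j)"] that by (simp add: Mf_def)
  define M where "M = (\<Sum>i<n. \<Sum>j<n. \<bar>Mf i j\<bar>)"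
  have M0: "M \<ge> 0" unfolding M_def by (intro sum_nonneg) auto
  have bM: "norm (fps_nth (b i j) k) * \<rho> ^ k \<le> M" if "i < n" "j < n" for i j k
  proof -
    have "norm (fps_nth (b i j) k) * \<rho> ^ k \<le> Mf i j" using Mf that by blast
    also have "\<dots> \<le> \<bar>Mf i j\<bar>" by simp
    also have "\<dots> \<le> (\<Sum>j<n. \<bar>Mf i j\<bar>)" using that by (intro member_le_sum) auto
    also have "\<dots> \<le> M" unfolding M_def using that by (intro member_le_sum[of i _ "\<lambda>i. \<Sum>j<n. \<bar>Mf i j\<bar>"] sum_nonneg) auto
    finally show ?thesis .
  qed
  obtain C where C: "\<And>w i. i < n \<Longrightarrow> w i = (\<Sum>k<n. (\<Sum>i'<n. w i' * B i' k 0) * C k i)"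
    by (rule injective_inverse[of n "\<lambda>i j. B i j 0", OF inj]) (assumption, rule that)
  define K where "K = (\<Sum>i<n. \<Sum>k<n. norm (C k i))"
  have K0: "K \<ge> 0" unfolding K_def by (intro sum_nonneg) auto
  have Kb: "(\<Sum>i<n. norm (w i)) \<le> K * (\<Sum>j<n. norm (\<Sum>i<n. w i * B i j 0))" for w
  proof -
    define Y where "Y = (\<Sum>j<n. norm (\<Sum>i<n. w i * B i j 0))"
    have "(\<Sum>i<n. norm (w i)) \<le> (\<Sum>i<n. \<Sum>k<n. Y * norm (C k i))"
    proof (intro sum_mono)
      fix i assume i: "i \<in> {..<n}"
      have "norm (w i) = norm (\<Sum>k<n. (\<Sum>i'<n. w i' * B i' k 0) * C k i)"
        using C[of i w] i by simp
      also have "\<dots> \<le> (\<Sum>k<n. norm (\<Sum>i'<n. w i' * B i' k 0) * norm (C k i))"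
        by (rule order_trans[OF norm_sum]) (simp add: norm_mult)
      also have "\<dots> \<le> (\<Sum>k<n. Y * norm (C k i))"
        unfolding Y_def by (intro sum_mono mult_right_mono member_le_sum) auto
      finally show "norm (w i) \<le> (\<Sum>k<n. Y * norm (C k i))" .
    qed
    also have "\<dots> = K * Y" by (simp only: K_def sum_distrib_left mult.commute[of _ Y])
    finally show ?thesis unfolding Y_def .
  qed
  \<comment> \<open>\<open>R k g x\<close> says that \<open>x\<close> can be the \<open>k\<close>-th
    coefficient, given the lower ones in \<open>g\<close>; the constant term is the eigenvector of
    \<open>B\<close> at 0.\<close>
  define R where "R k g x \<longleftrightarrow> (if k = 0 then x = v0 else \<forall>j<n. of_real (P ^ k) * (\<Sum>i<n. x i * B i j 0) - lam * x j
      = - (\<Sum>l<k. of_real (P ^ l) * (\<Sum>i<n. g l i * fps_nth (b i j) (k - l))))" for k :: nat and g :: "nat \<Rightarrow> nat \<Rightarrow> complex" and x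
  have "\<exists>f. \<forall>k. R k f (f k)"
  proof (rule nat_rec_choice)
    fix k g
    show "\<exists>x. R k g x"
    proof (cases "k = 0")
      case False
      have Pk: "P ^ k > 1" using P False by (intro one_less_power) auto
      \<comment> \<open>A kernel vector would be an eigenvector for \<open>lam / P ^ k\<close>,
        whose modulus is smaller than that of \<open>lam\<close>.\<close>
      obtain C where C: "\<And>r j. j < n \<Longrightarrow> (\<Sum>i<n. (\<Sum>m<n. r m * C m i) * (of_real (P ^ k) * B i j 0 - (if i = j then lam else 0))) = r j"
      proof (rule injective_inverse[of n "\<lambda>i j. of_real (P ^ k) * B i j 0 - (if i = j then lam else 0)"])
        fix w assume w: "\<And>j. j < n \<Longrightarrow> (\<Sum>i<n. w i * (of_real (P ^ k) * B i j 0 - (if i = j then lam else 0))) = 0"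
        have "(\<Sum>i<n. w i * B i j 0) = (lam / of_real (P ^ k)) * w j" if j: "j < n" for j
        proof -
          have "(\<Sum>i<n. w i * (of_real (P ^ k) * B i j 0 - (if i = j then lam else 0)))
            = (\<Sum>i<n. of_real (P ^ k) * (w i * B i j 0) - (if i = j then lam * w j else 0))"
            by (intro sum.cong) (auto simp: algebra_simps)
          also have "\<dots> = of_real (P ^ k) * (\<Sum>i<n. w i * B i j 0) - lam * w j"
            using j by (simp add: sum_subtractf sum_distrib_left)
          finally have "of_real (P ^ k) * (\<Sum>i<n. w i * B i j 0) = lam * w j" using w[OF j] by simp
          moreover have "complex_of_real (P ^ k) \<noteq> 0" using P by simp
          ultimately show ?thesis by (simp add: field_simps)
        qed
        moreover have "norm (lam / of_real (P ^ k)) < norm lam"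
        proof -
          have "norm lam / P ^ k < norm lam / 1" using Pk lam by (intro divide_strict_left_mono) auto
          then show ?thesis using P by (simp add: norm_divide norm_power)
        qed
        ultimately show "\<forall>i<n. w i = 0"
          using minimal[rule_format, of "lam / of_real (P ^ k)" w] by blast
      qed (rule that)
      define rr where "rr j = - (\<Sum>l<k. of_real (P ^ l) * (\<Sum>i<n. g l i * fps_nth (b i j) (k - l)))" for j
      define x where "x i = (\<Sum>m<n. rr m * C m i)" for i
      have "of_real (P ^ k) * (\<Sum>i<n. x i * B i j 0) - lam * x j = rr j" if j: "j < n" for j
      proof -
        have "(\<Sum>i<n. x i * (of_real (P ^ k) * B i j 0 - (if i = j then lam else 0)))
            = (\<Sum>i<n. of_real (P ^ k) * (x i * B i j 0) - (if i = j then lam * x j else 0))"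
            by (intro sum.cong) (auto simp: algebra_simps)
        also have "\<dots> = of_real (P ^ k) * (\<Sum>i<n. x i * B i j 0) - lam * x j"
            using j by (simp add: sum_subtractf sum_distrib_left)
        finally show ?thesis using C[OF j, of rr] unfolding x_def by simp
      qed
      then show ?thesis using False unfolding R_def rr_def by (intro exI[of _ x]) simp
    qed (simp add: R_def)
  next
    fix k and g h :: "nat \<Rightarrow> nat \<Rightarrow> complex" and x
    assume "\<And>l. l < k \<Longrightarrow> g l = h l"
    then show "R k g x = R k h x" unfolding R_def by simp
  qed
  then obtain f where f: "\<And>k. R k f (f k)" by blast
  have f0: "f 0 = v0" using f[of 0] by (simp add: R_def)
  have fk: "of_real (P ^ k) * (\<Sum>i<n. f k i * B i j 0) - lam * f k j
      = - (\<Sum>l<k. of_real (P ^ l) * (\<Sum>i<n. f l i * fps_nth (b i j) (k - l)))" if "k > 0" "j < n" for k j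
    using f[of k] that by (simp add: R_def)
  \<comment> \<open>The weight combines the radius \<rho> of the Cauchy bounds for \<open>b\<close>
    with the powers of \<open>P\<close> from the argument \<open>P * \<tau>\<close>, so that both
    disappear in \<open>a_step\<close>.\<close>
  define a where "a k = (\<Sum>i<n. norm (f k i)) * (P * \<rho>) ^ k" for k
  have a0: "a k \<ge> 0" for k unfolding a_def using P \<rho> by (intro mult_nonneg_nonneg sum_nonneg) auto
  \<comment> \<open>From \<open>k0\<close> on the term with \<open>lam\<close> is at most half of
    the left side and can be absorbed.\<close>
  obtain k0 where k0: "k0 > 0" "K * norm lam \<le> P ^ k0 / 2"
  proof -
    obtain k where "2 * (K * norm lam) < P ^ k" using real_arch_pow[OF P] by blast
    moreover have "P ^ k \<le> P ^ Suc k" using P by (intro power_increasing) auto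
    ultimately show thesis by (intro that[of "Suc k"]) auto
  qed
  define c where "c = 2 * K * real n * M"
  have c0: "c \<ge> 0" using K0 M0 by (simp add: c_def)
  have a_step: "a k \<le> c * (\<Sum>l<k. a l)" if k: "k \<ge> k0" for k
  proof -
    define S where "S = (\<Sum>i<n. norm (f k i))"
    define rr where "rr j = - (\<Sum>l<k. of_real (P ^ l) * (\<Sum>i<n. f l i * fps_nth (b i j) (k - l)))" for j
    have Pk: "P ^ k > 0" "P ^ k0 \<le> P ^ k" using P k by (auto intro: power_increasing)
    have eq: "(\<Sum>i<n. f k i * B i j 0) = (rr j + lam * f k j) / of_real (P ^ k)" if "j < n" for j
    proof -
      have "of_real (P ^ k) * (\<Sum>i<n. f k i * B i j 0) = rr j + lam * f k j"
        using fk[of k j] k k0 that by (simp add: rr_def algebra_simps)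
      moreover have "complex_of_real (P ^ k) \<noteq> 0" using Pk P by auto
      ultimately show ?thesis by (simp add: field_simps)
    qed
    have "S \<le> K * (\<Sum>j<n. norm (\<Sum>i<n. f k i * B i j 0))" unfolding S_def by (rule Kb)
    also have "(\<Sum>j<n. norm (\<Sum>i<n. f k i * B i j 0)) = (\<Sum>j<n. norm ((rr j + lam * f k j) / of_real (P ^ k)))"
      using eq by (intro sum.cong) auto
    also have "\<dots> \<le> (\<Sum>j<n. (norm (rr j) + norm lam * norm (f k j)) / P ^ k)"
      using Pk P by (intro sum_mono) (auto simp: norm_divide norm_power norm_mult[symmetric] intro!: divide_right_mono norm_triangle_ineq)
    also have "\<dots> = ((\<Sum>j<n. norm (rr j)) + norm lam * S) / P ^ k"
      by (simp add: S_def sum_divide_distrib[symmetric] sum.distrib sum_distrib_left)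
    finally have "S \<le> K * (((\<Sum>j<n. norm (rr j)) + norm lam * S) / P ^ k)" using K0 by (simp add: mult_left_mono)
    then have "S * P ^ k \<le> K * (\<Sum>j<n. norm (rr j)) + (K * norm lam) * S"
      using Pk by (simp add: field_simps)
    also have "\<dots> \<le> K * (\<Sum>j<n. norm (rr j)) + (P ^ k / 2) * S"
      using k0 Pk by (intro add_left_mono mult_right_mono) (auto simp: S_def intro: sum_nonneg)
    finally have S1: "S * P ^ k \<le> 2 * K * (\<Sum>j<n. norm (rr j))" by (simp add: field_simps)
    have "norm (rr j) * \<rho> ^ k \<le> M * (\<Sum>l<k. a l)" if j: "j < n" for j
    proof -
      have "norm (rr j) \<le> (\<Sum>l<k. P ^ l * (\<Sum>i<n. norm (f l i) * norm (fps_nth (b i j) (k - l))))"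
        unfolding rr_def norm_minus_cancel
      proof (rule order_trans[OF norm_sum], intro sum_mono)
        fix l
        have "norm (\<Sum>i<n. f l i * fps_nth (b i j) (k - l)) \<le> (\<Sum>i<n. norm (f l i) * norm (fps_nth (b i j) (k - l)))"
          by (rule order_trans[OF norm_sum]) (simp add: norm_mult)
        then show "norm (of_real (P ^ l) * (\<Sum>i<n. f l i * fps_nth (b i j) (k - l))) \<le>
            P ^ l * (\<Sum>i<n. norm (f l i) * norm (fps_nth (b i j) (k - l)))"
          using P by (simp add: norm_mult norm_power mult_left_mono)
      qed
      then have "norm (rr j) * \<rho> ^ k \<le> (\<Sum>l<k. P ^ l * (\<Sum>i<n. norm (f l i) * norm (fps_nth (b i j) (k - l)))) * \<rho> ^ k"
        using \<rho> by (intro mult_right_mono) auto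
      also have "\<dots> = (\<Sum>l<k. P ^ l * \<rho> ^ l * (\<Sum>i<n. norm (f l i) * (norm (fps_nth (b i j) (k - l)) * \<rho> ^ (k - l))))"
        unfolding sum_distrib_right
      proof (intro sum.cong refl)
        fix l assume "l \<in> {..<k}"
        then have "\<rho> ^ k = \<rho> ^ l * \<rho> ^ (k - l)" by (simp flip: power_add)
        then show "P ^ l * (\<Sum>i<n. norm (f l i) * norm (fps_nth (b i j) (k - l))) * \<rho> ^ k =
          P ^ l * \<rho> ^ l * (\<Sum>i<n. norm (f l i) * (norm (fps_nth (b i j) (k - l)) * \<rho> ^ (k - l)))"
          by (simp add: sum_distrib_left sum_distrib_right mult_ac)
      qed
      also have "\<dots> \<le> (\<Sum>l<k. P ^ l * \<rho> ^ l * (\<Sum>i<n. norm (f l i) * M))"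
        using P \<rho> bM j by (intro sum_mono mult_left_mono) auto
      also have "\<dots> = M * (\<Sum>l<k. a l)"
        by (simp add: a_def sum_distrib_left sum_distrib_right power_mult_distrib mult_ac)
      finally show ?thesis .
    qed
    then have "(\<Sum>j<n. norm (rr j) * \<rho> ^ k) \<le> (\<Sum>j<n. M * (\<Sum>l<k. a l))" by (intro sum_mono) auto
    then have S2: "(\<Sum>j<n. norm (rr j)) * \<rho> ^ k \<le> real n * (M * (\<Sum>l<k. a l))"
      by (simp add: sum_distrib_right)
    have "a k = (S * P ^ k) * \<rho> ^ k" by (simp add: a_def S_def power_mult_distrib)
    also have "\<dots> \<le> (2 * K * (\<Sum>j<n. norm (rr j))) * \<rho> ^ k" using S1 \<rho> by (intro mult_right_mono) auto
    also have "\<dots> = 2 * K * ((\<Sum>j<n. norm (rr j)) * \<rho> ^ k)" by simp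
    also have "\<dots> \<le> 2 * K * (real n * (M * (\<Sum>l<k. a l)))" using S2 K0 by (intro mult_left_mono) auto
    finally show ?thesis by (simp add: c_def)
  qed
  define A where "A = (\<Sum>l<k0. a l)"
  have A0: "A \<ge> 0" unfolding A_def by (intro sum_nonneg a0)
  \<comment> \<open>A discrete Gronwall argument: from \<open>k0\<close> on each new
    \<open>a k\<close> is at most \<open>c\<close> times the sum so far.\<close>
  have sumA: "(\<Sum>l<k. a l) \<le> A * (1 + c) ^ k" for k
  proof (induction k)
    case 0
    then show ?case using A0 by simp
  next
    case (Suc k)
    show ?case
    proof (cases "k \<ge> k0")
      case True
      have "(\<Sum>l<Suc k. a l) \<le> (1 + c) * (\<Sum>l<k. a l)" using a_step[OF True] by (simp add: algebra_simps)
      also have "\<dots> \<le> (1 + c) * (A * (1 + c) ^ k)" using Suc c0 by (intro mult_left_mono) auto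
      finally show ?thesis by (simp add: mult_ac)
    next
      case False
      have "(\<Sum>l<Suc k. a l) \<le> A" unfolding A_def using False a0 by (intro sum_mono2) auto
      also have "A * 1 \<le> A * (1 + c) ^ Suc k" using c0 A0 by (intro mult_left_mono one_le_power) auto
      finally show ?thesis by simp
    qed
  qed
  \<comment> \<open>The growth factor \<open>1 + c\<close> is paid for by a smaller radius.\<close>
  define R2 where "R2 = P * \<rho> / (1 + c)"
  have R2: "R2 > 0" using P \<rho> c0 by (simp add: R2_def)
  define V where "V i = Abs_fps (\<lambda>k. if i < n then f k i else 0)" for i
  have V_bound: "norm (fps_nth (V i) k) * R2 ^ k \<le> A * (1 + c)" for i k
  proof (cases "i < n")
    case True
    have "norm (f k i) \<le> (\<Sum>i<n. norm (f k i))" using True by (intro member_le_sum) auto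
    then have "norm (f k i) * (P * \<rho>) ^ k \<le> a k" unfolding a_def using P \<rho> by (intro mult_right_mono) auto
    also have "\<dots> \<le> (\<Sum>l<Suc k. a l)" using a0 by (intro member_le_sum) auto
    also have "\<dots> \<le> A * (1 + c) ^ Suc k" by (rule sumA)
    finally have "norm (f k i) * (P * \<rho>) ^ k / (1 + c) ^ k \<le> A * (1 + c) ^ Suc k / (1 + c) ^ k"
      using c0 by (intro divide_right_mono) auto
    then show ?thesis using True c0 by (simp add: V_def R2_def power_divide)
  qed (use A0 c0 in \<open>simp add: V_def\<close>)
  have V_conv: "fps_conv_radius (V i) \<ge> ereal R2" for i
    by (rule conv_radius_geometric_bound[OF R2 V_bound])
  define r' where "r' = min r R2"
  have r': "r' > 0" "r' \<le> r" "r' \<le> R2" using r R2 by (auto simp: r'_def)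
  define v where "v i z = eval_fps (V i) z" for i z
  show thesis
  proof (rule that[of lam r' v, OF lam r'(1,2)])
    show "v i holomorphic_on ball 0 r'" for i
    proof -
      have "ball 0 r' \<subseteq> eball 0 (fps_conv_radius (V i))"
        using r'(3) by (auto simp: dist_norm intro!: less_le_trans[OF _ V_conv[of i]])
      then have "eval_fps (V i) holomorphic_on ball 0 r'" by (rule holomorphic_on_eval_fps)
      then show ?thesis by (simp add: v_def[abs_def])
    qed
    show "\<exists>i<n. v i 0 \<noteq> 0" using v0(1) by (auto simp: v_def eval_fps_at_0 V_def f0)
    fix \<tau> :: complex and j assume j: "j < n" and \<tau>: "norm \<tau> < r' / P"
    have "norm (of_real P * \<tau>) = P * norm \<tau>" using P by (simp add: norm_mult)
    moreover have "P * norm \<tau> < r'" using \<tau> P by (simp add: field_simps)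
    moreover have "1 * norm \<tau> \<le> P * norm \<tau>" using P by (intro mult_right_mono) auto
    ultimately have \<tau>': "norm \<tau> < r'" "norm (of_real P * \<tau>) < r'" by auto
    define W where "W i = Abs_fps (\<lambda>k. fps_nth (V i) k * of_real P ^ k)" for i
    have W_conv: "fps_conv_radius (W i) \<ge> ereal (R2 / P)" for i
    proof (rule conv_radius_geometric_bound)
      show "R2 / P > 0" using R2 P by simp
      fix k show "norm (fps_nth (W i) k) * (R2 / P) ^ k \<le> A * (1 + c)"
        using V_bound[of i k] P by (simp add: W_def norm_mult norm_power power_divide)
    qed
    have \<tau>W: "ereal (norm \<tau>) < fps_conv_radius (W i)" for i
    proof -
      have "norm \<tau> < R2 / P" using \<tau> r'(3) P by (smt (verit) divide_right_mono)
      then show ?thesis by (intro less_le_trans[OF _ W_conv[of i]]) simp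
    qed
    have \<tau>b: "ereal (norm \<tau>) < fps_conv_radius (b i j)" if "i < n" for i
      using \<tau>'(1) r'(2) by (intro less_le_trans[OF _ b_conv[OF that j]]) simp
    have "(\<Sum>i<n. v i (of_real P * \<tau>) * B i j \<tau>) = (\<Sum>i<n. eval_fps (W i * b i j) \<tau>)"
    proof (intro sum.cong refl)
      fix i assume i: "i \<in> {..<n}"
      have "v i (of_real P * \<tau>) = eval_fps (W i) \<tau>" unfolding v_def W_def by (rule eval_fps_scale)
      moreover have "B i j \<tau> = eval_fps (b i j) \<tau>" using b_eval[of i j \<tau>] i j \<tau>' r'(2) by simp
      ultimately show "v i (of_real P * \<tau>) * B i j \<tau> = eval_fps (W i * b i j) \<tau>"
        using eval_fps_mult[OF \<tau>W \<tau>b, of i i] i by simp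
    qed
    also have "\<dots> = eval_fps (\<Sum>i<n. W i * b i j) \<tau>"
    proof -
      have "ereal (norm \<tau>) < fps_conv_radius (W i * b i j)" if "i < n" for i
        using \<tau>W[of i] \<tau>b[OF that] by (intro less_le_trans[OF _ fps_conv_radius_mult]) simp
      then have "(\<Sum>i<m. eval_fps (W i * b i j) \<tau>) = eval_fps (\<Sum>i<m. W i * b i j) \<tau> \<and> ereal (norm \<tau>) < fps_conv_radius (\<Sum>i<m. W i * b i j)" if "m \<le> n" for m
        using that
      proof (induction m)
        case (Suc m)
        then have m: "(\<Sum>i<m. eval_fps (W i * b i j) \<tau>) = eval_fps (\<Sum>i<m. W i * b i j) \<tau>"
          "ereal (norm \<tau>) < fps_conv_radius (\<Sum>i<m. W i * b i j)" "ereal (norm \<tau>) < fps_conv_radius (W m * b m j)"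
          using \<open>\<And>i. i < n \<Longrightarrow> ereal (norm \<tau>) < fps_conv_radius (W i * b i j)\<close> by auto
        then have "ereal (norm \<tau>) < min (fps_conv_radius (\<Sum>i<m. W i * b i j)) (fps_conv_radius (W m * b m j))" by simp
        also have "\<dots> \<le> fps_conv_radius ((\<Sum>i<m. W i * b i j) + W m * b m j)" by (rule fps_conv_radius_add)
        finally show ?case using m by (simp add: eval_fps_add)
      qed auto
      then show ?thesis by simp
    qed
    also have "(\<Sum>i<n. W i * b i j) = fps_const lam * V j"
    proof (rule fps_ext)
      fix k
      have "fps_nth (\<Sum>i<n. W i * b i j) k = (\<Sum>i<n. \<Sum>l\<le>k. f l i * of_real P ^ l * fps_nth (b i j) (k - l))"
        by (simp add: fps_sum_nth fps_mult_nth W_def V_def atLeast0AtMost)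
      also have "\<dots> = (\<Sum>l\<le>k. of_real (P ^ l) * (\<Sum>i<n. f l i * fps_nth (b i j) (k - l)))"
        by (subst sum.swap) (simp add: sum_distrib_left mult_ac)
      also have "\<dots> = lam * f k j"
      proof (cases "k = 0")
        case True
        then show ?thesis using v0(2)[OF j] b0 j by (simp add: f0)
      next
        case False
        have "(\<Sum>l\<le>k. of_real (P ^ l) * (\<Sum>i<n. f l i * fps_nth (b i j) (k - l)))
          = (\<Sum>l<k. of_real (P ^ l) * (\<Sum>i<n. f l i * fps_nth (b i j) (k - l))) + of_real (P ^ k) * (\<Sum>i<n. f k i * B i j 0)"
          using b0 j by (simp flip: lessThan_Suc_atMost)
        also have "\<dots> = lam * f k j" using fk[of k j] False j by (simp add: algebra_simps add_eq_0_iff)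
        finally show ?thesis .
      qed
      finally show "fps_nth (\<Sum>i<n. W i * b i j) k = fps_nth (fps_const lam * V j) k" using j by (simp add: V_def)
    qed
    also have "eval_fps (fps_const lam * V j) \<tau> = lam * v j \<tau>"
    proof -
      have "ereal (norm \<tau>) < fps_conv_radius (V j)"
        using \<tau>'(1) r'(3) by (intro less_le_trans[OF _ V_conv[of j]]) simp
      then show ?thesis by (simp add: eval_fps_mult v_def)
    qed
    finally show "(\<Sum>i<n. v i (of_real P * \<tau>) * B i j \<tau>) = lam * v j \<tau>" .
  qed
qed

subsection \<open>Local expansions at a root of unity\<close>

text \<open>Up to multiples of \<open>2 * pi\<close> in \<open>Im s\<close>, this is where
  \<open>exp (- s)\<close> has positive real part. Hence for \<zeta> of modulus 1 the map
  \<open>near_root \<zeta>\<close> sends it into the unit disc and its edges to the unit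
  circle.\<close>

definition strip :: "complex set" where "strip = {s. \<bar>Im s\<bar> < pi / 2}"

text \<open>Far to the right inside the strip, which means towards \<zeta> from inside the
  disc.\<close>

definition strip_top :: "complex filter" where
  "strip_top = inf (filtercomap Re at_top) (principal strip)"

lemma eventually_strip_top:
  "eventually P strip_top \<longleftrightarrow> (\<exists>\<sigma>. \<forall>s\<in>strip. Re s > \<sigma> \<longrightarrow> P s)"
  unfolding strip_top_def eventually_inf_principal eventually_filtercomap_at_top_dense by blast

lemma eventually_strip_top_in: "eventually (\<lambda>s. s \<in> strip \<and> Re s > \<sigma>) strip_top"
  unfolding eventually_strip_top by blast

lemma eventually_exp_small:
  assumes "r > 0"
  shows "eventually (\<lambda>s. norm (exp (- s)) < r) strip_top"
  unfolding eventually_strip_top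
proof (intro exI[of _ "- ln r"] ballI impI)
  fix s assume "Re s > - ln r"
  then have "exp (- Re s) < exp (ln r)" by simp
  then show "norm (exp (- s)) < r" using assms by simp
qed

section \<open>Holomorphic functions far out in the strip\<close>

definition ev_hol :: "(complex \<Rightarrow> complex) \<Rightarrow> bool" where
  "ev_hol y \<longleftrightarrow> (\<exists>\<sigma>. y holomorphic_on (strip \<inter> {s. Re s > \<sigma>}))"

lemma open_strip: "open strip"
proof -
  have eq: "strip = {s. Im s < pi / 2} \<inter> {s. Im s > - (pi / 2)}" by (auto simp: strip_def)
  show ?thesis unfolding eq by (intro open_Int open_halfspace_Im_lt open_halfspace_Im_gt)
qed

lemma ev_hol_cong:
  assumes "ev_hol y" "eventually (\<lambda>s. z s = y s) strip_top"
  shows "ev_hol z"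
proof -
  obtain \<sigma>1 \<sigma>2 where 1: "y holomorphic_on (strip \<inter> {s. Re s > \<sigma>1})" "\<forall>s\<in>strip. Re s > \<sigma>2 \<longrightarrow> z s = y s"
    using assms unfolding ev_hol_def eventually_strip_top by blast
  have "y holomorphic_on (strip \<inter> {s. Re s > max \<sigma>1 \<sigma>2})" by (rule holomorphic_on_subset[OF 1(1)]) auto
  then have "z holomorphic_on (strip \<inter> {s. Re s > max \<sigma>1 \<sigma>2})"
    by (rule holomorphic_transform) (use 1(2) in auto)
  then show ?thesis unfolding ev_hol_def by blast
qed

lemma ev_hol_binop:
  assumes "ev_hol y" "ev_hol z"
  shows "ev_hol (\<lambda>s. y s + z s)" "ev_hol (\<lambda>s. y s - z s)" "ev_hol (\<lambda>s. y s * z s)"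
proof -
  obtain \<sigma>1 \<sigma>2 where "y holomorphic_on (strip \<inter> {s. Re s > \<sigma>1})" "z holomorphic_on (strip \<inter> {s. Re s > \<sigma>2})"
    using assms unfolding ev_hol_def by blast
  then have "y holomorphic_on (strip \<inter> {s. Re s > max \<sigma>1 \<sigma>2})" "z holomorphic_on (strip \<inter> {s. Re s > max \<sigma>1 \<sigma>2})"
    by (auto elim: holomorphic_on_subset)
  then show "ev_hol (\<lambda>s. y s + z s)" "ev_hol (\<lambda>s. y s - z s)" "ev_hol (\<lambda>s. y s * z s)"
    unfolding ev_hol_def by (blast intro: holomorphic_intros)+
qed

lemma ev_hol_exp:
  assumes "h holomorphic_on ball 0 r" "r > 0"
  shows "ev_hol (\<lambda>s. h (exp (- s)))"
proof -
  obtain \<sigma> where \<sigma>: "\<forall>s\<in>strip. Re s > \<sigma> \<longrightarrow> norm (exp (- s)) < r"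
    using eventually_exp_small[OF assms(2)] unfolding eventually_strip_top by blast
  have "(h \<circ> (\<lambda>s. exp (- s))) holomorphic_on (strip \<inter> {s. Re s > \<sigma>})"
    by (rule holomorphic_on_compose_gen[OF _ assms(1)]) (use \<sigma> in \<open>auto intro!: holomorphic_intros\<close>)
  then show ?thesis unfolding ev_hol_def o_def by blast
qed

lemma ev_hol_strip: "y holomorphic_on strip \<Longrightarrow> ev_hol y"
  unfolding ev_hol_def by (meson holomorphic_on_subset inf_le1)

text \<open>Equality is asked for only eventually, so germs \<open>h\<close> with different radii
  can be added freely; the periodic factors, in contrast, live on the whole strip, up to the edges
  where the continuation will take place.\<close>

inductive qexp :: "real \<Rightarrow> (complex \<Rightarrow> complex) \<Rightarrow> bool" for L where
  qexp_base: "r > 0 \<Longrightarrow> h holomorphic_on ball 0 r \<Longrightarrow> m holomorphic_on strip \<Longrightarrow>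
     (\<And>s. s \<in> strip \<Longrightarrow> m (s + of_real L) = m s) \<Longrightarrow>
     eventually (\<lambda>s. y s = h (exp (- s)) * exp (- lam * s) * s ^ l * m s) strip_top \<Longrightarrow> qexp L y"
| qexp_add: "qexp L y \<Longrightarrow> qexp L z \<Longrightarrow> eventually (\<lambda>s. w s = y s + z s) strip_top \<Longrightarrow> qexp L w"

lemma qexp_cong:
  assumes "qexp L y" "eventually (\<lambda>s. z s = y s) strip_top"
  shows "qexp L z"
  using assms(1)
proof (cases rule: qexp.cases)
  case (qexp_base r h m lam l)
  have "eventually (\<lambda>s. z s = h (exp (- s)) * exp (- lam * s) * s ^ l * m s) strip_top"
    using qexp_base(5) assms(2) by eventually_elim simp
  with qexp_base(1-4) show ?thesis by (rule qexp.qexp_base)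
next
  case (qexp_add y1 y2)
  have "eventually (\<lambda>s. z s = y1 s + y2 s) strip_top"
    using qexp_add(3) assms(2) by eventually_elim simp
  then show ?thesis by (rule qexp.qexp_add[OF qexp_add(1,2)])
qed

lemma qexp_mult_hol:
  assumes "qexp L y" and g: "g holomorphic_on ball 0 \<rho>" "\<rho> > 0"
  shows "qexp L (\<lambda>s. g (exp (- s)) * y s)"
  using assms(1)
proof (induction rule: qexp.induct)
  case (qexp_base r h m y lam l)
  show ?case
  proof (rule qexp.qexp_base[of "min r \<rho>" "\<lambda>z. g z * h z"])
    show "(\<lambda>z. g z * h z) holomorphic_on ball 0 (min r \<rho>)"
      using qexp_base(2) g by (intro holomorphic_intros) (auto elim: holomorphic_on_subset)
    show "eventually (\<lambda>s. g (exp (- s)) * y s = g (exp (- s)) * h (exp (- s)) * exp (- lam * s) * s ^ l * m s) strip_top"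
      using qexp_base(5) by eventually_elim simp
  qed (use qexp_base g in auto)
next
  case (qexp_add y z w)
  show ?case
    by (rule qexp.qexp_add[OF qexp_add(4,5)]) (use qexp_add(3) in \<open>eventually_elim, simp add: algebra_simps\<close>)
qed

lemma qexp_cmult: "qexp L y \<Longrightarrow> qexp L (\<lambda>s. c * y s)"
  using qexp_mult_hol[of L y "\<lambda>_. c" 1] by auto

lemma qexp_0: "qexp L (\<lambda>_. 0)"
  by (rule qexp_base[of 1 "\<lambda>_. 0" "\<lambda>_. 0"]) auto

lemma qexp_plus: "qexp L y \<Longrightarrow> qexp L z \<Longrightarrow> qexp L (\<lambda>s. y s + z s)"
  by (erule (1) qexp_add) simp

lemma qexp_sum: "(\<And>i. i \<in> I \<Longrightarrow> qexp L (y i)) \<Longrightarrow> qexp L (\<lambda>s. \<Sum>i\<in>I. y i s)"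
  by (induction I rule: infinite_finite_induct) (auto intro: qexp_0 qexp_plus)

lemma qexp_ev_hol: "qexp L y \<Longrightarrow> ev_hol y"
proof (induction rule: qexp.induct)
  case (qexp_base r h m y lam l)
  have "ev_hol (\<lambda>s. h (exp (- s)) * (exp (- lam * s) * s ^ l * m s))"
    by (intro ev_hol_binop ev_hol_exp[OF qexp_base(2,1)] ev_hol_strip holomorphic_intros qexp_base(3))
  then show ?case
    by (rule ev_hol_cong) (use qexp_base(5) in \<open>eventually_elim, simp add: mult.assoc\<close>)
next
  case (qexp_add y z w)
  show ?case by (rule ev_hol_cong[OF ev_hol_binop(1)[OF qexp_add(4,5)] qexp_add(3)])
qed

text \<open>The shift by \<open>- L\<close> multiplies \<open>exp (- s)\<close> by
  \<open>exp L\<close>, which near \<zeta> is a substitution of a power of \<open>x\<close>; so this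
  is an inhomogeneous Mahler equation of order one.\<close>

definition solvable :: "real \<Rightarrow> complex \<Rightarrow> (complex \<Rightarrow> complex) \<Rightarrow> bool" where
  "solvable L c \<psi> \<longleftrightarrow> (\<exists>z. qexp L z \<and> eventually (\<lambda>s. z (s - of_real L) = c * z s + \<psi> s) strip_top)"

lemma solvable_add:
  assumes "solvable L c \<psi>" "solvable L c \<phi>" "eventually (\<lambda>s. \<xi> s = \<psi> s + \<phi> s) strip_top"
  shows "solvable L c \<xi>"
proof -
  obtain y z where y: "qexp L y" "eventually (\<lambda>s. y (s - of_real L) = c * y s + \<psi> s) strip_top"
    and z: "qexp L z" "eventually (\<lambda>s. z (s - of_real L) = c * z s + \<phi> s) strip_top"
    using assms unfolding solvable_def by blast
  have "eventually (\<lambda>s. y (s - of_real L) + z (s - of_real L) = c * (y s + z s) + \<xi> s) strip_top"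
    using y(2) z(2) assms(3) by eventually_elim (simp add: algebra_simps)
  then show ?thesis unfolding solvable_def using qexp_plus[OF y(1) z(1)] by blast
qed

lemma solvable_cong:
  assumes "solvable L c \<psi>" "eventually (\<lambda>s. \<xi> s = \<psi> s) strip_top"
  shows "solvable L c \<xi>"
proof -
  obtain z where z: "qexp L z" "eventually (\<lambda>s. z (s - of_real L) = c * z s + \<psi> s) strip_top"
    using assms(1) unfolding solvable_def by (elim exE conjE)
  have "eventually (\<lambda>s. z (s - of_real L) = c * z s + \<xi> s) strip_top"
    using z(2) assms(2) by eventually_elim simp
  with z(1) show ?thesis unfolding solvable_def by (intro exI conjI)
qed

lemma solvable_0: "solvable L c (\<lambda>_. 0)"
  unfolding solvable_def by (rule exI[of _ "\<lambda>_. 0"], rule conjI, rule qexp_0) simp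

lemma solvable_sum:
  assumes "\<And>i. i \<in> I \<Longrightarrow> solvable L c (\<psi> i)"
  shows "solvable L c (\<lambda>s. \<Sum>i\<in>I. \<psi> i s)"
  using assms
proof (induction I rule: infinite_finite_induct)
  case (insert i I)
  have "solvable L c (\<lambda>s. \<Sum>i\<in>I. \<psi> i s)" by (rule insert.IH) (rule insert.prems, simp)
  then show ?case
    by (rule solvable_add[of L c "\<psi> i", OF insert.prems[OF insertI1]]) (use insert.hyps in simp)
qed (simp_all add: solvable_0)

lemma solvable_qexp: 
  assumes "qexp L z" "eventually (\<lambda>s. z (s - of_real L) = c * z s + \<xi> s) strip_top"
  shows "solvable L c \<xi>"
  using assms unfolding solvable_def by blast

text \<open>Solving \<open>\<kappa> H(P \<tau>) - c H(\<tau>) = h(\<tau>)\<close> coefficientwise; the exponent \<open>k0\<close> with \<open>\<kappa> P\<^sup>k\<^sup>0 = c\<close> (if any) is left out.\<close>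

lemma solve_holomorphic:
  assumes h: "h holomorphic_on ball 0 r" "r > 0" and P: "(P::real) > 1" and \<kappa>: "\<kappa> \<noteq> 0" and c: "c \<noteq> 0"
  obtains H d k0 where "H holomorphic_on ball 0 r" "d = 0 \<or> \<kappa> * of_real P ^ k0 = c"
    "\<And>\<tau>. norm \<tau> < r / P \<Longrightarrow> \<kappa> * H (of_real P * \<tau>) - c * H \<tau> = h \<tau> - d * \<tau> ^ k0"
proof -
  define f where "f = fps_expansion h 0"
  have f_conv: "fps_conv_radius f \<ge> ereal r" and f_eval: "\<And>z. norm z < r \<Longrightarrow> eval_fps f z = h z"
    using conv_radius_fps_expansion[of h 0 "ereal r"] eval_fps_expansion[of h 0 "ereal r"] h by (auto simp: f_def)
  define D where "D k = \<kappa> * of_real P ^ k - c" for k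
  \<comment> \<open>The resonant exponent, unique because \<open>P > 1\<close>. If there is none,
    \<open>SOME\<close> yields an arbitrary number and \<open>d\<close> below is 0.\<close>
  define k0 where "k0 = (SOME k. D k = 0)"
  have D_uniq: "D k = 0 \<Longrightarrow> k = k0" for k
  proof -
    assume k: "D k = 0"
    then have "D k0 = 0" unfolding k0_def by (rule someI)
    with k have "\<kappa> * of_real P ^ k = \<kappa> * of_real P ^ k0" by (simp add: D_def)
    then have "complex_of_real (P ^ k) = of_real (P ^ k0)" using \<kappa> by simp
    then have "P ^ k = P ^ k0" by (simp only: of_real_eq_iff)
    then show "k = k0" using P by (simp add: power_inject_exp)
  qed
  define d where "d = (if D k0 = 0 then fps_nth f k0 else 0)"
  define G where "G = Abs_fps (\<lambda>k. fps_nth f k / D k)"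
  obtain C where C: "C > 0" "\<And>k. norm (fps_nth G k) \<le> C * norm (fps_nth f k)"
  proof -
    obtain K where K0: "(norm c + 1) / norm \<kappa> < P ^ K" using real_arch_pow[OF P] by blast
    have K: "norm \<kappa> * P ^ k \<ge> norm c + 1" if "k \<ge> K" for k
    proof -
      have "(norm c + 1) / norm \<kappa> \<le> P ^ k"
        using K0 power_increasing[OF that, of P] P by linarith
      then show ?thesis using \<kappa> by (simp add: field_simps)
    qed
    define C where "C = 1 + (\<Sum>k<K. norm (inverse (D k)))"
    have C1: "C \<ge> 1" unfolding C_def by (simp add: sum_nonneg)
    have "norm (inverse (D k)) \<le> C" for k
    proof (cases "k < K")
      case True
      then have "norm (inverse (D k)) \<le> (\<Sum>k<K. norm (inverse (D k)))" by (intro member_le_sum) auto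
      then show ?thesis by (simp add: C_def)
    next
      case False
      have "norm (\<kappa> * of_real P ^ k) \<le> norm (D k) + norm c" unfolding D_def by (metis diff_add_cancel norm_triangle_ineq)
      then have "norm (D k) \<ge> 1" using K[of k] False P by (simp add: norm_mult norm_power)
      then have "norm (inverse (D k)) \<le> 1" by (simp add: norm_inverse inverse_le_1_iff)
      then show ?thesis using C1 by simp
    qed
    then have "norm (fps_nth G k) \<le> C * norm (fps_nth f k)" for k
    proof -
      have "fps_nth G k = inverse (D k) * fps_nth f k" by (simp add: G_def divide_inverse mult.commute)
      then have "norm (fps_nth G k) = norm (inverse (D k)) * norm (fps_nth f k)" by (simp only: norm_mult)
      also have "\<dots> \<le> C * norm (fps_nth f k)" by (intro mult_right_mono) (use \<open>\<And>k. norm (inverse (D k)) \<le> C\<close> in auto)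
      finally show ?thesis .
    qed
    then show thesis using that[of C] C1 by simp
  qed
  have G_conv: "fps_conv_radius G \<ge> ereal r"
    unfolding fps_conv_radius_def
  proof (rule conv_radius_geI_ex')
    fix r' :: real assume r': "0 < r'" "ereal r' < ereal r"
    have "ereal (norm (complex_of_real r')) < fps_conv_radius f"
      using r' by (intro less_le_trans[OF _ f_conv]) simp
    then have s: "summable (\<lambda>k. norm (fps_nth f k * of_real r' ^ k))" by (rule norm_summable_fps)
    show "summable (\<lambda>k. fps_nth G k * of_real r' ^ k)"
    proof (rule summable_comparison_test')
      show "summable (\<lambda>k. C * norm (fps_nth f k * of_real r' ^ k))" by (intro summable_mult s)
      fix k show "norm (fps_nth G k * of_real r' ^ k) \<le> C * norm (fps_nth f k * of_real r' ^ k)"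
        using C(2)[of k] by (simp add: norm_mult mult.assoc[symmetric] mult_right_mono)
    qed
  qed
  show thesis
  proof (rule that[of "eval_fps G" d k0])
    have "ball 0 r \<subseteq> eball 0 (fps_conv_radius G)"
      by (auto simp: dist_norm intro!: less_le_trans[OF _ G_conv])
    then show "eval_fps G holomorphic_on ball 0 r" by (rule holomorphic_on_eval_fps)
    show "d = 0 \<or> \<kappa> * of_real P ^ k0 = c" by (auto simp: d_def D_def)
    fix \<tau> :: complex assume \<tau>: "norm \<tau> < r / P"
    have "norm (of_real P * \<tau>) = P * norm \<tau>" using P by (simp add: norm_mult)
    moreover have "P * norm \<tau> < r" using \<tau> P by (simp add: field_simps)
    moreover have "1 * norm \<tau> \<le> P * norm \<tau>" using P by (intro mult_right_mono) auto
    ultimately have \<tau>': "norm \<tau> < r" "norm (of_real P * \<tau>) < r" by auto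
    have s1: "(\<lambda>k. fps_nth G k * (of_real P * \<tau>) ^ k) sums eval_fps G (of_real P * \<tau>)"
      by (rule sums_eval_fps) (use \<tau>'(2) in \<open>intro less_le_trans[OF _ G_conv], simp\<close>)
    have s2: "(\<lambda>k. fps_nth G k * \<tau> ^ k) sums eval_fps G \<tau>"
      by (rule sums_eval_fps) (use \<tau>'(1) in \<open>intro less_le_trans[OF _ G_conv], simp\<close>)
    have s3: "(\<lambda>k. fps_nth f k * \<tau> ^ k) sums h \<tau>"
      unfolding f_eval[OF \<tau>'(1), symmetric]
      by (rule sums_eval_fps) (use \<tau>'(1) in \<open>intro less_le_trans[OF _ f_conv], simp\<close>)
    have s4: "(\<lambda>k. (if k = k0 then d * \<tau> ^ k else 0)) sums (d * \<tau> ^ k0)"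
      using sums_single[of k0 "\<lambda>k. d * \<tau> ^ k"] by simp
    have "(\<lambda>k. \<kappa> * (fps_nth G k * (of_real P * \<tau>) ^ k) - c * (fps_nth G k * \<tau> ^ k)) sums
        (\<kappa> * eval_fps G (of_real P * \<tau>) - c * eval_fps G \<tau>)"
      by (intro sums_diff sums_mult s1 s2)
    moreover have "\<kappa> * (fps_nth G k * (of_real P * \<tau>) ^ k) - c * (fps_nth G k * \<tau> ^ k) = 
        fps_nth f k * \<tau> ^ k - (if k = k0 then d * \<tau> ^ k else 0)" for k
    proof -
      have "\<kappa> * (fps_nth G k * (of_real P * \<tau>) ^ k) - c * (fps_nth G k * \<tau> ^ k) = D k * fps_nth G k * \<tau> ^ k"
        by (simp add: D_def power_mult_distrib algebra_simps)
      then show ?thesis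
        using D_uniq[of k] by (cases "D k = 0") (auto simp: G_def d_def)
    qed
    ultimately have "(\<lambda>k. fps_nth f k * \<tau> ^ k - (if k = k0 then d * \<tau> ^ k else 0)) sums
        (\<kappa> * eval_fps G (of_real P * \<tau>) - c * eval_fps G \<tau>)" by simp
    then show "\<kappa> * eval_fps G (of_real P * \<tau>) - c * eval_fps G \<tau> = h \<tau> - d * \<tau> ^ k0"
      using sums_diff[OF s3 s4] by (rule sums_unique2)
  qed
qed

lemma binomial_shift:
  fixes s a :: complex
  shows "(s - a) ^ Suc l = s ^ Suc l - of_nat (Suc l) * a * s ^ l + (\<Sum>j<l. of_nat (Suc l choose j) * (- a) ^ (Suc l - j) * s ^ j)"
    "(s - a) ^ l = s ^ l + (\<Sum>j<l. of_nat (l choose j) * (- a) ^ (l - j) * s ^ j)"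
proof -
  have b: "(s - a) ^ n = (\<Sum>j\<le>n. of_nat (n choose j) * (- a) ^ (n - j) * s ^ j)" for n
    using binomial_ring[of s "- a" n] by (simp add: mult_ac)
  show "(s - a) ^ l = s ^ l + (\<Sum>j<l. of_nat (l choose j) * (- a) ^ (l - j) * s ^ j)"
    unfolding b lessThan_Suc_atMost[symmetric] by simp
  show "(s - a) ^ Suc l = s ^ Suc l - of_nat (Suc l) * a * s ^ l + (\<Sum>j<l. of_nat (Suc l choose j) * (- a) ^ (Suc l - j) * s ^ j)"
    unfolding b lessThan_Suc_atMost[symmetric] by (simp add: algebra_simps)
qed

text \<open>Induction on the power of \<open>s\<close>. A term with the same power solves the
  equation up to lower powers and one resonant monomial; the lower powers are left to the induction,
  and the resonant monomial is produced by a term with one more power of \<open>s\<close>.\<close>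

lemma solvable_base:
  assumes L: "L > 0" and c: "c \<noteq> 0" and m: "m holomorphic_on strip" "\<And>s. s \<in> strip \<Longrightarrow> m (s + of_real L) = m s"
    and h: "h holomorphic_on ball 0 r" "r > 0"
  shows "solvable L c (\<lambda>s. h (exp (- s)) * exp (- \<mu> * s) * s ^ l * m s)"
  using h
proof (induction l arbitrary: h r rule: less_induct)
  case (less l)
  define P where "P = exp L"
  have P: "P > 1" using L by (simp add: P_def)
  define \<kappa> where "\<kappa> = exp (\<mu> * of_real L)"
  have \<kappa>: "\<kappa> \<noteq> 0" by (simp add: \<kappa>_def)
  obtain H d k0 where H: "H holomorphic_on ball 0 r" and d: "d = 0 \<or> \<kappa> * of_real P ^ k0 = c"
    and Heq: "\<And>\<tau>. norm \<tau> < r / P \<Longrightarrow> \<kappa> * H (of_real P * \<tau>) - c * H \<tau> = h \<tau> - d * \<tau> ^ k0"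
    by (rule solve_holomorphic[OF less.prems P \<kappa> c]) (rule that)
  have rP: "r / P > 0" using less.prems P by simp
  have expL: "exp (- (s - of_real L)) = of_real P * exp (- s)" for s :: complex
  proof -
    have "- (s - of_real L) = of_real L + - s" by simp
    then show ?thesis by (simp only: exp_add exp_of_real P_def)
  qed
  have exp\<mu>: "exp (- \<mu> * (s - of_real L)) = \<kappa> * exp (- \<mu> * s)" for s
    by (simp add: \<kappa>_def algebra_simps flip: exp_add)
  have mL: "m (s - of_real L) = m s" if "s \<in> strip" for s
    using m(2)[of "s - of_real L"] that by (simp add: strip_def)
  have HP: "(\<lambda>\<tau>. H (of_real P * \<tau>)) holomorphic_on ball 0 (r / P)"
  proof -
    have "(H \<circ> (\<lambda>\<tau>. of_real P * \<tau>)) holomorphic_on ball 0 (r / P)"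
      by (rule holomorphic_on_compose_gen[OF _ H]) (use P in \<open>auto intro!: holomorphic_intros simp: norm_mult field_simps\<close>)
    then show ?thesis by (simp add: o_def)
  qed
  define z1 where "z1 s = H (exp (- s)) * exp (- \<mu> * s) * s ^ l * m s" for s
  have z1: "qexp L z1" unfolding z1_def
    by (rule qexp_base[OF less.prems(2) H m, where lam = \<mu> and l = l]) auto
  \<comment> \<open>What the shift makes out of \<open>s ^ l\<close> below the top power.\<close>
  define low1 where "low1 s = (\<Sum>j<l. (\<lambda>\<tau>. of_nat (l choose j) * (- of_real L) ^ (l - j) * \<kappa> * H (of_real P * \<tau>)) (exp (- s)) * exp (- \<mu> * s) * s ^ j * m s)" for s
  have low1: "solvable L c low1" unfolding low1_def
  proof (rule solvable_sum)
    fix j assume "j \<in> {..<l}"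
    then show "solvable L c (\<lambda>s. of_nat (l choose j) * (- of_real L) ^ (l - j) * \<kappa> * H (of_real P * exp (- s)) * exp (- \<mu> * s) * s ^ j * m s)"
      by (intro less.IH[of j "\<lambda>\<tau>. of_nat (l choose j) * (- of_real L) ^ (l - j) * \<kappa> * H (of_real P * \<tau>)" "r / P"] rP
          holomorphic_intros HP) auto
  qed
  have ev: "eventually (\<lambda>s. s \<in> strip \<and> norm (exp (- s)) < r / P) strip_top"
    using eventually_strip_top_in[of 0] eventually_exp_small[OF rP] by eventually_elim simp
  have s1: "solvable L c (\<lambda>s. (h (exp (- s)) - d * exp (- s) ^ k0) * exp (- \<mu> * s) * s ^ l * m s + low1 s)"
  proof (rule solvable_qexp[OF z1])
    show "eventually (\<lambda>s. z1 (s - of_real L) = c * z1 s + ((h (exp (- s)) - d * exp (- s) ^ k0) * exp (- \<mu> * s) * s ^ l * m s + low1 s)) strip_top"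
      using ev
    proof eventually_elim
      case (elim s)
      define X where "X = \<kappa> * H (of_real P * exp (- s))"
      have "z1 (s - of_real L) = X * exp (- \<mu> * s) * (s - of_real L) ^ l * m s"
        unfolding z1_def expL exp\<mu> using mL elim by (simp add: X_def)
      also have "\<dots> = X * exp (- \<mu> * s) * s ^ l * m s + low1 s"
        unfolding binomial_shift(2) low1_def X_def by (simp add: distrib_left distrib_right sum_distrib_left sum_distrib_right mult_ac)
      also have "X = c * H (exp (- s)) + (h (exp (- s)) - d * exp (- s) ^ k0)"
        using Heq[of "exp (- s)"] elim by (simp add: X_def algebra_simps)
      finally show ?case by (simp add: z1_def algebra_simps)
    qed
  qed
  have s2: "solvable L c (\<lambda>s. - low1 s)"
  proof -
    obtain z where "qexp L z" "eventually (\<lambda>s. z (s - of_real L) = c * z s + low1 s) strip_top"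
      using low1 unfolding solvable_def by blast
    then show ?thesis
      by (intro solvable_qexp[of L "\<lambda>s. - 1 * z s"] qexp_cmult) (auto elim: eventually_mono)
  qed
  have s12: "solvable L c (\<lambda>s. (h (exp (- s)) - d * exp (- s) ^ k0) * exp (- \<mu> * s) * s ^ l * m s)"
    by (rule solvable_add[OF s1 s2]) auto
  have s3: "solvable L c (\<lambda>s. d * exp (- s) ^ k0 * exp (- \<mu> * s) * s ^ l * m s)"
  proof (cases "d = 0")
    case True
    then show ?thesis using solvable_0[of L c] by simp
  next
    case False
    then have dk: "\<kappa> * of_real P ^ k0 = c" using d by simp
    \<comment> \<open>At resonance the terms with \<open>s ^ Suc l\<close> cancel, and the
      coefficient of \<open>s ^ l\<close> that remains is \<open>- c * a * Suc l * L\<close>; this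
      choice of \<open>a\<close> makes it equal to \<open>d\<close>.\<close>
    define a where "a = - d / (c * of_nat (Suc l) * of_real L)"
    have ac: "c * a * (- (of_nat (Suc l) * of_real L)) = d" using c L by (simp add: a_def del: of_nat_Suc)
    define z3 where "z3 s = (\<lambda>\<tau>. a * \<tau> ^ k0) (exp (- s)) * exp (- \<mu> * s) * s ^ Suc l * m s" for s
    have z3: "qexp L z3" unfolding z3_def
      by (rule qexp_base[of 1 "\<lambda>\<tau>. a * \<tau> ^ k0", OF _ _ m, where lam = \<mu> and l = "Suc l"]) (auto intro!: holomorphic_intros)
    define low3 where "low3 s = (\<Sum>j<l. (\<lambda>\<tau>. of_nat (Suc l choose j) * (- of_real L) ^ (Suc l - j) * (c * a) * \<tau> ^ k0) (exp (- s)) * exp (- \<mu> * s) * s ^ j * m s)" for s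
    have low3: "solvable L c low3" unfolding low3_def
    proof (rule solvable_sum)
      fix j assume "j \<in> {..<l}"
      then show "solvable L c (\<lambda>s. of_nat (Suc l choose j) * (- of_real L) ^ (Suc l - j) * (c * a) * exp (- s) ^ k0 * exp (- \<mu> * s) * s ^ j * m s)"
        by (intro less.IH[of j "\<lambda>\<tau>. of_nat (Suc l choose j) * (- of_real L) ^ (Suc l - j) * (c * a) * \<tau> ^ k0" 1]
            holomorphic_intros) auto
    qed
    have s4: "solvable L c (\<lambda>s. d * exp (- s) ^ k0 * exp (- \<mu> * s) * s ^ l * m s + low3 s)"
    proof (rule solvable_qexp[OF z3])
      show "eventually (\<lambda>s. z3 (s - of_real L) = c * z3 s + (d * exp (- s) ^ k0 * exp (- \<mu> * s) * s ^ l * m s + low3 s)) strip_top"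
        using ev
      proof eventually_elim
        case (elim s)
        define X where "X = exp (- s) ^ k0 * exp (- \<mu> * s)"
        have "z3 (s - of_real L) = a * (\<kappa> * of_real P ^ k0) * X * (s - of_real L) ^ Suc l * m s"
          unfolding z3_def expL exp\<mu> using mL elim by (simp add: X_def power_mult_distrib del: power_Suc)
        also have "\<dots> = c * (a * X * s ^ Suc l * m s) + (c * a * (- (of_nat (Suc l) * of_real L))) * X * s ^ l * m s
           + (\<Sum>j<l. of_nat (Suc l choose j) * (- of_real L) ^ (Suc l - j) * s ^ j) * (c * a * X * m s)"
          unfolding dk binomial_shift(1) by (simp only: ring_distribs) (simp add: algebra_simps)
        also have "(\<Sum>j<l. of_nat (Suc l choose j) * (- of_real L) ^ (Suc l - j) * s ^ j) * (c * a * X * m s) = low3 s"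
          unfolding low3_def sum_distrib_right by (intro sum.cong refl) (simp add: X_def mult_ac del: binomial_Suc_Suc)
        finally show ?case unfolding ac by (simp add: z3_def X_def mult_ac)
      qed
    qed
    have s5: "solvable L c (\<lambda>s. - low3 s)"
    proof -
      obtain z where "qexp L z" "eventually (\<lambda>s. z (s - of_real L) = c * z s + low3 s) strip_top"
        using low3 unfolding solvable_def by blast
      then show ?thesis
        by (intro solvable_qexp[of L "\<lambda>s. - 1 * z s"] qexp_cmult) (auto elim: eventually_mono)
    qed
    show ?thesis by (rule solvable_add[OF s4 s5]) auto
  qed
  show ?case by (rule solvable_add[OF s12 s3]) (auto simp: algebra_simps)
qed

lemma qexp_solvable:
  assumes "qexp L \<psi>" "L > 0" "c \<noteq> 0"
  shows "solvable L c \<psi>"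
  using assms(1)
proof (induction rule: qexp.induct)
  case (qexp_base r h m y lam l)
  show ?case by (rule solvable_cong[OF solvable_base[OF assms(2,3) qexp_base(3,4,2,1)] qexp_base(5)])
next
  case (qexp_add y z w)
  show ?case by (rule solvable_add[OF qexp_add(4,5,3)])
qed

text \<open>Dividing by an exponential with the same multiplier leaves a function that is periodic
  far out, and periodicity itself extends it holomorphically to the whole strip.\<close>

lemma qexp_homogeneous:
  assumes L: "L > 0" and c: "c \<noteq> 0" and w: "ev_hol w" and eq: "eventually (\<lambda>s. w (s - of_real L) = c * w s) strip_top"
  obtains lam m where "m holomorphic_on strip" "\<And>s. s \<in> strip \<Longrightarrow> m (s + of_real L) = m s"
    "eventually (\<lambda>s. w s = exp (- lam * s) * m s) strip_top"
proof -
  define lam where "lam = Ln c / of_real L"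
  have lamL: "exp (lam * of_real L) = c" using L c by (simp add: lam_def)
  define m0 where "m0 s = w s * exp (lam * s)" for s
  obtain \<sigma>1 \<sigma>2 where \<sigma>: "w holomorphic_on (strip \<inter> {s. Re s > \<sigma>1})" "\<forall>s\<in>strip. Re s > \<sigma>2 \<longrightarrow> w (s - of_real L) = c * w s"
    using w eq unfolding ev_hol_def eventually_strip_top by blast
  define \<sigma> where "\<sigma> = max \<sigma>1 \<sigma>2"
  have m0h: "m0 holomorphic_on (strip \<inter> {s. Re s > \<sigma>})" unfolding m0_def
    by (intro holomorphic_intros holomorphic_on_subset[OF \<sigma>(1)]) (auto simp: \<sigma>_def)
  have m0L: "m0 (s + of_real L) = m0 s" if "s \<in> strip" "Re s > \<sigma>" for s
  proof -
    have "w s = c * w (s + of_real L)" using \<sigma>(2)[rule_format, of "s + of_real L"] that L by (simp add: strip_def \<sigma>_def)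
    then show ?thesis by (simp add: m0_def distrib_left exp_add lamL)
  qed
  have m0n: "m0 (s + of_real (real n * L)) = m0 s" if s: "s \<in> strip" "Re s > \<sigma>" for s n
  proof (induction n)
    case (Suc n)
    have "m0 (s + of_real (real (Suc n) * L)) = m0 ((s + of_real (real n * L)) + of_real L)"
      by (simp add: algebra_simps)
    also have "\<dots> = m0 (s + of_real (real n * L))"
      using s L by (intro m0L) (auto simp: strip_def add_pos_nonneg intro: less_le_trans[of _ "Re s"])
    finally show ?case using Suc by simp
  qed simp
  \<comment> \<open>Enough periods to move a point with real part \<open>x\<close> beyond \<sigma>;
    the added 1 makes the inequality strict.\<close>
  define N where "N x = nat \<lceil>(\<sigma> - x) / L\<rceil> + 1" for x
  have N: "x + real (N x) * L > \<sigma>" for x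
  proof -
    have "(\<sigma> - x) / L < real (N x)" unfolding N_def by linarith
    then show ?thesis using L by (simp add: field_simps)
  qed
  define m where "m s = m0 (s + of_real (real (N (Re s)) * L))" for s
  have m_eq: "m s = m0 (s + of_real (real n * L))" if s: "s \<in> strip" and n: "Re s + real n * L > \<sigma>" for s n
  proof -
    have "m0 (s + of_real (real (max n k) * L)) = m0 (s + of_real (real k * L))" if k: "Re s + real k * L > \<sigma>" for k
    proof -
      have "s + of_real (real (max n k) * L) = (s + of_real (real k * L)) + of_real (real (max n k - k) * L)"
        by (simp add: of_nat_diff algebra_simps)
      moreover have "m0 ((s + of_real (real k * L)) + of_real (real (max n k - k) * L)) = m0 (s + of_real (real k * L))"
        by (rule m0n) (use s k in \<open>auto simp: strip_def\<close>)
      ultimately show ?thesis by (simp only:)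
    qed
    moreover have "m0 (s + of_real (real (max n k) * L)) = m0 (s + of_real (real n * L))" for k
    proof -
      have "s + of_real (real (max n k) * L) = (s + of_real (real n * L)) + of_real (real (max n k - n) * L)"
        by (simp add: of_nat_diff algebra_simps)
      moreover have "m0 ((s + of_real (real n * L)) + of_real (real (max n k - n) * L)) = m0 (s + of_real (real n * L))"
        by (rule m0n) (use s n in \<open>auto simp: strip_def\<close>)
      ultimately show ?thesis by (simp only:)
    qed
    ultimately show ?thesis using N[of "Re s"] unfolding m_def by metis
  qed
  show thesis
  proof (rule that[of m lam])
    show "m holomorphic_on strip"
    proof (rule analytic_imp_holomorphic, subst analytic_on_analytic_at, rule ballI)
      fix s0 assume s0: "s0 \<in> strip"
      \<comment> \<open>Taken for a real part one unit further left, so that the same number of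
        periods serves a whole neighbourhood of \<open>s0\<close>.\<close>
      define n where "n = N (Re s0 - 1)"
      define U where "U = strip \<inter> {s. Re s > Re s0 - 1}"
      have U: "open U" unfolding U_def by (intro open_Int open_strip open_halfspace_Re_gt)
      have big: "Re s + real n * L > \<sigma>" if "s \<in> U" for s using N[of "Re s0 - 1"] that by (simp add: U_def n_def)
      have "(m0 \<circ> (\<lambda>s. s + of_real (real n * L))) holomorphic_on U"
        by (rule holomorphic_on_compose_gen[OF _ m0h]) (use big in \<open>auto intro!: holomorphic_intros simp: U_def strip_def\<close>)
      then have "m holomorphic_on U"
      proof (rule holomorphic_transform)
        fix x assume x: "x \<in> U"
        then have "x \<in> strip" by (simp add: U_def)
        then show "(m0 \<circ> (\<lambda>s. s + of_real (real n * L))) x = m x"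
          unfolding o_def by (rule m_eq[OF _ big[OF x], symmetric])
      qed
      then show "m analytic_on {s0}" using U s0 by (auto simp: analytic_at U_def)
    qed
    fix s assume s: "s \<in> strip"
    have "Re (s + of_real L) + real (N (Re s)) * L > \<sigma>" using N[of "Re s"] L by simp
    then have "m (s + of_real L) = m0 ((s + of_real L) + of_real (real (N (Re s)) * L))"
      using s by (intro m_eq) (auto simp: strip_def)
    also have "\<dots> = m0 ((s + of_real (real (N (Re s)) * L)) + of_real L)" by (simp add: algebra_simps)
    also have "\<dots> = m0 (s + of_real (real (N (Re s)) * L))" using s N[of "Re s"] by (intro m0L) (auto simp: strip_def)
    finally show "m (s + of_real L) = m s" by (simp add: m_def)
  next
    show "eventually (\<lambda>s. w s = exp (- lam * s) * m s) strip_top"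
      unfolding eventually_strip_top
    proof (intro exI[of _ \<sigma>] ballI impI)
      fix s assume s: "s \<in> strip" "Re s > \<sigma>"
      have "m s = m0 s" using m_eq[of s 0] s by simp
      then show "w s = exp (- lam * s) * m s" by (simp add: m0_def exp_minus)
    qed
  qed
qed

lemma qexp_first_order:
  assumes L: "L > 0" and c: "c \<noteq> 0" and y: "ev_hol y" and \<psi>: "qexp L \<psi>"
    and eq: "eventually (\<lambda>s. y (s - of_real L) = c * y s + \<psi> s) strip_top"
  shows "qexp L y"
proof -
  obtain z where z: "qexp L z" "eventually (\<lambda>s. z (s - of_real L) = c * z s + \<psi> s) strip_top"
    using qexp_solvable[OF \<psi> L c] unfolding solvable_def by blast
  define w where "w s = y s - z s" for s
  have "eventually (\<lambda>s. w (s - of_real L) = c * w s) strip_top"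
    using eq z(2) by eventually_elim (simp add: w_def algebra_simps)
  moreover have "ev_hol w" unfolding w_def by (intro ev_hol_binop y qexp_ev_hol[OF z(1)])
  ultimately obtain lam m where m: "m holomorphic_on strip" "\<And>s. s \<in> strip \<Longrightarrow> m (s + of_real L) = m s"
    "eventually (\<lambda>s. w s = exp (- lam * s) * m s) strip_top"
    using qexp_homogeneous[OF L c] by blast
  have "qexp L w"
    by (rule qexp_base[of 1 "\<lambda>_. 1", OF _ _ m(1,2), where lam = lam and l = 0]) (use m(3) in auto)
  then show ?thesis by (rule qexp_add[OF _ z(1)]) (simp add: w_def)
qed

text \<open>Deflation. With a holomorphic left eigenvector \<open>v\<close> the combination
  \<open>z\<close> of the unknowns satisfies a scalar equation with the constant factor
  \<open>lam\<close>. An unknown \<open>y k\<close> with \<open>v k 0 \<noteq> 0\<close> is then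
  eliminated, and the smaller system has \<open>z\<close> in its inhomogeneous part.\<close>

lemma system_qexp:
  fixes B :: "nat \<Rightarrow> nat \<Rightarrow> complex \<Rightarrow> complex"
  assumes L: "L > 0" and r: "r > 0"
    and B: "\<And>i j. i < n \<Longrightarrow> j < n \<Longrightarrow> B i j holomorphic_on ball 0 r"
    and inj: "\<And>w. (\<And>j. j < n \<Longrightarrow> (\<Sum>i<n. w i * B i j 0) = 0) \<Longrightarrow> \<forall>i<n. w i = 0"
    and \<psi>: "\<And>i. i < n \<Longrightarrow> qexp L (\<psi> i)"
    and y: "\<And>i. i < n \<Longrightarrow> ev_hol (y i)"
    and eq: "\<And>i. i < n \<Longrightarrow> eventually (\<lambda>s. y i (s - of_real L) = (\<Sum>j<n. B i j (exp (- s)) * y j s) + \<psi> i s) strip_top"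
  shows "i < n \<Longrightarrow> qexp L (y i)"
  using r B inj \<psi> y eq
proof (induction n arbitrary: B \<psi> y r i)
  case 0
  then show ?case by simp
next
  case (Suc n)
  note r = Suc.prems(2) and B = Suc.prems(3) and inj = Suc.prems(4) and \<psi> = Suc.prems(5)
    and y = Suc.prems(6) and eq = Suc.prems(7)
  define P where "P = exp L"
  have P: "P > 1" using L by (simp add: P_def)
  have expL: "exp (- (s - of_real L)) = of_real P * exp (- s)" for s :: complex
  proof -
    have "- (s - of_real L) = of_real L + - s" by simp
    then show ?thesis by (simp only: exp_add exp_of_real P_def)
  qed
  obtain lam v r' where lam: "lam \<noteq> 0" and r': "r' > 0" "r' \<le> r" and v: "\<And>i. v i holomorphic_on ball 0 r'"
    and vnz: "\<exists>i<Suc n. v i 0 \<noteq> 0"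
    and veq: "\<And>\<tau> j. j < Suc n \<Longrightarrow> norm \<tau> < r' / P \<Longrightarrow> (\<Sum>i<Suc n. v i (of_real P * \<tau>) * B i j \<tau>) = lam * v j \<tau>"
  proof (rule holomorphic_left_eigen[of "Suc n" r P B, OF _ r P])
    show "1 \<le> Suc n" by simp
    show "B i j holomorphic_on ball 0 r" if "i < Suc n" "j < Suc n" for i j using that by (rule B)
    show "\<forall>i<Suc n. w i = 0" if "\<And>j. j < Suc n \<Longrightarrow> (\<Sum>i<Suc n. w i * B i j 0) = 0" for w using that by (rule inj)
  qed (rule that)
  have rP: "r' / P > 0" using r' P by simp
  have vP: "(\<lambda>\<tau>. v i (of_real P * \<tau>)) holomorphic_on ball 0 (r' / P)" for i
  proof -
    have "(v i \<circ> (\<lambda>\<tau>. of_real P * \<tau>)) holomorphic_on ball 0 (r' / P)"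
      by (rule holomorphic_on_compose_gen[OF _ v]) (use P in \<open>auto intro!: holomorphic_intros simp: norm_mult field_simps\<close>)
    then show ?thesis by (simp add: o_def)
  qed
  define z where "z s = (\<Sum>i<Suc n. v i (exp (- s)) * y i s)" for s
  have ev_sum: "ev_hol (\<lambda>s. \<Sum>i<k. f i s)" if "\<And>i. i < k \<Longrightarrow> ev_hol (f i)" for k :: nat and f
    using that
  proof (induction k)
    case 0
    show ?case by (rule ev_hol_strip) simp
  next
    case (Suc k)
    have "ev_hol (\<lambda>s. (\<Sum>i<k. f i s) + f k s)"
      by (rule ev_hol_binop(1)[OF Suc.IH]) (use Suc.prems in simp_all)
    then show ?case by simp
  qed
  have z_hol: "ev_hol z" unfolding z_def
  proof (rule ev_sum)
    fix i assume "i < Suc n"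
    then show "ev_hol (\<lambda>s. v i (exp (- s)) * y i s)" by (rule ev_hol_binop(3)[OF ev_hol_exp[OF v r'(1)] y])
  qed
  define \<phi> where "\<phi> s = (\<Sum>i<Suc n. v i (of_real P * exp (- s)) * \<psi> i s)" for s
  have \<phi>: "qexp L \<phi>" unfolding \<phi>_def
  proof (rule qexp_sum)
    fix i assume "i \<in> {..<Suc n}"
    then have "i < Suc n" by simp
    then show "qexp L (\<lambda>s. v i (of_real P * exp (- s)) * \<psi> i s)" by (rule qexp_mult_hol[OF \<psi> vP rP])
  qed
  have eq': "eventually (\<lambda>s. \<forall>i\<in>{..<Suc n}. y i (s - of_real L) = (\<Sum>j<Suc n. B i j (exp (- s)) * y j s) + \<psi> i s) strip_top"
    by (rule eventually_ball_finite) (use eq in auto)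
  have z: "qexp L z"
  proof (rule qexp_first_order[OF L lam z_hol \<phi>])
    show "eventually (\<lambda>s. z (s - of_real L) = lam * z s + \<phi> s) strip_top"
      using eq' eventually_exp_small[OF rP]
    proof eventually_elim
      case (elim s)
      have "z (s - of_real L) = (\<Sum>i<Suc n. v i (of_real P * exp (- s)) * ((\<Sum>j<Suc n. B i j (exp (- s)) * y j s) + \<psi> i s))"
        unfolding z_def expL by (intro sum.cong refl) (use elim(1) in simp)
      also have "\<dots> = (\<Sum>i<Suc n. v i (of_real P * exp (- s)) * (\<Sum>j<Suc n. B i j (exp (- s)) * y j s)) + \<phi> s"
        unfolding \<phi>_def by (simp only: distrib_left sum.distrib)
      also have "(\<Sum>i<Suc n. v i (of_real P * exp (- s)) * (\<Sum>j<Suc n. B i j (exp (- s)) * y j s))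
          = (\<Sum>j<Suc n. (\<Sum>i<Suc n. v i (of_real P * exp (- s)) * B i j (exp (- s))) * y j s)"
        unfolding sum_distrib_left sum_distrib_right by (subst sum.swap) (simp only: mult.assoc)
      also have "\<dots> = (\<Sum>j<Suc n. lam * v j (exp (- s)) * y j s)"
        by (intro sum.cong refl arg_cong2[of _ _ _ _ "(*)"] veq elim(2)) simp
      also have "\<dots> = lam * z s" unfolding z_def by (simp only: sum_distrib_left mult.assoc)
      finally show ?case .
    qed
  qed
  obtain k where k: "k < Suc n" "v k 0 \<noteq> 0" using vnz by blast
  obtain \<rho> where \<rho>: "\<rho> > 0" "\<rho> \<le> r'" "\<And>\<tau>. \<tau> \<in> ball 0 \<rho> \<Longrightarrow> v k \<tau> \<noteq> 0"
  proof -
    have "continuous (at 0) (v k)"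
      using holomorphic_on_imp_continuous_on[OF v[of k]] r' by (simp add: continuous_on_eq_continuous_at)
    from continuous_at_avoid[OF this k(2)] obtain e where "e > 0" "\<forall>\<tau>. dist 0 \<tau> < e \<longrightarrow> v k \<tau> \<noteq> 0" by blast
    then show thesis using that[of "min e r'"] r' by auto
  qed
  \<comment> \<open>Enumerates the remaining indices, skipping \<open>k\<close>.\<close>
  define \<pi> where "\<pi> i = (if i < k then i else Suc i)" for i
  have \<pi>: "bij_betw \<pi> {..<n} ({..<Suc n} - {k})"
    by (rule bij_betw_byWitness[where f' = "\<lambda>i. if i < k then i else i - 1"]) (use k in \<open>auto simp: \<pi>_def\<close>)
  have \<pi>n: "\<pi> i < Suc n" "\<pi> i \<noteq> k" if "i < n" for i using bij_betwE[OF \<pi>] that by auto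
  have sum_split: "(\<Sum>j<Suc n. f j) = f k + (\<Sum>j<n. f (\<pi> j))" for f :: "nat \<Rightarrow> complex"
    using sum.remove[of "{..<Suc n}" k f] k sum.reindex_bij_betw[OF \<pi>, of f] by simp
  define B' where "B' i j \<tau> = B (\<pi> i) (\<pi> j) \<tau> - B (\<pi> i) k \<tau> * v (\<pi> j) \<tau> / v k \<tau>" for i j \<tau>
  define \<psi>' where "\<psi>' i s = \<psi> (\<pi> i) s + (B (\<pi> i) k (exp (- s)) / v k (exp (- s))) * z s" for i s
  have Bsub: "B i j holomorphic_on ball 0 \<rho>" if "i < Suc n" "j < Suc n" for i j
    using B[OF that] by (rule holomorphic_on_subset) (use r' \<rho> in auto)
  have vsub: "v i holomorphic_on ball 0 \<rho>" for i
    using v by (rule holomorphic_on_subset) (use r' \<rho> in auto)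
  have rest: "qexp L (y (\<pi> i))" if i: "i < n" for i
  proof (rule Suc.IH[OF i \<rho>(1), of B' \<psi>' "\<lambda>i. y (\<pi> i)"])
    fix i j assume "i < n" "j < n"
    then show "B' i j holomorphic_on ball 0 \<rho>" unfolding B'_def
      by (intro holomorphic_intros Bsub vsub \<pi>n k \<rho>)
  next
    fix w assume w: "\<And>j. j < n \<Longrightarrow> (\<Sum>i<n. w i * B' i j 0) = 0"
    \<comment> \<open>A kernel vector of the reduced matrix at 0, extended by 0 at \<open>k\<close>,
      is mapped by \<open>B\<close> to \<open>\<kappa>\<close> times \<open>v\<close>. Subtracting
      \<open>\<kappa> / lam\<close> times \<open>v\<close> gives a kernel vector of \<open>B\<close>
      at 0, which is zero, and its \<open>k\<close>-th entry forces
      \<open>\<kappa> = 0\<close>.\<close>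
    define W where "W i = (if i = k then 0 else w (if i < k then i else i - 1))" for i
    have W: "W (\<pi> i) = w i" "W k = 0" for i by (auto simp: W_def \<pi>_def)
    define \<kappa> where "\<kappa> = (\<Sum>i<n. w i * B (\<pi> i) k 0) / v k 0"
    have WB: "(\<Sum>i<Suc n. W i * B i j 0) = \<kappa> * v j 0" if j: "j < Suc n" for j
    proof (cases "j = k")
      case True
      then show ?thesis unfolding sum_split W using k by (simp add: \<kappa>_def)
    next
      case False
      then obtain j' where j': "j' < n" "j = \<pi> j'" using \<pi> j by (auto simp: bij_betw_def image_iff)
      have "(\<Sum>i<n. w i * B' i j' 0) = (\<Sum>i<n. w i * B (\<pi> i) j 0) - (\<Sum>i<n. w i * B (\<pi> i) k 0) * v j 0 / v k 0"
        unfolding B'_def j'(2)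
        by (simp add: right_diff_distrib sum_subtractf sum_distrib_right sum_divide_distrib mult.assoc)
      then show ?thesis unfolding sum_split W w[OF j'(1)] by (simp add: \<kappa>_def)
    qed
    have "(\<Sum>i<Suc n. (W i - \<kappa> / lam * v i 0) * B i j 0) = 0" if "j < Suc n" for j
    proof -
      have "(\<Sum>i<Suc n. (W i - \<kappa> / lam * v i 0) * B i j 0)
          = (\<Sum>i<Suc n. W i * B i j 0) - \<kappa> / lam * (\<Sum>i<Suc n. v i 0 * B i j 0)"
        by (simp only: left_diff_distrib sum_subtractf sum_distrib_left mult.assoc)
      also have "(\<Sum>i<Suc n. v i 0 * B i j 0) = lam * v j 0" using veq[OF that, of 0] rP by simp
      finally show ?thesis unfolding WB[OF that] using lam by simp
    qed
    then have "\<forall>i<Suc n. W i - \<kappa> / lam * v i 0 = 0" by (rule inj)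
    then have *: "W i = \<kappa> / lam * v i 0" if "i < Suc n" for i using that by simp
    have "\<kappa> = 0" using *[OF k(1)] W(2) k lam by simp
    then have "w i = 0" if "i < n" for i using *[OF \<pi>n(1)[OF that]] unfolding W by simp
    then show "\<forall>i<n. w i = 0" by blast
  next
    fix i assume i: "i < n"
    have "(\<lambda>\<tau>. B (\<pi> i) k \<tau> / v k \<tau>) holomorphic_on ball 0 \<rho>"
      by (intro holomorphic_intros Bsub vsub \<pi>n k \<rho> i)
    then show "qexp L (\<psi>' i)" unfolding \<psi>'_def
      by (rule qexp_plus[OF \<psi>[OF \<pi>n(1)[OF i]] qexp_mult_hol[OF z _ \<rho>(1), of "\<lambda>\<tau>. B (\<pi> i) k \<tau> / v k \<tau>"]])
    show "ev_hol (y (\<pi> i))" by (rule y[OF \<pi>n(1)[OF i]])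
    show "eventually (\<lambda>s. y (\<pi> i) (s - of_real L) = (\<Sum>j<n. B' i j (exp (- s)) * y (\<pi> j) s) + \<psi>' i s) strip_top"
      using eq[OF \<pi>n(1)[OF i]] eventually_exp_small[OF \<rho>(1)]
    proof eventually_elim
      case (elim s)
      define \<tau> where "\<tau> = exp (- s)"
      have vk: "v k \<tau> \<noteq> 0" by (rule \<rho>(3)) (use elim(2) in \<open>simp add: \<tau>_def\<close>)
      have zs: "z s = v k \<tau> * y k s + (\<Sum>j<n. v (\<pi> j) \<tau> * y (\<pi> j) s)" unfolding z_def sum_split \<tau>_def ..
      have "(\<Sum>j<n. B' i j \<tau> * y (\<pi> j) s) = (\<Sum>j<n. B (\<pi> i) (\<pi> j) \<tau> * y (\<pi> j) s)
          - B (\<pi> i) k \<tau> / v k \<tau> * (\<Sum>j<n. v (\<pi> j) \<tau> * y (\<pi> j) s)"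
        unfolding B'_def by (simp add: left_diff_distrib sum_subtractf sum_distrib_left mult.assoc)
      also have "\<dots> = (\<Sum>j<n. B (\<pi> i) (\<pi> j) \<tau> * y (\<pi> j) s) - B (\<pi> i) k \<tau> / v k \<tau> * (z s - v k \<tau> * y k s)"
        unfolding zs by simp
      also have "\<dots> = (\<Sum>j<n. B (\<pi> i) (\<pi> j) \<tau> * y (\<pi> j) s) + B (\<pi> i) k \<tau> * y k s - B (\<pi> i) k \<tau> / v k \<tau> * z s"
        using vk by (simp add: field_simps)
      finally show ?case using elim(1) unfolding sum_split \<psi>'_def \<tau>_def by simp
    qed
  qed
  show "qexp L (y i)"
  proof (cases "i = k")
    case False
    then obtain j where "j < n" "i = \<pi> j" using \<pi> Suc.prems(1) by (auto simp: bij_betw_def image_iff)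
    then show ?thesis using rest by simp
  next
    case True
    have "qexp L (\<lambda>s. \<Sum>j<n. - v (\<pi> j) (exp (- s)) * y (\<pi> j) s)"
    proof (rule qexp_sum)
      fix j assume "j \<in> {..<n}"
      then show "qexp L (\<lambda>s. - v (\<pi> j) (exp (- s)) * y (\<pi> j) s)"
        by (intro qexp_mult_hol[OF rest _ \<rho>(1), of _ "\<lambda>\<tau>. - v (\<pi> j) \<tau>"] holomorphic_on_minus vsub) simp
    qed
    moreover have "(\<lambda>\<tau>. 1 / v k \<tau>) holomorphic_on ball 0 \<rho>" by (intro holomorphic_intros vsub \<rho>(3))
    ultimately have "qexp L (\<lambda>s. (\<lambda>\<tau>. 1 / v k \<tau>) (exp (- s)) * (z s + (\<Sum>j<n. - v (\<pi> j) (exp (- s)) * y (\<pi> j) s)))"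
      by (intro qexp_mult_hol[OF qexp_plus[OF z] _ \<rho>(1)])
    then have "qexp L (\<lambda>s. 1 / v k (exp (- s)) * (z s + (\<Sum>j<n. - v (\<pi> j) (exp (- s)) * y (\<pi> j) s)))" by simp
    then show ?thesis unfolding True
    proof (rule qexp_cong)
      show "eventually (\<lambda>s. y k s = 1 / v k (exp (- s)) * (z s + (\<Sum>j<n. - v (\<pi> j) (exp (- s)) * y (\<pi> j) s))) strip_top"
        using eventually_exp_small[OF \<rho>(1)]
      proof eventually_elim
        case (elim s)
        have vk: "v k (exp (- s)) \<noteq> 0" by (rule \<rho>(3)) (use elim in simp)
        have zs: "z s = v k (exp (- s)) * y k s + (\<Sum>j<n. v (\<pi> j) (exp (- s)) * y (\<pi> j) s)" unfolding z_def sum_split ..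
        show ?case unfolding zs using vk by (simp add: sum_negf)
      qed
    qed
  qed
qed

text \<open>In rank one the expansion is a single term whose holomorphic factor has no zeros. It is
  this single term that makes the twist of \<open>H\<close> differ from \<open>H\<close> only by an
  exponential.\<close>

lemma rank_one_expansion:
  assumes L: "L > 0" and r: "r > 0" and B: "B holomorphic_on ball 0 r" "B 0 \<noteq> 0" and y: "ev_hol y"
    and eq: "eventually (\<lambda>s. y (s - of_real L) = B (exp (- s)) * y s) strip_top"
  obtains u \<rho> lam m where "\<rho> > 0" "u holomorphic_on ball 0 \<rho>" "\<And>\<tau>. \<tau> \<in> ball 0 \<rho> \<Longrightarrow> u \<tau> \<noteq> 0"
    "m holomorphic_on strip" "\<And>s. s \<in> strip \<Longrightarrow> m (s + of_real L) = m s"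
    "eventually (\<lambda>s. y s = u (exp (- s)) * exp (- lam * s) * m s) strip_top"
proof -
  define P where "P = exp L"
  have P: "P > 1" using L by (simp add: P_def)
  have expL: "exp (- (s - of_real L)) = of_real P * exp (- s)" for s :: complex
  proof -
    have "- (s - of_real L) = of_real L + - s" by simp
    then show ?thesis by (simp only: exp_add exp_of_real P_def)
  qed
  obtain lam v r' where lam: "lam \<noteq> 0" and r': "r' > 0" "r' \<le> r" and v: "\<And>i. v i holomorphic_on ball 0 r'"
    and vnz: "\<exists>i<(1::nat). v i 0 \<noteq> 0"
    and veq: "\<And>\<tau> j. j < (1::nat) \<Longrightarrow> norm \<tau> < r' / P \<Longrightarrow> (\<Sum>i<1. v i (of_real P * \<tau>) * B \<tau>) = lam * v j \<tau>"
  proof (rule holomorphic_left_eigen[of 1 r P "\<lambda>_ _. B", OF _ r P])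
    fix w :: "nat \<Rightarrow> complex" assume "\<And>j. j < (1::nat) \<Longrightarrow> (\<Sum>i<(1::nat). w i * B 0) = 0"
    from this[of 0] show "\<forall>i<(1::nat). w i = (0::complex)" using B(2) by simp
  next
    show "B holomorphic_on ball 0 r" if "i < 1" "j < 1" for i j :: nat by (rule B(1))
  qed (rule order_refl, rule that)
  have v0: "v 0 0 \<noteq> 0" using vnz by simp
  obtain \<rho> where \<rho>: "\<rho> > 0" "\<rho> \<le> r'" "\<And>\<tau>. \<tau> \<in> ball 0 \<rho> \<Longrightarrow> v 0 \<tau> \<noteq> 0"
  proof -
    have "continuous (at 0) (v 0)"
      using holomorphic_on_imp_continuous_on[OF v[of 0]] r' by (simp add: continuous_on_eq_continuous_at)
    from continuous_at_avoid[OF this v0] obtain e where "e > 0" "\<forall>\<tau>. dist 0 \<tau> < e \<longrightarrow> v 0 \<tau> \<noteq> 0" by blast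
    then show thesis using that[of "min e r'"] r' by auto
  qed
  have rP: "r' / P > 0" using r' P by simp
  have e1: "eventually (\<lambda>s. v 0 (exp (- (s - of_real L))) * y (s - of_real L) = lam * (v 0 (exp (- s)) * y s)) strip_top"
    using eq eventually_exp_small[OF rP]
  proof eventually_elim
    case (elim s)
    then show ?case using veq[of 0 "exp (- s)"] unfolding expL by simp
  qed
  have e2: "ev_hol (\<lambda>s. v 0 (exp (- s)) * y s)"
    by (rule ev_hol_binop(3)[OF ev_hol_exp[OF v r'(1)] y])
  obtain lm m where m: "m holomorphic_on strip" "\<And>s. s \<in> strip \<Longrightarrow> m (s + of_real L) = m s"
    "eventually (\<lambda>s. v 0 (exp (- s)) * y s = exp (- lm * s) * m s) strip_top"
    by (rule qexp_homogeneous[OF L lam e2 e1]) (rule that)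
  show thesis
  proof (rule that[OF \<rho>(1), of "\<lambda>\<tau>. 1 / v 0 \<tau>" m lm])
    show "(\<lambda>\<tau>. 1 / v 0 \<tau>) holomorphic_on ball 0 \<rho>"
      by (intro holomorphic_intros holomorphic_on_subset[OF v]) (use \<rho> in auto)
    show "1 / v 0 \<tau> \<noteq> 0" if "\<tau> \<in> ball 0 \<rho>" for \<tau> using \<rho>(3)[OF that] by simp
    show "eventually (\<lambda>s. y s = 1 / v 0 (exp (- s)) * exp (- lm * s) * m s) strip_top"
      using m(3) eventually_exp_small[OF \<rho>(1)]
    proof eventually_elim
      case (elim s)
      have "v 0 (exp (- s)) \<noteq> 0" by (rule \<rho>(3)) (use elim(2) in simp)
      then show ?case using elim(1) by (simp add: field_simps)
    qed
  qed (use m in auto)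
qed

text \<open>Flattens the derivation into one finite sum, with a common bound
  \<open>\<sigma>0\<close> in place of the eventual equalities.\<close>

lemma qexp_terms:
  assumes "qexp L y"
  obtains \<sigma>0 and n :: nat and h lam l m where
    "\<And>i. i < n \<Longrightarrow> m i holomorphic_on strip" "\<And>i s. i < n \<Longrightarrow> s \<in> strip \<Longrightarrow> m i (s + of_real L) = m i s"
    "\<And>i. i < n \<Longrightarrow> h i holomorphic_on ball 0 (exp (- \<sigma>0))"
    "\<And>s. s \<in> strip \<Longrightarrow> Re s > \<sigma>0 \<Longrightarrow> y s = (\<Sum>i<n. h i (exp (- s)) * exp (- lam i * s) * s ^ l i * m i s)"
proof -
  have "\<exists>\<sigma>0 n h lam l m. (\<forall>i<n. m i holomorphic_on strip) \<and> (\<forall>i<n. \<forall>s\<in>strip. m i (s + of_real L) = m i s) \<and>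
    (\<forall>i<n. h i holomorphic_on ball 0 (exp (- \<sigma>0))) \<and>
    (\<forall>s\<in>strip. Re s > \<sigma>0 \<longrightarrow> y s = (\<Sum>i<n::nat. h i (exp (- s)) * exp (- lam i * s) * s ^ l i * m i s))"
    using assms
  proof (induction rule: qexp.induct)
    case (qexp_base r h m y lam l)
    obtain \<sigma> where \<sigma>: "\<forall>s\<in>strip. Re s > \<sigma> \<longrightarrow> y s = h (exp (- s)) * exp (- lam * s) * s ^ l * m s"
      using qexp_base(5) unfolding eventually_strip_top by blast
    define \<sigma>0 where "\<sigma>0 = max \<sigma> (- ln r)"
    have "exp (- \<sigma>0) \<le> exp (ln r)" unfolding \<sigma>0_def by (subst exp_le_cancel_iff) linarith
    then have "exp (- \<sigma>0) \<le> r" using qexp_base(1) by simp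
    then have h0: "h holomorphic_on ball 0 (exp (- \<sigma>0))" by (intro holomorphic_on_subset[OF qexp_base(2)]) auto
    show ?case
      by (rule exI[of _ \<sigma>0], rule exI[of _ 1], rule exI[of _ "\<lambda>_. h"], rule exI[of _ "\<lambda>_. lam"], rule exI[of _ "\<lambda>_. l"],
          rule exI[of _ "\<lambda>_. m"]) (use h0 qexp_base(3,4) \<sigma> in \<open>auto simp: \<sigma>0_def\<close>)
  next
    case (qexp_add y z w)
    obtain \<sigma>1 n1 h1 lam1 l1 m1 where 1: "\<forall>i<n1. m1 i holomorphic_on strip" "\<forall>i<n1. \<forall>s\<in>strip. m1 i (s + of_real L) = m1 i s"
      "\<forall>i<n1. h1 i holomorphic_on ball 0 (exp (- \<sigma>1))"
      "\<forall>s\<in>strip. Re s > \<sigma>1 \<longrightarrow> y s = (\<Sum>i<n1::nat. h1 i (exp (- s)) * exp (- lam1 i * s) * s ^ l1 i * m1 i s)"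
      using qexp_add.IH(1) by (elim exE conjE)
    obtain \<sigma>2 n2 h2 lam2 l2 m2 where 2: "\<forall>i<n2. m2 i holomorphic_on strip" "\<forall>i<n2. \<forall>s\<in>strip. m2 i (s + of_real L) = m2 i s"
      "\<forall>i<n2. h2 i holomorphic_on ball 0 (exp (- \<sigma>2))"
      "\<forall>s\<in>strip. Re s > \<sigma>2 \<longrightarrow> z s = (\<Sum>i<n2::nat. h2 i (exp (- s)) * exp (- lam2 i * s) * s ^ l2 i * m2 i s)"
      using qexp_add.IH(2) by (elim exE conjE)
    obtain \<sigma>3 where 3: "\<forall>s\<in>strip. Re s > \<sigma>3 \<longrightarrow> w s = y s + z s"
      using qexp_add(3) unfolding eventually_strip_top by blast
    define \<sigma>0 where "\<sigma>0 = Max {\<sigma>1, \<sigma>2, \<sigma>3}"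
    have le: "\<sigma>1 \<le> \<sigma>0" "\<sigma>2 \<le> \<sigma>0" "\<sigma>3 \<le> \<sigma>0" by (auto simp: \<sigma>0_def)
    have sub: "ball (0::complex) (exp (- \<sigma>0)) \<subseteq> ball 0 (exp (- \<sigma>1))" "ball (0::complex) (exp (- \<sigma>0)) \<subseteq> ball 0 (exp (- \<sigma>2))"
      by (rule subset_ball; use le in simp)+
    have split: "(\<Sum>i<n1+n2. f i) = (\<Sum>i<n1. f i) + (\<Sum>i<n2. f (n1 + i))" for f :: "nat \<Rightarrow> complex"
      by (induction n2) simp_all
    show ?case
    proof (rule exI[of _ \<sigma>0], rule exI[of _ "n1 + n2"], rule exI[of _ "\<lambda>i. if i < n1 then h1 i else h2 (i - n1)"],
        rule exI[of _ "\<lambda>i. if i < n1 then lam1 i else lam2 (i - n1)"], rule exI[of _ "\<lambda>i. if i < n1 then l1 i else l2 (i - n1)"],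
        rule exI[of _ "\<lambda>i. if i < n1 then m1 i else m2 (i - n1)"], intro conjI allI impI ballI)
      fix i assume "i < n1 + n2"
      then have i2: "i - n1 < n2" if "\<not> i < n1" using that by linarith
      show "(if i < n1 then m1 i else m2 (i - n1)) holomorphic_on strip" using 1(1) 2(1) i2 by simp
    next
      fix i assume "i < n1 + n2"
      then have i2: "i - n1 < n2" if "\<not> i < n1" using that by linarith
      show "(if i < n1 then h1 i else h2 (i - n1)) holomorphic_on ball 0 (exp (- \<sigma>0))"
        using 1(3) 2(3) i2 holomorphic_on_subset[OF _ sub(1)] holomorphic_on_subset[OF _ sub(2)] by simp
    next
      fix i s assume "i < n1 + n2" and "s \<in> strip"
      then have i2: "i - n1 < n2" if "\<not> i < n1" using that by linarith
      show "(if i < n1 then m1 i else m2 (i - n1)) (s + of_real L) = (if i < n1 then m1 i else m2 (i - n1)) s"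
        using 1(2) 2(2) i2 \<open>s \<in> strip\<close> by simp
    next
      fix s assume s: "s \<in> strip" "Re s > \<sigma>0"
      have ys: "y s = (\<Sum>i<n1. h1 i (exp (- s)) * exp (- lam1 i * s) * s ^ l1 i * m1 i s)"
        using 1(4) s le by fastforce
      have zs: "z s = (\<Sum>i<n2. h2 i (exp (- s)) * exp (- lam2 i * s) * s ^ l2 i * m2 i s)"
        using 2(4) s le by fastforce
      have "w s = y s + z s" using 3 s le by fastforce
      then show "w s = (\<Sum>i<n1 + n2. (if i < n1 then h1 i else h2 (i - n1)) (exp (- s)) * exp (- (if i < n1 then lam1 i else lam2 (i - n1)) * s)
        * s ^ (if i < n1 then l1 i else l2 (i - n1)) * (if i < n1 then m1 i else m2 (i - n1)) s)"
        unfolding ys zs split by simp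
    qed
  qed
  then obtain \<sigma>0 n h lam l m where *: "\<forall>i<n. m i holomorphic_on strip" "\<forall>i<n. \<forall>s\<in>strip. m i (s + of_real L) = m i s"
    "\<forall>i<n. h i holomorphic_on ball 0 (exp (- \<sigma>0))"
    "\<forall>s\<in>strip. Re s > \<sigma>0 \<longrightarrow> y s = (\<Sum>i<n::nat. h i (exp (- s)) * exp (- lam i * s) * s ^ l i * m i s)"
    by (elim exE conjE)
  show thesis by (rule that[where n = n and m = m and h = h and ?\<sigma>0.0 = \<sigma>0 and lam = lam and l = l]) (use * in simp_all)
qed

section \<open>Evaluation of power series in the unit disc\<close>

lemma conv_radius_sum:
  assumes "\<And>i. i \<in> I \<Longrightarrow> fps_conv_radius (F i :: complex fps) \<ge> 1"
  shows "fps_conv_radius (\<Sum>i\<in>I. F i) \<ge> 1"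
  using assms by (induction I rule: infinite_finite_induct) (auto intro: fps_conv_radius_add_ge)

lemma conv_radius_power: "fps_conv_radius (F :: complex fps) \<ge> 1 \<Longrightarrow> fps_conv_radius (F ^ n) \<ge> 1"
  by (rule order_trans[OF _ fps_conv_radius_power])

lemma conv_radius_fps_of_poly: "fps_conv_radius (fps_of_poly (p :: complex poly)) \<ge> 1"
proof (induction p)
  case (pCons c p)
  then show ?case unfolding fps_of_poly_pCons
    by (intro fps_conv_radius_add_ge fps_conv_radius_mult_ge) simp_all
qed simp

lemma less_conv_radius: "fps_conv_radius (F :: complex fps) \<ge> 1 \<Longrightarrow> norm (x :: complex) < 1 \<Longrightarrow> ereal (norm x) < fps_conv_radius F"
  by (rule less_le_trans[of _ "ereal 1"]) (auto simp: one_ereal_def)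

lemma eval_fps_of_poly_disc: "norm x < 1 \<Longrightarrow> eval_fps (fps_of_poly (p :: complex poly)) x = poly p x"
proof (induction p)
  case (pCons c p)
  have 1: "fps_conv_radius (fps_of_poly p * fps_X) \<ge> 1"
    by (intro fps_conv_radius_mult_ge conv_radius_fps_of_poly) simp
  have "eval_fps (fps_of_poly (pCons c p)) x = c + eval_fps (fps_of_poly p * fps_X) x"
    unfolding fps_of_poly_pCons by (subst eval_fps_add) (use less_conv_radius[OF 1] pCons in simp_all)
  also have "eval_fps (fps_of_poly p * fps_X) x = eval_fps (fps_of_poly p) x * x"
    by (subst eval_fps_mult) (use less_conv_radius[OF conv_radius_fps_of_poly] pCons in simp_all)
  finally have "eval_fps (fps_of_poly (pCons c p)) x = c + eval_fps (fps_of_poly p) x * x" .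
  then show ?case using pCons by (simp add: mult.commute)
qed simp

lemma eval_fps_sum_disc:
  assumes "\<And>i. i \<in> I \<Longrightarrow> fps_conv_radius (F i :: complex fps) \<ge> 1" "norm x < 1"
  shows "eval_fps (\<Sum>i\<in>I. F i) x = (\<Sum>i\<in>I. eval_fps (F i) x)"
  using assms(1)
proof (induction I rule: infinite_finite_induct)
  case (insert i I)
  have "eval_fps (F i + (\<Sum>i\<in>I. F i)) x = eval_fps (F i) x + eval_fps (\<Sum>i\<in>I. F i) x"
    by (rule eval_fps_add) (intro less_conv_radius assms(2) conv_radius_sum insert.prems; simp)+
  then show ?case using insert by simp
qed simp_all

lemma eval_fps_mult_disc:
  assumes "fps_conv_radius (F :: complex fps) \<ge> 1" "fps_conv_radius G \<ge> 1" "norm x < 1"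
  shows "eval_fps (F * G) x = eval_fps F x * eval_fps G x"
  by (rule eval_fps_mult) (intro less_conv_radius assms)+

lemma eval_fps_power_disc:
  assumes "fps_conv_radius (F :: complex fps) \<ge> 1" "norm x < 1"
  shows "eval_fps (F ^ n) x = eval_fps F x ^ n"
  by (rule eval_fps_power) (intro less_conv_radius assms)

lemma compose_X_power_disc:
  assumes F: "fps_conv_radius (F :: complex fps) \<ge> 1" and M: "M > 0"
  shows "fps_conv_radius (F oo fps_X ^ M) \<ge> 1" "norm x < 1 \<Longrightarrow> eval_fps (F oo fps_X ^ M) x = eval_fps F (x ^ M)"
proof -
  have sums: "(\<lambda>k. fps_nth (F oo fps_X ^ M) k * x ^ k) sums eval_fps F (x ^ M)" if x: "norm x < 1" for x
  proof -
    have "norm (x ^ M) < 1" using x M by (simp add: norm_power power_less_one_iff)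
    then have "(\<lambda>k. fps_nth F k * (x ^ M) ^ k) sums eval_fps F (x ^ M)"
      using F by (intro sums_eval_fps less_conv_radius)
    then have "(\<lambda>k. fps_nth (F oo fps_X ^ M) (M * k) * x ^ (M * k)) sums eval_fps F (x ^ M)"
      using M by (simp add: nth_compose_X_power power_mult)
    then show ?thesis
    proof (subst sums_mono_reindex[of "\<lambda>k. M * k", symmetric])
      show "strict_mono (\<lambda>k. M * k)" using M by (simp add: strict_mono_def)
    qed (use M in \<open>auto simp: nth_compose_X_power dvd_def image_iff\<close>)
  qed
  show "norm x < 1 \<Longrightarrow> eval_fps (F oo fps_X ^ M) x = eval_fps F (x ^ M)"
    using sums[of x] by (simp add: eval_fps_def sums_iff)
  show "fps_conv_radius (F oo fps_X ^ M) \<ge> 1"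
    unfolding fps_conv_radius_def
  proof (rule conv_radius_geI_ex')
    fix r :: real assume "0 < r" "ereal r < 1"
    then have "norm (complex_of_real r) < 1" by simp
    from sums[OF this] show "summable (\<lambda>n. fps_nth (F oo fps_X ^ M) n * of_real r ^ n)" by (simp add: sums_iff)
  qed
qed

lemma eval_mahler_equation:
  assumes F: "fps_conv_radius (F :: complex fps) \<ge> 1" and p: "p > 0"
    and eq: "(\<Sum>i\<le>n. fps_of_poly (c i) * (F oo fps_X ^ (p ^ i))) = 0" and x: "norm x < 1"
  shows "(\<Sum>i\<le>n. poly (c i) x * eval_fps F (x ^ (p ^ i))) = 0"
proof -
  have pi: "p ^ i > 0" for i using p by simp
  have "0 = eval_fps (\<Sum>i\<le>n. fps_of_poly (c i) * (F oo fps_X ^ (p ^ i))) x" unfolding eq by simp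
  also have "\<dots> = (\<Sum>i\<le>n. eval_fps (fps_of_poly (c i) * (F oo fps_X ^ (p ^ i))) x)"
    by (intro eval_fps_sum_disc fps_conv_radius_mult_ge conv_radius_fps_of_poly compose_X_power_disc F pi x)
  also have "\<dots> = (\<Sum>i\<le>n. poly (c i) x * eval_fps F (x ^ (p ^ i)))"
    by (intro sum.cong refl)
      (simp only: eval_fps_mult_disc[OF conv_radius_fps_of_poly compose_X_power_disc(1)[OF F pi] x]
        compose_X_power_disc(2)[OF F pi x] eval_fps_of_poly_disc[OF x])
  finally show ?thesis by simp
qed

lemma eval_fps_holomorphic_disc: "fps_conv_radius (F :: complex fps) \<ge> 1 \<Longrightarrow> eval_fps F holomorphic_on ball 0 1"
  by (rule holomorphic_on_eval_fps) (auto simp: eball_def intro: less_conv_radius)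

section \<open>The coordinate near a root of unity\<close>

definition near_root :: "complex \<Rightarrow> complex \<Rightarrow> complex" where
  "near_root \<zeta> s = \<zeta> * exp (- exp (- s))"

lemma near_root_holomorphic: "near_root \<zeta> holomorphic_on A"
  unfolding near_root_def by (intro holomorphic_intros)

lemma near_root_norm: "norm (near_root \<zeta> s) = norm \<zeta> * exp (- (exp (- Re s) * cos (Im s)))"
  by (simp add: near_root_def norm_mult Re_exp)

lemma near_root_strip:
  assumes "norm \<zeta> = 1" "s \<in> strip"
  shows "norm (near_root \<zeta> s) < 1"
proof -
  have "cos (Im s) > 0" using assms(2) by (intro cos_gt_zero_pi) (auto simp: strip_def)
  then show ?thesis using assms(1) by (simp add: near_root_norm)
qed

lemma near_root_power: "near_root \<zeta> s ^ k = \<zeta> ^ k * exp (- (of_nat k * exp (- s)))"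
  by (simp add: near_root_def power_mult_distrib flip: exp_of_nat_mult)

lemma near_root_shift:
  assumes "\<zeta> ^ P = \<zeta>" "P > 0"
  shows "near_root \<zeta> s ^ P = near_root \<zeta> (s - of_real (ln (real P)))"
proof -
  have "exp (- (s - of_real (ln (real P)))) = of_nat P * exp (- s)"
  proof -
    have "- (s - of_real (ln (real P))) = of_real (ln (real P)) + - s" by simp
    then have "exp (- (s - of_real (ln (real P)))) = of_real (exp (ln (real P))) * exp (- s)" by (simp only: exp_add exp_of_real)
    then show ?thesis using assms(2) by simp
  qed
  then show ?thesis using assms(1) by (simp only: near_root_power) (simp add: near_root_def)
qed

lemma root_of_unity_norm: "\<zeta> ^ N = 1 \<Longrightarrow> N > 0 \<Longrightarrow> norm (\<zeta> :: complex) = 1"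
  by (metis norm_ge_zero norm_one norm_power power_eq_1_iff less_numeral_extra(3))

text \<open>Row \<open>i\<close> after \<open>k\<close> shifts expresses \<open>y\<^sub>k\<^sub>+\<^sub>i\<close> through \<open>y\<^sub>0, \<dots>, y\<^sub>n\<^sub>-\<^sub>1\<close> when
  \<open>y\<^sub>k\<^sub>+\<^sub>n = \<Sum>l<n. a k l * y\<^sub>k\<^sub>+\<^sub>l\<close>.\<close>

primrec shift_rows :: "nat \<Rightarrow> (nat \<Rightarrow> nat \<Rightarrow> complex \<Rightarrow> complex) \<Rightarrow> nat \<Rightarrow> nat \<Rightarrow> nat \<Rightarrow> complex \<Rightarrow> complex" where
  "shift_rows n a 0 i j = (\<lambda>\<tau>. if i = j then 1 else 0)"
| "shift_rows n a (Suc k) i j = (\<lambda>\<tau>. if Suc i < n then shift_rows n a k (Suc i) j \<tau>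
     else (\<Sum>l<n. a k l \<tau> * shift_rows n a k l j \<tau>))"

lemma shift_rows_analytic:
  assumes "\<And>k l. l < n \<Longrightarrow> a k l analytic_on {0}"
  shows "shift_rows n a k i j analytic_on {0}"
proof (induction k arbitrary: i)
  case (Suc k)
  show ?case
  proof (cases "Suc i < n")
    case True
    then show ?thesis using Suc by simp
  next
    case False
    have "(\<lambda>\<tau>. \<Sum>l<n. a k l \<tau> * shift_rows n a k l j \<tau>) analytic_on {0}"
      using Suc assms by (intro analytic_intros) auto
    then show ?thesis using False by simp
  qed
qed simp

lemma shift_rows_eq:
  fixes y :: "nat \<Rightarrow> complex"
  assumes "n \<ge> 1" "\<And>k'. k' < k \<Longrightarrow> y (k' + n) = (\<Sum>l<n. a k' l \<tau> * y (k' + l))" "i < n"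
  shows "y (k + i) = (\<Sum>j<n. shift_rows n a k i j \<tau> * y j)"
  using assms(2,3)
proof (induction k arbitrary: i)
  case 0
  have "(\<Sum>j<n. (if i = j then 1 else 0) * y j) = (\<Sum>j<n. if i = j then y j else 0)"
    by (intro sum.cong) auto
  then show ?case using 0 by simp
next
  case (Suc k)
  have IH: "i < n \<Longrightarrow> y (k + i) = (\<Sum>j<n. shift_rows n a k i j \<tau> * y j)" for i
    by (rule Suc.IH) (use Suc.prems in simp_all)
  show ?case
  proof (cases "Suc i < n")
    case True
    then show ?thesis using IH[of "Suc i"] by simp
  next
    case False
    then have i: "Suc i = n" using Suc.prems by simp
    have "y (Suc k + i) = (\<Sum>l<n. a k l \<tau> * y (k + l))" using Suc.prems(1)[of k] unfolding i[symmetric] by simp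
    also have "\<dots> = (\<Sum>l<n. a k l \<tau> * (\<Sum>j<n. shift_rows n a k l j \<tau> * y j))"
      by (intro sum.cong refl) (use IH in simp)
    also have "\<dots> = (\<Sum>j<n. (\<Sum>l<n. a k l \<tau> * shift_rows n a k l j \<tau>) * y j)"
      unfolding sum_distrib_left sum_distrib_right by (subst sum.swap) (simp only: mult.assoc)
    finally show ?thesis using False by simp
  qed
qed

text \<open>Each shift is a companion matrix, invertible because its corner entry
  \<open>a k 0\<close> does not vanish; \<open>w'\<close> is the row vector pulled back through the
  last shift.\<close>

lemma shift_rows_injective:
  assumes n: "n \<ge> 1" and a0: "\<And>k. a k 0 \<tau> \<noteq> 0"
  shows "(\<And>j. j < n \<Longrightarrow> (\<Sum>i<n. w i * shift_rows n a k i j \<tau>) = 0) \<Longrightarrow> \<forall>i<n. w i = 0"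
proof (induction k arbitrary: w)
  case 0
  have "w j = 0" if "j < n" for j
  proof -
    have "(\<Sum>i<n. w i * (if i = j then 1 else 0)) = (\<Sum>i<n. if i = j then w i else 0)"
      by (intro sum.cong) auto
    then show ?thesis using 0[OF that] that by (simp add: sum.delta)
  qed
  then show ?case by blast
next
  case (Suc k)
  obtain m where m: "n = Suc m" using n by (cases n) auto
  define w' where "w' l = (if l = 0 then 0 else w (l - 1)) + w m * a k l \<tau>" for l
  have "(\<Sum>l<n. w' l * shift_rows n a k l j \<tau>) = 0" if j: "j < n" for j
  proof -
    have "(\<Sum>l<n. w' l * shift_rows n a k l j \<tau>)
      = (\<Sum>l<Suc m. (if l = 0 then 0 else w (l - 1)) * shift_rows n a k l j \<tau>) + w m * (\<Sum>l<n. a k l \<tau> * shift_rows n a k l j \<tau>)"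
      unfolding w'_def m by (simp only: distrib_right sum.distrib sum_distrib_left mult.assoc)
    also have "(\<Sum>l<Suc m. (if l = 0 then 0 else w (l - 1)) * shift_rows n a k l j \<tau>) = (\<Sum>i<m. w i * shift_rows n a k (Suc i) j \<tau>)"
      by (subst sum.lessThan_Suc_shift) simp
    also have "(\<Sum>i<m. w i * shift_rows n a k (Suc i) j \<tau>) + w m * (\<Sum>l<n. a k l \<tau> * shift_rows n a k l j \<tau>)
      = (\<Sum>i<n. w i * shift_rows n a (Suc k) i j \<tau>)" unfolding m by simp
    finally show ?thesis using Suc.prems[OF j] by simp
  qed
  then have w': "w' l = 0" if "l < n" for l using Suc.IH that by blast
  have "w m = 0" using w'[of 0] a0[of k] m by (simp add: w'_def)
  moreover have "w i = 0" if "i < m" for i using w'[of "Suc i"] that \<open>w m = 0\<close> m by (simp add: w'_def)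
  ultimately show ?case unfolding m by (auto simp: less_Suc_eq)
qed

text \<open>A single step \<open>x ^ p\<close> may move \<zeta>, so \<open>M\<close> steps are
  composed: the values of \<open>F\<close> at \<open>x ^ (p ^ i)\<close>, \<open>i < n\<close>,
  satisfy a first-order system for the map \<open>x ^ (p ^ M)\<close>, which fixes \<zeta>. Its
  matrix is holomorphic and regular at 0 because the outer coefficients do not vanish at the points
  \<open>\<zeta> ^ (p ^ k)\<close>.\<close>

lemma qexp_mahler:
  fixes F :: "complex fps"
  assumes F: "fps_conv_radius F \<ge> 1" and p: "p \<ge> 2" and n: "n \<ge> 1"
    and eq: "(\<Sum>i\<le>n. fps_of_poly (c i) * (F oo fps_X ^ (p ^ i))) = 0"
    and \<zeta>: "norm \<zeta> = 1" "\<zeta> ^ (p ^ M) = \<zeta>" "M > 0"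
    and c0: "\<And>k. poly (c 0) (\<zeta> ^ k) \<noteq> 0 \<or> \<zeta> ^ k = 1" and cn: "\<And>k. poly (c n) (\<zeta> ^ k) \<noteq> 0 \<or> \<zeta> ^ k = 1"
    and \<zeta>p: "\<And>k. \<zeta> ^ (p ^ k) \<noteq> 1"
  shows "qexp (M * ln p) (\<lambda>s. eval_fps F (near_root \<zeta> s))"
proof -
  define L where "L = ln (real (p ^ M))"
  have L: "L > 0" "L = M * ln p" unfolding L_def using p \<zeta>(3) by (auto simp: ln_realpow)
  \<comment> \<open>The point \<open>x ^ (p ^ k)\<close> as a function of
    \<open>\<tau> = exp (- s)\<close>; the centre \<open>\<tau> = 0\<close> corresponds to
    \<zeta>.\<close>
  define x where "x k \<tau> = \<zeta> ^ (p ^ k) * exp (- (of_nat (p ^ k) * \<tau>))" for k and \<tau> :: complex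
  have x: "x k (exp (- s)) = near_root \<zeta> s ^ (p ^ k)" for k s unfolding x_def near_root_power ..
  define a where "a k l \<tau> = - poly (c l) (x k \<tau>) / poly (c n) (x k \<tau>)" for k l \<tau>
  have x_an: "x k analytic_on A" for k A unfolding x_def by (intro analytic_intros)
  have poly_an: "(\<lambda>\<tau>. poly q (x k \<tau>)) analytic_on A" for q k A
    by (induction q) (auto intro!: analytic_intros x_an)
  have cn0: "poly (c n) (x k 0) \<noteq> 0" and c00: "poly (c 0) (x k 0) \<noteq> 0" for k
    using cn c0 \<zeta>p by (auto simp: x_def)
  have a_an: "a k l analytic_on {0}" for k l
    unfolding a_def by (intro analytic_intros poly_an) (use cn0 in auto)
  define B where "B i j = shift_rows n a M i j" for i j
  have "\<exists>r>0. B i j holomorphic_on ball 0 r" for i j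
    using shift_rows_analytic[of n a M i j] a_an unfolding B_def analytic_on_def by auto
  then obtain r where r: "\<And>i j. r i j > 0" "\<And>i j. B i j holomorphic_on ball 0 (r i j)" by metis
  define r0 where "r0 = Min ((\<lambda>(i, j). r i j) ` ({..<n} \<times> {..<n}))"
  have r0: "r0 > 0" unfolding r0_def using n r(1) by (subst Min_gr_iff) (auto simp: lessThan_empty_iff)
  have "\<forall>k. eventually (\<lambda>\<tau>. poly (c n) (x k \<tau>) \<noteq> 0) (nhds 0)"
  proof
    fix k
    have "isCont (\<lambda>\<tau>. poly (c n) (x k \<tau>)) 0"
      using analytic_imp_holomorphic[OF poly_an[of "c n" k UNIV], THEN holomorphic_on_imp_continuous_on]
      by (simp add: continuous_on_eq_continuous_at)
    then show "eventually (\<lambda>\<tau>. poly (c n) (x k \<tau>) \<noteq> 0) (nhds 0)"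
      using continuous_at_avoid[of 0 "\<lambda>\<tau>. poly (c n) (x k \<tau>)", OF _ cn0] unfolding eventually_nhds_metric
      by (simp add: dist_commute)
  qed
  then have "eventually (\<lambda>\<tau>. \<forall>k\<in>{..M}. poly (c n) (x k \<tau>) \<noteq> 0) (nhds 0)"
    by (intro eventually_ball_finite) auto
  then obtain \<rho> where \<rho>: "\<rho> > 0" "\<And>\<tau> k. norm \<tau> < \<rho> \<Longrightarrow> k \<le> M \<Longrightarrow> poly (c n) (x k \<tau>) \<noteq> 0"
    unfolding eventually_nhds_metric by (auto simp: dist_norm)
  define y where "y k s = eval_fps F (near_root \<zeta> s ^ (p ^ k))" for k s
  have nr: "norm (near_root \<zeta> s ^ (p ^ k)) < 1" if "s \<in> strip" for s k
    using near_root_strip[OF \<zeta>(1) that] p by (simp add: norm_power power_less_one_iff)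
  have rec: "y (k + n) s = (\<Sum>l<n. a k l (exp (- s)) * y (k + l) s)" 
    if s: "s \<in> strip" and nz: "poly (c n) (x k (exp (- s))) \<noteq> 0" for k s
  proof -
    have lin: "Y = - S / C" if "C * Y + S = 0" "C \<noteq> 0" for C Y S :: complex
    proof -
      have "C * Y = - S" using that(1) by (simp add: eq_neg_iff_add_eq_0)
      then show ?thesis using nonzero_mult_div_cancel_left[OF that(2), of Y] by simp
    qed
    have yk: "eval_fps F ((near_root \<zeta> s ^ (p ^ k)) ^ (p ^ i)) = y (k + i) s" for i
      unfolding y_def by (simp add: power_add flip: power_mult)
    have "(\<Sum>i\<le>n. poly (c i) (x k (exp (- s))) * y (k + i) s) = 0"
      using eval_mahler_equation[OF F _ eq nr[OF s, of k]] p unfolding yk x by simp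
    then have "poly (c n) (x k (exp (- s))) * y (k + n) s + (\<Sum>i<n. poly (c i) (x k (exp (- s))) * y (k + i) s) = 0"
      by (simp add: lessThan_Suc_atMost[symmetric] add.commute)
    then have "y (k + n) s = - (\<Sum>i<n. poly (c i) (x k (exp (- s))) * y (k + i) s) / poly (c n) (x k (exp (- s)))"
      by (rule lin[OF _ nz])
    then show ?thesis by (simp add: a_def sum_negf sum_divide_distrib)
  qed
  have "qexp L (y 0)"
  proof (rule system_qexp[where n = n and B = B and r = r0 and \<psi> = "\<lambda>_ _. 0"])
    fix i j assume "i < n" "j < n"
    then have "r0 \<le> r i j" unfolding r0_def by (intro Min_le) auto
    then show "B i j holomorphic_on ball 0 r0" by (intro holomorphic_on_subset[OF r(2)]) auto
  next
    have a0: "a k 0 0 \<noteq> 0" for k using c00[of k] cn0[of k] by (simp add: a_def)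
    fix w assume "\<And>j. j < n \<Longrightarrow> (\<Sum>i<n. w i * B i j 0) = 0"
    then show "\<forall>i<n. w i = 0" unfolding B_def by (rule shift_rows_injective[of n a 0, OF n a0])
  next
    fix i assume i: "i < n"
    have "(eval_fps F \<circ> (\<lambda>s. near_root \<zeta> s ^ (p ^ i))) holomorphic_on strip"
      by (rule holomorphic_on_compose_gen[OF _ eval_fps_holomorphic_disc[OF F]])
        (auto intro!: holomorphic_intros near_root_holomorphic nr)
    then show "ev_hol (y i)" by (intro ev_hol_strip) (simp add: o_def y_def[abs_def])
    show "eventually (\<lambda>s. y i (s - of_real L) = (\<Sum>j<n. B i j (exp (- s)) * y j s) + 0) strip_top"
      using eventually_exp_small[OF \<rho>(1)] eventually_strip_top_in[of 0]
    proof eventually_elim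
      case (elim s)
      have "y i (s - of_real L) = y (M + i) s"
        unfolding y_def L_def using near_root_shift[OF \<zeta>(2), of s] p by (simp add: power_add power_mult)
      also have "\<dots> = (\<Sum>j<n. B i j (exp (- s)) * y j s)" unfolding B_def
        by (rule shift_rows_eq[OF n _ i]) (use elim \<rho>(2) in \<open>intro rec, auto\<close>)
      finally show ?case by simp
    qed
  qed (use L r0 n qexp_0 in simp_all)
  then show ?thesis unfolding y_def L by simp
qed

text \<open>Iteration expresses \<open>H\<close> at \<open>x\<close> as \<open>M\<close> values of
  \<open>b\<close> times \<open>H\<close> at \<open>x ^ (p ^ M)\<close>. Read as an equation for the
  shifted function it has the coefficient \<open>1 / B0\<close>, which is holomorphic near
  0.\<close>

lemma rank_one_mahler:
  fixes H :: "complex fps"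
  assumes H: "fps_conv_radius H \<ge> 1" and p: "p \<ge> 2" and eq: "H = fps_of_poly b * (H oo fps_X ^ p)"
    and \<zeta>: "norm \<zeta> = 1" "\<zeta> ^ (p ^ M) = \<zeta>" "M > 0"
    and b0: "\<And>k. poly b (\<zeta> ^ k) \<noteq> 0 \<or> \<zeta> ^ k = 1" and \<zeta>p: "\<And>k. \<zeta> ^ (p ^ k) \<noteq> 1"
  obtains u \<rho> lam m where "\<rho> > 0" "u holomorphic_on ball 0 \<rho>" "\<And>\<tau>. \<tau> \<in> ball 0 \<rho> \<Longrightarrow> u \<tau> \<noteq> 0"
    "m holomorphic_on strip" "\<And>s. s \<in> strip \<Longrightarrow> m (s + of_real (M * ln p)) = m s"
    "eventually (\<lambda>s. eval_fps H (near_root \<zeta> s) = u (exp (- s)) * exp (- lam * s) * m s) strip_top"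
proof -
  define L where "L = ln (real (p ^ M))"
  have L: "L > 0" "L = M * ln p" unfolding L_def using p \<zeta>(3) by (auto simp: ln_realpow)
  define x where "x k \<tau> = \<zeta> ^ (p ^ k) * exp (- (of_nat (p ^ k) * \<tau>))" for k and \<tau> :: complex
  have x: "x k (exp (- s)) = near_root \<zeta> s ^ (p ^ k)" for k s unfolding x_def near_root_power ..
  define B0 where "B0 \<tau> = (\<Prod>k<M. poly b (x k \<tau>))" for \<tau>
  have x_hol: "x k holomorphic_on A" for k A unfolding x_def by (intro holomorphic_intros)
  have poly_hol: "(\<lambda>\<tau>. poly q (x k \<tau>)) holomorphic_on A" for q k A
    by (induction q) (auto intro!: holomorphic_intros x_hol)
  have B0_hol: "B0 holomorphic_on A" for A unfolding B0_def by (intro holomorphic_intros poly_hol)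
  have B00: "B0 0 \<noteq> 0" unfolding B0_def using b0 \<zeta>p by (auto simp: x_def)
  obtain r where r: "r > 0" "\<And>\<tau>. \<tau> \<in> ball 0 r \<Longrightarrow> B0 \<tau> \<noteq> 0"
  proof -
    have "continuous (at 0) B0" using holomorphic_on_imp_continuous_on[OF B0_hol[of UNIV]] by (simp add: continuous_on_eq_continuous_at)
    from continuous_at_avoid[OF this B00] obtain e where "e > 0" "\<forall>\<tau>. dist 0 \<tau> < e \<longrightarrow> B0 \<tau> \<noteq> 0" by blast
    then show thesis using that[of e] by auto
  qed
  have H1: "eval_fps H z = poly b z * eval_fps H (z ^ p)" if "norm z < 1" for z
  proof -
    have "eval_fps H z = eval_fps (fps_of_poly b * (H oo fps_X ^ p)) z" using eq by simp
    also have "\<dots> = poly b z * eval_fps H (z ^ p)"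
      using p that by (simp add: eval_fps_mult_disc conv_radius_fps_of_poly compose_X_power_disc H eval_fps_of_poly_disc)
    finally show ?thesis .
  qed
  define y where "y s = eval_fps H (near_root \<zeta> s)" for s
  have y_eq: "y s = B0 (exp (- s)) * y (s - of_real L)" if s: "s \<in> strip" for s
  proof -
    have "y s = (\<Prod>k<j. poly b (x k (exp (- s)))) * eval_fps H (near_root \<zeta> s ^ (p ^ j))" for j
    proof (induction j)
      case (Suc j)
      have "norm (near_root \<zeta> s ^ (p ^ j)) < 1"
        using near_root_strip[OF \<zeta>(1) s] p by (simp add: norm_power power_less_one_iff)
      from H1[OF this] Suc show ?case by (simp add: x mult.assoc mult.commute[of p] flip: power_mult)
    qed (simp add: y_def)
    from this[of M] show ?thesis
      unfolding y_def L_def B0_def using near_root_shift[OF \<zeta>(2), of s] p by simp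
  qed
  have "(eval_fps H \<circ> near_root \<zeta>) holomorphic_on strip"
    by (rule holomorphic_on_compose_gen[OF near_root_holomorphic eval_fps_holomorphic_disc[OF H]])
      (auto intro!: near_root_strip \<zeta>)
  then have yh: "ev_hol y" by (intro ev_hol_strip) (simp add: o_def y_def[abs_def])
  have inv_hol: "(\<lambda>\<tau>. 1 / B0 \<tau>) holomorphic_on ball 0 r" by (intro holomorphic_intros B0_hol r(2))
  have ev: "eventually (\<lambda>s. y (s - of_real L) = 1 / B0 (exp (- s)) * y s) strip_top"
    using eventually_exp_small[OF r(1)] eventually_strip_top_in[of 0]
  proof eventually_elim
    case (elim s)
    have "B0 (exp (- s)) \<noteq> 0" by (rule r(2)) (use elim(1) in simp)
    then show ?case using y_eq[of s] elim(2) by simp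
  qed
  obtain u \<rho> lam m where *: "\<rho> > 0" "u holomorphic_on ball 0 \<rho>" "\<And>\<tau>. \<tau> \<in> ball 0 \<rho> \<Longrightarrow> u \<tau> \<noteq> 0"
    "m holomorphic_on strip" "\<And>s. s \<in> strip \<Longrightarrow> m (s + of_real L) = m s"
    "eventually (\<lambda>s. y s = u (exp (- s)) * exp (- lam * s) * m s) strip_top"
  proof (rule rank_one_expansion[OF L(1) r(1) inv_hol _ yh ev])
    show "1 / B0 0 \<noteq> 0" using B00 by simp
  qed (rule that)
  show thesis using that[OF *[unfolded L(2) y_def]] by blast
qed

subsection \<open>Algebraic functions over holomorphic functions\<close>

text \<open>The holomorphic functions on a connected open set have no zero divisors.\<close>

lemma holomorphic_nonzero_mult:
  assumes "open U" "connected U" "f holomorphic_on U" "g holomorphic_on U"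
    and "a \<in> U" "f a \<noteq> 0" "b \<in> U" "g b \<noteq> 0"
  shows "\<exists>z\<in>U. f z * g z \<noteq> 0"
proof (rule ccontr)
  assume *: "\<not> (\<exists>z\<in>U. f z * g z \<noteq> 0)"
  have "open {z \<in> U. f z \<noteq> 0}"
  proof -
    have "{z \<in> U. f z \<noteq> 0} = U \<inter> f -` (- {0})" by auto
    moreover have "open (U \<inter> f -` (- {0}))"
      by (intro continuous_open_preimage holomorphic_on_imp_continuous_on assms) auto
    ultimately show ?thesis by simp
  qed
  then have "g b = (\<lambda>_. 0) b"
    by (rule analytic_continuation_open[where s' = U]) (use assms * in auto)
  then show False using assms by simp
qed

text \<open>Elimination over the fraction field of the holomorphic functions, with cross
  multiplication by the pivot \<open>M r j0\<close> in place of division; there are more rows than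
  columns, so a nontrivial relation remains.\<close>

lemma holomorphic_dependency:
  fixes M :: "'i \<Rightarrow> 'j \<Rightarrow> complex \<Rightarrow> complex"
  assumes U: "open U" "connected U" "U \<noteq> {}"
  assumes "finite J" "finite I" "card J < card I" "\<And>i j. i \<in> I \<Longrightarrow> j \<in> J \<Longrightarrow> M i j holomorphic_on U"
  shows "\<exists>e. (\<forall>i\<in>I. e i holomorphic_on U) \<and> (\<exists>i\<in>I. \<exists>z\<in>U. e i z \<noteq> 0) \<and> (\<forall>j\<in>J. \<forall>z\<in>U. (\<Sum>i\<in>I. e i z * M i j z) = 0)"
  using assms(4-)
proof (induction J arbitrary: I M rule: finite_induct)
  case empty
  then have "I \<noteq> {}" by auto
  then show ?case using U(3) by (intro exI[of _ "\<lambda>_ _. 1"]) auto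
next
  case (insert j0 J)
  show ?case
  proof (cases "\<exists>i\<in>I. \<exists>z\<in>U. M i j0 z \<noteq> 0")
    case False
    have "\<exists>e. (\<forall>i\<in>I. e i holomorphic_on U) \<and> (\<exists>i\<in>I. \<exists>z\<in>U. e i z \<noteq> 0) \<and> (\<forall>j\<in>J. \<forall>z\<in>U. (\<Sum>i\<in>I. e i z * M i j z) = 0)"
      using insert.prems insert.hyps by (intro insert.IH) auto
    then show ?thesis using False by auto
  next
    case True
    then obtain r a where r: "r \<in> I" "a \<in> U" "M r j0 a \<noteq> 0" by blast
    define I' where "I' = I - {r}"
    have I': "finite I'" "card J < card I'" "I = insert r I'" "r \<notin> I'"
      using insert r by (auto simp: I'_def)
    define M' where "M' i j z = M r j0 z * M i j z - M i j0 z * M r j z" for i j z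
    have "\<exists>e. (\<forall>i\<in>I'. e i holomorphic_on U) \<and> (\<exists>i\<in>I'. \<exists>z\<in>U. e i z \<noteq> 0) \<and> (\<forall>j\<in>J. \<forall>z\<in>U. (\<Sum>i\<in>I'. e i z * M' i j z) = 0)"
    proof (rule insert.IH[OF I'(1,2)])
      fix i j assume "i \<in> I'" "j \<in> J"
      then show "M' i j holomorphic_on U" unfolding M'_def
        using insert.prems(3) I'(3) by (intro holomorphic_intros) auto
    qed
    then obtain e i1 z1 where e: "\<forall>i\<in>I'. e i holomorphic_on U" "i1 \<in> I'" "z1 \<in> U" "e i1 z1 \<noteq> 0"
      "\<forall>j\<in>J. \<forall>z\<in>U. (\<Sum>i\<in>I'. e i z * M' i j z) = 0" by blast
    define e' where "e' i = (if i = r then (\<lambda>z. - (\<Sum>i\<in>I'. e i z * M i j0 z)) else (\<lambda>z. e i z * M r j0 z))" for i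
    have sums: "(\<Sum>i\<in>I. e' i z * M i j z) = (\<Sum>i\<in>I'. e i z * M' i j z)" for j z
    proof -
      have "(\<Sum>i\<in>I. e' i z * M i j z) = e' r z * M r j z + (\<Sum>i\<in>I'. e' i z * M i j z)"
        unfolding I'(3) using I' by simp
      also have "(\<Sum>i\<in>I'. e' i z * M i j z) = (\<Sum>i\<in>I'. e i z * M r j0 z * M i j z)"
        using I'(4) by (intro sum.cong) (auto simp: e'_def)
      also have "e' r z * M r j z = - (\<Sum>i\<in>I'. e i z * M i j0 z * M r j z)"
        by (simp add: e'_def sum_distrib_right)
      finally show ?thesis by (simp add: M'_def algebra_simps sum_subtractf)
    qed
    show ?thesis
    proof (intro exI[of _ e'] conjI ballI)
      fix i assume "i \<in> I"
      then show "e' i holomorphic_on U"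
        using e(1) insert.prems(3) I'(3) by (auto simp: e'_def intro!: holomorphic_intros)
    next
      have "\<exists>z\<in>U. e i1 z * M r j0 z \<noteq> 0"
        using e insert.prems(3) r U by (intro holomorphic_nonzero_mult[of U _ _ z1 a]) auto
      then show "\<exists>i\<in>I. \<exists>z\<in>U. e' i z \<noteq> 0"
        using e(2) I'(3,4) by (intro bexI[of _ i1]) (auto simp: e'_def)
    next
      fix j z assume jz: "j \<in> insert j0 J" "z \<in> U"
      show "(\<Sum>i\<in>I. e' i z * M i j z) = 0"
        unfolding sums using jz e(5) by (cases "j = j0") (auto simp: M'_def)
    qed
  qed
qed

text \<open>The quotient is meromorphic and bounded, so its singularities are removable.\<close>

lemma bounded_quotient_holomorphic:
  assumes U: "open U" "connected U" and N: "N holomorphic_on U" and H: "H holomorphic_on U"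
    and a: "a \<in> U" "H a \<noteq> 0" and bd: "\<And>z. z \<in> U \<Longrightarrow> norm (N z) \<le> M * norm (H z)"
  obtains \<phi> where "\<phi> holomorphic_on U" "\<And>z. z \<in> U \<Longrightarrow> N z = H z * \<phi> z"
proof -
  define q where "q z = N z / H z" for z
  define \<phi> where "\<phi> = remove_sings q"
  have qb: "norm (q z) \<le> \<bar>M\<bar>" if "z \<in> U" for z
  proof (cases "H z = 0")
    case False
    then have "norm (q z) \<le> M" using bd[OF that] by (simp add: q_def norm_divide divide_le_eq)
    then show ?thesis by simp
  qed (simp add: q_def)
  have main: "\<phi> analytic_on {z} \<and> N z = H z * \<phi> z" if z: "z \<in> U" for z
  proof -
    have an: "N analytic_on {z}" "H analytic_on {z}"
      using U N H z by (auto simp: analytic_at)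
    have iso: "isolated_singularity_at q z"
      unfolding q_def using an by (intro isolated_singularity_at_divide isolated_singularity_at_analytic not_essential_analytic) auto
    have ness: "not_essential q z"
      unfolding q_def using an by (intro not_essential_divide isolated_singularity_at_analytic not_essential_analytic) auto
    have ev_U: "eventually (\<lambda>w. w \<in> U) (at z)" using U z by (simp add: eventually_at_in_open')
    have "\<not> is_pole q z"
    proof
      assume "is_pole q z"
      then have "filterlim (\<lambda>w. norm (q w)) at_top (at z)"
        unfolding is_pole_def by (rule filterlim_at_infinity_imp_norm_at_top)
      then have "eventually (\<lambda>w. norm (q w) > \<bar>M\<bar>) (at z)" by (simp add: filterlim_at_top_dense)
      with ev_U have "eventually (\<lambda>w. False) (at z)"
        by eventually_elim (use qb in force)
      then show False by simp
    qed
    then obtain c where c: "q \<midarrow>z\<rightarrow> c" using ness by (auto simp: not_essential_def)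
    have \<phi>an: "\<phi> analytic_on {z}" unfolding \<phi>_def by (rule remove_sings_analytic_at[OF iso c])
    have "eventually (\<lambda>w. H w \<noteq> 0) (at z)"
    proof (cases "H z = 0")
      case True
      obtain r where "0 < r" "\<And>w. w \<in> ball z r - {z} \<Longrightarrow> H w \<noteq> 0"
        by (rule isolated_zeros[OF H U z True a]) blast
      then show ?thesis unfolding eventually_at by (intro exI[of _ r]) (auto simp: dist_commute)
    next
      case False
      have "isCont H z" using an(2) by (simp add: analytic_at_imp_isCont)
      then have "(H \<longlongrightarrow> H z) (at z)" by (simp add: isCont_def)
      then show ?thesis using False by (rule tendsto_imp_eventually_ne)
    qed
    moreover have "eventually (\<lambda>w. \<phi> w = q w) (at z)"
      unfolding \<phi>_def by (rule eventually_remove_sings_eq_at[OF iso])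
    ultimately have "eventually (\<lambda>w. N w = H w * \<phi> w) (at z)"
      by eventually_elim (simp add: q_def)
    moreover have "(N \<longlongrightarrow> N z) (at z)" "((\<lambda>w. H w * \<phi> w) \<longlongrightarrow> H z * \<phi> z) (at z)"
      using an \<phi>an by (auto intro!: tendsto_mult simp: analytic_at_imp_isCont isCont_def[symmetric])
    ultimately have "N z = H z * \<phi> z"
      by (intro tendsto_unique[OF at_neq_bot _ \<open>((\<lambda>w. H w * \<phi> w) \<longlongrightarrow> H z * \<phi> z) (at z)\<close>])
         (rule Lim_transform_eventually)
    then show ?thesis using \<phi>an by blast
  qed
  show thesis
  proof (rule that)
    show "\<phi> holomorphic_on U"
      using main by (intro analytic_imp_holomorphic) (auto simp: analytic_on_analytic_at[of _ U])
  qed (use main in blast)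
qed

lemma poly_sum_le: "degree p \<le> d \<Longrightarrow> poly p x = (\<Sum>i\<le>d. Polynomial.coeff p i * x ^ i)"
  for x :: "'a::comm_semiring_1"
  unfolding poly_altdef by (rule sum.mono_neutral_left) (auto simp: coeff_eq_0)

text \<open>Holomorphic implicit functions by the contraction \<open>X \<mapsto> X - Q(z, X) / Q\<^sub>X(z\<^sub>1, \<alpha>)\<close>.\<close>

lemma implicit_holomorphic:
  fixes Q :: "complex \<Rightarrow> complex poly"
  assumes r: "r > 0" and hol: "\<And>i. (\<lambda>z. Polynomial.coeff (Q z) i) holomorphic_on ball z1 r"
    and deg: "\<And>z. z \<in> ball z1 r \<Longrightarrow> degree (Q z) \<le> d"
    and root: "poly (Q z1) \<alpha> = 0" "poly (pderiv (Q z1)) \<alpha> \<noteq> 0"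
  obtains \<rho> r1 \<epsilon> where "r1 > 0" "r1 \<le> r" "\<epsilon> > 0" "\<rho> holomorphic_on ball z1 r1"
    "\<And>z X. z \<in> ball z1 r1 \<Longrightarrow> X \<in> cball \<alpha> \<epsilon> \<Longrightarrow> poly (Q z) X = 0 \<Longrightarrow> X = \<rho> z"
proof -
  define b where "b = poly (pderiv (Q z1)) \<alpha>"
  have b: "b \<noteq> 0" using root by (simp add: b_def)
  have Qe: "poly (Q z) X = (\<Sum>i\<le>d. Polynomial.coeff (Q z) i * X ^ i)" if "z \<in> ball z1 r" for z X
    using deg[OF that] by (rule poly_sum_le)
  have Q'e: "poly (pderiv (Q z)) X = (\<Sum>i\<le>d. of_nat (Suc i) * Polynomial.coeff (Q z) (Suc i) * X ^ i)" if "z \<in> ball z1 r" for z X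
  proof -
    have "degree (pderiv (Q z)) \<le> d" using deg[OF that] by (simp add: degree_pderiv)
    then show ?thesis by (simp add: poly_sum_le[of _ d] coeff_pderiv)
  qed
  have cont: "continuous_on (ball z1 r \<times> UNIV) (\<lambda>p. poly (pderiv (Q (fst p))) (snd p))"
  proof -
    have "continuous_on (ball z1 r \<times> UNIV) (\<lambda>p. \<Sum>i\<le>d. of_nat (Suc i) * Polynomial.coeff (Q (fst p)) (Suc i) * snd p ^ i)"
      by (intro continuous_intros continuous_on_compose2[OF holomorphic_on_imp_continuous_on[OF hol]]) auto
    then show ?thesis by (rule continuous_on_eq) (auto simp: Q'e)
  qed
  then have "isCont (\<lambda>p. poly (pderiv (Q (fst p))) (snd p)) (z1, \<alpha>)"
    using r by (subst (asm) continuous_on_eq_continuous_at) (auto intro: open_Times)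
  then obtain \<delta> where \<delta>: "\<delta> > 0" "\<And>p. dist p (z1, \<alpha>) < \<delta> \<Longrightarrow> dist (poly (pderiv (Q (fst p))) (snd p)) b < norm b / 2"
  proof -
    assume "isCont (\<lambda>p. poly (pderiv (Q (fst p))) (snd p)) (z1, \<alpha>)"
    then have "\<forall>e>0. \<exists>d>0. \<forall>p. dist p (z1, \<alpha>) < d \<longrightarrow> dist (poly (pderiv (Q (fst p))) (snd p)) b < e"
      unfolding continuous_at_eps_delta b_def by simp
    moreover have "norm b / 2 > 0" using b by simp
    ultimately obtain d where "d > 0" "\<forall>p. dist p (z1, \<alpha>) < d \<longrightarrow> dist (poly (pderiv (Q (fst p))) (snd p)) b < norm b / 2"
      by blast
    then show thesis using that by blast
  qed
  \<comment> \<open>A third of \<delta> for \<open>X\<close> and, through \<open>r1\<close>, a third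
    for \<open>z\<close>: together still less than \<delta>.\<close>
  define \<epsilon> where "\<epsilon> = \<delta> / 3"
  have \<epsilon>: "\<epsilon> > 0" using \<delta> by (simp add: \<epsilon>_def)
  have "continuous_on (ball z1 r) (\<lambda>z. poly (Q z) \<alpha>)"
  proof -
    have "continuous_on (ball z1 r) (\<lambda>z. \<Sum>i\<le>d. Polynomial.coeff (Q z) i * \<alpha> ^ i)"
      by (intro continuous_intros holomorphic_on_imp_continuous_on[OF hol])
    then show ?thesis by (rule continuous_on_eq) (auto simp: Qe)
  qed
  then have "isCont (\<lambda>z. poly (Q z) \<alpha>) z1" using r by (auto simp: continuous_on_eq_continuous_at)
  then obtain \<delta>2 where \<delta>2: "\<delta>2 > 0" "\<And>z. dist z z1 < \<delta>2 \<Longrightarrow> norm (poly (Q z) \<alpha>) < \<epsilon> / 2 * norm b"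
  proof -
    have "\<epsilon> / 2 * norm b > 0" using \<epsilon> b by simp
    moreover have "\<forall>e>0. \<exists>d>0. \<forall>z. dist z z1 < d \<longrightarrow> norm (poly (Q z) \<alpha>) < e"
      using \<open>isCont (\<lambda>z. poly (Q z) \<alpha>) z1\<close> root(1) unfolding continuous_at_eps_delta by simp
    ultimately obtain d where "d > 0" "\<forall>z. dist z z1 < d \<longrightarrow> norm (poly (Q z) \<alpha>) < \<epsilon> / 2 * norm b" by blast
    then show thesis using that by blast
  qed
  define r1 where "r1 = Min {r, \<delta> / 3, \<delta>2}"
  have r1: "r1 > 0" "r1 \<le> r" "r1 \<le> \<delta> / 3" "r1 \<le> \<delta>2" using r \<delta> \<delta>2 by (auto simp: r1_def)
  define T where "T z X = X - poly (Q z) X / b" for z X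
  have inr: "z \<in> ball z1 r" if "z \<in> ball z1 r1" for z using that r1 by auto
  \<comment> \<open>The derivative of \<open>T z\<close> is at most 1/2 in modulus, since the
    derivative of \<open>Q z\<close> stays within \<open>norm b / 2\<close> of
    \<open>b\<close>.\<close>
  have T_lip: "norm (T z X - T z Y) \<le> 1 / 2 * norm (X - Y)"
    if z: "z \<in> ball z1 r1" and XY: "X \<in> cball \<alpha> \<epsilon>" "Y \<in> cball \<alpha> \<epsilon>" for z X Y
  proof (rule field_differentiable_bound[of "cball \<alpha> \<epsilon>" "T z" "\<lambda>X. 1 - poly (pderiv (Q z)) X / b"])
    fix X assume X: "X \<in> cball \<alpha> \<epsilon>"
    show "(T z has_field_derivative 1 - poly (pderiv (Q z)) X / b) (at X within cball \<alpha> \<epsilon>)"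
      unfolding T_def using b by (auto intro!: derivative_eq_intros)
    have "dist (z, X) (z1, \<alpha>) \<le> dist z z1 + dist X \<alpha>" by (simp add: dist_Pair_Pair sqrt_sum_squares_le_sum)
    also have "\<dots> < \<delta>" using z X r1 \<epsilon> by (auto simp: \<epsilon>_def dist_commute)
    finally have "norm (poly (pderiv (Q z)) X - b) < norm b / 2" using \<delta>(2) by (force simp: dist_norm)
    then have "norm ((b - poly (pderiv (Q z)) X) / b) \<le> 1 / 2"
      using b by (simp add: norm_divide norm_minus_commute divide_le_eq)
    then show "norm (1 - poly (pderiv (Q z)) X / b) \<le> 1 / 2" using b by (simp add: diff_divide_distrib)
  qed (use XY in auto)
  have T_\<alpha>: "norm (T z \<alpha> - \<alpha>) \<le> \<epsilon> / 2" if "z \<in> ball z1 r1" for z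
  proof -
    have "dist z z1 < \<delta>2" using that r1 by (simp add: dist_commute)
    from \<delta>2(2)[OF this] show ?thesis using b by (simp add: T_def norm_divide divide_le_eq)
  qed
  have T_ball: "T z X \<in> cball \<alpha> \<epsilon>" if z: "z \<in> ball z1 r1" and X: "X \<in> cball \<alpha> \<epsilon>" for z X
  proof -
    have "norm (T z X - \<alpha>) \<le> norm (T z X - T z \<alpha>) + norm (T z \<alpha> - \<alpha>)" 
      using norm_triangle_ineq[of "T z X - T z \<alpha>" "T z \<alpha> - \<alpha>"] by simp
    also have "\<dots> \<le> 1 / 2 * norm (X - \<alpha>) + \<epsilon> / 2"
      using T_lip[OF z X, of \<alpha>] T_\<alpha>[OF z] \<epsilon> by (intro add_mono) auto
    also have "\<dots> \<le> \<epsilon>" using X by (simp add: dist_norm norm_minus_commute)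
    finally show ?thesis by (simp add: dist_norm norm_minus_commute)
  qed
  define \<rho>k where "\<rho>k k z = (T z ^^ k) \<alpha>" for k z
  have \<rho>k_ball: "\<rho>k k z \<in> cball \<alpha> \<epsilon>" if "z \<in> ball z1 r1" for k z
    by (induction k) (use \<epsilon> T_ball that in \<open>auto simp: \<rho>k_def\<close>)
  have \<rho>k_Suc: "\<rho>k (Suc k) z = T z (\<rho>k k z)" for k z by (simp add: \<rho>k_def)
  have \<rho>k_diff: "norm (\<rho>k (Suc k) z - \<rho>k k z) \<le> \<epsilon> * (1 / 2) ^ k" if z: "z \<in> ball z1 r1" for k z
  proof (induction k)
    case 0
    show ?case using T_\<alpha>[OF z] \<epsilon> by (simp add: \<rho>k_def)
  next
    case (Suc k)
    have "norm (\<rho>k (Suc (Suc k)) z - \<rho>k (Suc k) z) \<le> 1 / 2 * norm (\<rho>k (Suc k) z - \<rho>k k z)"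
      unfolding \<rho>k_Suc[of "Suc k"] by (subst (2) \<rho>k_Suc) (intro T_lip z \<rho>k_ball)
    then show ?case using Suc by simp
  qed
  have hol_\<rho>k: "\<rho>k k holomorphic_on ball z1 r1" for k
  proof (induction k)
    case 0
    have "\<rho>k 0 = (\<lambda>_. \<alpha>)" by (auto simp: \<rho>k_def)
    then show ?case by simp
  next
    case (Suc k)
    have "(\<lambda>z. \<rho>k k z - (\<Sum>i\<le>d. Polynomial.coeff (Q z) i * \<rho>k k z ^ i) / b) holomorphic_on ball z1 r1"
      using b r1 by (intro holomorphic_intros Suc holomorphic_on_subset[OF hol]) auto
    then show ?case
      by (rule holomorphic_transform) (simp only: \<rho>k_Suc T_def Qe[OF inr])
  qed
  define \<rho> where "\<rho> z = \<alpha> + (\<Sum>k. \<rho>k (Suc k) z - \<rho>k k z)" for z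
  have tel: "\<alpha> + (\<Sum>k<n. \<rho>k (Suc k) z - \<rho>k k z) = \<rho>k n z" for n z
  proof (induction n)
    case (Suc n)
    then show ?case by (simp only: sum.lessThan_Suc) (simp add: algebra_simps)
  qed (simp add: \<rho>k_def)
  have "uniform_limit (ball z1 r1) (\<lambda>n z. \<Sum>k<n. \<rho>k (Suc k) z - \<rho>k k z) (\<lambda>z. \<Sum>k. \<rho>k (Suc k) z - \<rho>k k z) sequentially"
    by (rule Weierstrass_m_test[where M = "\<lambda>k. \<epsilon> * (1 / 2) ^ k"]) (use \<rho>k_diff in \<open>auto intro: summable_mult summable_geometric\<close>)
  then have "uniform_limit (ball z1 r1) (\<lambda>n z. \<alpha> + (\<Sum>k<n. \<rho>k (Suc k) z - \<rho>k k z)) \<rho> sequentially"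
    unfolding \<rho>_def by (intro uniform_limit_intros)
  then have ul: "uniform_limit (ball z1 r1) \<rho>k \<rho> sequentially" by (simp only: tel)
  have hol_\<rho>: "\<rho> holomorphic_on ball z1 r1"
  proof (rule holomorphic_uniform_sequence[OF _ hol_\<rho>k])
    fix x assume "x \<in> ball z1 r1"
    then obtain e where "e > 0" "cball x e \<subseteq> ball z1 r1" by (meson open_ball open_contains_cball)
    then show "\<exists>d>0. cball x d \<subseteq> ball z1 r1 \<and> uniform_limit (cball x d) \<rho>k \<rho> sequentially"
      using uniform_limit_on_subset[OF ul] by blast
  qed auto
  show thesis
  proof (rule that[OF r1(1,2) \<epsilon> hol_\<rho>])
    fix z X assume z: "z \<in> ball z1 r1" and X: "X \<in> cball \<alpha> \<epsilon>" "poly (Q z) X = 0"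
    have lim: "(\<lambda>n. \<rho>k n z) \<longlonglongrightarrow> \<rho> z" using tendsto_uniform_limitI[OF ul z] .
    have \<rho>b: "\<rho> z \<in> cball \<alpha> \<epsilon>"
      using closed_sequentially[OF closed_cball _ lim] \<rho>k_ball[OF z] by blast
    have "(\<lambda>n. \<rho>k (Suc n) z) \<longlonglongrightarrow> \<rho> z" using lim by (rule LIMSEQ_Suc)
    moreover have "(\<lambda>n. \<rho>k (Suc n) z) \<longlonglongrightarrow> T z (\<rho> z)"
      unfolding \<rho>k_Suc T_def using b by (intro tendsto_intros lim) 
    ultimately have fixp: "T z (\<rho> z) = \<rho> z" by (metis LIMSEQ_unique)
    have "T z X = X" using X by (simp add: T_def)
    then have "norm (X - \<rho> z) \<le> 1 / 2 * norm (X - \<rho> z)" using T_lip[OF z X(1) \<rho>b] by (simp only: fixp)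
    then show "X = \<rho> z" by simp
  qed
qed

text \<open>A function vanishing on the part of the line inside the ball has zeros accumulating at
  the centre, so it would vanish identically.\<close>

lemma line_nonzero:
  assumes e: "e holomorphic_on ball z0 r" and "Im z0 = c" "a \<in> ball z0 r" "e a \<noteq> 0"
  shows "\<exists>z1\<in>ball z0 r. Im z1 = c \<and> e z1 \<noteq> 0"
proof (rule ccontr)
  assume "\<not> ?thesis"
  then have *: "e z = 0" if "z \<in> ball z0 r" "Im z = c" for z using that by blast
  have r: "r > 0" using assms(3) by (metis ball_eq_empty empty_iff not_le)
  define V where "V = {z \<in> ball z0 r. Im z = c}"
  have lim: "z0 islimpt V" unfolding islimpt_approachable
  proof (intro allI impI)
    fix d :: real assume d: "d > 0"
    define m where "m = min (d / 2) (r / 2)"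
    have m: "m > 0" "m < d" "m < r" using d r by (auto simp: m_def)
    show "\<exists>x'\<in>V. x' \<noteq> z0 \<and> dist x' z0 < d"
      using m assms(2) by (intro bexI[of _ "z0 + of_real m"]) (auto simp: V_def dist_norm)
  qed
  have "e a = 0"
    by (rule analytic_continuation[OF e open_ball connected_ball, of V z0 a])
       (use lim assms(3) r * in \<open>auto simp: V_def\<close>)
  then show False using assms by simp
qed

lemma monic_root_bound:
  fixes x :: complex
  assumes "d \<ge> 1" "x ^ d = (\<Sum>i<d. a i * x ^ i)"
  shows "norm x \<le> 1 + (\<Sum>i<d. norm (a i))"
proof (cases "norm x \<le> 1")
  case True
  then show ?thesis by (simp add: add_increasing2 sum_nonneg)
next
  case False
  have "norm x ^ d \<le> (\<Sum>i<d. norm (a i) * norm x ^ i)"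
    using norm_sum[of "\<lambda>i. a i * x ^ i" "{..<d}"] by (simp add: assms(2)[symmetric] norm_mult norm_power)
  also have "\<dots> \<le> (\<Sum>i<d. norm (a i) * norm x ^ (d - 1))"
    using False by (intro sum_mono mult_left_mono power_increasing) auto
  also have "\<dots> = (\<Sum>i<d. norm (a i)) * norm x ^ (d - 1)" by (simp add: sum_distrib_right)
  finally have "norm x * norm x ^ (d - 1) \<le> (\<Sum>i<d. norm (a i)) * norm x ^ (d - 1)"
    using assms(1) by (simp flip: power_Suc)
  moreover have "norm x ^ (d - 1) > 0" using False by (intro zero_less_power) linarith
  ultimately have "norm x \<le> (\<Sum>i<d. norm (a i))" by (metis mult_le_cancel_right_pos)
  then show ?thesis by simp
qed

text \<open>An integral element \<open>\<phi>\<close> over the holomorphic functions near a boundary line: after replacing its equation by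
  the last derivative \<open>Q\<close> that still vanishes at \<open>\<phi>\<close>, the element \<open>E = Q\<^sub>X(z, \<phi>)\<close> is not zero and again algebraic, so
  it stays away from \<open>0\<close> near almost all boundary points, where \<open>\<phi>\<close> is then given by the implicit function theorem.\<close>

lemma monic_extension:
  fixes a :: "nat \<Rightarrow> complex \<Rightarrow> complex"
  assumes r: "r > 0" and c: "Im z0 = c" and d: "d \<ge> 1"
    and a: "\<And>i. i < d \<Longrightarrow> a i holomorphic_on ball z0 r"
    and bd: "\<And>i z. i < d \<Longrightarrow> z \<in> ball z0 r \<Longrightarrow> norm (a i z) \<le> K"
    and \<phi>: "\<phi> holomorphic_on (ball z0 r \<inter> {z. Im z < c})"
    and eq: "\<And>z. z \<in> ball z0 r \<Longrightarrow> Im z < c \<Longrightarrow> \<phi> z ^ d = (\<Sum>i<d. a i z * \<phi> z ^ i)"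
  obtains z1 r1 \<rho> where "Im z1 = c" "r1 > 0" "ball z1 r1 \<subseteq> ball z0 r" "\<rho> holomorphic_on ball z1 r1"
    "\<And>z. z \<in> ball z1 r1 \<Longrightarrow> Im z < c \<Longrightarrow> \<phi> z = \<rho> z"
proof -
  define B where "B = ball z0 r"
  define S where "S = B \<inter> {z. Im z < c}"
  have hp: "open {z. Im z < c}" "convex {z. Im z < c}" by (auto simp: open_halfspace_Im_lt convex_halfspace_Im_lt)
  have B: "open B" "connected B" "B \<noteq> {}" "convex B" using r by (auto simp: B_def)
  have S: "open S" "convex S" using B hp by (auto simp: S_def intro: convex_Int)
  have Scon: "connected S" using S(2) convex_connected by blast
  have SB: "S \<subseteq> B" by (auto simp: S_def)
  have \<phi>S: "\<phi> holomorphic_on S" using \<phi> by (simp add: S_def B_def)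
  have eqS: "\<phi> z ^ d = (\<Sum>i<d. a i z * \<phi> z ^ i)" if "z \<in> S" for z using eq that by (auto simp: S_def B_def)
  have aB: "a i holomorphic_on B" if "i < d" for i using a that by (simp add: B_def)
  define M where "M = 1 + real d * K"
  have \<phi>M: "norm (\<phi> z) \<le> M" if "z \<in> S" for z
  proof -
    have "norm (\<phi> z) \<le> 1 + (\<Sum>i<d. norm (a i z))" by (rule monic_root_bound[OF d eqS[OF that]])
    also have "\<dots> \<le> 1 + (\<Sum>i<d. K)" using bd that by (intro add_left_mono sum_mono) (auto simp: S_def B_def)
    finally show ?thesis by (simp add: M_def)
  qed
  define p where "p z = Polynomial.monom 1 d - (\<Sum>i<d. Polynomial.monom (a i z) i)" for z
  have cp: "Polynomial.coeff (p z) i = (if i = d then 1 else if i < d then - a i z else 0)" for z i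
    by (auto simp: p_def coeff_sum)
  have degp: "degree (p z) = d" for z
  proof (rule antisym)
    show "degree (p z) \<le> d" by (rule degree_le) (simp add: cp)
    show "d \<le> degree (p z)" by (rule le_degree) (simp add: cp)
  qed
  have pp: "poly (p z) x = x ^ d - (\<Sum>i<d. a i z * x ^ i)" for z x
    by (simp add: p_def poly_monom poly_sum)
  define P where "P k z = (pderiv ^^ k) (p z)" for k z
  have degP: "degree (P k z) \<le> d" for k z
    using degp[of z] by (simp add: P_def degree_higher_pderiv)
  have cP: "(\<lambda>z. Polynomial.coeff (P k z) i) holomorphic_on B" for k i
  proof -
    have "(\<lambda>z. Polynomial.coeff (p z) j) holomorphic_on B" for j
      unfolding cp by (cases "j = d"; cases "j < d") (auto intro!: holomorphic_intros aB)
    then show ?thesis unfolding P_def coeff_higher_pderiv by (intro holomorphic_intros)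
  qed
  have P0: "poly (P 0 z) (\<phi> z) = 0" if "z \<in> S" for z
    using eqS[OF that] by (simp add: P_def pp)
  \<comment> \<open>\<open>bad k\<close> says that the \<open>k\<close>-th derivative of the
    equation does not vanish identically at \<phi>. It fails for 0 and holds for \<open>d\<close>,
    where the derivative is a nonzero constant.\<close>
  define bad where "bad k \<longleftrightarrow> (\<exists>z\<in>S. poly (P k z) (\<phi> z) \<noteq> 0)" for k
  have Sne: "S \<noteq> {}"
  proof -
    have "z0 - \<i> * of_real (r / 2) \<in> S" using r c by (auto simp: S_def B_def dist_norm norm_mult)
    then show ?thesis by blast
  qed
  have "bad d"
  proof -
    have "degree (P d z) = 0" for z using degp[of z] by (simp add: P_def degree_higher_pderiv)
    then have "poly (P d z) x = Polynomial.coeff (P d z) 0" for z x using poly_sum_le[of "P d z" 0 x] by simp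
    moreover have "Polynomial.coeff (P d z) 0 \<noteq> 0" for z
      by (simp add: P_def coeff_higher_pderiv cp pochhammer_fact[symmetric])
    ultimately show ?thesis using Sne unfolding bad_def by auto
  qed
  then have LB: "bad (LEAST k. bad k)" by (rule LeastI)
  define k where "k = (LEAST k. bad k)"
  have "\<not> bad 0" using P0 by (simp add: bad_def)
  then have "k \<noteq> 0" using LB unfolding k_def[symmetric] by (intro notI) simp
  then obtain k' where k': "k = Suc k'" by (cases k) auto
  define Q where "Q = P k'"
  have Q0: "poly (Q z) (\<phi> z) = 0" if "z \<in> S" for z
  proof -
    have "k' < (LEAST k. bad k)" using k' by (simp add: k_def)
    then have "\<not> bad k'" by (rule not_less_Least)
    then show ?thesis using that by (simp add: bad_def Q_def)
  qed
  define E where "E z = poly (pderiv (Q z)) (\<phi> z)" for z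
  have E_P: "E z = poly (P k z) (\<phi> z)" for z by (simp add: E_def Q_def k' P_def)
  have "bad k" using LB by (simp add: k_def)
  then obtain s where s: "s \<in> S" "E s \<noteq> 0" using E_P by (auto simp: bad_def)
  have E_sum: "E z = (\<Sum>i\<le>d. Polynomial.coeff (P k z) i * \<phi> z ^ i)" for z
    unfolding E_P by (rule poly_sum_le[OF degP])
  have E_hol: "E holomorphic_on S" unfolding E_sum
    by (intro holomorphic_intros \<phi>S holomorphic_on_subset[OF cP SB])
  \<comment> \<open>The module over the holomorphic functions on \<open>B\<close> generated by the
    powers of \<phi> below \<open>d\<close>. The monic equation makes it closed under multiplication
    by \<phi>, so it contains all powers of \<open>E\<close>, and \<open>d + 1\<close> of them are
    dependent.\<close>
  define span where "span u \<longleftrightarrow> (\<exists>m. (\<forall>j<d. m j holomorphic_on B) \<and> (\<forall>z\<in>S. u z = (\<Sum>j<d. m j z * \<phi> z ^ j)))" for u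
  have span_add: "span (\<lambda>z. u z + v z)" if uv: "span u" "span v" for u v
  proof -
    obtain m n where "\<forall>j<d. m j holomorphic_on B" "\<forall>z\<in>S. u z = (\<Sum>j<d. m j z * \<phi> z ^ j)"
      "\<forall>j<d. n j holomorphic_on B" "\<forall>z\<in>S. v z = (\<Sum>j<d. n j z * \<phi> z ^ j)" using uv unfolding span_def by blast
    then show ?thesis unfolding span_def
      by (intro exI[of _ "\<lambda>j z. m j z + n j z"]) (auto intro!: holomorphic_intros simp: distrib_right sum.distrib)
  qed
  have span_mult: "span (\<lambda>z. h z * u z)" if uh: "span u" "h holomorphic_on B" for u h
  proof -
    obtain m where "\<forall>j<d. m j holomorphic_on B" "\<forall>z\<in>S. u z = (\<Sum>j<d. m j z * \<phi> z ^ j)" using uh unfolding span_def by blast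
    then show ?thesis unfolding span_def using uh(2)
      by (intro exI[of _ "\<lambda>j z. h z * m j z"]) (auto intro!: holomorphic_intros simp: sum_distrib_left mult.assoc)
  qed
  have span_\<phi>: "span (\<lambda>z. \<phi> z * u z)" if su: "span u" for u
  proof -
    obtain m where m: "\<forall>j<d. m j holomorphic_on B" "\<forall>z\<in>S. u z = (\<Sum>j<d. m j z * \<phi> z ^ j)" using su unfolding span_def by blast
    define n where "n j z = (if j = 0 then 0 else m (j - 1) z) + m (d - 1) z * a j z" for j z
    show ?thesis unfolding span_def
    proof (intro exI[of _ n] conjI allI impI ballI)
      fix j assume "j < d"
      then show "n j holomorphic_on B" unfolding n_def using m(1) aB d
        by (cases "j = 0") (auto intro!: holomorphic_intros)
    next
      fix z assume z: "z \<in> S"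
      obtain d' where d': "d = Suc d'" using d by (cases d) auto
      have "\<phi> z * u z = (\<Sum>j<d. m j z * \<phi> z ^ Suc j)" using m(2) z by (simp add: sum_distrib_left mult_ac)
      also have "\<dots> = (\<Sum>j<d'. m j z * \<phi> z ^ Suc j) + m d' z * (\<Sum>i<d. a i z * \<phi> z ^ i)"
        using eqS[OF z] by (simp add: d')
      also have "(\<Sum>j<d'. m j z * \<phi> z ^ Suc j) = (\<Sum>j<d. (if j = 0 then 0 else m (j - 1) z) * \<phi> z ^ j)"
        unfolding d' sum.lessThan_Suc_shift by simp
      also have "m d' z * (\<Sum>i<d. a i z * \<phi> z ^ i) = (\<Sum>i<d. m (d - 1) z * a i z * \<phi> z ^ i)"
        by (simp only: sum_distrib_left mult.assoc) (simp add: d')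
      finally show "\<phi> z * u z = (\<Sum>j<d. n j z * \<phi> z ^ j)"
        unfolding n_def by (simp only: distrib_right sum.distrib)
    qed
  qed
  have span_\<phi>pow: "span (\<lambda>z. \<phi> z ^ i * u z)" if "span u" for u i
    by (induction i) (use that span_\<phi> in \<open>auto simp: mult.assoc\<close>)
  have span_0: "span (\<lambda>_. 0)" unfolding span_def by (intro exI[of _ "\<lambda>_ _. 0"]) auto
  have span_sum: "span (\<lambda>z. \<Sum>i\<in>I. u i z)" if "finite I" "\<And>i. i \<in> I \<Longrightarrow> span (u i)" for I :: "nat set" and u
    using that by (induction I rule: finite_induct) (auto intro: span_0 span_add)
  have span_E: "span (\<lambda>z. E z * u z)" if "span u" for u
    unfolding E_sum sum_distrib_right mult.assoc by (intro span_sum span_mult span_\<phi>pow that cP) auto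
  have span_1: "span (\<lambda>_. 1)"
    unfolding span_def
  proof (intro exI[of _ "\<lambda>j _. if j = 0 then 1 else 0"] conjI allI impI ballI)
    fix z
    have "(\<Sum>j<d. (if j = 0 then 1 else 0) * \<phi> z ^ j) = (\<Sum>j<d. if j = 0 then 1 else 0)" by (intro sum.cong) auto
    then show "1 = (\<Sum>j<d. (if j = 0 then 1 else 0) * \<phi> z ^ j)" using d by simp
  qed auto
  have "span (\<lambda>z. E z ^ i)" for i
    by (induction i) (use span_1 span_E in auto)
  then have "\<forall>i. \<exists>m. (\<forall>j<d. m j holomorphic_on B) \<and> (\<forall>z\<in>S. E z ^ i = (\<Sum>j<d. m j z * \<phi> z ^ j))"
    unfolding span_def by blast
  from choice[OF this] obtain m where m: "\<forall>i. (\<forall>j<d. m i j holomorphic_on B) \<and> (\<forall>z\<in>S. E z ^ i = (\<Sum>j<d. m i j z * \<phi> z ^ j))" ..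
  have "\<exists>e. (\<forall>i\<in>{..d}. e i holomorphic_on B) \<and> (\<exists>i\<in>{..d}. \<exists>z\<in>B. e i z \<noteq> 0) \<and> (\<forall>j\<in>{..<d}. \<forall>z\<in>B. (\<Sum>i\<in>{..d}. e i z * m i j z) = 0)"
    by (rule holomorphic_dependency[OF B(1-3)]) (use m in auto)
  then obtain e where e: "\<forall>i\<in>{..d}. e i holomorphic_on B" "\<exists>i\<le>d. \<exists>z\<in>B. e i z \<noteq> 0"
    "\<forall>j\<in>{..<d}. \<forall>z\<in>B. (\<Sum>i\<in>{..d}. e i z * m i j z) = 0" by auto
  have eE: "(\<Sum>i\<le>d. e i z * E z ^ i) = 0" if "z \<in> S" for z
  proof -
    have "(\<Sum>i\<le>d. e i z * E z ^ i) = (\<Sum>i\<le>d. \<Sum>j<d. e i z * m i j z * \<phi> z ^ j)"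
      using m that by (simp add: sum_distrib_left mult.assoc)
    also have "\<dots> = (\<Sum>j<d. (\<Sum>i\<le>d. e i z * m i j z) * \<phi> z ^ j)"
      by (subst sum.swap) (simp add: sum_distrib_right)
    also have "\<dots> = 0" using e(3) that SB by auto
    finally show ?thesis .
  qed
  define nz where "nz i \<longleftrightarrow> i \<le> d \<and> (\<exists>z\<in>B. e i z \<noteq> 0)" for i
  define i0 where "i0 = (LEAST i. nz i)"
  have "\<exists>i. nz i" using e(2) by (auto simp: nz_def)
  then have "nz i0" unfolding i0_def by (rule LeastI_ex)
  have i0: "i0 \<le> d" "\<exists>z\<in>B. e i0 z \<noteq> 0" using \<open>nz i0\<close> by (auto simp: nz_def)
  have i0_least: "e i z = 0" if "i < i0" "z \<in> B" for i z
  proof -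
    have "\<not> nz i" using not_less_Least[of i nz] that(1) by (simp add: i0_def)
    then show ?thesis using that i0(1) by (auto simp: nz_def)
  qed
  \<comment> \<open>The relation divided by the largest power of \<open>E\<close> that it contains;
    its constant coefficient \<open>e i0\<close> is not identically zero.\<close>
  define g where "g z = (\<Sum>i\<in>{i0..d}. e i z * E z ^ (i - i0))" for z
  have eS: "e i holomorphic_on S" if "i \<le> d" for i using e(1) that holomorphic_on_subset[OF _ SB] by auto
  have g0: "g z = 0" if z: "z \<in> S" for z
  proof (rule ccontr)
    assume nzg: "g z \<noteq> 0"
    have "\<exists>z\<in>S. E z ^ i0 * g z \<noteq> 0"
    proof (rule holomorphic_nonzero_mult[OF S(1) Scon])
      show "(\<lambda>z. E z ^ i0) holomorphic_on S" by (intro holomorphic_intros E_hol)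
      show "g holomorphic_on S" unfolding g_def by (intro holomorphic_intros E_hol eS) auto
    qed (use s z nzg in auto)
    moreover have "E z ^ i0 * g z = 0" if "z \<in> S" for z
    proof -
      have "(\<Sum>i\<le>d. e i z * E z ^ i) = (\<Sum>i\<in>{i0..d}. e i z * E z ^ i)"
        using i0_least that SB by (intro sum.mono_neutral_right) auto
      also have "\<dots> = E z ^ i0 * g z" unfolding g_def sum_distrib_left
        by (intro sum.cong) (auto simp: mult_ac simp flip: power_add)
      finally show ?thesis using eE[OF that] by simp
    qed
    ultimately show False by blast
  qed
  obtain zz where "zz \<in> B" "e i0 zz \<noteq> 0" using i0(2) by blast
  then obtain z1 where z1: "z1 \<in> B" "Im z1 = c" "e i0 z1 \<noteq> 0"
    using line_nonzero[of "e i0" z0 r c zz] e(1) i0(1) c unfolding B_def by auto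
  obtain r2 where r2: "r2 > 0" "cball z1 r2 \<subseteq> B" using B(1) z1(1) open_contains_cball by blast
  have "\<exists>C. \<forall>z\<in>cball z1 r2. norm (f z) \<le> C" if "f holomorphic_on B" for f
  proof -
    have "compact (f ` cball z1 r2)"
      by (intro compact_continuous_image holomorphic_on_imp_continuous_on holomorphic_on_subset[OF that r2(2)]) auto
    then show ?thesis by (meson bounded_iff compact_imp_bounded imageI)
  qed
  note bdd = this
  have "\<forall>i. \<exists>C. i \<le> d \<longrightarrow> (\<forall>z\<in>cball z1 r2. norm (e i z) \<le> C)" using bdd e(1) by auto
  from choice[OF this] obtain Ce where Ce: "\<forall>i. i \<le> d \<longrightarrow> (\<forall>z\<in>cball z1 r2. norm (e i z) \<le> Ce i)" ..
  have "\<forall>i. \<exists>C. \<forall>z\<in>cball z1 r2. norm (Polynomial.coeff (P k z) i) \<le> C" using bdd[OF cP] by blast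
  from choice[OF this] obtain CP where CP: "\<forall>i. \<forall>z\<in>cball z1 r2. norm (Polynomial.coeff (P k z) i) \<le> CP i" ..
  define ME where "ME = (\<Sum>i\<le>d. CP i * M ^ i)"
  have EM: "norm (E z) \<le> ME" if "z \<in> S" "z \<in> cball z1 r2" for z
    unfolding E_sum ME_def
  proof (intro sum_norm_le)
    fix i
    have "norm (Polynomial.coeff (P k z) i) * norm (\<phi> z) ^ i \<le> CP i * M ^ i"
    proof (intro mult_mono power_mono)
      show c: "norm (Polynomial.coeff (P k z) i) \<le> CP i" using CP that by blast
      show "0 \<le> CP i" using norm_ge_zero c by (rule order_trans)
    qed (use \<phi>M[OF that(1)] in auto)
    then show "norm (Polynomial.coeff (P k z) i * \<phi> z ^ i) \<le> CP i * M ^ i" by (simp add: norm_mult norm_power)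
  qed
  define L where "L = (\<Sum>i\<in>{Suc i0..d}. Ce i * ME ^ (i - Suc i0)) + 1"
  \<comment> \<open>The relation writes \<open>e i0\<close> as a multiple of \<open>E\<close> with
    bounded cofactor, so \<open>E\<close> stays away from 0 near a boundary point where
    \<open>e i0\<close> does not vanish.\<close>
  have Lb: "norm (e i0 z) \<le> norm (E z) * L" if z: "z \<in> S" "z \<in> cball z1 r2" for z
  proof -
    have ME0: "ME \<ge> 0" using EM[OF z] norm_ge_zero order_trans by blast
    have "{i0..d} = insert i0 {Suc i0..d}" using i0(1) by auto
    then have "e i0 z = - (\<Sum>i\<in>{Suc i0..d}. e i z * E z ^ (i - i0))"
      using g0[OF z(1)] by (simp add: g_def eq_neg_iff_add_eq_0)
    also have "(\<Sum>i\<in>{Suc i0..d}. e i z * E z ^ (i - i0)) = E z * (\<Sum>i\<in>{Suc i0..d}. e i z * E z ^ (i - Suc i0))"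
      unfolding sum_distrib_left
    proof (intro sum.cong refl)
      fix i assume "i \<in> {Suc i0..d}"
      then have "i - i0 = Suc (i - Suc i0)" by auto
      then show "e i z * E z ^ (i - i0) = E z * (e i z * E z ^ (i - Suc i0))" by simp
    qed
    finally have "norm (e i0 z) = norm (E z) * norm (\<Sum>i\<in>{Suc i0..d}. e i z * E z ^ (i - Suc i0))"
      by (simp add: norm_mult)
    also have "norm (\<Sum>i\<in>{Suc i0..d}. e i z * E z ^ (i - Suc i0)) \<le> (\<Sum>i\<in>{Suc i0..d}. Ce i * ME ^ (i - Suc i0))"
    proof (intro sum_norm_le)
      fix i assume i: "i \<in> {Suc i0..d}"
      have "norm (e i z) * norm (E z) ^ (i - Suc i0) \<le> Ce i * ME ^ (i - Suc i0)"
      proof (intro mult_mono power_mono)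
        show c: "norm (e i z) \<le> Ce i" using Ce i z by auto
        show "0 \<le> Ce i" using norm_ge_zero c by (rule order_trans)
      qed (use EM[OF z] in auto)
      then show "norm (e i z * E z ^ (i - Suc i0)) \<le> Ce i * ME ^ (i - Suc i0)" by (simp add: norm_mult norm_power)
    qed
    then have "norm (E z) * norm (\<Sum>i\<in>{Suc i0..d}. e i z * E z ^ (i - Suc i0)) \<le> norm (E z) * L"
      unfolding L_def by (intro mult_left_mono) auto
    finally show ?thesis .
  qed
  \<comment> \<open>A sequence approaching \<open>z1\<close> from below. Along a subsequence the
    bounded values of \<phi> converge to a root \<alpha> of \<open>Q z1\<close>, and
    \<open>Lb\<close> passes to the limit and makes this root simple.\<close>
  define zn where "zn n = z1 - \<i> * of_real (r2 / (real n + 2))" for n :: nat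
  have zn: "zn n \<in> S" "zn n \<in> cball z1 r2" for n
  proof -
    have d: "dist z1 (zn n) = r2 / (real n + 2)" 
      using r2 by (simp add: zn_def dist_norm norm_mult del: of_real_divide of_real_add)
    also have "\<dots> \<le> r2" using r2 by (simp add: divide_le_eq mult_le_cancel_left1)
    finally show "zn n \<in> cball z1 r2" by simp
    then show "zn n \<in> S" using r2 z1(2) by (auto simp: S_def zn_def)
  qed
  have zn_lim: "zn \<longlonglongrightarrow> z1"
  proof -
    have "(\<lambda>n. r2 / (real n + 2)) \<longlonglongrightarrow> 0"
      by real_asymp
    then have "(\<lambda>n. z1 - \<i> * of_real (r2 / (real n + 2))) \<longlonglongrightarrow> z1 - \<i> * of_real 0"
      by (intro tendsto_intros)
    then show ?thesis unfolding zn_def by (simp only: of_real_0 mult_zero_right diff_zero)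
  qed
  have "\<forall>n. \<phi> (zn n) \<in> cball 0 M" using \<phi>M zn by simp
  then obtain \<alpha> u where u: "strict_mono u" "((\<lambda>n. \<phi> (zn n)) \<circ> u) \<longlonglongrightarrow> \<alpha>"
    by (rule seq_compactE[OF compact_imp_seq_compact[OF compact_cball]]) (rule that)
  have u_lim: "(\<lambda>n. zn (u n)) \<longlonglongrightarrow> z1" using LIMSEQ_subseq_LIMSEQ[OF zn_lim u(1)] by (simp add: o_def)
  have \<phi>u: "(\<lambda>n. \<phi> (zn (u n))) \<longlonglongrightarrow> \<alpha>" using u(2) by (simp add: o_def)
  have cP_lim: "(\<lambda>n. poly (P l (zn (u n))) (\<phi> (zn (u n)))) \<longlonglongrightarrow> poly (P l z1) \<alpha>" for l
    unfolding poly_sum_le[OF degP]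
  proof (intro tendsto_intros \<phi>u)
    fix i
    have "isCont (\<lambda>z. Polynomial.coeff (P l z) i) z1"
      using holomorphic_on_imp_continuous_on[OF cP] B(1) z1(1) continuous_on_eq_continuous_at by blast
    then show "(\<lambda>n. Polynomial.coeff (P l (zn (u n))) i) \<longlonglongrightarrow> Polynomial.coeff (P l z1) i" using u_lim by (rule isCont_tendsto_compose)
  qed
  have root: "poly (Q z1) \<alpha> = 0"
    using cP_lim[of k'] Q0 zn(1) by (simp add: Q_def LIMSEQ_const_iff)
  have "norm (e i0 z1) \<le> norm (poly (P k z1) \<alpha>) * L"
  proof (rule tendsto_le[OF sequentially_bot])
    show "(\<lambda>n. norm (poly (P k (zn (u n))) (\<phi> (zn (u n)))) * L) \<longlonglongrightarrow> norm (poly (P k z1) \<alpha>) * L"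
      by (intro tendsto_intros cP_lim)
    have "isCont (e i0) z1"
    proof -
      have "continuous_on B (e i0)" using e(1) i0(1) by (intro holomorphic_on_imp_continuous_on) auto
      then show ?thesis using B(1) z1(1) by (simp add: continuous_on_eq_continuous_at)
    qed
    then show "(\<lambda>n. norm (e i0 (zn (u n)))) \<longlonglongrightarrow> norm (e i0 z1)"
      using u_lim by (intro tendsto_norm isCont_tendsto_compose[of _ "e i0"])
    show "eventually (\<lambda>n. norm (e i0 (zn (u n))) \<le> norm (poly (P k (zn (u n))) (\<phi> (zn (u n)))) * L) sequentially"
      using Lb zn by (simp add: E_P)
  qed
  then have simple: "poly (pderiv (Q z1)) \<alpha> \<noteq> 0" using z1(3) by (auto simp: Q_def P_def k')
  have r2B: "ball z1 r2 \<subseteq> B" using r2(2) ball_subset_cball by blast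
  obtain \<rho> r3 \<epsilon> where \<rho>: "r3 > 0" "r3 \<le> r2" "\<epsilon> > 0" "\<rho> holomorphic_on ball z1 r3"
    "\<And>z X. z \<in> ball z1 r3 \<Longrightarrow> X \<in> cball \<alpha> \<epsilon> \<Longrightarrow> poly (Q z) X = 0 \<Longrightarrow> X = \<rho> z"
    by (rule implicit_holomorphic[of r2 Q z1 d \<alpha>]) 
       (use r2 root simple degP holomorphic_on_subset[OF cP r2B] in \<open>auto simp: Q_def\<close>)
  have "eventually (\<lambda>n. zn (u n) \<in> ball z1 r3) sequentially" "eventually (\<lambda>n. \<phi> (zn (u n)) \<in> ball \<alpha> \<epsilon>) sequentially"
    using u_lim \<phi>u \<rho>(1,3) by (auto simp: tendsto_iff dist_commute)
  then have "eventually (\<lambda>n. zn (u n) \<in> ball z1 r3 \<and> \<phi> (zn (u n)) \<in> ball \<alpha> \<epsilon>) sequentially" by eventually_elim simp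
  then obtain n0 where n0: "zn (u n0) \<in> ball z1 r3" "\<phi> (zn (u n0)) \<in> ball \<alpha> \<epsilon>"
    using eventually_happens'[OF sequentially_bot] by blast
  \<comment> \<open>Closeness of \<phi> to \<alpha> is known only along the sequence. One of its
    points gives a nonempty open set where \<phi> agrees with the implicit function, and the
    identity theorem covers the half ball.\<close>
  define V where "V = (S \<inter> \<phi> -` ball \<alpha> \<epsilon>) \<inter> ball z1 r3"
  have V: "open V" unfolding V_def
    by (intro open_Int continuous_open_preimage holomorphic_on_imp_continuous_on[OF \<phi>S] S) auto
  have S3: "ball z1 r3 \<inter> {z. Im z < c} \<subseteq> S" using \<rho>(2) r2B by (auto simp: S_def)
  show thesis
  proof (rule that[OF z1(2) \<rho>(1) _ \<rho>(4)])
    show "ball z1 r3 \<subseteq> ball z0 r" using \<rho>(2) r2B unfolding B_def by (meson dual_order.trans subset_ball)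
    fix z assume z: "z \<in> ball z1 r3" "Im z < c"
    show "\<phi> z = \<rho> z"
    proof (rule analytic_continuation_open[where f = \<phi> and g = \<rho> and s = V and s' = "ball z1 r3 \<inter> {z. Im z < c}"])
      have "zn (u n0) \<in> V" using n0 zn(1)[of "u n0"] by (simp add: V_def)
      then show "V \<noteq> {}" by blast
      show "connected (ball z1 r3 \<inter> {z. Im z < c})" using hp by (intro convex_connected convex_Int) auto
      show "\<phi> w = \<rho> w" if "w \<in> V" for w using that Q0 by (intro \<rho>(5)) (auto simp: V_def)
      show "open V" by (rule V)
      show "open (ball z1 r3 \<inter> {z. Im z < c})" using hp by auto
      show "V \<subseteq> ball z1 r3 \<inter> {z. Im z < c}" by (auto simp: V_def S_def)
      show "\<phi> holomorphic_on ball z1 r3 \<inter> {z. Im z < c}" by (rule holomorphic_on_subset[OF \<phi>S S3])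
      show "\<rho> holomorphic_on ball z1 r3 \<inter> {z. Im z < c}" by (rule holomorphic_on_subset[OF \<rho>(4)]) auto
    qed (use z in auto)
  qed
qed

text \<open>The relation is homogenised in \<open>N\<close> and \<open>H\<close> because
  \<open>H\<close> may vanish. If the leading coefficient is identically zero, a factor
  \<open>H\<close> splits off and the degree drops. Otherwise, near a boundary point where it is
  nonzero, the quotient is a root of a monic equation, hence bounded and holomorphic, and
  \<open>monic_extension\<close> continues it.\<close>

theorem algebraic_extension:
  fixes A :: "nat \<Rightarrow> complex \<Rightarrow> complex"
  assumes c: "Im z0 = c" and A: "\<And>i. i \<le> d \<Longrightarrow> A i holomorphic_on ball z0 r"
    and A0: "i0 \<le> d" "a \<in> ball z0 r" "A i0 a \<noteq> 0"
    and N: "N holomorphic_on (ball z0 r \<inter> {z. Im z < c})" and H: "H holomorphic_on (ball z0 r \<inter> {z. Im z < c})"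
    and H0: "b \<in> ball z0 r" "Im b < c" "H b \<noteq> 0"
    and eq: "\<And>z. z \<in> ball z0 r \<Longrightarrow> Im z < c \<Longrightarrow> (\<Sum>i\<le>d. A i z * N z ^ i * H z ^ (d - i)) = 0"
  shows "\<exists>z1 r1 \<phi>. Im z1 = c \<and> r1 > 0 \<and> ball z1 r1 \<subseteq> ball z0 r \<and> \<phi> holomorphic_on ball z1 r1 \<and>
    (\<forall>z\<in>ball z1 r1. Im z < c \<longrightarrow> N z = H z * \<phi> z)"
  using A A0 eq
proof (induction d arbitrary: i0 a)
  define S where "S = ball z0 r \<inter> {z. Im z < c}"
  have r: "r > 0" using H0(1) by (metis ball_eq_empty empty_iff not_le)
  have hp: "open {z. Im z < c}" "convex {z. Im z < c}" by (auto simp: open_halfspace_Im_lt convex_halfspace_Im_lt)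
  have S: "open S" "connected S" using hp by (auto simp: S_def intro!: convex_connected convex_Int)
  case 0
  then have "A 0 z = 0" if "z \<in> S" for z using that by (simp add: S_def)
  moreover have "b \<in> S" using H0 by (simp add: S_def)
  ultimately have "A 0 a = 0"
    using analytic_continuation_open[of S "ball z0 r" "A 0" "\<lambda>_. 0" a] S 0(1)[of 0] 0(3)
    by (force simp: S_def)
  then show ?case using 0 by simp
next
  case (Suc d)
  define S where "S = ball z0 r \<inter> {z. Im z < c}"
  have r: "r > 0" using H0(1) by (metis ball_eq_empty empty_iff not_le)
  have hp: "open {z. Im z < c}" "convex {z. Im z < c}" by (auto simp: open_halfspace_Im_lt convex_halfspace_Im_lt)
  have S: "open S" "connected S" using hp by (auto simp: S_def intro!: convex_connected convex_Int)
  have NS: "N holomorphic_on S" and HS: "H holomorphic_on S" using N H by (auto simp: S_def)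
  show ?case
  proof (cases "\<exists>z\<in>ball z0 r. A (Suc d) z \<noteq> 0")
    case False
    have i0d: "i0 \<le> d" using Suc.prems(2-4) False by (metis le_Suc_eq)
    have "(\<Sum>i\<le>d. A i z * N z ^ i * H z ^ (d - i)) = 0" if z: "z \<in> ball z0 r" "Im z < c" for z
    proof (rule ccontr)
      assume nz: "(\<Sum>i\<le>d. A i z * N z ^ i * H z ^ (d - i)) \<noteq> 0"
      have "\<exists>z\<in>S. H z * (\<Sum>i\<le>d. A i z * N z ^ i * H z ^ (d - i)) \<noteq> 0"
      proof (rule holomorphic_nonzero_mult[OF S HS])
        show "(\<lambda>z. \<Sum>i\<le>d. A i z * N z ^ i * H z ^ (d - i)) holomorphic_on S"
          by (intro holomorphic_intros NS HS holomorphic_on_subset[OF Suc.prems(1)]) (auto simp: S_def)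
      qed (use nz z H0 in \<open>auto simp: S_def\<close>)
      then obtain w where w: "w \<in> S" "H w * (\<Sum>i\<le>d. A i w * N w ^ i * H w ^ (d - i)) \<noteq> 0" by blast
      have "(\<Sum>i\<le>Suc d. A i w * N w ^ i * H w ^ (Suc d - i)) = (\<Sum>i\<le>d. A i w * N w ^ i * H w ^ (Suc d - i))"
        using False w(1) by (simp add: S_def)
      also have "\<dots> = H w * (\<Sum>i\<le>d. A i w * N w ^ i * H w ^ (d - i))"
        unfolding sum_distrib_left by (intro sum.cong) (auto simp: Suc_diff_le)
      finally show False using w Suc.prems(5)[of w] by (simp add: S_def)
    qed
    then show ?thesis using Suc.prems i0d by (intro Suc.IH[of i0 a]) auto
  next
    case True
    obtain z1 where z1: "z1 \<in> ball z0 r" "Im z1 = c" "A (Suc d) z1 \<noteq> 0"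
      using line_nonzero[of "A (Suc d)" z0 r c] Suc.prems(1) c True by blast
    have "continuous_on (ball z0 r) (A (Suc d))" using Suc.prems(1) by (intro holomorphic_on_imp_continuous_on) auto
    then have "open (ball z0 r \<inter> A (Suc d) -` (- {0}))"
      by (intro continuous_open_preimage) auto
    moreover have "z1 \<in> ball z0 r \<inter> A (Suc d) -` (- {0})" using z1 by auto
    ultimately obtain r' where r': "r' > 0" "cball z1 r' \<subseteq> ball z0 r \<inter> A (Suc d) -` (- {0})"
      using open_contains_cball by blast
    define S' where "S' = ball z1 r' \<inter> {z. Im z < c}"
    have S': "open S'" "connected S'" using hp by (auto simp: S'_def intro!: convex_connected convex_Int)
    have bsub: "ball z1 r' \<subseteq> ball z0 r" "\<And>z. z \<in> ball z1 r' \<Longrightarrow> A (Suc d) z \<noteq> 0"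
    proof -
      have "ball z1 r' \<subseteq> ball z0 r \<inter> A (Suc d) -` (- {0})" using r'(2) ball_subset_cball by (rule order_trans[rotated])
      then show "ball z1 r' \<subseteq> ball z0 r" "\<And>z. z \<in> ball z1 r' \<Longrightarrow> A (Suc d) z \<noteq> 0" by auto
    qed
    have SS: "S' \<subseteq> S" using bsub(1) by (auto simp: S'_def S_def)
    define q where "q i z = - (A i z / A (Suc d) z)" for i z
    have qh: "q i holomorphic_on cball z1 r'" if "i < Suc d" for i
      unfolding q_def using r'(2) that
      by (intro holomorphic_intros holomorphic_on_subset[OF Suc.prems(1)]) auto
    have "\<forall>i. \<exists>C. i < Suc d \<longrightarrow> (\<forall>z\<in>cball z1 r'. norm (q i z) \<le> C)"
    proof (intro allI)
      fix i
      show "\<exists>C. i < Suc d \<longrightarrow> (\<forall>z\<in>cball z1 r'. norm (q i z) \<le> C)"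
      proof (cases "i < Suc d")
        case True
        have "compact (q i ` cball z1 r')"
          by (intro compact_continuous_image holomorphic_on_imp_continuous_on qh True) auto
        then show ?thesis by (meson bounded_iff compact_imp_bounded imageI)
      qed auto
    qed
    from choice[OF this] obtain C where C: "\<forall>i. i < Suc d \<longrightarrow> (\<forall>z\<in>cball z1 r'. norm (q i z) \<le> C i)" ..
    define K where "K = (\<Sum>i<Suc d. \<bar>C i\<bar>)"
    have qK: "norm (q i z) \<le> K" if "i < Suc d" "z \<in> ball z1 r'" for i z
    proof -
      have "norm (q i z) \<le> C i" using C that by auto
      also have "\<dots> \<le> \<bar>C i\<bar>" by simp
      also have "\<dots> \<le> K" unfolding K_def using that(1) by (intro member_le_sum) auto
      finally show ?thesis .
    qed
    have monic: "N z ^ Suc d = (\<Sum>i<Suc d. q i z * N z ^ i * H z ^ (Suc d - i))" if z: "z \<in> S'" for z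
    proof -
      have nz: "A (Suc d) z \<noteq> 0" "z \<in> ball z0 r" "Im z < c" using z bsub by (auto simp: S'_def)
      have "(\<Sum>i\<le>d. A i z * N z ^ i * H z ^ (Suc d - i)) + A (Suc d) z * N z ^ Suc d = 0"
        using Suc.prems(5)[OF nz(2,3)] by simp
      then have "A (Suc d) z * N z ^ Suc d = - (\<Sum>i\<le>d. A i z * N z ^ i * H z ^ (Suc d - i))"
        by (simp add: add_eq_0_iff)
      then have "N z ^ Suc d = - (\<Sum>i\<le>d. A i z * N z ^ i * H z ^ (Suc d - i)) / A (Suc d) z"
        using nz(1) by (metis nonzero_mult_div_cancel_left)
      also have "\<dots> = (\<Sum>i\<le>d. q i z * N z ^ i * H z ^ (Suc d - i))"
        by (simp add: q_def sum_divide_distrib sum_negf)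
      finally show ?thesis by (simp only: lessThan_Suc_atMost)
    qed
    \<comment> \<open>A zero of \<open>H\<close> is a zero of \<open>N\<close>, since every term on
      the right of the monic equation contains \<open>H\<close>; elsewhere the root bound applies to
      the quotient.\<close>
    have quot: "norm (N z) \<le> (1 + real (Suc d) * K) * norm (H z)" if z: "z \<in> S'" for z
    proof (cases "H z = 0")
      case True
      then have "N z ^ Suc d = 0" unfolding monic[OF z] by (intro sum.neutral) (auto simp: Suc_diff_le)
      then have "N z = 0" by (rule power_eq_0_iff[THEN iffD1, THEN conjunct1])
      then show ?thesis using True by simp
    next
      case False
      have "(N z / H z) ^ Suc d = (\<Sum>i<Suc d. q i z * (N z / H z) ^ i)"
      proof -
        have "(N z / H z) ^ Suc d = (\<Sum>i<Suc d. q i z * N z ^ i * H z ^ (Suc d - i)) / H z ^ Suc d"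
          by (simp only: power_divide monic[OF z])
        also have "\<dots> = (\<Sum>i<Suc d. q i z * (N z / H z) ^ i)"
          unfolding sum_divide_distrib
        proof (intro sum.cong refl)
          fix i assume "i \<in> {..<Suc d}"
          then have "H z ^ Suc d = H z ^ i * H z ^ (Suc d - i)" by (subst power_add[symmetric]) auto
          then show "q i z * N z ^ i * H z ^ (Suc d - i) / H z ^ Suc d = q i z * (N z / H z) ^ i"
            using False by (simp add: power_divide)
        qed
        finally show ?thesis .
      qed
      then have "norm (N z / H z) \<le> 1 + (\<Sum>i<Suc d. norm (q i z))" by (intro monic_root_bound) auto
      also have "\<dots> \<le> 1 + (\<Sum>i<Suc d. K)"
        using z qK by (intro add_left_mono sum_mono) (auto simp: S'_def)
      finally show ?thesis using False by (simp add: norm_divide divide_le_eq)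
    qed
    have "\<exists>b\<in>S'. H b \<noteq> 0"
    proof (rule ccontr)
      assume *: "\<not> (\<exists>b\<in>S'. H b \<noteq> 0)"
      have "z1 - \<i> * of_real (r' / 2) \<in> S'" using r' z1 by (auto simp: S'_def dist_norm norm_mult)
      then have "S' \<noteq> {}" by blast
      then have "H b = 0"
        using analytic_continuation_open[OF S'(1) S(1) _ S(2) SS HS, of "\<lambda>_. 0" b] * H0(1,2) by (force simp: S_def)
      then show False using H0 by simp
    qed
    then obtain b' where b': "b' \<in> S'" "H b' \<noteq> 0" by blast
    have NS': "N holomorphic_on S'" and HS': "H holomorphic_on S'" using NS HS SS holomorphic_on_subset by blast+
    obtain \<phi> where \<phi>: "\<phi> holomorphic_on S'" "\<And>z. z \<in> S' \<Longrightarrow> N z = H z * \<phi> z"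
      by (rule bounded_quotient_holomorphic[OF S' NS' HS' b' quot], assumption, rule that)
    have \<phi>eq: "\<phi> z ^ Suc d = (\<Sum>i<Suc d. q i z * \<phi> z ^ i)" if z: "z \<in> S'" for z
    proof (rule ccontr)
      assume ne: "\<phi> z ^ Suc d \<noteq> (\<Sum>i<Suc d. q i z * \<phi> z ^ i)"
      have "\<exists>w\<in>S'. H w ^ Suc d * (\<phi> w ^ Suc d - (\<Sum>i<Suc d. q i w * \<phi> w ^ i)) \<noteq> 0"
      proof (rule holomorphic_nonzero_mult[OF S'])
        show "(\<lambda>w. H w ^ Suc d) holomorphic_on S'" by (intro holomorphic_intros HS')
        show "(\<lambda>w. \<phi> w ^ Suc d - (\<Sum>i<Suc d. q i w * \<phi> w ^ i)) holomorphic_on S'"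
          by (intro holomorphic_intros \<phi> holomorphic_on_subset[OF qh]) (auto simp: S'_def)
      qed (use b' z ne in auto)
      then obtain w where w: "w \<in> S'" "H w ^ Suc d * (\<phi> w ^ Suc d - (\<Sum>i<Suc d. q i w * \<phi> w ^ i)) \<noteq> 0" by blast
      have "H w ^ Suc d * (\<Sum>i<Suc d. q i w * \<phi> w ^ i) = (\<Sum>i<Suc d. q i w * N w ^ i * H w ^ (Suc d - i))"
        unfolding sum_distrib_left
      proof (intro sum.cong refl)
        fix i assume "i \<in> {..<Suc d}"
        then have "H w ^ Suc d = H w ^ i * H w ^ (Suc d - i)" by (subst power_add[symmetric]) auto
        then show "H w ^ Suc d * (q i w * \<phi> w ^ i) = q i w * N w ^ i * H w ^ (Suc d - i)"
          by (simp add: \<phi>(2)[OF w(1)] power_mult_distrib mult_ac)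
      qed
      also have "\<dots> = H w ^ Suc d * \<phi> w ^ Suc d"
        unfolding monic[OF w(1), symmetric] by (simp only: \<phi>(2)[OF w(1)] power_mult_distrib)
      finally show False using w(2) by (simp add: right_diff_distrib)
    qed
    obtain z2 r2 \<rho> where \<rho>: "Im z2 = c" "r2 > 0" "ball z2 r2 \<subseteq> ball z1 r'" "\<rho> holomorphic_on ball z2 r2"
      "\<And>z. z \<in> ball z2 r2 \<Longrightarrow> Im z < c \<Longrightarrow> \<phi> z = \<rho> z"
    proof (rule monic_extension[OF r'(1) z1(2), of "Suc d" q K \<phi>])
      show "q i holomorphic_on ball z1 r'" if "i < Suc d" for i
        using holomorphic_on_subset[OF qh[OF that]] by auto
    qed (use qK \<phi>(1) \<phi>eq in \<open>auto simp: S'_def\<close>)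
    have "N z = H z * \<rho> z" if z: "z \<in> ball z2 r2" "Im z < c" for z
    proof -
      have "z \<in> S'" using z \<rho>(3) by (auto simp: S'_def)
      then show ?thesis using \<phi>(2) \<rho>(5) z by simp
    qed
    then show ?thesis using \<rho> bsub(1) by (intro exI[of _ z2] exI[of _ r2] exI[of _ \<rho>]) auto
  qed
qed

subsection \<open>Extension across a dense set of boundary points\<close>

text \<open>A finite Baire argument: each condition can be reached inside any good set and is
  inherited by subsets, so finitely many are reached together.\<close>

lemma nested_refinement:
  fixes Q :: "nat \<Rightarrow> 'a set \<Rightarrow> bool"
  assumes dense: "\<And>k B. k < q \<Longrightarrow> good B \<Longrightarrow> \<exists>B'. good B' \<and> B' \<subseteq> B \<and> Q k B'"
    and mono: "\<And>k B B'. k < q \<Longrightarrow> B' \<subseteq> B \<Longrightarrow> Q k B \<Longrightarrow> Q k B'" and B: "good B"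
  shows "\<exists>B'. good B' \<and> B' \<subseteq> B \<and> (\<forall>k<q. Q k B')"
  using dense mono
proof (induction q)
  case 0
  then show ?case using B by blast
next
  case (Suc q)
  have "\<exists>B'. good B' \<and> B' \<subseteq> B \<and> (\<forall>k<q. Q k B')"
  proof (rule Suc.IH)
    show "\<exists>B'. good B' \<and> B' \<subseteq> B \<and> Q k B'" if "k < q" "good B" for k B
      by (rule Suc.prems(1)) (use that in simp_all)
    show "Q k B'" if "k < q" "B' \<subseteq> B" "Q k B" for k B B'
      by (rule Suc.prems(2)[of k B' B]) (use that in simp_all)
  qed
  then obtain B1 where B1: "good B1" "B1 \<subseteq> B" "\<forall>k<q. Q k B1" by (elim exE conjE)
  obtain B2 where B2: "good B2" "B2 \<subseteq> B1" "Q q B2" using Suc.prems(1)[of q B1] B1(1) by blast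
  have "Q k B2" if "k < Suc q" for k
  proof (cases "k = q")
    case False
    then have "k < q" using that by simp
    then show ?thesis using Suc.prems(2)[of k B2 B1] B1(3) B2(2) that by blast
  qed (use B2 in simp)
  then show ?case using B1 B2 by blast
qed

definition circle_ball :: "complex set \<Rightarrow> bool" where
  "circle_ball B \<longleftrightarrow> (\<exists>x r. B = ball x r \<and> r > 0 \<and> norm x = 1)"

text \<open>For \<open>F = H * f\<close> this means that \<open>f\<close> at \<open>x ^ m\<close>
  continues across the part of the circle in \<open>B\<close>; the product form allows for zeros of
  \<open>H\<close>.\<close>

definition extends_on :: "complex fps \<Rightarrow> complex fps \<Rightarrow> nat \<Rightarrow> complex set \<Rightarrow> bool" where
  "extends_on F H m B \<longleftrightarrow> (\<exists>\<phi>. \<phi> holomorphic_on B \<and>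
     (\<forall>x\<in>B. norm x < 1 \<longrightarrow> eval_fps F (x ^ m) = eval_fps H (x ^ m) * \<phi> x))"

lemma extends_on_subset: "B' \<subseteq> B \<Longrightarrow> extends_on F H m B \<Longrightarrow> extends_on F H m B'"
  unfolding extends_on_def by (meson holomorphic_on_subset subsetD)

text \<open>A local branch \<open>g\<close> of the \<open>m\<close>-th root carries a neighbourhood
  of \<open>x ^ m\<close> into the given ball; the extension found near \<open>x ^ m\<close> is
  pulled back along the power map.\<close>

lemma extends_on_power:
  assumes dense: "\<And>B. circle_ball B \<Longrightarrow> \<exists>B'. circle_ball B' \<and> B' \<subseteq> B \<and> extends_on F H 1 B'"
    and m: "m > 0" and B: "circle_ball B"
  shows "\<exists>B'. circle_ball B' \<and> B' \<subseteq> B \<and> extends_on F H m B'"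
proof -
  obtain x r where x: "B = ball x r" "r > 0" "norm x = 1" using B unfolding circle_ball_def by blast
  then have x0: "x \<noteq> 0" by auto
  define g where "g y = x * exp (Ln (y / x ^ m) / of_nat m)" for y
  have "isCont g (x ^ m)" unfolding g_def using x0 m by (intro continuous_intros) auto
  moreover have "g (x ^ m) = x" using x0 by (simp add: g_def)
  ultimately obtain d where d: "d > 0" "\<And>y. dist y (x ^ m) < d \<Longrightarrow> dist (g y) x < r"
    unfolding continuous_at_eps_delta using x(2) by metis
  have "norm (x ^ m) = 1" using x(3) by (simp add: norm_power)
  then have "circle_ball (ball (x ^ m) d)" unfolding circle_ball_def using d(1) by blast
  from dense[OF this] obtain y1 r1 \<phi> where y1: "ball y1 r1 \<subseteq> ball (x ^ m) d" "r1 > 0" "norm y1 = 1"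
    and \<phi>: "\<phi> holomorphic_on ball y1 r1"
      "\<And>y. y \<in> ball y1 r1 \<Longrightarrow> norm y < 1 \<Longrightarrow> eval_fps F y = eval_fps H y * \<phi> y"
    unfolding circle_ball_def extends_on_def by auto
  have y10: "y1 \<noteq> 0" using y1 by auto
  have g1: "g y1 ^ m = y1"
    using x0 m y10 by (simp add: g_def power_mult_distrib flip: exp_of_nat_mult)
  have "norm (g y1) ^ m = 1 ^ m" using g1 y1(3) by (simp flip: norm_power)
  then have n1: "norm (g y1) = 1" using m power_eq_imp_eq_base[of "norm (g y1)" m 1] by simp
  have "y1 \<in> ball (x ^ m) d" using y1(2) by (intro subsetD[OF y1(1)]) simp
  then have gx: "g y1 \<in> ball x r" using d(2)[of y1] by (simp add: dist_commute)
  have "isCont (\<lambda>z. z ^ m) (g y1)" by (intro continuous_intros)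
  then obtain e where e: "e > 0" "\<And>z. dist z (g y1) < e \<Longrightarrow> dist (z ^ m) y1 < r1"
    unfolding continuous_at_eps_delta g1 using y1(2) by metis
  obtain e' where e': "e' > 0" "ball (g y1) e' \<subseteq> ball x r"
    using gx open_ball[of x r] by (meson openE)
  define B' where "B' = ball (g y1) (min e e')"
  have im: "z ^ m \<in> ball y1 r1" if "z \<in> B'" for z
    using e(2)[of z] that by (simp add: B'_def dist_commute)
  have "(\<phi> \<circ> (\<lambda>z. z ^ m)) holomorphic_on B'"
    by (rule holomorphic_on_compose_gen[OF _ \<phi>(1)]) (use im in \<open>auto intro!: holomorphic_intros\<close>)
  moreover have "norm (z ^ m) < 1" if "norm z < 1" for z :: complex
    using that m by (simp add: norm_power power_less_one_iff)
  ultimately have "extends_on F H m B'"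
    unfolding extends_on_def using \<phi>(2) im by (intro exI[of _ "\<phi> \<circ> (\<lambda>z. z ^ m)"]) auto
  moreover have "circle_ball B'" unfolding circle_ball_def B'_def using e(1) e'(1) n1
    by (intro exI[of _ "g y1"] exI[of _ "min e e'"]) simp
  moreover have "B' \<subseteq> B" unfolding B'_def x(1) using e' by auto
  ultimately show ?thesis by blast
qed

section \<open>Wrapping an arc around the circle\<close>

lemma poly_compose_X_power:
  assumes "M > 0"
  obtains Q :: "complex poly" where "fps_of_poly Q = fps_of_poly P oo fps_X ^ M" "P \<noteq> 0 \<Longrightarrow> Q \<noteq> 0"
proof (cases "P = 0")
  case True
  then show ?thesis by (intro that[of 0]) auto
next
  case False
  with assms show ?thesis by (rule compose_X_power_neq_0) (rule that)
qed

text \<open>Over the rational functions the first \<open>n\<close> of the series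
  \<open>f oo fps_X ^ (p ^ i)\<close> span all later ones.\<close>

lemma iterated_mahler:
  fixes a :: "nat \<Rightarrow> complex poly"
  assumes p: "p \<ge> 2" and n: "n \<ge> 1" and an: "a n \<noteq> 0"
    and eq: "(\<Sum>i\<le>n. fps_of_poly (a i) * (f oo fps_X ^ (p ^ i))) = 0"
  shows "\<exists>E P. E \<noteq> 0 \<and> fps_of_poly E * (f oo fps_X ^ (p ^ J)) = (\<Sum>i<n. fps_of_poly (P i) * (f oo fps_X ^ (p ^ i)))"
proof (induction J)
  case 0
  have "(\<Sum>i<n. fps_of_poly (if i = 0 then 1 else 0) * (f oo fps_X ^ (p ^ i))) = (\<Sum>i<n. if i = 0 then f oo fps_X ^ (p ^ i) else 0)"
    by (intro sum.cong) auto
  then show ?case using n by (intro exI[of _ 1] exI[of _ "\<lambda>i. if i = 0 then 1 else 0"]) (simp add: sum.delta)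
next
  case (Suc J)
  obtain m where m: "n = Suc m" using n by (cases n) auto
  obtain E P where E: "E \<noteq> 0" "fps_of_poly E * (f oo fps_X ^ (p ^ J)) = (\<Sum>i<n. fps_of_poly (P i) * (f oo fps_X ^ (p ^ i)))"
    using Suc by blast
  have p0: "p > 0" using p by simp
  obtain E' where E': "fps_of_poly E' = fps_of_poly E oo fps_X ^ p" "E' \<noteq> 0"
    using E(1) by (rule_tac poly_compose_X_power[OF p0, of E]) blast
  have "\<forall>i. \<exists>Q. fps_of_poly Q = fps_of_poly (P i) oo fps_X ^ p"
    using poly_compose_X_power[OF p0] by metis
  then obtain P' where P': "\<And>i. fps_of_poly (P' i) = fps_of_poly (P i) oo fps_X ^ p" by metis
  have X0: "fps_nth (fps_X ^ p :: complex fps) 0 = 0" using p0 by simp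
  have ff: "(f oo fps_X ^ (p ^ i)) oo fps_X ^ p = f oo fps_X ^ (p ^ Suc i)" for i
    using compose_X_power_power[of "p ^ i" p f] p0 by (simp add: mult.commute)
  have "fps_of_poly E' * (f oo fps_X ^ (p ^ Suc J)) = (fps_of_poly E * (f oo fps_X ^ (p ^ J))) oo fps_X ^ p"
    unfolding fps_compose_mult_distrib[OF X0] ff E'(1) ..
  also have "\<dots> = (\<Sum>i<n. fps_of_poly (P' i) * (f oo fps_X ^ (p ^ Suc i)))"
    unfolding E(2) fps_compose_sum_distrib fps_compose_mult_distrib[OF X0] ff P' ..
  also have "\<dots> = (\<Sum>i<m. fps_of_poly (P' i) * (f oo fps_X ^ (p ^ Suc i))) + fps_of_poly (P' m) * (f oo fps_X ^ (p ^ n))"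
    unfolding m by simp
  finally have 1: "fps_of_poly E' * (f oo fps_X ^ (p ^ Suc J)) = \<dots>" .
  have 2: "fps_of_poly (a n) * (f oo fps_X ^ (p ^ n)) = - (\<Sum>i<n. fps_of_poly (a i) * (f oo fps_X ^ (p ^ i)))"
    using eq unfolding lessThan_Suc_atMost[symmetric] sum.lessThan_Suc by (simp add: eq_neg_iff_add_eq_0 add.commute)
  define R where "R i = a n * (if i = 0 then 0 else P' (i - 1)) - P' m * a i" for i
  have "fps_of_poly (a n * E') * (f oo fps_X ^ (p ^ Suc J))
    = (\<Sum>i<m. fps_of_poly (a n * P' i) * (f oo fps_X ^ (p ^ Suc i))) + fps_of_poly (P' m) * (fps_of_poly (a n) * (f oo fps_X ^ (p ^ n)))"
    unfolding fps_of_poly_mult mult.assoc 1 by (simp only: distrib_left sum_distrib_left mult_ac)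
  also have "(\<Sum>i<m. fps_of_poly (a n * P' i) * (f oo fps_X ^ (p ^ Suc i)))
     = (\<Sum>i<n. fps_of_poly (a n * (if i = 0 then 0 else P' (i - 1))) * (f oo fps_X ^ (p ^ i)))"
    unfolding m by (subst sum.lessThan_Suc_shift) simp
  also have "\<dots> + fps_of_poly (P' m) * (fps_of_poly (a n) * (f oo fps_X ^ (p ^ n))) = (\<Sum>i<n. fps_of_poly (R i) * (f oo fps_X ^ (p ^ i)))"
    unfolding 2 R_def fps_of_poly_diff left_diff_distrib sum_subtractf fps_of_poly_mult
    by (simp add: sum_distrib_left mult.assoc)
  finally show ?case using E'(2) an by (intro exI[of _ "a n * E'"] exI[of _ R]) simp
qed

text \<open>Every factor \<open>x - z\<close> divides \<open>x ^ M - z ^ M\<close>. This turns a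
  denominator in \<open>x\<close> into one in \<open>y = x ^ M\<close>, the variable in which the
  function is to be continued.\<close>

lemma power_multiple_exists:
  fixes E :: "complex poly"
  assumes "M > 0" "E \<noteq> 0"
  shows "\<exists>D K. D \<noteq> 0 \<and> (\<forall>x. poly D (x ^ M) = poly E x * poly K x)"
  using assms(2)
proof (induction "degree E" arbitrary: E)
  case 0
  then obtain c where "E = [:c:]" "c \<noteq> 0" using degree_eq_zeroE[of E] by force
  then show ?case by (intro exI[of _ 1] exI[of _ "[:1 / c:]"]) simp
next
  case (Suc d)
  have "\<not> constant (poly E)" using Suc by (simp add: constant_degree)
  then obtain z where z: "poly E z = 0" using Fundamental_Theorem_Algebra.fundamental_theorem_of_algebra[of E] by blast
  have "[:- z, 1:] dvd E" using z by (rule iffD1[OF poly_eq_0_iff_dvd])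
  then obtain E1 where E1: "E = [:- z, 1:] * E1" by (rule dvdE)
  have "E1 \<noteq> 0" using Suc.prems E1 by auto
  then have "degree E = Suc (degree E1)" unfolding E1 by (subst degree_mult_eq) auto
  then have d: "d = degree E1" using Suc.hyps(2) by simp
  obtain D1 K1 where D1: "D1 \<noteq> 0" "\<forall>x. poly D1 (x ^ M) = poly E1 x * poly K1 x"
    using Suc.hyps(1)[OF d \<open>E1 \<noteq> 0\<close>] by (elim exE conjE)
  have "poly (Polynomial.monom 1 M - [:z ^ M:]) z = 0" by (simp add: poly_monom)
  then have "[:- z, 1:] dvd Polynomial.monom 1 M - [:z ^ M:]" by (rule iffD1[OF poly_eq_0_iff_dvd])
  then obtain S where S: "Polynomial.monom 1 M - [:z ^ M:] = [:- z, 1:] * S" by (rule dvdE)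
  have "poly ([:- (z ^ M), 1:] * D1) (x ^ M) = poly E x * poly (S * K1) x" for x
  proof -
    have "x ^ M - z ^ M = (x - z) * poly S x" using arg_cong[OF S, of "\<lambda>q. poly q x"] by (simp add: poly_monom algebra_simps)
    then show ?thesis unfolding E1 poly_mult D1(2)[rule_format] by simp
  qed
  moreover have "[:- (z ^ M), 1:] * D1 \<noteq> 0" unfolding mult_eq_0_iff using D1(1) by simp
  ultimately show ?case by blast
qed

text \<open>In the logarithmic coordinate \<open>v\<close> the function is \<open>2\<pi>i\<close>-periodic because it is so for very negative \<open>Re v\<close>.\<close>

lemma logarithmic_extension:
  assumes W0: "W0 holomorphic_on ball 0 \<rho>" and \<rho>: "0 < \<rho>" "\<rho> \<le> 1" and \<omega>: "norm \<omega> = 1"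
    and \<Theta>: "\<Theta> holomorphic_on ball 0 R" and R: "R \<ge> 20 - ln \<rho>"
    and eq: "\<And>v. v \<in> ball 0 R \<Longrightarrow> norm (\<omega> * exp v) < \<rho> \<Longrightarrow> \<Theta> v = W0 (\<omega> * exp v)"
  shows "\<exists>W. W holomorphic_on ball 0 (exp 1) \<and> (\<forall>y\<in>ball 0 \<rho>. W y = W0 y)"
proof -
  have \<omega>0: "\<omega> \<noteq> 0" using \<omega> by auto
  have ln\<rho>: "ln \<rho> \<le> 0" using \<rho> by simp
  have small: "norm (\<omega> * exp v) < \<rho>" if "Re v < ln \<rho>" for v
  proof -
    have "exp (Re v) < exp (ln \<rho>)" using that by simp
    then show ?thesis using \<rho> \<omega> by (simp add: norm_mult)
  qed
  have pi4: "pi < 4" using pi_less_4 .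
  \<comment> \<open>The proof moves in real parts between \<open>ln \<rho> - 1\<close> and 1 and
    imaginary parts up to \<open>4 * pi < 16\<close>; the constant 20 leaves room for both.\<close>
  have inball: "v \<in> ball 0 R" if "ln \<rho> - 1 < Re v" "Re v < 1" "\<bar>Im v\<bar> \<le> 4 * pi" for v
  proof -
    have "norm v \<le> \<bar>Re v\<bar> + \<bar>Im v\<bar>" by (rule cmod_le)
    then show ?thesis using that pi4 R ln\<rho> by (auto simp: abs_if split: if_splits)
  qed
  define T where "T = 2 * of_real pi * \<i>"
  have expT: "exp (v + T) = exp v" for v unfolding T_def by (simp add: exp_add exp_two_pi_i)
  have periodic: "\<Theta> (v + T) = \<Theta> v" if v: "v \<in> ball 0 R" "v + T \<in> ball 0 R" for v
  proof -
    define S where "S = ball 0 R \<inter> ball (- T) R"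
    have S: "u \<in> S \<longleftrightarrow> u \<in> ball 0 R \<and> u + T \<in> ball 0 R" for u
      by (simp add: S_def dist_norm norm_minus_commute add.commute)
    define S' where "S' = S \<inter> {u. Re u < ln \<rho>}"
    define u0 where "u0 = Complex (ln \<rho> - 1/2) 0"
    have "u0 \<in> S" unfolding S using pi4 ln\<rho> by (intro conjI inball) (auto simp: u0_def T_def)
    then have ne: "S' \<noteq> {}" by (auto simp: S'_def u0_def)
    show ?thesis
    proof (rule analytic_continuation_open[where s = S' and s' = S and f = "\<lambda>u. \<Theta> (u + T)" and g = \<Theta>])
      show "open S'" unfolding S'_def S_def by (intro open_Int open_ball open_halfspace_Re_lt)
      show "open S" unfolding S_def by (intro open_Int open_ball)
      show "S' \<noteq> {}" by (rule ne)
      show "connected S" unfolding S_def by (intro convex_connected convex_Int convex_ball)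
      show "S' \<subseteq> S" by (auto simp: S'_def)
      have "(\<Theta> \<circ> (\<lambda>u. u + T)) holomorphic_on S"
        by (rule holomorphic_on_compose_gen[OF _ \<Theta>]) (auto intro!: holomorphic_intros simp: S)
      then show "(\<lambda>u. \<Theta> (u + T)) holomorphic_on S" by (simp add: o_def)
      show "\<Theta> holomorphic_on S" by (rule holomorphic_on_subset[OF \<Theta>]) (simp add: S_def)
      show "\<Theta> (u + T) = \<Theta> u" if u: "u \<in> S'" for u
      proof -
        have "u \<in> ball 0 R" "u + T \<in> ball 0 R" "Re u < ln \<rho>" using u by (auto simp: S'_def S)
        then show ?thesis using eq[of u] eq[of "u + T"] small[of u] by (simp add: expT)
      qed
      show "v \<in> S" using v by (simp add: S)
    qed
  qed
  define W where "W y = (if norm y < \<rho> then W0 y else \<Theta> (Ln (y / \<omega>)))" for y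
  have "W holomorphic_on ball 0 (exp 1)"
  proof (rule analytic_imp_holomorphic, subst analytic_on_analytic_at, rule ballI)
    fix y0 :: complex assume y0: "y0 \<in> ball 0 (exp 1)"
    show "W analytic_on {y0}"
    proof (cases "norm y0 < \<rho>")
      case True
      have "W holomorphic_on ball 0 \<rho>" by (rule holomorphic_transform[OF W0]) (simp add: W_def)
      then show ?thesis using True by (auto simp: analytic_at intro!: exI[of _ "ball 0 \<rho>"])
    next
      case False
      then have y0nz: "y0 \<noteq> 0" using \<rho> by auto
      define U where "U = ball y0 (norm y0 / 2) \<inter> ball 0 (exp 1)"
      define v0 where "v0 = Ln (y0 / \<omega>)"
      \<comment> \<open>A branch of the logarithm of \<open>y / \<omega>\<close> centred at
        \<open>y0\<close>; unlike \<open>Ln (y / \<omega>)\<close> it has no cut near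
        \<open>y0\<close>.\<close>
      define g where "g y = v0 + Ln (y / y0)" for y
      have U: "open U" "y0 \<in> U" using y0 y0nz by (auto simp: U_def)
      have near: "Re (y / y0) > 0" if "y \<in> U" for y
      proof -
        have "norm (1 - y / y0) = norm (y0 - y) / norm y0" using y0nz by (simp add: diff_divide_eq_iff flip: norm_divide)
        also have "\<dots> < 1 / 2" using that y0nz by (simp add: U_def dist_norm field_simps)
        finally show ?thesis using abs_Re_le_cmod[of "1 - y / y0"] by simp
      qed
      have yn: "y / y0 \<noteq> 0" if "y \<in> U" for y using near[OF that] by (metis less_irrefl zero_complex.sel(1))
      have expg: "\<omega> * exp (g y) = y" if "y \<in> U" for y
        using yn[OF that] y0nz \<omega>0 by (simp add: g_def v0_def exp_add)
      have Reg: "Re (g y) = ln (norm y)" if "y \<in> U" for y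
      proof -
        have "norm y = exp (Re (g y))" using arg_cong[OF expg[OF that], of norm] \<omega> by (simp add: norm_mult)
        then show ?thesis by simp
      qed
      have Img: "\<bar>Im (g y)\<bar> < 2 * pi" if "y \<in> U" for y
      proof -
        have "\<bar>Im (Ln (y / y0))\<bar> < pi / 2" by (rule Re_Ln_pos_lt_imp[OF near[OF that]])
        moreover have "- pi < Im v0" "Im v0 \<le> pi"
          unfolding v0_def using mpi_less_Im_Ln[of "y0 / \<omega>"] Im_Ln_le_pi[of "y0 / \<omega>"] y0nz \<omega>0 by auto
        ultimately show ?thesis unfolding g_def by simp
      qed
      have gb: "ln \<rho> - 1 < Re (g y)" "Re (g y) < 1" if "y \<in> U" for y
      proof -
        have "norm y0 \<le> norm y + norm (y0 - y)" using norm_triangle_ineq[of y "y0 - y"] by simp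
        then have "norm y > norm y0 / 2" using that by (simp add: U_def dist_norm)
        then have ny: "norm y > \<rho> / 2" using False by simp
        have y_pos: "norm y > 0" using ny \<rho> by linarith
        have "ln (\<rho> / 2) < ln (norm y)" by (subst ln_less_cancel_iff) (use ny \<rho> y_pos in simp_all)
        moreover have "ln (\<rho> / 2) = ln \<rho> - ln 2" using \<rho> by (simp add: ln_div)
        moreover have "ln 2 < (1::real)" using ln_2_less_1 .
        ultimately show "ln \<rho> - 1 < Re (g y)" using Reg[OF that] by simp
        have "norm y < exp 1" using that by (simp add: U_def)
        then have "ln (norm y) < ln (exp 1)" using y_pos by (subst ln_less_cancel_iff) simp_all
        then show "Re (g y) < 1" using Reg[OF that] by simp
      qed
      have g_hol: "g holomorphic_on U" unfolding g_def
      proof (intro holomorphic_intros)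
        fix y assume "y \<in> U"
        then have "Re (y / y0) > 0" by (rule near)
        then show "y / y0 \<notin> \<real>\<^sub>\<le>\<^sub>0" by (auto simp: complex_nonpos_Reals_iff)
      qed (use y0nz in auto)
      have "(\<Theta> \<circ> g) holomorphic_on U"
        by (rule holomorphic_on_compose_gen[OF g_hol \<Theta>]) (use gb Img inball in fastforce)
      then have "W holomorphic_on U"
      proof (rule holomorphic_transform)
        fix y assume y: "y \<in> U"
        have gin: "g y \<in> ball 0 R" using gb[OF y] Img[OF y] by (intro inball) auto
        show "(\<Theta> \<circ> g) y = W y"
        proof (cases "norm y < \<rho>")
          case True
          then show ?thesis using eq[OF gin] expg[OF y] by (simp add: W_def)
        next
          case False
          \<comment> \<open>\<open>Ln\<close> and the local branch differ by at most one period, and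
            both values stay in the ball, so \<open>periodic\<close> identifies their
            images.\<close>
          define l where "l = Ln (y / \<omega>)"
          have ynz: "y / \<omega> \<noteq> 0" using yn[OF y] \<omega>0 by auto
          have "exp l = exp (g y)" using expg[OF y] ynz \<omega>0 by (simp add: l_def field_simps)
          then obtain k :: int where k: "l = g y + (of_int (2 * k) * pi) * \<i>" using exp_eq by blast
          have lIm: "- pi < Im l" "Im l \<le> pi" unfolding l_def using mpi_less_Im_Ln[OF ynz] Im_Ln_le_pi[OF ynz] by auto
          have "Im l = Im (g y) + 2 * pi * of_int k" unfolding k by simp
          then have "\<bar>2 * pi * of_int k\<bar> < 3 * pi" using lIm Img[OF y] by linarith
          then have "\<bar>real_of_int k\<bar> < 3 / 2" by (simp add: abs_mult field_simps)
          then have "k = 0 \<or> k = 1 \<or> k = -1" by linarith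
          moreover have lin: "l \<in> ball 0 R"
          proof (rule inball)
            have "Re l = Re (g y)" unfolding k by simp
            then show "ln \<rho> - 1 < Re l" "Re l < 1" using gb[OF y] by simp_all
            show "\<bar>Im l\<bar> \<le> 4 * pi" using lIm by simp
          qed
          ultimately have "\<Theta> l = \<Theta> (g y)"
          proof (elim disjE)
            assume "k = 1"
            then have "l = g y + T" unfolding k by (simp add: T_def)
            then show ?thesis using periodic[OF gin] lin by simp
          next
            assume "k = -1"
            then have "g y = l + T" unfolding k by (simp add: T_def)
            then show ?thesis using periodic[OF lin] gin by simp
          qed (simp add: k)
          then show ?thesis using False by (simp add: W_def l_def)
        qed
      qed
      then show ?thesis using U by (auto simp: analytic_at)
    qed
  qed
  then show ?thesis by (intro exI[of _ W]) (simp add: W_def)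
qed

lemma conv_radius_prod:
  assumes "\<And>i. i \<in> I \<Longrightarrow> fps_conv_radius (F i :: complex fps) \<ge> 1"
  shows "fps_conv_radius (\<Prod>i\<in>I. F i) \<ge> 1"
  using assms by (induction I rule: infinite_finite_induct) (auto intro: fps_conv_radius_mult_ge)

lemma eval_fps_prod_disc:
  assumes "\<And>i. i \<in> I \<Longrightarrow> fps_conv_radius (F i :: complex fps) \<ge> 1" "norm x < 1"
  shows "eval_fps (\<Prod>i\<in>I. F i) x = (\<Prod>i\<in>I. eval_fps (F i) x)"
  using assms(1)
proof (induction I rule: infinite_finite_induct)
  case (insert i I)
  have "eval_fps (F i * (\<Prod>i\<in>I. F i)) x = eval_fps (F i) x * eval_fps (\<Prod>i\<in>I. F i) x"
    by (rule eval_fps_mult_disc) (intro assms(2) conv_radius_prod insert.prems; simp)+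
  then show ?case using insert by simp
qed simp_all

lemma geo_conv_radius:
  fixes w :: "complex fps"
  assumes "ereal R < fps_conv_radius w" "R > 0"
  shows "geo R w"
proof -
  have "summable (\<lambda>k. fps_nth w k * of_real R ^ k)" by (rule summable_fps) (use assms in simp)
  then have "Bseq (\<lambda>k. fps_nth w k * of_real R ^ k)"
    by (rule convergent_imp_Bseq[OF convergentI[OF summable_LIMSEQ_zero]])
  then obtain C where "\<And>k. norm (fps_nth w k * of_real R ^ k) \<le> C" unfolding Bseq_def by blast
  then show ?thesis using assms(2) by (intro geoI) (simp add: norm_mult norm_power)
qed

text \<open>On a small arc the functions \<open>f\<close> at \<open>x ^ (p ^ i)\<close>,
  \<open>i < n\<close>, continue, hence, up to a denominator, also \<open>f\<close> at
  \<open>x ^ M\<close> for every \<open>M = p ^ J\<close>. For large \<open>J\<close> the map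
  \<open>x ^ M\<close> wraps the arc around the entire circle, so \<open>f\<close> times a
  polynomial continues to a larger disc and \<open>mahler_rational\<close> applies.\<close>

theorem dense_extension_rational:
  assumes p: "p \<ge> 2" and n: "n \<ge> 1" and an: "a n \<noteq> 0"
    and eq: "(\<Sum>i\<le>n. fps_of_poly (a i) * (f oo fps_X ^ (p ^ i))) = 0"
    and H0: "fps_nth H 0 = 1" and F: "F = H * f"
    and Fc: "fps_conv_radius F \<ge> 1" and Hc: "fps_conv_radius H \<ge> 1"
    and dense: "\<And>B. circle_ball B \<Longrightarrow> \<exists>B'. circle_ball B' \<and> B' \<subseteq> B \<and> extends_on F H 1 B'"
  shows "is_rational_fps f"
proof -
  have Fh: "eval_fps F holomorphic_on ball 0 1" and Hh: "eval_fps H holomorphic_on ball 0 1"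
    using Fc Hc by (auto intro: eval_fps_holomorphic_disc)
  have pk: "p ^ k > 0" for k using p by simp
  have pow_in: "norm (x ^ p ^ k) < 1" if "norm x < 1" for x :: complex and k
    using that pk[of k] by (simp add: norm_power power_less_one_iff)
  have H00: "eval_fps H 0 = 1" using H0 by (simp add: eval_fps_at_0)
  obtain \<rho> where \<rho>: "0 < \<rho>" "\<rho> \<le> 1" "\<And>y. norm y < \<rho> \<Longrightarrow> eval_fps H y \<noteq> 0"
  proof -
    have "continuous (at 0) (eval_fps H)"
      using holomorphic_on_imp_continuous_on[OF Hh] by (simp add: continuous_on_eq_continuous_at)
    from continuous_at_avoid[OF this, of 0] obtain e where "e > 0" "\<forall>y. dist 0 y < e \<longrightarrow> eval_fps H y \<noteq> 0"
      using H00 by auto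
    then show thesis using that[of "min e 1"] by auto
  qed
  have "circle_ball (ball 1 1)" unfolding circle_ball_def by (intro exI[of _ 1]) simp
  then have "\<exists>B'. circle_ball B' \<and> B' \<subseteq> ball 1 1 \<and> (\<forall>i<n. extends_on F H (p ^ i) B')"
    by (rule nested_refinement[where Q = "\<lambda>i. extends_on F H (p ^ i)", rotated 2])
      (rule extends_on_power[OF dense pk], assumption, assumption, rule extends_on_subset)
  then obtain B where B: "circle_ball B" "\<forall>i<n. extends_on F H (p ^ i) B" by blast
  obtain x1 r where x1: "B = ball x1 r" "r > 0" "norm x1 = 1" using B(1) unfolding circle_ball_def by blast
  then have x10: "x1 \<noteq> 0" by auto
  obtain \<phi> where \<phi>: "\<And>i. i < n \<Longrightarrow> \<phi> i holomorphic_on ball x1 r"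
    "\<And>i x. i < n \<Longrightarrow> x \<in> ball x1 r \<Longrightarrow> norm x < 1 \<Longrightarrow> eval_fps F (x ^ p ^ i) = eval_fps H (x ^ p ^ i) * \<phi> i x"
  proof -
    have "\<forall>i\<in>{..<n}. \<exists>\<phi>. \<phi> holomorphic_on ball x1 r \<and> (\<forall>x\<in>ball x1 r. norm x < 1 \<longrightarrow> eval_fps F (x ^ p ^ i) = eval_fps H (x ^ p ^ i) * \<phi> x)"
      using B(2) unfolding x1(1) extends_on_def by blast
    from bchoice[OF this] obtain \<phi> where "\<forall>i\<in>{..<n}. \<phi> i holomorphic_on ball x1 r \<and>
      (\<forall>x\<in>ball x1 r. norm x < 1 \<longrightarrow> eval_fps F (x ^ p ^ i) = eval_fps H (x ^ p ^ i) * \<phi> i x)" by (elim exE)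
    then show thesis by (intro that[of \<phi>]) simp_all
  qed
  obtain r' where r': "r' > 0" "\<And>u. norm u < r' \<Longrightarrow> x1 * exp u \<in> ball x1 r"
  proof -
    have "isCont (\<lambda>u. x1 * exp u) 0" by (intro continuous_intros)
    then obtain d where "d > 0" "\<And>u. dist u 0 < d \<Longrightarrow> dist (x1 * exp u) (x1 * exp 0) < r"
      unfolding continuous_at_eps_delta using x1(2) by metis
    then show thesis using that[of d] by (simp add: dist_commute)
  qed
  \<comment> \<open>In the coordinate \<open>v\<close> with \<open>x = x1 * exp (v / M)\<close> the
    disc of radius \<open>r'\<close> is blown up by \<open>M\<close>; it has to reach the radius
    that \<open>logarithmic_extension\<close> demands.\<close>
  obtain J where J: "(20 - ln \<rho>) / r' < real p ^ J" using real_arch_pow[of "real p"] p by auto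
  define M where "M = p ^ J"
  have M: "M > 0" "real M * r' \<ge> 20 - ln \<rho>" using J r'(1) pk by (auto simp: M_def field_simps)
  obtain E P where E: "E \<noteq> 0" "fps_of_poly E * (f oo fps_X ^ M) = (\<Sum>i<n. fps_of_poly (P i) * (f oo fps_X ^ (p ^ i)))"
    using iterated_mahler[OF p n an eq, of J] unfolding M_def by (elim exE conjE)
  obtain D K where D: "D \<noteq> 0" and D': "\<forall>x. poly D (x ^ M) = poly E x * poly K x"
    using power_multiple_exists[OF M(1) E(1)] by (elim exE conjE)
  define V where "V x = (\<Sum>i<n. poly (P i) x * \<phi> i x)" for x
  have V_hol: "V holomorphic_on ball x1 r" unfolding V_def using \<phi>(1) by (intro holomorphic_intros) auto
  \<comment> \<open>Multiplication by all \<open>H oo fps_X ^ (p ^ l)\<close> replaces each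
    \<open>f\<close> by \<open>F\<close> without division; \<open>main\<close> cancels this factor
    again because it is not identically zero.\<close>
  define \<Pi>f where "\<Pi>f = (\<Prod>l<n. H oo fps_X ^ (p ^ l))"
  have hc: "fps_conv_radius (H oo fps_X ^ (p ^ l)) \<ge> 1" and fc: "fps_conv_radius (F oo fps_X ^ (p ^ l)) \<ge> 1" for l
    by (intro compose_X_power_disc(1) Hc Fc pk)+
  have \<Pi>c: "fps_conv_radius \<Pi>f \<ge> 1" unfolding \<Pi>f_def by (intro conv_radius_prod hc)
  have comp: "F oo fps_X ^ (p ^ k) = (H oo fps_X ^ (p ^ k)) * (f oo fps_X ^ (p ^ k))" for k
    unfolding F using pk[of k] by (intro fps_compose_mult_distrib) simp
  have fps_id: "fps_of_poly E * (F oo fps_X ^ M) * \<Pi>f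
    = (H oo fps_X ^ M) * (\<Sum>i<n. fps_of_poly (P i) * ((F oo fps_X ^ (p ^ i)) * (\<Prod>l\<in>{..<n} - {i}. H oo fps_X ^ (p ^ l))))"
  proof -
    have "fps_of_poly E * (F oo fps_X ^ M) * \<Pi>f = (H oo fps_X ^ M) * (fps_of_poly E * (f oo fps_X ^ M) * \<Pi>f)"
      unfolding M_def comp by (simp only: mult_ac)
    also have "fps_of_poly E * (f oo fps_X ^ M) * \<Pi>f
      = (\<Sum>i<n. fps_of_poly (P i) * ((F oo fps_X ^ (p ^ i)) * (\<Prod>l\<in>{..<n} - {i}. H oo fps_X ^ (p ^ l))))"
      unfolding E(2) sum_distrib_right
    proof (rule sum.cong[OF refl])
      fix i assume i: "i \<in> {..<n}"
      have "\<Pi>f = (H oo fps_X ^ (p ^ i)) * (\<Prod>l\<in>{..<n} - {i}. H oo fps_X ^ (p ^ l))"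
        unfolding \<Pi>f_def by (rule prod.remove) (use i in simp_all)
      then show "fps_of_poly (P i) * (f oo fps_X ^ (p ^ i)) * \<Pi>f
        = fps_of_poly (P i) * ((F oo fps_X ^ (p ^ i)) * (\<Prod>l\<in>{..<n} - {i}. H oo fps_X ^ (p ^ l)))"
        unfolding comp by (simp only: mult_ac)
    qed
    finally show ?thesis .
  qed
  define S where "S = ball x1 r \<inter> ball 0 1"
  have key: "poly E x * eval_fps F (x ^ M) * eval_fps \<Pi>f x = eval_fps H (x ^ M) * V x * eval_fps \<Pi>f x" if x: "x \<in> S" for x
  proof -
    have x': "norm x < 1" "x \<in> ball x1 r" using x by (auto simp: S_def)
    have ev: "eval_fps (F oo fps_X ^ (p ^ k)) x = eval_fps F (x ^ p ^ k)" "eval_fps (H oo fps_X ^ (p ^ k)) x = eval_fps H (x ^ p ^ k)" for k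
      by (intro compose_X_power_disc(2) Fc Hc pk x'(1))+
    have pc: "fps_conv_radius (\<Prod>l\<in>{..<n} - {i}. H oo fps_X ^ (p ^ l)) \<ge> 1" for i by (intro conv_radius_prod hc)
    have "poly E x * eval_fps F (x ^ M) * eval_fps \<Pi>f x = eval_fps (fps_of_poly E * (F oo fps_X ^ M) * \<Pi>f) x"
      unfolding M_def
      by (simp only: eval_fps_mult_disc[OF fps_conv_radius_mult_ge[OF conv_radius_fps_of_poly fc] \<Pi>c x'(1)]
        eval_fps_mult_disc[OF conv_radius_fps_of_poly fc x'(1)] eval_fps_of_poly_disc[OF x'(1)] ev)
    also have "\<dots> = eval_fps H (x ^ M) * eval_fps (\<Sum>i<n. fps_of_poly (P i) * ((F oo fps_X ^ (p ^ i)) * (\<Prod>l\<in>{..<n} - {i}. H oo fps_X ^ (p ^ l)))) x"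
      unfolding fps_id unfolding M_def ev(2)[symmetric]
      by (intro eval_fps_mult_disc hc conv_radius_sum fps_conv_radius_mult_ge conv_radius_fps_of_poly fc pc x')
    also have "eval_fps (\<Sum>i<n. fps_of_poly (P i) * ((F oo fps_X ^ (p ^ i)) * (\<Prod>l\<in>{..<n} - {i}. H oo fps_X ^ (p ^ l)))) x
      = (\<Sum>i<n. eval_fps (fps_of_poly (P i) * ((F oo fps_X ^ (p ^ i)) * (\<Prod>l\<in>{..<n} - {i}. H oo fps_X ^ (p ^ l)))) x)"
      by (intro eval_fps_sum_disc fps_conv_radius_mult_ge conv_radius_fps_of_poly fc pc x')
    also have "\<dots> = (\<Sum>i<n. poly (P i) x * \<phi> i x * eval_fps \<Pi>f x)"
    proof (rule sum.cong[OF refl])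
      fix i assume i: "i \<in> {..<n}"
      have "\<Pi>f = (H oo fps_X ^ (p ^ i)) * (\<Prod>l\<in>{..<n} - {i}. H oo fps_X ^ (p ^ l))"
        unfolding \<Pi>f_def by (rule prod.remove) (use i in simp_all)
      then have p1: "eval_fps \<Pi>f x = eval_fps H (x ^ p ^ i) * eval_fps (\<Prod>l\<in>{..<n} - {i}. H oo fps_X ^ (p ^ l)) x"
        by (simp only: eval_fps_mult_disc[OF hc pc x'(1)] ev)
      have "eval_fps (fps_of_poly (P i) * ((F oo fps_X ^ (p ^ i)) * (\<Prod>l\<in>{..<n} - {i}. H oo fps_X ^ (p ^ l)))) x
        = poly (P i) x * (eval_fps F (x ^ p ^ i) * eval_fps (\<Prod>l\<in>{..<n} - {i}. H oo fps_X ^ (p ^ l)) x)"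
        by (simp only: eval_fps_mult_disc[OF conv_radius_fps_of_poly fps_conv_radius_mult_ge[OF fc pc] x'(1)]
          eval_fps_mult_disc[OF fc pc x'(1)] eval_fps_of_poly_disc[OF x'(1)] ev)
      also have "eval_fps F (x ^ p ^ i) = eval_fps H (x ^ p ^ i) * \<phi> i x" using \<phi>(2)[of i x] i x' by simp
      finally show "eval_fps (fps_of_poly (P i) * ((F oo fps_X ^ (p ^ i)) * (\<Prod>l\<in>{..<n} - {i}. H oo fps_X ^ (p ^ l)))) x
        = poly (P i) x * \<phi> i x * eval_fps \<Pi>f x" unfolding p1 by (simp only: mult_ac)
    qed
    finally show ?thesis unfolding V_def sum_distrib_right[symmetric] by (simp only: mult_ac)
  qed
  have S: "open S" "connected S" unfolding S_def by (auto intro: convex_connected convex_Int)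
  have main: "poly E x * eval_fps F (x ^ M) = eval_fps H (x ^ M) * V x" if x: "x \<in> S" for x
  proof (rule ccontr)
    assume ne: "poly E x * eval_fps F (x ^ M) \<noteq> eval_fps H (x ^ M) * V x"
    define T where "T x = poly E x * eval_fps F (x ^ M) - eval_fps H (x ^ M) * V x" for x
    have comp_hol: "(\<lambda>x. eval_fps G (x ^ M)) holomorphic_on S" if "eval_fps G holomorphic_on ball 0 1" for G
    proof -
      have "(eval_fps G \<circ> (\<lambda>x. x ^ M)) holomorphic_on S"
        by (rule holomorphic_on_compose_gen[OF _ that]) (auto intro!: holomorphic_intros pow_in simp: S_def M_def simp del: norm_power)
      then show ?thesis by (simp add: o_def)
    qed
    have Th: "T holomorphic_on S" unfolding T_def
      by (intro holomorphic_intros comp_hol Fh Hh holomorphic_on_subset[OF V_hol]) (auto simp: S_def)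
    have \<Pi>h: "eval_fps \<Pi>f holomorphic_on ball 0 1" by (rule eval_fps_holomorphic_disc[OF \<Pi>c])
    have "\<exists>b\<in>S. eval_fps \<Pi>f b \<noteq> 0"
    proof (rule ccontr)
      assume "\<not> (\<exists>b\<in>S. eval_fps \<Pi>f b \<noteq> 0)"
      then have zero: "eval_fps \<Pi>f b = 0" if "b \<in> S" for b using that by simp
      have "eval_fps \<Pi>f 0 = (\<lambda>_. 0) 0"
      proof (rule analytic_continuation_open[where s = S and s' = "ball 0 1" and f = "eval_fps \<Pi>f" and g = "\<lambda>_. 0"])
        show "S \<noteq> {}" using x by (metis empty_iff)
        show "S \<subseteq> ball 0 1" by (simp add: S_def)
        show "connected (ball 0 1 :: complex set)" by (rule connected_ball)
      qed (use S(1) \<Pi>h zero in simp_all)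
      moreover have "eval_fps \<Pi>f 0 = 1"
      proof -
        have "fps_nth (H oo fps_X ^ (p ^ l)) 0 = 1" for l using nth_compose_X_power[OF pk, of H l 0] H0 by simp
        then show ?thesis unfolding \<Pi>f_def by (subst eval_fps_prod_disc[OF hc]) (simp_all add: eval_fps_at_0)
      qed
      ultimately show False by simp
    qed
    then obtain b where b: "b \<in> S" "eval_fps \<Pi>f b \<noteq> 0" by blast
    have "T x \<noteq> 0" using ne by (simp add: T_def)
    have "eval_fps \<Pi>f holomorphic_on S" by (rule holomorphic_on_subset[OF \<Pi>h]) (simp add: S_def)
    from holomorphic_nonzero_mult[OF S Th this x \<open>T x \<noteq> 0\<close> b]
    obtain z where z: "z \<in> S" "T z * eval_fps \<Pi>f z \<noteq> 0" by blast
    then show False using key[OF z(1)] by (simp add: T_def left_diff_distrib)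
  qed
  define \<Theta> where "\<Theta> v = poly K (x1 * exp (v / of_nat M)) * V (x1 * exp (v / of_nat M))" for v
  have near: "x1 * exp (v / of_nat M) \<in> ball x1 r" if "v \<in> ball 0 (real M * r')" for v
    using that M(1) by (intro r'(2)) (simp add: norm_divide field_simps)
  have \<Theta>_hol: "\<Theta> holomorphic_on ball 0 (real M * r')"
  proof -
    have "(V \<circ> (\<lambda>v. x1 * exp (v / of_nat M))) holomorphic_on ball 0 (real M * r')"
      by (rule holomorphic_on_compose_gen[OF _ V_hol]) (use near M(1) in \<open>auto intro!: holomorphic_intros simp del: mem_ball\<close>)
    then have "(\<lambda>v. V (x1 * exp (v / of_nat M))) holomorphic_on ball 0 (real M * r')" by (simp add: o_def)
    then show ?thesis unfolding \<Theta>_def using M(1) by (intro holomorphic_intros) auto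
  qed
  \<comment> \<open>Near 0, where \<open>H\<close> has no zeros, the function to be continued can be
    written down directly.\<close>
  define W0 where "W0 y = poly D y * eval_fps F y / eval_fps H y" for y
  have W0_hol: "W0 holomorphic_on ball 0 \<rho>" unfolding W0_def
    using \<rho> by (intro holomorphic_intros holomorphic_on_subset[OF Fh] holomorphic_on_subset[OF Hh]) auto
  have "\<exists>W. W holomorphic_on ball 0 (exp 1) \<and> (\<forall>y\<in>ball 0 \<rho>. W y = W0 y)"
  proof (rule logarithmic_extension[OF W0_hol \<rho>(1,2) _ \<Theta>_hol M(2)])
    show "norm (x1 ^ M) = 1" using x1(3) by (simp add: norm_power)
    fix v assume v: "v \<in> ball 0 (real M * r')" "norm (x1 ^ M * exp v) < \<rho>"
    define x where "x = x1 * exp (v / of_nat M)"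
    have xM: "x ^ M = x1 ^ M * exp v" using M(1) by (simp add: x_def power_mult_distrib flip: exp_of_nat_mult)
    have "norm x ^ M < 1" using v(2) \<rho>(2) unfolding xM[symmetric] by (simp add: norm_power)
    then have "norm x < 1" using M(1) by (simp add: power_less_one_iff)
    then have "x \<in> S" using near[OF v(1)] by (simp add: S_def x_def)
    from main[OF this] have "poly D (x ^ M) * eval_fps F (x ^ M) = eval_fps H (x ^ M) * (poly K x * V x)"
      unfolding D'[rule_format] by (simp add: mult_ac)
    then show "\<Theta> v = W0 (x1 ^ M * exp v)"
      using \<rho>(3)[OF v(2)] unfolding W0_def \<Theta>_def xM[symmetric] x_def[symmetric] by (simp add: field_simps)
  qed
  then obtain W where W: "W holomorphic_on ball 0 (exp 1)" "\<And>y. y \<in> ball 0 \<rho> \<Longrightarrow> W y = W0 y" by blast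
  define w where "w = fps_expansion W 0"
  have We: "W holomorphic_on eball 0 (ereal (exp 1))" using W(1) by simp
  have wc: "fps_conv_radius w \<ge> ereal (exp 1)" unfolding w_def by (rule conv_radius_fps_expansion[OF We])
  \<comment> \<open>The last step works with a radius strictly between 1 and \<open>exp 1\<close>;
    3/2 is taken.\<close>
  have e2: "exp 1 > (3 / 2::real)" using exp_ge_add_one_self[of "1::real"] by simp
  have w_eval: "eval_fps w y = W y" if "norm y < exp 1" for y
    unfolding w_def using eval_fps_expansion'[OF We, of y] that by simp
  have wc1: "fps_conv_radius w \<ge> 1" using e2 by (intro order_trans[OF _ wc]) (simp add: one_ereal_def)
  have Dc: "fps_conv_radius (fps_of_poly D) \<ge> 1" by (rule conv_radius_fps_of_poly)
  have "fps_of_poly D * F = H * w"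
  proof (rule eval_fps_eqD)
    show "fps_conv_radius (fps_of_poly D * F) > 0" "fps_conv_radius (H * w) > 0"
      by (rule less_le_trans[of 0 1], simp, intro fps_conv_radius_mult_ge Dc Fc Hc wc1)+
    have "eventually (\<lambda>y. y \<in> ball (0::complex) \<rho>) (nhds 0)" using \<rho>(1) by (intro eventually_nhds_in_open) auto
    then show "eventually (\<lambda>y. eval_fps (fps_of_poly D * F) y = eval_fps (H * w) y) (nhds 0)"
    proof eventually_elim
      case (elim y)
      then have y: "norm y < \<rho>" "norm y < 1" "norm y < exp 1" using \<rho>(2) e2 by auto
      show ?case using W(2)[OF elim] \<rho>(3)[OF y(1)] w_eval[OF y(3)]
        by (simp add: eval_fps_mult_disc Dc Fc Hc wc1 y eval_fps_of_poly_disc W0_def)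
    qed
  qed
  then have "H * (fps_of_poly D * f) = H * w" unfolding F by (simp add: mult_ac)
  moreover have "H \<noteq> 0" using H0 by auto
  ultimately have "fps_of_poly D * f = w" by simp
  moreover have "geo (3 / 2) w" by (rule geo_conv_radius) (use e2 wc in \<open>auto intro: less_le_trans[of _ "ereal (exp 1)"]\<close>)
  ultimately show ?thesis by (intro mahler_rational[OF p n an eq D]) auto
qed

section \<open>Between the unit circle and the line Im s = pi / 2\<close>

lemma near_root_tends:
  assumes "open U" "\<zeta> \<in> U"
  obtains \<sigma> where "\<sigma> \<ge> 0" "\<And>s. Re s > \<sigma> \<Longrightarrow> near_root \<zeta> s \<in> U"
proof -
  obtain e where e: "e > 0" "ball \<zeta> e \<subseteq> U" using assms by (meson openE)
  have "isCont (\<lambda>\<tau>. \<zeta> * exp (- \<tau>)) 0" by (intro continuous_intros)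
  then obtain d where d: "d > 0" "\<And>\<tau>. dist \<tau> 0 < d \<Longrightarrow> dist (\<zeta> * exp (- \<tau>)) (\<zeta> * exp (- 0)) < e"
    unfolding continuous_at_eps_delta using e(1) by metis
  show thesis
  proof (rule that[of "max 0 (- ln d)"])
    fix s assume "Re s > max 0 (- ln d)"
    then have "exp (- Re s) < exp (ln d)" by (subst exp_less_cancel_iff) linarith
    then have "dist (exp (- s)) 0 < d" using d(1) by simp
    from d(2)[OF this] show "near_root \<zeta> s \<in> U"
      by (intro subsetD[OF e(2)]) (simp add: near_root_def dist_commute)
  qed simp
qed

text \<open>For \<open>Im s = pi / 2\<close> the number \<open>exp (- s)\<close> is purely
  imaginary, so \<open>near_root \<zeta> s\<close> lies on the circle. Its local inverse
  \<open>G\<close> consists of two principal logarithms, and the extension is transported along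
  it.\<close>

lemma extends_transfer:
  assumes \<zeta>: "norm \<zeta> = 1" and z1: "Im z1 = pi / 2" "Re z1 > 0" and r1: "r1 > 0"
    and \<phi>: "\<phi> holomorphic_on ball z1 r1"
    and eq: "\<And>s. s \<in> ball z1 r1 \<Longrightarrow> Im s < pi / 2 \<Longrightarrow>
      eval_fps F (near_root \<zeta> s) = eval_fps H (near_root \<zeta> s) * \<phi> s"
    and U: "open U" "near_root \<zeta> z1 \<in> U"
  shows "\<exists>B'. circle_ball B' \<and> B' \<subseteq> U \<and> extends_on F H 1 B'"
proof -
  have \<zeta>0: "\<zeta> \<noteq> 0" using \<zeta> by auto
  define x1 where "x1 = near_root \<zeta> z1"
  have x1n: "norm x1 = 1" unfolding x1_def near_root_norm z1(1) using \<zeta> by simp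
  define \<tau> where "\<tau> = exp (- z1)"
  have Re\<tau>: "Re \<tau> = 0" unfolding \<tau>_def Re_exp uminus_complex.sel z1(1) by simp
  have Im\<tau>: "Im \<tau> = - exp (- Re z1)" unfolding \<tau>_def Im_exp uminus_complex.sel z1(1) by simp
  \<comment> \<open>With \<open>Re z1 > 0\<close> the imaginary part of \<tau> is below 1 in
    modulus, so the principal logarithm of \<open>x1 / \<zeta>\<close> is
    \<open>- \<tau>\<close>.\<close>
  have Im\<tau>b: "Im \<tau> < 0" "Im \<tau> > - 1" unfolding Im\<tau> using z1 by simp_all
  have pi2: "pi / 2 > 1" using pi_gt3 by simp
  have x1\<zeta>: "x1 / \<zeta> = exp (- \<tau>)" using \<zeta>0 by (simp add: x1_def near_root_def \<tau>_def)
  have Rex1: "Re (x1 / \<zeta>) > 0"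
  proof -
    have "cos (Im \<tau>) > 0" using Im\<tau>b pi2 by (intro cos_gt_zero_pi) linarith+
    then show ?thesis unfolding x1\<zeta> Re_exp using Re\<tau> by simp
  qed
  define a where "a x = - Ln (x / \<zeta>)" for x
  have ax1: "a x1 = \<tau>" unfolding a_def x1\<zeta> using Im\<tau>b pi2 by (subst Ln_exp) auto
  define G where "G x = - Ln (a x)" for x
  have "Im z1 < pi" "- Im z1 \<le> pi" using z1(1) pi_gt_zero by linarith+
  then have Gx1: "G x1 = z1" unfolding G_def ax1 \<tau>_def by (subst Ln_exp) simp_all
  define V where "V = {x. Re (x / \<zeta>) > 0}"
  have "open V" unfolding V_def by (intro open_Collect_less continuous_intros) (use \<zeta>0 in auto)
  have a_hol: "a holomorphic_on V" unfolding a_def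
    by (intro holomorphic_intros) (use \<zeta>0 in \<open>auto simp: V_def complex_nonpos_Reals_iff\<close>)
  define V' where "V' = V \<inter> a -` {z. Im z < 0}"
  have "open V'" unfolding V'_def
    by (intro continuous_open_preimage holomorphic_on_imp_continuous_on[OF a_hol] \<open>open V\<close> open_halfspace_Im_lt)
  have G_hol: "G holomorphic_on V'" unfolding G_def
    by (intro holomorphic_intros holomorphic_on_subset[OF a_hol]) (auto simp: V'_def complex_nonpos_Reals_iff)
  define V2 where "V2 = V' \<inter> G -` ball z1 r1"
  have "open V2" unfolding V2_def
    by (intro continuous_open_preimage holomorphic_on_imp_continuous_on[OF G_hol] \<open>open V'\<close> open_ball)
  have "x1 \<in> V" using Rex1 by (simp add: V_def)
  then have "x1 \<in> V'" using ax1 Im\<tau>b by (simp add: V'_def)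
  then have "x1 \<in> V2" using Gx1 r1 by (simp add: V2_def)
  then have "x1 \<in> V2 \<inter> U" using U(2) by (simp add: x1_def)
  then obtain \<rho> where \<rho>: "\<rho> > 0" "ball x1 \<rho> \<subseteq> V2 \<inter> U" using \<open>open V2\<close> U(1) by (meson openE open_Int)
  have "(\<phi> \<circ> G) holomorphic_on ball x1 \<rho>"
    by (rule holomorphic_on_compose_gen[OF _ \<phi>]) (use \<rho> in \<open>auto intro: holomorphic_on_subset[OF G_hol] simp: V2_def\<close>)
  moreover have "eval_fps F (x ^ 1) = eval_fps H (x ^ 1) * (\<phi> \<circ> G) x" if x: "x \<in> ball x1 \<rho>" "norm x < 1" for x
  proof -
    have xV: "x \<in> V2" using x(1) \<rho>(2) by blast
    then have xV': "x \<in> V'" "G x \<in> ball z1 r1" by (simp_all add: V2_def)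
    then have "x / \<zeta> \<noteq> 0" "Im (a x) \<noteq> 0" by (auto simp: V'_def V_def)
    then have nz: "x / \<zeta> \<noteq> 0" "a x \<noteq> 0" by auto
    have G: "near_root \<zeta> (G x) = x" using nz \<zeta>0 by (simp add: near_root_def G_def exp_Ln) (simp add: a_def exp_Ln)
    have "Re (a x) = - ln (norm (x / \<zeta>))" unfolding a_def using nz by (simp add: Re_Ln)
    moreover have "ln (norm (x / \<zeta>)) < ln 1" using nz x(2) \<zeta> by (subst ln_less_cancel_iff) (auto simp: norm_divide)
    ultimately have "Re (a x) > 0" by simp
    then have "\<bar>Im (Ln (a x))\<bar> < pi / 2" by (rule Re_Ln_pos_lt_imp)
    then have "Im (G x) < pi / 2" by (simp add: G_def)
    from eq[OF xV'(2) this] show ?thesis unfolding G by simp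
  qed
  ultimately have "extends_on F H 1 (ball x1 \<rho>)" unfolding extends_on_def by blast
  moreover have "circle_ball (ball x1 \<rho>)" unfolding circle_ball_def using \<rho>(1) x1n by blast
  ultimately show ?thesis using \<rho>(2) by blast
qed

text \<open>For real \<open>s\<close> the point \<open>near_root \<zeta> s\<close> runs along the
  radius to \<zeta>, and a power series that vanishes on a piece of it is zero.\<close>

lemma eval_near_root_nonzero:
  fixes E :: "complex fps"
  assumes E: "E \<noteq> 0" "fps_conv_radius E \<ge> 1" and \<zeta>: "norm \<zeta> = 1"
  obtains s :: real where "s > \<sigma>" "eval_fps E (near_root \<zeta> (of_real s)) \<noteq> 0"
proof (rule ccontr)
  assume nt: "\<not> thesis"
  note outer = that
  have zero: "eval_fps E (near_root \<zeta> (of_real s)) = 0" if "s > \<sigma>" for s using outer[OF that] nt by blast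
  have \<zeta>0: "\<zeta> \<noteq> 0" using \<zeta> by auto
  have strip: "of_real s \<in> strip" for s by (simp add: strip_def)
  define X where "X s = near_root \<zeta> (of_real s)" for s :: real
  have X_eq: "X s = \<zeta> * of_real (exp (- exp (- s)))" for s by (simp add: X_def near_root_def flip: exp_of_real)
  have inj: "X s = X t \<Longrightarrow> s = t" for s t unfolding X_eq using \<zeta>0 by simp
  have lim: "X (\<sigma> + 1) islimpt X ` {\<sigma><..}"
    unfolding islimpt_sequential
  proof (intro exI conjI allI)
    show "X (\<sigma> + 1 + inverse (real (Suc k))) \<in> X ` {\<sigma><..} - {X (\<sigma> + 1)}" for k
    proof -
      have p: "inverse (real (Suc k)) > 0" by simp
      then have "\<sigma> + 1 + inverse (real (Suc k)) \<in> {\<sigma><..}" by (simp add: add_pos_pos del: of_nat_Suc)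
      moreover have "X (\<sigma> + 1 + inverse (real (Suc k))) \<noteq> X (\<sigma> + 1)" using inj[of "\<sigma> + 1 + inverse (real (Suc k))" "\<sigma> + 1"] p by auto
      ultimately show ?thesis by blast
    qed
    have "isCont X (\<sigma> + 1)" unfolding X_eq[abs_def] by (intro continuous_intros)
    then show "(\<lambda>k. X (\<sigma> + 1 + inverse (real (Suc k)))) \<longlonglongrightarrow> X (\<sigma> + 1)"
      by (rule isCont_tendsto_compose[OF _ LIMSEQ_inverse_real_of_nat_add])
  qed
  have zero': "eval_fps E z = 0" if "norm z < 1" for z
  proof (rule analytic_continuation[of "eval_fps E" "ball 0 1" "X ` {\<sigma><..}" "X (\<sigma> + 1)"])
    show "eval_fps E holomorphic_on ball 0 1" by (rule eval_fps_holomorphic_disc[OF E(2)])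
    show "X ` {\<sigma><..} \<subseteq> ball 0 1" "X (\<sigma> + 1) \<in> ball 0 1"
      using near_root_strip[OF \<zeta> strip] by (auto simp: X_def simp del: of_real_add)
    show "eval_fps E x = 0" if "x \<in> X ` {\<sigma><..}" for x using that zero by (auto simp: X_def)
  qed (use lim that in auto)
  have "E = 0"
  proof (rule eval_fps_eqD)
    show "fps_conv_radius E > 0" by (rule less_le_trans[OF _ E(2)]) simp
    have "eventually (\<lambda>y. y \<in> ball (0::complex) 1) (nhds 0)" by (intro eventually_nhds_in_open) auto
    then show "eventually (\<lambda>z. eval_fps E z = eval_fps 0 z) (nhds 0)" by eventually_elim (simp add: zero')
  qed simp
  then show False using E(1) by simp
qed

lemma nonzero_on_open_subset:
  assumes "f holomorphic_on T" "open T" "connected T" "z \<in> T" "f z \<noteq> 0" "open S" "S \<noteq> {}" "S \<subseteq> T"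
  obtains b where "b \<in> S" "f b \<noteq> 0"
proof (rule ccontr)
  assume nt: "\<not> thesis"
  note outer = that
  have "f b = 0" if "b \<in> S" for b using outer[OF that] nt by blast
  have "f z = (\<lambda>_. 0) z"
    by (rule analytic_continuation_open[where s = S and s' = T and f = f and g = "\<lambda>_. 0"])
      (fact assms holomorphic_on_const \<open>\<And>b. b \<in> S \<Longrightarrow> f b = 0\<close>)+
  then show False using assms by simp
qed

text \<open>The bound \<open>r \<le> 1\<close> keeps the half below the line inside the strip, away
  from the other edge.\<close>

definition line_ball :: "real \<Rightarrow> complex set \<Rightarrow> bool" where
  "line_ball \<sigma> B \<longleftrightarrow> (\<exists>z r. B = ball z r \<and> 0 < r \<and> r \<le> 1 \<and> Im z = pi / 2 \<and> (\<forall>s\<in>B. Re s > \<sigma>))"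

lemma line_ball_lower: "line_ball \<sigma> B \<Longrightarrow> s \<in> B \<Longrightarrow> Im s < pi / 2 \<Longrightarrow> s \<in> strip \<and> Re s > \<sigma>"
proof -
  assume "line_ball \<sigma> B" "s \<in> B" "Im s < pi / 2"
  then obtain z r where z: "B = ball z r" "r \<le> 1" "Im z = pi / 2" "\<forall>s\<in>B. Re s > \<sigma>" unfolding line_ball_def by blast
  have "\<bar>Im (z - s)\<bar> \<le> norm (z - s)" by (rule abs_Im_le_cmod)
  then have "\<bar>pi / 2 - Im s\<bar> < 1" using \<open>s \<in> B\<close> z by (simp add: dist_norm)
  then show ?thesis using pi_gt3 z(4) \<open>s \<in> B\<close> \<open>Im s < pi / 2\<close> by (auto simp: strip_def abs_less_iff)
qed

lemma line_ball_exists: "\<exists>B. line_ball \<sigma> B"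
proof -
  have "Re s > \<sigma>" if "s \<in> ball (Complex (\<sigma> + 2) (pi / 2)) 1" for s
    using that abs_Re_le_cmod[of "Complex (\<sigma> + 2) (pi / 2) - s"] by (simp add: dist_norm)
  then show ?thesis unfolding line_ball_def
    by (intro exI[of _ "ball (Complex (\<sigma> + 2) (pi / 2)) 1"] exI[of _ "Complex (\<sigma> + 2) (pi / 2)"] exI[of _ 1]) auto
qed

text \<open>By the identity theorem, non-vanishing somewhere to the right of \<sigma> gives
  non-vanishing in the ball at hand, as \<open>algebraic_extension\<close> requires.\<close>

lemma line_ball_extension:
  fixes A :: "nat \<Rightarrow> complex \<Rightarrow> complex"
  assumes A: "\<And>i. i \<le> d \<Longrightarrow> A i holomorphic_on {s. Re s > \<sigma>}" and A0: "i0 \<le> d" "Re a > \<sigma>" "A i0 a \<noteq> 0"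
    and N: "N holomorphic_on (strip \<inter> {s. Re s > \<sigma>})" and H: "H holomorphic_on (strip \<inter> {s. Re s > \<sigma>})"
    and H0: "b \<in> strip" "Re b > \<sigma>" "H b \<noteq> 0"
    and eq: "\<And>s. s \<in> strip \<Longrightarrow> Re s > \<sigma> \<Longrightarrow> (\<Sum>i\<le>d. A i s * N s ^ i * H s ^ (d - i)) = 0"
    and B: "line_ball \<sigma> B"
  shows "\<exists>B'. line_ball \<sigma> B' \<and> B' \<subseteq> B \<and> (\<exists>\<phi>. \<phi> holomorphic_on B' \<and> (\<forall>s\<in>B'. Im s < pi / 2 \<longrightarrow> N s = H s * \<phi> s))"
proof -
  obtain z r where z: "B = ball z r" "0 < r" "r \<le> 1" "Im z = pi / 2" "\<forall>s\<in>B. Re s > \<sigma>"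
    using B unfolding line_ball_def by blast
  define S where "S = ball z r \<inter> {s. Im s < pi / 2}"
  have low: "S \<subseteq> strip \<inter> {s. Re s > \<sigma>}" using line_ball_lower[OF B] unfolding S_def z(1) by blast
  have "z - \<i> * of_real (r / 2) \<in> S" using z(2,4) by (simp add: S_def dist_norm norm_mult)
  then have Sne: "S \<noteq> {}" by blast
  have Sop: "open S" unfolding S_def by (intro open_Int open_ball open_halfspace_Im_lt)
  have cvx: "convex (strip \<inter> {s. Re s > \<sigma>})"
  proof -
    have eq: "strip = {s. Im s < pi / 2} \<inter> {s. Im s > - (pi / 2)}" by (auto simp: strip_def)
    show ?thesis unfolding eq by (intro convex_Int convex_halfspace_Im_lt convex_halfspace_Im_gt convex_halfspace_Re_gt)
  qed
  have Bsub: "B \<subseteq> {s. Re s > \<sigma>}" using z(5) by blast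
  obtain a' where a': "a' \<in> B" "A i0 a' \<noteq> 0"
    by (rule nonzero_on_open_subset[OF A[OF A0(1)] open_halfspace_Re_gt convex_connected[OF convex_halfspace_Re_gt], of a B])
      (use A0 z Bsub in simp_all)
  obtain b' where b': "b' \<in> S" "H b' \<noteq> 0"
    by (rule nonzero_on_open_subset[OF H _ convex_connected[OF cvx], of b S])
      (use H0 Sop Sne low in \<open>auto intro: open_Int open_strip open_halfspace_Re_gt\<close>)
  have "\<exists>z1 r1 \<phi>. Im z1 = pi / 2 \<and> r1 > 0 \<and> ball z1 r1 \<subseteq> ball z r \<and> \<phi> holomorphic_on ball z1 r1 \<and>
    (\<forall>s\<in>ball z1 r1. Im s < pi / 2 \<longrightarrow> N s = H s * \<phi> s)"
  proof (rule algebraic_extension[where d = d and A = A and ?i0.0 = i0 and a = a' and b = b'])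
    show "A i holomorphic_on ball z r" if "i \<le> d" for i by (rule holomorphic_on_subset[OF A[OF that]]) (use Bsub z(1) in simp)
    show "N holomorphic_on ball z r \<inter> {s. Im s < pi / 2}" "H holomorphic_on ball z r \<inter> {s. Im s < pi / 2}"
      using holomorphic_on_subset[OF N low] holomorphic_on_subset[OF H low] by (simp_all add: S_def)
    show "(\<Sum>i\<le>d. A i s * N s ^ i * H s ^ (d - i)) = 0" if "s \<in> ball z r" "Im s < pi / 2" for s
      using line_ball_lower[OF B, of s] that z(1) by (intro eq) auto
  qed (use z A0 a' b' in \<open>auto simp: S_def\<close>)
  then obtain z1 r1 \<phi> where z1: "Im z1 = pi / 2" "r1 > 0" "ball z1 r1 \<subseteq> ball z r" "\<phi> holomorphic_on ball z1 r1"
    "\<forall>s\<in>ball z1 r1. Im s < pi / 2 \<longrightarrow> N s = H s * \<phi> s" by (elim exE conjE)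
  define B' where "B' = ball z1 (min r1 1)"
  have sub: "B' \<subseteq> ball z1 r1" by (auto simp: B'_def)
  then have sub': "B' \<subseteq> B" using z1(3) z(1) by blast
  have "line_ball \<sigma> B'" unfolding line_ball_def
    by (intro exI[of _ z1] exI[of _ "min r1 1"]) (use z1 z(5) sub' in \<open>auto simp: B'_def\<close>)
  moreover have "\<phi> holomorphic_on B'" by (rule holomorphic_on_subset[OF z1(4) sub])
  ultimately show ?thesis using sub sub' z1(5) by blast
qed

lemma transcendental_equation:
  fixes g :: "complex fps"
  assumes "G = K * g" "(\<Sum>j\<le>D. fps_of_poly (d j) * g ^ j) = 0" "fps_conv_radius G \<ge> 1" "fps_conv_radius K \<ge> 1" "norm x < 1"
  shows "(\<Sum>j\<le>D. poly (d j) x * eval_fps G x ^ j * eval_fps K x ^ (D - j)) = 0"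
proof -
  have "(\<Sum>j\<le>D. fps_of_poly (d j) * (G ^ j * K ^ (D - j))) = K ^ D * (\<Sum>j\<le>D. fps_of_poly (d j) * g ^ j)"
    unfolding sum_distrib_left
  proof (rule sum.cong[OF refl])
    fix j assume "j \<in> {..D}"
    then have "K ^ D = K ^ j * K ^ (D - j)" by (simp flip: power_add)
    then show "fps_of_poly (d j) * (G ^ j * K ^ (D - j)) = K ^ D * (fps_of_poly (d j) * g ^ j)"
      unfolding assms(1) by (simp only: power_mult_distrib mult_ac)
  qed
  then have "(\<Sum>j\<le>D. fps_of_poly (d j) * (G ^ j * K ^ (D - j))) = 0" using assms(2) by simp
  then have "0 = eval_fps (\<Sum>j\<le>D. fps_of_poly (d j) * (G ^ j * K ^ (D - j))) x" by simp
  also have "\<dots> = (\<Sum>j\<le>D. eval_fps (fps_of_poly (d j) * (G ^ j * K ^ (D - j))) x)"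
    by (intro eval_fps_sum_disc fps_conv_radius_mult_ge conv_radius_power conv_radius_fps_of_poly assms)
  also have "\<dots> = (\<Sum>j\<le>D. poly (d j) x * eval_fps G x ^ j * eval_fps K x ^ (D - j))"
  proof (rule sum.cong[OF refl])
    fix j
    have "eval_fps (fps_of_poly (d j) * (G ^ j * K ^ (D - j))) x = eval_fps (fps_of_poly (d j)) x * (eval_fps (G ^ j) x * eval_fps (K ^ (D - j)) x)"
      using assms(3-5) by (simp only: eval_fps_mult_disc fps_conv_radius_mult_ge conv_radius_power conv_radius_fps_of_poly)
    then show "eval_fps (fps_of_poly (d j) * (G ^ j * K ^ (D - j))) x = poly (d j) x * eval_fps G x ^ j * eval_fps K x ^ (D - j)"
      using assms(3-5) by (simp only: eval_fps_power_disc eval_fps_of_poly_disc mult.assoc)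
  qed
  finally show ?thesis by simp
qed

section \<open>Transcendence of a single Mahler function\<close>

lemma eval_near_root_holomorphic:
  assumes "fps_conv_radius F \<ge> 1" "norm \<zeta> = 1"
  shows "(\<lambda>s. eval_fps F (near_root \<zeta> s)) holomorphic_on strip"
proof -
  have "(eval_fps F \<circ> near_root \<zeta>) holomorphic_on strip"
    by (rule holomorphic_on_compose_gen[OF near_root_holomorphic eval_fps_holomorphic_disc[OF assms(1)]])
      (auto intro!: near_root_strip assms)
  then show ?thesis by (simp add: o_def)
qed

lemma poly_near_root_holomorphic: "(\<lambda>s. poly q (near_root \<zeta> s)) holomorphic_on A"
  by (induction q) (auto intro!: holomorphic_intros near_root_holomorphic)

text \<open>An algebraic equation for \<open>g\<close> has polynomial coefficients, which are
  holomorphic across the circle, so \<open>algebraic_extension\<close> applies near every point of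
  the circle and \<open>g\<close> would be rational.\<close>

theorem mahler_transcendental:
  assumes p: "p \<ge> 2" and n: "n \<ge> 1" and an: "a n \<noteq> 0"
    and eq: "(\<Sum>i\<le>n. fps_of_poly (a i) * (g oo fps_X ^ (p ^ i))) = 0"
    and K0: "fps_nth K 0 = 1" and G: "G = K * g"
    and Gc: "fps_conv_radius G \<ge> 1" and Kc: "fps_conv_radius K \<ge> 1"
    and irr: "\<not> is_rational_fps g" and d: "j0 \<le> D" "d j0 \<noteq> 0"
  shows "(\<Sum>j\<le>D. fps_of_poly (d j) * g ^ j) \<noteq> 0"
proof
  assume rel: "(\<Sum>j\<le>D. fps_of_poly (d j) * g ^ j) = 0"
  have "is_rational_fps g"
  proof (rule dense_extension_rational[OF p n an eq K0 G Gc Kc])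
    fix B assume "circle_ball B"
    then obtain \<zeta> r where \<zeta>: "B = ball \<zeta> r" "r > 0" "norm \<zeta> = 1" unfolding circle_ball_def by blast
    then have B: "open B" "\<zeta> \<in> B" by auto
    obtain \<sigma> where \<sigma>: "\<sigma> \<ge> 0" "\<And>s. Re s > \<sigma> \<Longrightarrow> near_root \<zeta> s \<in> B"
      by (rule near_root_tends[OF B]) (rule that)
    obtain B0 where B0: "line_ball \<sigma> B0" using line_ball_exists by blast
    obtain s1 where s1: "s1 > \<sigma>" "eval_fps (fps_of_poly (d j0)) (near_root \<zeta> (of_real s1)) \<noteq> 0"
      by (rule eval_near_root_nonzero[OF _ conv_radius_fps_of_poly \<zeta>(3), of "d j0"]) (use d in simp, rule that)
    have K: "K \<noteq> 0" using K0 by auto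
    obtain s2 where s2: "s2 > \<sigma>" "eval_fps K (near_root \<zeta> (of_real s2)) \<noteq> 0"
      by (rule eval_near_root_nonzero[OF K Kc \<zeta>(3)]) (rule that)
    have st: "of_real s \<in> strip" for s by (simp add: strip_def)
    have "\<exists>B'. line_ball \<sigma> B' \<and> B' \<subseteq> B0 \<and> (\<exists>\<phi>. \<phi> holomorphic_on B' \<and>
      (\<forall>s\<in>B'. Im s < pi / 2 \<longrightarrow> eval_fps G (near_root \<zeta> s) = eval_fps K (near_root \<zeta> s) * \<phi> s))"
    proof (rule line_ball_extension[where d = D and A = "\<lambda>j s. poly (d j) (near_root \<zeta> s)" and ?i0.0 = j0
          and a = "of_real s1" and b = "of_real s2" and \<sigma> = \<sigma>
          and N = "\<lambda>s. eval_fps G (near_root \<zeta> s)" and H = "\<lambda>s. eval_fps K (near_root \<zeta> s)"])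
      show "poly (d j0) (near_root \<zeta> (of_real s1)) \<noteq> 0"
        using s1(2) near_root_strip[OF \<zeta>(3) st] by (simp add: eval_fps_of_poly_disc)
      show "(\<lambda>s. eval_fps G (near_root \<zeta> s)) holomorphic_on strip \<inter> {s. Re s > \<sigma>}"
        "(\<lambda>s. eval_fps K (near_root \<zeta> s)) holomorphic_on strip \<inter> {s. Re s > \<sigma>}"
        by (rule holomorphic_on_subset[OF eval_near_root_holomorphic[OF _ \<zeta>(3)]]; use Gc Kc in simp)+
      show "(\<Sum>i\<le>D. poly (d i) (near_root \<zeta> s) * eval_fps G (near_root \<zeta> s) ^ i * eval_fps K (near_root \<zeta> s) ^ (D - i)) = 0"
        if "s \<in> strip" for s by (rule transcendental_equation[OF G rel Gc Kc near_root_strip[OF \<zeta>(3) that]])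
    qed (use s1 s2 d B0 st in \<open>simp_all add: poly_near_root_holomorphic\<close>)
    then obtain B' \<phi> where B': "line_ball \<sigma> B'" "\<phi> holomorphic_on B'"
      "\<forall>s\<in>B'. Im s < pi / 2 \<longrightarrow> eval_fps G (near_root \<zeta> s) = eval_fps K (near_root \<zeta> s) * \<phi> s" by (elim exE conjE)
    obtain z r1 where z: "B' = ball z r1" "0 < r1" "Im z = pi / 2" "\<forall>s\<in>B'. Re s > \<sigma>"
      using B'(1) unfolding line_ball_def by blast
    then have zR: "Re z > \<sigma>" by simp
    show "\<exists>B'. circle_ball B' \<and> B' \<subseteq> B \<and> extends_on G K 1 B'"
      by (rule extends_transfer[OF \<zeta>(3) z(3) _ z(2) _ _ B(1) \<sigma>(2)[OF zR]]) (use zR \<sigma>(1) B' z(1) in auto)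
  qed
  then show False using irr by blast
qed

section \<open>Twisting the algebraic relation\<close>

lemma twist_term:
  assumes L: "L > 0" and m: "m holomorphic_on strip" "\<And>s. s \<in> strip \<Longrightarrow> m (s + of_real L) = m s"
    and h: "h holomorphic_on ball 0 (exp (- \<sigma>))"
  shows "twist \<sigma> \<eta> (\<lambda>s. h (exp (- of_real s)) * exp (- lam * of_real s) * of_real s ^ l * m (of_real s))
    (\<lambda>s. h (exp (- of_real s)) * (exp (- \<i> * of_real (\<eta> (Im lam))) * exp (- lam * of_real s)) * of_real s ^ l
      * m (of_real (s + \<eta> (2 * pi / L) * L / (2 * pi))))"
proof -
  have st: "of_real s \<in> strip" for s by (simp add: strip_def)
  have cont: "continuous_on UNIV (\<lambda>s::real. m (of_real s))"
    by (rule continuous_on_compose2[OF holomorphic_on_imp_continuous_on[OF m(1)]])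
      (use st in \<open>auto intro!: continuous_intros\<close>)
  have per: "m (of_real (s + L)) = m (of_real s)" for s using m(2)[OF st, of s] by simp
  define Fr where "Fr = {Im lam, 2 * pi / L}"
  \<comment> \<open>The real part of \<open>lam\<close> is a growth rate, but its imaginary part is
    a frequency, so this exponential is twisted as well.\<close>
  have exp_split: "exp (- lam * of_real s) = of_real (exp (- Re lam * s)) * exp (- \<i> * of_real (Im lam * s))" for s
  proof -
    have "- lam * of_real s = of_real (- Re lam * s) + - \<i> * of_real (Im lam * s)"
      by (simp add: complex_eq_iff)
    then show ?thesis by (simp only: exp_add exp_of_real)
  qed
  have e: "exp (- complex_of_real s) = of_real (exp (- s))" for s by (simp flip: exp_of_real)
  have "adm Fr \<eta> (\<lambda>s. exp (- \<i> * of_real (Im lam * s)) * m (of_real s))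
      (\<lambda>s. (exp (- \<i> * of_real (\<eta> (Im lam))) * exp (- \<i> * of_real (Im lam * s))) * m (of_real (s + \<eta> (2 * pi / L) * L / (2 * pi))))"
    by (rule adm_mult[OF adm_mono[OF adm_exp] adm_mono[OF adm_periodic[OF cont per L]]]) (simp_all add: Fr_def)
  then show ?thesis
    by (rule twist_base[OF h, where \<rho> = "Re lam" and l = l, rotated]) (unfold Fr_def exp_split e, simp_all only: of_real_mult of_real_power mult_ac finite.intros)
qed

text \<open>The terms behind a \<open>qexp\<close> with all data explicit: four such expansions have
  to be brought to one bound \<sigma> and twisted together.\<close>

definition expansion :: "real \<Rightarrow> real \<Rightarrow> (complex \<Rightarrow> complex) \<Rightarrow> nat \<Rightarrow> (nat \<Rightarrow> complex \<Rightarrow> complex) \<Rightarrow> (nat \<Rightarrow> complex)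
    \<Rightarrow> (nat \<Rightarrow> nat) \<Rightarrow> (nat \<Rightarrow> complex \<Rightarrow> complex) \<Rightarrow> bool" where
  "expansion L \<sigma> y n h lam l m \<longleftrightarrow> (\<forall>i<n. m i holomorphic_on strip \<and> (\<forall>s\<in>strip. m i (s + of_real L) = m i s) \<and>
       h i holomorphic_on ball 0 (exp (- \<sigma>))) \<and>
     (\<forall>s\<in>strip. Re s > \<sigma> \<longrightarrow> y s = (\<Sum>i<n. h i (exp (- s)) * exp (- lam i * s) * s ^ l i * m i s))"

lemma expansionD:
  assumes "expansion L \<sigma> y n h lam l m"
  shows "i < n \<Longrightarrow> m i holomorphic_on strip" "i < n \<Longrightarrow> s \<in> strip \<Longrightarrow> m i (s + of_real L) = m i s"
    "i < n \<Longrightarrow> h i holomorphic_on ball 0 (exp (- \<sigma>))"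
    "s \<in> strip \<Longrightarrow> Re s > \<sigma> \<Longrightarrow> y s = (\<Sum>i<n. h i (exp (- s)) * exp (- lam i * s) * s ^ l i * m i s)"
  using assms unfolding expansion_def by blast+

lemma expansion_mono:
  assumes "expansion L \<sigma> y n h lam l m" "\<sigma> \<le> \<sigma>'"
  shows "expansion L \<sigma>' y n h lam l m"
proof -
  have "ball (0::complex) (exp (- \<sigma>')) \<subseteq> ball 0 (exp (- \<sigma>))" by (rule subset_ball) (use assms(2) in simp)
  then have "h i holomorphic_on ball 0 (exp (- \<sigma>'))" if "i < n" for i
    by (rule holomorphic_on_subset[OF expansionD(3)[OF assms(1) that]])
  then show ?thesis using assms unfolding expansion_def by auto
qed

lemma expansion_exists:
  assumes "qexp L y"
  shows "\<exists>\<sigma> n h lam l m. expansion L \<sigma> y n h lam l m"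
proof -
  obtain \<sigma>0 and n :: nat and h lam l m where
    "\<And>i. i < n \<Longrightarrow> m i holomorphic_on strip" "\<And>i s. i < n \<Longrightarrow> s \<in> strip \<Longrightarrow> m i (s + of_real L) = m i s"
    "\<And>i. i < n \<Longrightarrow> h i holomorphic_on ball 0 (exp (- \<sigma>0))"
    "\<And>s. s \<in> strip \<Longrightarrow> Re s > \<sigma>0 \<Longrightarrow> y s = (\<Sum>i<n. h i (exp (- s)) * exp (- lam i * s) * s ^ l i * m i s)"
    by (rule qexp_terms[OF assms]) (rule that)
  then have "expansion L \<sigma>0 y n h lam l m" unfolding expansion_def by blast
  then show ?thesis by blast
qed

text \<open>With \<open>w = s1 - s\<close> the twist fixes \<open>L\<close>-periodic factors and makes \<open>L'\<close>-periodic factors \<open>q\<close> constant, equal to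
  their value at \<open>s1\<close>. Hence the twisted second function is holomorphic beyond the strip.\<close>

definition twisted :: "(real \<Rightarrow> real) \<Rightarrow> nat \<Rightarrow> (nat \<Rightarrow> complex \<Rightarrow> complex) \<Rightarrow> (nat \<Rightarrow> complex) \<Rightarrow> (nat \<Rightarrow> nat)
    \<Rightarrow> (nat \<Rightarrow> complex \<Rightarrow> complex) \<Rightarrow> real \<Rightarrow> complex \<Rightarrow> complex" where
  "twisted \<eta> n h lam l q s1 s = (\<Sum>i<n. h i (exp (- s)) * (exp (- \<i> * of_real (\<eta> (Im (lam i))) * (of_real s1 - s)) * exp (- lam i * s)) * s ^ l i * q i s)"

lemma twist_expansion:
  assumes ex: "expansion L \<sigma> y n h lam l m" and L: "L > 0"
  shows "twist \<sigma> \<eta> (\<lambda>s. y (of_real s)) (\<lambda>s. \<Sum>i<n. h i (exp (- of_real s)) * (exp (- \<i> * of_real (\<eta> (Im (lam i)))) * exp (- lam i * of_real s))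
    * of_real s ^ l i * m i (of_real (s + \<eta> (2 * pi / L) * L / (2 * pi))))"
proof -
  have "twist \<sigma> \<eta> (\<lambda>s. \<Sum>i<n. h i (exp (- of_real s)) * exp (- lam i * of_real s) * of_real s ^ l i * m i (of_real s))
    (\<lambda>s. \<Sum>i<n. h i (exp (- of_real s)) * (exp (- \<i> * of_real (\<eta> (Im (lam i)))) * exp (- lam i * of_real s))
    * of_real s ^ l i * m i (of_real (s + \<eta> (2 * pi / L) * L / (2 * pi))))"
  proof (rule twist_sum)
    fix i assume "i \<in> {..<n}"
    then have i: "i < n" by simp
    show "twist \<sigma> \<eta> (\<lambda>s. h i (exp (- of_real s)) * exp (- lam i * of_real s) * of_real s ^ l i * m i (of_real s))
      (\<lambda>s. h i (exp (- of_real s)) * (exp (- \<i> * of_real (\<eta> (Im (lam i)))) * exp (- lam i * of_real s))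
       * of_real s ^ l i * m i (of_real (s + \<eta> (2 * pi / L) * L / (2 * pi))))"
      by (rule twist_term[OF L expansionD(1)[OF ex i] expansionD(2)[OF ex i] expansionD(3)[OF ex i]])
  qed
  then show ?thesis
  proof (rule twist_cong)
    fix s assume "s > \<sigma>"
    then show "(\<Sum>i<n. h i (exp (- of_real s)) * exp (- lam i * of_real s) * of_real s ^ l i * m i (of_real s)) = y (of_real s)"
      by (intro expansionD(4)[OF ex, symmetric]) (simp_all add: strip_def)
  qed simp
qed

text \<open>Twisting yields relations for real \<open>s\<close> only; the identity theorem carries
  them to the strip.\<close>

lemma real_ray_zero:
  assumes f: "f holomorphic_on (strip \<inter> {s. Re s > \<sigma>})" and zero: "\<And>s. s > \<sigma> \<Longrightarrow> f (of_real s) = 0"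
    and z: "z \<in> strip" "Re z > \<sigma>"
  shows "f z = 0"
proof (rule analytic_continuation[OF f, where U = "of_real ` {\<sigma><..}" and \<xi> = "of_real (\<sigma> + 1)"])
  show "open (strip \<inter> {s. Re s > \<sigma>})" by (intro open_Int open_strip open_halfspace_Re_gt)
  have eq: "strip = {s. Im s < pi / 2} \<inter> {s. Im s > - (pi / 2)}" by (auto simp: strip_def)
  have "convex (strip \<inter> {s. Re s > \<sigma>})"
    unfolding eq by (intro convex_Int convex_halfspace_Im_lt convex_halfspace_Im_gt convex_halfspace_Re_gt)
  then show "connected (strip \<inter> {s. Re s > \<sigma>})" by (rule convex_connected)
  show "of_real ` {\<sigma><..} \<subseteq> strip \<inter> {s. Re s > \<sigma>}" "of_real (\<sigma> + 1) \<in> strip \<inter> {s. Re s > \<sigma>}"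
    by (auto simp: strip_def)
  show "complex_of_real (\<sigma> + 1) islimpt of_real ` {\<sigma><..}"
    unfolding islimpt_approachable
  proof (intro allI impI)
    fix e :: real assume e: "e > 0"
    have "dist (complex_of_real (\<sigma> + 1 + e / 2)) (of_real (\<sigma> + 1)) = e / 2"
      unfolding dist_norm of_real_diff[symmetric] norm_of_real using e by simp
    moreover have "complex_of_real (\<sigma> + 1 + e / 2) \<noteq> of_real (\<sigma> + 1)" unfolding of_real_eq_iff using e by simp
    moreover have "complex_of_real (\<sigma> + 1 + e / 2) \<in> of_real ` {\<sigma><..}" using e by (intro imageI) simp
    ultimately show "\<exists>x'\<in>of_real ` {\<sigma><..}. x' \<noteq> complex_of_real (\<sigma> + 1) \<and> dist x' (of_real (\<sigma> + 1)) < e"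
      using e by (intro bexI[of _ "complex_of_real (\<sigma> + 1 + e / 2)"]) auto
  qed
  show "f x = 0" if "x \<in> of_real ` {\<sigma><..}" for x using that zero by auto
  show "z \<in> strip \<inter> {s. Re s > \<sigma>}" using z by simp
qed

lemma twisted_holomorphic:
  assumes "\<And>i. i < n \<Longrightarrow> h i holomorphic_on ball 0 (exp (- \<sigma>))" "\<And>i. i < n \<Longrightarrow> q i holomorphic_on A" "A \<subseteq> {s. Re s > \<sigma>}"
  shows "twisted \<eta> n h lam l q s1 holomorphic_on A"
proof -
  have "(\<lambda>s. h i (exp (- s))) holomorphic_on A" if "i < n" for i
  proof -
    have "(h i \<circ> (\<lambda>s. exp (- s))) holomorphic_on A"
      by (rule holomorphic_on_compose_gen[OF _ assms(1)[OF that]]) (use assms(3) in \<open>auto intro!: holomorphic_intros\<close>)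
    then show ?thesis by (simp add: o_def)
  qed
  then show ?thesis unfolding twisted_def[abs_def] using assms(2) by (intro holomorphic_intros) auto
qed

text \<open>The coefficients of the Lagrange basis polynomials at the nodes
  \<open>x \<nu>\<close>.\<close>

lemma lagrange_coefficients:
  fixes x :: "'a \<Rightarrow> complex"
  assumes "finite M" "inj_on x M"
  shows "\<exists>e. \<forall>\<mu>\<in>M. \<forall>\<nu>\<in>M. (\<Sum>k\<le>card M. e \<mu> k * x \<nu> ^ k) = (if \<mu> = \<nu> then 1 else 0)"
proof -
  define P where "P \<mu> = (\<Prod>\<nu>\<in>M - {\<mu>}. Polynomial.smult (inverse (x \<mu> - x \<nu>)) [:- x \<nu>, 1:])" for \<mu>
  have "(\<Sum>k\<le>card M. Polynomial.coeff (P \<mu>) k * x \<nu> ^ k) = (if \<mu> = \<nu> then 1 else 0)" if \<mu>: "\<mu> \<in> M" and \<nu>: "\<nu> \<in> M" for \<mu> \<nu>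
  proof -
    have "degree (P \<mu>) \<le> (\<Sum>\<nu>\<in>M - {\<mu>}. degree (Polynomial.smult (inverse (x \<mu> - x \<nu>)) [:- x \<nu>, 1:]))"
      unfolding P_def using degree_prod_sum_le[of "M - {\<mu>}" "\<lambda>\<nu>. Polynomial.smult (inverse (x \<mu> - x \<nu>)) [:- x \<nu>, 1:]"]
        assms(1) by (simp only: o_def finite_Diff)
    also have "\<dots> \<le> (\<Sum>\<nu>\<in>M - {\<mu>}. 1)" by (intro sum_mono) (rule order_trans[OF degree_smult_le], simp)
    also have "\<dots> \<le> card M" using card_Diff1_le[of M \<mu>] by simp
    finally have "(\<Sum>k\<le>card M. Polynomial.coeff (P \<mu>) k * x \<nu> ^ k) = poly (P \<mu>) (x \<nu>)" by (rule poly_sum_le[symmetric])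
    also have "\<dots> = (\<Prod>\<nu>'\<in>M - {\<mu>}. inverse (x \<mu> - x \<nu>') * (x \<nu> - x \<nu>'))"
      unfolding P_def poly_prod by (intro prod.cong refl) (simp add: algebra_simps)
    also have "\<dots> = (if \<mu> = \<nu> then 1 else 0)"
    proof (cases "\<mu> = \<nu>")
      case True
      have "(\<Prod>\<nu>'\<in>M - {\<mu>}. inverse (x \<mu> - x \<nu>') * (x \<nu> - x \<nu>')) = (\<Prod>\<nu>'\<in>M - {\<mu>}. 1)"
      proof (rule prod.cong[OF refl])
        fix \<nu>' assume "\<nu>' \<in> M - {\<mu>}"
        then have "x \<mu> \<noteq> x \<nu>'" using inj_onD[OF assms(2), of \<mu> \<nu>'] \<mu> by auto
        then show "inverse (x \<mu> - x \<nu>') * (x \<nu> - x \<nu>') = 1" using True by simp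
      qed
      then show ?thesis using True by simp
    next
      case False
      then show ?thesis using \<nu> assms(1) by (simp add: prod_zero_iff) blast
    qed
    finally show ?thesis .
  qed
  then show ?thesis by (intro exI[of _ "\<lambda>\<mu>. Polynomial.coeff (P \<mu>)"]) blast
qed

text \<open>The step has to separate the phases of distinct elements of \<open>M\<close> and keep
  all sample points within \<epsilon>. With \<open>\<delta> \<le> 1 / C\<close> phases differ by at
  most 2, which is less than a full turn.\<close>

lemma lagrange_step_exists:
  assumes "finite (M :: real set)" "\<epsilon> > 0"
  obtains \<delta> where "\<delta> > 0" "\<And>k. k \<le> card M \<Longrightarrow> real k * \<delta> < \<epsilon>" "inj_on (\<lambda>\<mu>. exp (- \<i> * of_real (\<mu> * \<delta>))) M"
proof -
  define C where "C = 1 + (\<Sum>\<mu>\<in>M. \<bar>\<mu>\<bar>)"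
  have C: "C \<ge> 1" unfolding C_def by (simp add: sum_nonneg)
  have Cb: "\<bar>\<mu>\<bar> \<le> C" if "\<mu> \<in> M" for \<mu>
    using member_le_sum[OF that, of abs] assms(1) unfolding C_def by simp
  define \<delta> where "\<delta> = min (\<epsilon> / (real (card M) + 1)) (1 / C)"
  have \<delta>: "\<delta> > 0" "\<delta> \<le> \<epsilon> / (real (card M) + 1)" "\<delta> \<le> 1 / C" unfolding \<delta>_def using assms(2) C by auto
  show thesis
  proof (rule that[OF \<delta>(1)])
    fix k assume "k \<le> card M"
    then have "real k * \<delta> < (real (card M) + 1) * \<delta>" using \<delta>(1) by (intro mult_strict_right_mono) auto
    also have "\<dots> \<le> \<epsilon>" using \<delta>(2) by (simp add: field_simps)
    finally show "real k * \<delta> < \<epsilon>" .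
  next
    show "inj_on (\<lambda>\<mu>. exp (- \<i> * of_real (\<mu> * \<delta>))) M"
    proof (rule inj_onI)
      fix \<mu> \<nu> assume M: "\<mu> \<in> M" "\<nu> \<in> M" and eq: "exp (- \<i> * of_real (\<mu> * \<delta>)) = exp (- \<i> * of_real (\<nu> * \<delta>))"
      obtain k :: int where "- \<i> * of_real (\<mu> * \<delta>) = - \<i> * of_real (\<nu> * \<delta>) + (of_int (2 * k) * pi) * \<i>"
        using eq exp_eq by blast
      from arg_cong[OF this, of Im] have k: "(\<nu> - \<mu>) * \<delta> = 2 * pi * of_int k" by (simp add: algebra_simps)
      have "\<bar>\<nu> - \<mu>\<bar> \<le> 2 * C" using Cb[OF M(1)] Cb[OF M(2)] by linarith
      then have "\<bar>\<nu> - \<mu>\<bar> * \<delta> \<le> 2 * C * (1 / C)" using \<delta> by (intro mult_mono) auto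
      then have "\<bar>2 * pi * of_int k\<bar> \<le> 2" using C \<delta>(1) unfolding k[symmetric] abs_mult by simp
      then have "2 * pi * \<bar>real_of_int k\<bar> \<le> 2" by (simp add: abs_mult)
      moreover have "2 * pi * \<bar>real_of_int k\<bar> \<ge> 2 * pi" if "k \<noteq> 0" using that by simp
      ultimately have "k = 0" using pi_gt3 by linarith
      then show "\<mu> = \<nu>" using k \<delta>(1) by simp
    qed
  qed
qed

text \<open>For each base point \<open>s1\<close> the twist by \<open>s1 - s\<close> gives an
  algebraic equation for the twisted \<open>F\<close> whose coefficients are holomorphic in a
  half-plane. For suitable \<open>s1\<close> it is nontrivial, because at \<open>s = s1\<close>
  nothing is twisted and one coefficient is the value of a nonzero series. As the exponentials in
  \<open>F\<close> are twisted too, several \<open>s1\<close> are used and \<open>F\<close> is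
  interpolated from them.\<close>

theorem relation_extension:
  fixes F G H K :: "complex fps" and c :: "nat \<Rightarrow> nat \<Rightarrow> complex poly"
  assumes Fc: "fps_conv_radius F \<ge> 1" and Hc: "fps_conv_radius H \<ge> 1" and Gc: "fps_conv_radius G \<ge> 1" and Kc: "fps_conv_radius K \<ge> 1"
    and \<zeta>: "norm \<zeta> = 1" and L: "L > 0" "L' > 0" "L / L' \<notin> \<rat>"
    and rel: "\<And>x. norm x < 1 \<Longrightarrow> (\<Sum>i\<le>D. \<Sum>j\<le>D. poly (c i j) x * eval_fps F x ^ i * eval_fps H x ^ (D - i)
        * (eval_fps G x ^ j * eval_fps K x ^ (D - j))) = 0"
    and F: "expansion L \<sigma> (\<lambda>s. eval_fps F (near_root \<zeta> s)) nF hF lF kF mF"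
    and H: "expansion L \<sigma> (\<lambda>s. eval_fps H (near_root \<zeta> s)) 1 hH lH kH mH"
    and G: "expansion L' \<sigma> (\<lambda>s. eval_fps G (near_root \<zeta> s)) nG hG lG kG mG"
    and K: "expansion L' \<sigma> (\<lambda>s. eval_fps K (near_root \<zeta> s)) nK hK lK kK mK"
    and i0: "i0 \<le> D" and E: "(\<Sum>j\<le>D. fps_of_poly (c i0 j) * (G ^ j * K ^ (D - j))) \<noteq> 0" and H0: "H \<noteq> 0"
    and B0: "line_ball \<sigma> B0"
  shows "\<exists>B'. line_ball \<sigma> B' \<and> B' \<subseteq> B0 \<and> (\<exists>\<phi>. \<phi> holomorphic_on B' \<and>
    (\<forall>s\<in>B'. Im s < pi / 2 \<longrightarrow> eval_fps F (near_root \<zeta> s) = eval_fps H (near_root \<zeta> s) * \<phi> s))"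
proof -
  have st: "of_real s \<in> strip" for s by (simp add: strip_def)
  have nr1: "norm (near_root \<zeta> s) < 1" if "s \<in> strip" for s by (rule near_root_strip[OF \<zeta> that])
  have irr: "(2 * pi / L') / (2 * pi / L) \<notin> \<rat>" using L by simp
  \<comment> \<open>The irrational ratio makes it possible to leave the frequency of
    \<open>L\<close> alone while factors of period \<open>L'\<close> are translated at unit
    speed.\<close>
  obtain \<eta> where \<eta>: "ratlin \<eta>" "\<eta> (2 * pi / L) = 0" "\<eta> (2 * pi / L') = 2 * pi / L'"
    by (rule ratlin_exists[OF _ irr, of "2 * pi / L'"]) (use L in simp, rule that)
  define S where "S = strip \<inter> {s. Re s > \<sigma>}"
  define Ft where "Ft = twisted \<eta> nF hF lF kF mF"
  define Ht where "Ht = twisted \<eta> 1 hH lH kH mH"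
  define Gt where "Gt s1 = twisted \<eta> nG hG lG kG (\<lambda>i _. mG i (of_real s1)) s1" for s1
  define Kt where "Kt s1 = twisted \<eta> nK hK lK kK (\<lambda>i _. mK i (of_real s1)) s1" for s1
  have Ft_hol: "Ft s1 holomorphic_on S" for s1 unfolding Ft_def S_def
    by (rule twisted_holomorphic[OF expansionD(3)[OF F]]) (auto intro: holomorphic_on_subset[OF expansionD(1)[OF F]])
  have Ht_hol: "Ht s1 holomorphic_on S" for s1 unfolding Ht_def S_def
    by (rule twisted_holomorphic[OF expansionD(3)[OF H]]) (auto intro: holomorphic_on_subset[OF expansionD(1)[OF H]])
  have Gt_hol: "Gt s1 holomorphic_on {s. Re s > \<sigma>}" for s1 unfolding Gt_def
    by (rule twisted_holomorphic[OF expansionD(3)[OF G]]) auto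
  have Kt_hol: "Kt s1 holomorphic_on {s. Re s > \<sigma>}" for s1 unfolding Kt_def
    by (rule twisted_holomorphic[OF expansionD(3)[OF K]]) auto
  \<comment> \<open>The twist for \<eta> multiplied by a real number \<open>w\<close>, which so far
    does not depend on \<open>s\<close>.\<close>
  define tw where "tw n h lam l m L w s = (\<Sum>i<n. h i (exp (- of_real s)) * (exp (- \<i> * of_real (\<eta> (Im (lam i)) * w)) * exp (- lam i * of_real s))
    * of_real s ^ l i * m i (of_real (s + \<eta> (2 * pi / L) * w * L / (2 * pi))))"
    for n :: nat and h :: "nat \<Rightarrow> complex \<Rightarrow> complex" and lam :: "nat \<Rightarrow> complex" and l :: "nat \<Rightarrow> nat"
      and m :: "nat \<Rightarrow> complex \<Rightarrow> complex" and L w s :: real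
  have tw_twist: "twist \<sigma> (\<lambda>x. \<eta> x * w) (\<lambda>s. y (of_real s)) (tw n h lam l m L w)"
    if "expansion L \<sigma> y n h lam l m" "L > 0" for L y n h lam l m w
    using twist_expansion[OF that, of "\<lambda>x. \<eta> x * w"] unfolding tw_def[abs_def] .
  have tw_poly: "twist \<sigma> \<eta>' (\<lambda>s. poly q (near_root \<zeta> (of_real s))) (\<lambda>s. poly q (near_root \<zeta> (of_real s)))" for q \<eta>'
  proof -
    have "(\<lambda>\<tau>. poly q (\<zeta> * exp (- \<tau>))) holomorphic_on ball 0 (exp (- \<sigma>))"
      by (induction q) (auto intro!: holomorphic_intros)
    from twist_holomorphic[OF this, of \<eta>'] show ?thesis by (simp only: near_root_def of_real_minus exp_of_real[symmetric])
  qed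
  \<comment> \<open>For fixed \<open>w\<close> the twisted relation holds at all
    \<open>s > \<sigma>\<close>; only then is it read at the one \<open>s\<close> with
    \<open>s + w = s1\<close>.\<close>
  have real_rel: "(\<Sum>i\<le>D. \<Sum>j\<le>D. poly (c i j) (near_root \<zeta> (of_real s)) * Ft s1 (of_real s) ^ i * Ht s1 (of_real s) ^ (D - i)
      * (Gt s1 (of_real s) ^ j * Kt s1 (of_real s) ^ (D - j))) = 0" if s: "s > \<sigma>" for s1 s
  proof -
    define w where "w = s1 - s"
    have shift0: "of_real (s + \<eta> (2 * pi / L) * w * L / (2 * pi)) = complex_of_real s" using \<eta>(2) by simp
    have shift1: "of_real (s + \<eta> (2 * pi / L') * w * L' / (2 * pi)) = complex_of_real s1" using \<eta>(3) L by (simp add: w_def)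
    have ew: "of_real (x * w) = of_real x * (of_real s1 - complex_of_real s)" for x by (simp add: w_def)
    have FT: "tw nF hF lF kF mF L w s = Ft s1 (of_real s)" and HT: "tw 1 hH lH kH mH L w s = Ht s1 (of_real s)"
      unfolding tw_def Ft_def Ht_def twisted_def shift0 ew by (simp_all only: mult.assoc)
    have GT: "tw nG hG lG kG mG L' w s = Gt s1 (of_real s)" and KT: "tw nK hK lK kK mK L' w s = Kt s1 (of_real s)"
      unfolding tw_def Gt_def Kt_def twisted_def shift1 ew by (simp_all only: mult.assoc)
    have "twist \<sigma> (\<lambda>x. \<eta> x * w)
      (\<lambda>s. \<Sum>i\<le>D. \<Sum>j\<le>D. poly (c i j) (near_root \<zeta> (of_real s)) * eval_fps F (near_root \<zeta> (of_real s)) ^ i * eval_fps H (near_root \<zeta> (of_real s)) ^ (D - i)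
        * (eval_fps G (near_root \<zeta> (of_real s)) ^ j * eval_fps K (near_root \<zeta> (of_real s)) ^ (D - j)))
      (\<lambda>s. \<Sum>i\<le>D. \<Sum>j\<le>D. poly (c i j) (near_root \<zeta> (of_real s)) * tw nF hF lF kF mF L w s ^ i * tw 1 hH lH kH mH L w s ^ (D - i)
        * (tw nG hG lG kG mG L' w s ^ j * tw nK hK lK kK mK L' w s ^ (D - j)))"
      by (intro twist_sum twist_mult twist_power tw_poly tw_twist[OF F L(1)] tw_twist[OF H L(1)] tw_twist[OF G L(2)] tw_twist[OF K L(2)])
    from twist_zero[OF this ratlin_mult[OF \<eta>(1)] _ s] rel[OF nr1[OF st]]
    have "(\<Sum>i\<le>D. \<Sum>j\<le>D. poly (c i j) (near_root \<zeta> (of_real s)) * tw nF hF lF kF mF L w s ^ i * tw 1 hH lH kH mH L w s ^ (D - i)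
        * (tw nG hG lG kG mG L' w s ^ j * tw nK hK lK kK mK L' w s ^ (D - j))) = 0" by blast
    then show ?thesis unfolding FT HT GT KT .
  qed
  define A where "A s1 i s = (\<Sum>j\<le>D. poly (c i j) (near_root \<zeta> s) * (Gt s1 s ^ j * Kt s1 s ^ (D - j)))" for s1 i s
  have A_hol: "A s1 i holomorphic_on {s. Re s > \<sigma>}" for s1 i unfolding A_def[abs_def]
    by (intro holomorphic_intros poly_near_root_holomorphic Gt_hol Kt_hol)
  have A_rel: "(\<Sum>i\<le>D. A s1 i s * Ft s1 s ^ i * Ht s1 s ^ (D - i)) = 0" if s: "s \<in> strip" "Re s > \<sigma>" for s1 s
  proof (rule real_ray_zero[where f = "\<lambda>s. \<Sum>i\<le>D. A s1 i s * Ft s1 s ^ i * Ht s1 s ^ (D - i)" and \<sigma> = \<sigma>])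
    have "A s1 i holomorphic_on S" for i by (rule holomorphic_on_subset[OF A_hol]) (auto simp: S_def)
    then show "(\<lambda>s. \<Sum>i\<le>D. A s1 i s * Ft s1 s ^ i * Ht s1 s ^ (D - i)) holomorphic_on strip \<inter> {s. \<sigma> < Re s}"
      unfolding S_def[symmetric] by (intro holomorphic_intros Ft_hol Ht_hol)
    show "(\<Sum>i\<le>D. A s1 i (of_real t) * Ft s1 (of_real t) ^ i * Ht s1 (of_real t) ^ (D - i)) = 0" if "t > \<sigma>" for t
      using real_rel[OF that, of s1] unfolding A_def sum_distrib_right by (simp only: mult_ac)
  qed (use s in simp_all)
  \<comment> \<open>There is only one term, so the twist multiplies \<open>H\<close> by a zero-free
    exponential, which can be moved into the extension.\<close>
  have Ht_eq: "Ht s1 s = exp (- \<i> * of_real (\<eta> (Im (lH 0))) * (of_real s1 - s)) * eval_fps H (near_root \<zeta> s)"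
    if "s \<in> strip" "Re s > \<sigma>" for s1 s
    using expansionD(4)[OF H that] unfolding Ht_def twisted_def by (simp add: mult_ac)
  \<comment> \<open>At \<open>s = s1\<close> the amount of twisting is 0.\<close>
  have diag: "Gt s1 (of_real s1) = eval_fps G (near_root \<zeta> (of_real s1))" "Kt s1 (of_real s1) = eval_fps K (near_root \<zeta> (of_real s1))"
    if "s1 > \<sigma>" for s1
    using expansionD(4)[OF G st, of s1] expansionD(4)[OF K st, of s1] that unfolding Gt_def Kt_def twisted_def by simp_all
  define e where "e = (\<Sum>j\<le>D. fps_of_poly (c i0 j) * (G ^ j * K ^ (D - j)))"
  have ec: "fps_conv_radius e \<ge> 1" unfolding e_def
    by (intro conv_radius_sum fps_conv_radius_mult_ge conv_radius_power conv_radius_fps_of_poly Gc Kc)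
  have e_eval: "eval_fps e (near_root \<zeta> (of_real s1)) = A s1 i0 (of_real s1)" if "s1 > \<sigma>" for s1
  proof -
    define x where "x = near_root \<zeta> (of_real s1)"
    have x: "norm x < 1" unfolding x_def by (rule nr1[OF st])
    have "eval_fps e x = (\<Sum>j\<le>D. eval_fps (fps_of_poly (c i0 j) * (G ^ j * K ^ (D - j))) x)" unfolding e_def
      by (intro eval_fps_sum_disc fps_conv_radius_mult_ge conv_radius_power conv_radius_fps_of_poly Gc Kc x)
    also have "\<dots> = (\<Sum>j\<le>D. poly (c i0 j) x * (eval_fps G x ^ j * eval_fps K x ^ (D - j)))"
    proof (rule sum.cong[OF refl])
      fix j
      have "eval_fps (fps_of_poly (c i0 j) * (G ^ j * K ^ (D - j))) x = eval_fps (fps_of_poly (c i0 j)) x * (eval_fps (G ^ j) x * eval_fps (K ^ (D - j)) x)"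
        using x Gc Kc by (simp only: eval_fps_mult_disc fps_conv_radius_mult_ge conv_radius_power conv_radius_fps_of_poly)
      then show "eval_fps (fps_of_poly (c i0 j) * (G ^ j * K ^ (D - j))) x = poly (c i0 j) x * (eval_fps G x ^ j * eval_fps K x ^ (D - j))"
        using x Gc Kc by (simp only: eval_fps_power_disc eval_fps_of_poly_disc)
    qed
    finally show ?thesis unfolding A_def diag[OF that] x_def .
  qed
  obtain s0 where s0: "s0 > \<sigma>" "eval_fps e (near_root \<zeta> (of_real s0)) \<noteq> 0"
    by (rule eval_near_root_nonzero[OF _ ec \<zeta>]) (use E in \<open>simp add: e_def\<close>, rule that)
  obtain b where b: "b > \<sigma>" "eval_fps H (near_root \<zeta> (of_real b)) \<noteq> 0"
    by (rule eval_near_root_nonzero[OF H0 Hc \<zeta>]) (rule that)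
  \<comment> \<open>By continuity the coefficient on the diagonal stays nonzero for base points
    slightly above \<open>s0\<close>; the interpolation nodes are placed there.\<close>
  obtain \<epsilon> where \<epsilon>: "\<epsilon> > 0" "\<And>t. 0 \<le> t \<Longrightarrow> t < \<epsilon> \<Longrightarrow> A (s0 + t) i0 (of_real (s0 + t)) \<noteq> 0"
  proof -
    define u where "u t = eval_fps e (near_root \<zeta> (of_real t))" for t :: real
    have "continuous_on UNIV u" unfolding u_def[abs_def]
      by (rule continuous_on_compose2[OF holomorphic_on_imp_continuous_on[OF eval_near_root_holomorphic[OF ec \<zeta>]]])
        (use st in \<open>auto intro!: continuous_intros\<close>)
    then have "continuous (at s0) u" by (simp add: continuous_on_eq_continuous_at)
    from continuous_at_avoid[OF this, of 0] s0(2) obtain d where d: "d > 0" "\<forall>t. dist s0 t < d \<longrightarrow> u t \<noteq> 0"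
      unfolding u_def by auto
    show thesis
    proof (rule that[OF d(1)])
      fix t assume t: "0 \<le> t" "t < d"
      then have "u (s0 + t) \<noteq> 0" using d(2) by (simp add: dist_real_def)
      then show "A (s0 + t) i0 (of_real (s0 + t)) \<noteq> 0" unfolding u_def using e_eval[of "s0 + t"] s0(1) t by simp
    qed
  qed
  \<comment> \<open>The phase speeds that the twist puts on the terms of \<open>F\<close>; the
    choice of \<eta> gives no control over them.\<close>
  define \<mu> where "\<mu> i = \<eta> (Im (lF i))" for i
  define M where "M = \<mu> ` {..<nF}"
  have fM: "finite M" by (simp add: M_def)
  obtain \<delta> where \<delta>: "\<delta> > 0" "\<And>k. k \<le> card M \<Longrightarrow> real k * \<delta> < \<epsilon>" "inj_on (\<lambda>\<mu>. exp (- \<i> * of_real (\<mu> * \<delta>))) M"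
    by (rule lagrange_step_exists[OF fM \<epsilon>(1)]) (rule that)
  obtain lg where lg': "\<forall>\<nu>\<in>M. \<forall>\<nu>'\<in>M. (\<Sum>k\<le>card M. lg \<nu> k * exp (- \<i> * of_real (\<nu>' * \<delta>)) ^ k) = (if \<nu> = \<nu>' then 1 else 0)"
    using lagrange_coefficients[OF fM \<delta>(3)] by (elim exE)
  have lg: "(\<Sum>k\<le>card M. lg \<nu> k * exp (- \<i> * of_real (\<nu>' * \<delta>)) ^ k) = (if \<nu> = \<nu>' then 1 else 0)"
    if "\<nu> \<in> M" "\<nu>' \<in> M" for \<nu> \<nu>' using lg'[rule_format, OF that] .
  define Q where "Q k B \<longleftrightarrow> (\<exists>\<phi>. \<phi> holomorphic_on B \<and>
    (\<forall>s\<in>B. Im s < pi / 2 \<longrightarrow> Ft (s0 + real k * \<delta>) s = eval_fps H (near_root \<zeta> s) * \<phi> s))" for k B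
  have "\<exists>B'. line_ball \<sigma> B' \<and> B' \<subseteq> B0 \<and> (\<forall>k<Suc (card M). Q k B')"
  proof (rule nested_refinement[where good = "line_ball \<sigma>" and Q = Q, OF _ _ B0])
    fix k B assume k: "k < Suc (card M)" and B: "line_ball \<sigma> B"
    define s1 where "s1 = s0 + real k * \<delta>"
    have k\<delta>: "0 \<le> real k * \<delta>" "real k * \<delta> < \<epsilon>" using k \<delta>(1) \<delta>(2)[of k] by simp_all
    have s1: "s1 > \<sigma>" using s0(1) k\<delta>(1) by (simp add: s1_def)
    have "\<exists>B'. line_ball \<sigma> B' \<and> B' \<subseteq> B \<and> (\<exists>\<phi>. \<phi> holomorphic_on B' \<and> (\<forall>s\<in>B'. Im s < pi / 2 \<longrightarrow> Ft s1 s = Ht s1 s * \<phi> s))"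
    proof (rule line_ball_extension[where d = D and A = "A s1" and ?i0.0 = i0 and a = "of_real s1" and b = "of_real b" and \<sigma> = \<sigma>])
      show "A s1 i0 (of_real s1) \<noteq> 0" unfolding s1_def by (rule \<epsilon>(2)[OF k\<delta>])
      show "Ht s1 (of_real b) \<noteq> 0" using b by (subst Ht_eq[OF st]) simp_all
      show "(\<Sum>i\<le>D. A s1 i s * Ft s1 s ^ i * Ht s1 s ^ (D - i)) = 0" if "s \<in> strip" "Re s > \<sigma>" for s by (rule A_rel[OF that])
    qed (use i0 s1 b st B A_hol Ft_hol Ht_hol in \<open>simp_all add: S_def\<close>)
    then obtain B' \<phi> where B': "line_ball \<sigma> B'" "B' \<subseteq> B" "\<phi> holomorphic_on B'"
      "\<forall>s\<in>B'. Im s < pi / 2 \<longrightarrow> Ft s1 s = Ht s1 s * \<phi> s" by (elim exE conjE)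
    have "Q k B'" unfolding Q_def s1_def[symmetric]
    proof (intro exI[of _ "\<lambda>s. exp (- \<i> * of_real (\<eta> (Im (lH 0))) * (of_real s1 - s)) * \<phi> s"] conjI ballI impI)
      show "(\<lambda>s. exp (- \<i> * of_real (\<eta> (Im (lH 0))) * (of_real s1 - s)) * \<phi> s) holomorphic_on B'"
        by (intro holomorphic_intros B'(3))
      fix s assume s: "s \<in> B'" "Im s < pi / 2"
      then have "s \<in> strip" "Re s > \<sigma>" using line_ball_lower[OF B'(1)] by blast+
      from Ht_eq[OF this, of s1] B'(4)[rule_format, OF s]
      show "Ft s1 s = eval_fps H (near_root \<zeta> s) * (exp (- \<i> * of_real (\<eta> (Im (lH 0))) * (of_real s1 - s)) * \<phi> s)"
        by (simp only: mult_ac)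
    qed
    then show "\<exists>B'. line_ball \<sigma> B' \<and> B' \<subseteq> B \<and> Q k B'" using B' by blast
  next
    fix k B B' assume "B' \<subseteq> B" "Q k B"
    then show "Q k B'" unfolding Q_def by (meson holomorphic_on_subset subsetD)
  qed
  then obtain B' where B': "line_ball \<sigma> B'" "B' \<subseteq> B0" "\<And>k. k \<le> card M \<Longrightarrow> Q k B'" by (auto simp: less_Suc_eq_le)
  have "\<forall>k\<in>{..card M}. \<exists>\<phi>. \<phi> holomorphic_on B' \<and> (\<forall>s\<in>B'. Im s < pi / 2 \<longrightarrow> Ft (s0 + real k * \<delta>) s = eval_fps H (near_root \<zeta> s) * \<phi> s)"
    using B'(3) unfolding Q_def by blast
  from bchoice[OF this] obtain \<phi> where \<phi>: "\<forall>k\<in>{..card M}. \<phi> k holomorphic_on B' \<and>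
    (\<forall>s\<in>B'. Im s < pi / 2 \<longrightarrow> Ft (s0 + real k * \<delta>) s = eval_fps H (near_root \<zeta> s) * \<phi> k s)" by (elim exE)
  \<comment> \<open>Interpolation weights: the Lagrange row of \<nu> picks out the terms with phase
    speed \<nu>, and the exponential removes the phase that the twist at base point
    \<open>s0\<close> gave them. The weights are entire in \<open>s\<close>, so they preserve
    holomorphy.\<close>
  define C where "C k s = (\<Sum>\<nu>\<in>M. lg \<nu> k * exp (- \<i> * of_real \<nu> * (s - of_real s0)))" for k s
  have interp: "eval_fps F (near_root \<zeta> s) = (\<Sum>k\<le>card M. C k s * Ft (s0 + real k * \<delta>) s)" if s: "s \<in> strip" "Re s > \<sigma>" for s
  proof -
    define T where "T i = hF i (exp (- s)) * exp (- lF i * s) * s ^ kF i * mF i s" for i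
    have FtT: "Ft (s0 + real k * \<delta>) s = (\<Sum>i<nF. T i * exp (- \<i> * of_real (\<mu> i) * (of_real s0 - s)) * exp (- \<i> * of_real (\<mu> i * \<delta>)) ^ k)" for k
      unfolding Ft_def twisted_def
    proof (rule sum.cong[OF refl])
      fix i
      have "exp (- \<i> * of_real (\<eta> (Im (lF i))) * (of_real (s0 + real k * \<delta>) - s))
        = exp (- \<i> * of_real (\<mu> i) * (of_real s0 - s)) * exp (- \<i> * of_real (\<mu> i * \<delta>)) ^ k"
        unfolding \<mu>_def exp_of_nat_mult[symmetric] exp_add[symmetric] by (rule arg_cong[of _ _ exp]) (simp add: algebra_simps)
      then show "hF i (exp (- s)) * (exp (- \<i> * of_real (\<eta> (Im (lF i))) * (of_real (s0 + real k * \<delta>) - s)) * exp (- lF i * s)) * s ^ kF i * mF i s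
        = T i * exp (- \<i> * of_real (\<mu> i) * (of_real s0 - s)) * exp (- \<i> * of_real (\<mu> i * \<delta>)) ^ k"
        unfolding T_def by (simp only: mult_ac)
    qed
    have "(\<Sum>k\<le>card M. C k s * Ft (s0 + real k * \<delta>) s)
      = (\<Sum>i<nF. T i * exp (- \<i> * of_real (\<mu> i) * (of_real s0 - s)) * (\<Sum>k\<le>card M. C k s * exp (- \<i> * of_real (\<mu> i * \<delta>)) ^ k))"
      unfolding FtT sum_distrib_left by (subst sum.swap) (simp only: mult_ac)
    also have "\<dots> = (\<Sum>i<nF. T i)"
    proof (rule sum.cong[OF refl])
      fix i assume "i \<in> {..<nF}"
      then have \<mu>i: "\<mu> i \<in> M" by (simp add: M_def)
      have "(\<Sum>k\<le>card M. C k s * exp (- \<i> * of_real (\<mu> i * \<delta>)) ^ k)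
        = (\<Sum>\<nu>\<in>M. exp (- \<i> * of_real \<nu> * (s - of_real s0)) * (\<Sum>k\<le>card M. lg \<nu> k * exp (- \<i> * of_real (\<mu> i * \<delta>)) ^ k))"
        unfolding C_def sum_distrib_left sum_distrib_right by (subst sum.swap) (simp only: mult_ac)
      also have "\<dots> = (\<Sum>\<nu>\<in>M. if \<nu> = \<mu> i then exp (- \<i> * of_real (\<mu> i) * (s - of_real s0)) else 0)"
        by (rule sum.cong[OF refl]) (simp only: lg[OF _ \<mu>i], simp)
      also have "\<dots> = exp (- \<i> * of_real (\<mu> i) * (s - of_real s0))" using fM \<mu>i by (simp add: sum.delta)
      finally have c: "(\<Sum>k\<le>card M. C k s * exp (- \<i> * of_real (\<mu> i * \<delta>)) ^ k) = exp (- \<i> * of_real (\<mu> i) * (s - of_real s0))" .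
      have "exp (- \<i> * of_real (\<mu> i) * (of_real s0 - s)) * exp (- \<i> * of_real (\<mu> i) * (s - of_real s0)) = 1"
        unfolding exp_add[symmetric] by (simp add: algebra_simps)
      then show "T i * exp (- \<i> * of_real (\<mu> i) * (of_real s0 - s)) * (\<Sum>k\<le>card M. C k s * exp (- \<i> * of_real (\<mu> i * \<delta>)) ^ k) = T i"
        unfolding c mult.assoc by simp
    qed
    finally show ?thesis using expansionD(4)[OF F s] unfolding T_def by simp
  qed
  have "(\<lambda>s. \<Sum>k\<le>card M. C k s * \<phi> k s) holomorphic_on B'"
    unfolding C_def using \<phi> by (intro holomorphic_intros) auto
  moreover have "eval_fps F (near_root \<zeta> s) = eval_fps H (near_root \<zeta> s) * (\<Sum>k\<le>card M. C k s * \<phi> k s)"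
    if s: "s \<in> B'" "Im s < pi / 2" for s
  proof -
    have "s \<in> strip" "Re s > \<sigma>" using line_ball_lower[OF B'(1) s] by blast+
    from interp[OF this] have "eval_fps F (near_root \<zeta> s) = (\<Sum>k\<le>card M. C k s * Ft (s0 + real k * \<delta>) s)" .
    also have "\<dots> = (\<Sum>k\<le>card M. C k s * (eval_fps H (near_root \<zeta> s) * \<phi> k s))"
      using \<phi> s by (intro sum.cong refl) simp
    finally show ?thesis by (simp only: sum_distrib_left mult_ac)
  qed
  ultimately show ?thesis using B'(1,2) by blast
qed

section \<open>Roots of unity of prime order\<close>

lemma root_of_unity_coprime:
  fixes z :: complex
  assumes "z ^ a = 1" "z ^ b = 1" "coprime a b"
  shows "z = 1"
proof (cases "a = 0")
  case True
  then show ?thesis using assms by simp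
next
  case False
  then obtain x y where "a * x = b * y + gcd a b" using bezout_nat by blast
  then have e: "a * x = b * y + 1" using assms(3) by simp
  have "z ^ (a * x) = 1" using assms(1) by (simp add: power_mult)
  moreover have "z ^ (b * y + 1) = z" using assms(2) by (simp add: power_mult)
  ultimately show ?thesis using e by simp
qed

text \<open>A number \<open>z \<noteq> 1\<close> satisfies \<open>z ^ N = 1\<close> for at most one
  prime \<open>N\<close>, and \<open>q\<close> has finitely many roots.\<close>

lemma finite_bad_primes:
  fixes q :: "complex poly"
  assumes "q \<noteq> 0"
  shows "finite {N. prime N \<and> (\<exists>z. z \<noteq> 1 \<and> z ^ N = 1 \<and> poly q z = 0)}"
proof -
  have fin: "finite {N::nat. prime N \<and> z ^ N = 1}" if "z \<noteq> 1" for z :: complex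
  proof (cases "\<exists>N0. prime N0 \<and> z ^ N0 = 1")
    case True
    then obtain N0 where N0: "prime N0" "z ^ N0 = 1" by blast
    have "{N::nat. prime N \<and> z ^ N = 1} \<subseteq> {N0}"
      using root_of_unity_coprime[OF N0(2)] primes_coprime[OF N0(1)] that by blast
    then show ?thesis by (rule finite_subset) simp
  next
    case False
    then have "{N::nat. prime N \<and> z ^ N = 1} = {}" by blast
    then show ?thesis by (simp only: finite.emptyI)
  qed
  have "{N. prime N \<and> (\<exists>z. z \<noteq> 1 \<and> z ^ N = 1 \<and> poly q z = 0)}
    = (\<Union>z\<in>{z. poly q z = 0} - {1}. {N. prime N \<and> z ^ N = 1})" by blast
  also have "finite \<dots>" using poly_roots_finite[OF assms] fin by (intro finite_UN_I) auto
  finally show ?thesis .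
qed

text \<open>For a large prime \<open>N\<close> the next multiple of \<open>2 * pi / N\<close> above
  the argument of \<open>x0\<close> is close to it. Being positive and below \<open>2 * pi\<close>,
  it does not give the root 1.\<close>

lemma prime_roots_dense:
  fixes x0 :: complex
  assumes x0: "norm x0 = 1" and U: "open U" "x0 \<in> U" and bad: "finite bad"
  obtains N \<zeta> where "prime N" "N > N0" "N \<notin> bad" "\<zeta> \<in> U" "\<zeta> ^ N = 1" "\<zeta> \<noteq> 1"
proof -
  define \<theta> where "\<theta> = Arg2pi x0"
  have \<theta>: "0 \<le> \<theta>" "\<theta> < 2 * pi" unfolding \<theta>_def using Arg2pi[of x0] by auto
  have x0\<theta>: "x0 = exp (\<i> * of_real \<theta>)" unfolding \<theta>_def using Arg2pi_eq[of x0] x0 by simp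
  \<comment> \<open>The added 1 makes the angle strictly larger than \<theta>, hence positive even
    for \<open>x0 = 1\<close>.\<close>
  define k where "k N = nat \<lfloor>real N * \<theta> / (2 * pi)\<rfloor> + 1" for N :: nat
  define a where "a N = 2 * pi * real (k N) / real N" for N
  have k: "real N * \<theta> / (2 * pi) < real (k N)" "real (k N) \<le> real N * \<theta> / (2 * pi) + 1" for N
  proof -
    have "real N * \<theta> / (2 * pi) \<ge> 0" using \<theta> by simp
    then show "real N * \<theta> / (2 * pi) < real (k N)" "real (k N) \<le> real N * \<theta> / (2 * pi) + 1"
      unfolding k_def by linarith+
  qed
  have ak: "\<theta> < a N" "a N \<le> \<theta> + 2 * pi / real N" if "N > 0" for N
  proof -
    show "\<theta> < a N" using k(1)[of N] that unfolding a_def by (simp add: field_simps)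
    have "2 * pi * real (k N) / real N \<le> 2 * pi * (real N * \<theta> / (2 * pi) + 1) / real N"
      by (intro divide_right_mono mult_left_mono k) auto
    also have "\<dots> = \<theta> + 2 * pi / real N" using that by (simp add: add_divide_distrib distrib_left)
    finally show "a N \<le> \<theta> + 2 * pi / real N" unfolding a_def .
  qed
  have "isCont (\<lambda>t. exp (\<i> * complex_of_real t)) \<theta>" by (intro continuous_intros)
  moreover obtain e where e: "e > 0" "ball x0 e \<subseteq> U" using U by (meson openE)
  ultimately obtain d where d: "d > 0" "\<And>t. dist t \<theta> < d \<Longrightarrow> dist (exp (\<i> * complex_of_real t)) (exp (\<i> * complex_of_real \<theta>)) < e"
    unfolding continuous_at_eps_delta by metis
  define g where "g = min d (2 * pi - \<theta>)"
  have g: "g > 0" using d \<theta> by (simp add: g_def)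
  obtain N1 :: nat where N1: "2 * pi / g < real N1" using reals_Archimedean2 by blast
  define N2 where "N2 = Max (insert N0 (insert N1 bad))"
  have N2: "N0 \<le> N2" "N1 \<le> N2" "\<And>x. x \<in> bad \<Longrightarrow> x \<le> N2"
    unfolding N2_def by (intro Max_ge; use bad in simp)+
  obtain N where N: "prime N" "N > N2" using bigger_prime by blast
  have N0': "N > 0" using N by simp
  have "real N1 < real N" using N(2) N2(2) by simp
  then have "2 * pi / g < real N" using N1 by linarith
  then have small: "2 * pi / real N < g" using g N0' by (simp add: field_simps)
  define \<zeta> where "\<zeta> = exp (\<i> * of_real (a N))"
  show thesis
  proof (rule that[of N \<zeta>])
    show "prime N" "N > N0" using N N2 by simp_all
    show "N \<notin> bad" using N(2) N2(3)[of N] by auto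
    have "dist (a N) \<theta> < d" using ak[OF N0'] small unfolding g_def dist_real_def by simp
    from d(2)[OF this] show "\<zeta> \<in> U" by (intro subsetD[OF e(2)]) (simp add: \<zeta>_def x0\<theta> dist_commute)
    have Na: "real N * a N = 2 * pi * real (k N)" using N0' by (simp add: a_def)
    have "exp (of_nat N * (\<i> * complex_of_real (a N))) = 1"
      unfolding exp_eq_1 by (intro conjI exI[of _ "int (k N)"]) (simp_all add: Na)
    then show "\<zeta> ^ N = 1" by (simp add: \<zeta>_def exp_of_nat_mult)
    show "\<zeta> \<noteq> 1"
    proof
      assume "\<zeta> = 1"
      then obtain n :: int where n: "Im (\<i> * of_real (a N)) = of_int (2 * n) * pi" unfolding \<zeta>_def exp_eq_1 by blast
      have "0 < a N" "a N < 2 * pi" using ak[OF N0'] small \<theta> unfolding g_def by auto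
      then have "0 < of_int n * (2 * pi)" "of_int n * (2 * pi) < 1 * (2 * pi)" using n by simp_all
      then have "0 < real_of_int n" "real_of_int n < 1" by (simp_all add: zero_less_mult_iff)
      then have "0 < n" "n < 1" by simp_all
      then show False by simp
    qed
  qed
qed

lemma log_ratio_irrational:
  assumes "mult_independent p1 p2" "p1 \<ge> 2" "p2 \<ge> 2"
  shows "ln (real p1) / ln (real p2) \<notin> \<rat>"
proof
  assume "ln (real p1) / ln (real p2) \<in> \<rat>"
  then obtain a b :: int where ab: "b > 0" "ln (real p1) / ln (real p2) = of_int a / of_int b" by (rule Rats_cases') auto
  have l: "ln (real p1) > 0" "ln (real p2) > 0" using assms by auto
  have eq: "of_int b * ln (real p1) = of_int a * ln (real p2)" using ab l by (simp add: field_simps)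
  have "real p1 powi b * real p2 powi (- a) = exp (of_int b * ln (real p1)) * exp (of_int (- a) * ln (real p2))"
    using assms by (simp add: powr_real_of_int'[symmetric] powr_def)
  also have "\<dots> = 1" unfolding exp_add[symmetric] using eq by simp
  finally have "b = 0" using assms(1) unfolding mult_independent_def by blast
  then show False using ab by simp
qed

text \<open>Fermat's little theorem gives the exponent \<open>N - 1\<close> for every base below
  \<open>N\<close>, so with two bases the periods are in the ratio of the logarithms of the
  bases.\<close>

lemma fermat_root:
  fixes \<zeta> :: complex
  assumes N: "prime N" "N > p" "p \<ge> 2" and \<zeta>: "\<zeta> ^ N = 1" "\<zeta> \<noteq> 1"
  shows "\<zeta> ^ (p ^ (N - 1)) = \<zeta>" "\<zeta> ^ (p ^ k) \<noteq> 1"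
proof -
  have nd: "\<not> N dvd p" using N by (auto dest: dvd_imp_le)
  then have "[p ^ (N - 1) = 1] (mod N)" by (rule fermat_theorem[OF N(1)])
  moreover have "p ^ (N - 1) \<ge> 1" using N by simp
  ultimately obtain t where "p ^ (N - 1) = 1 + N * t"
    using cong_le_nat[of 1 "p ^ (N - 1)" N] by (auto simp: cong_sym_eq mult.commute add.commute)
  then show "\<zeta> ^ (p ^ (N - 1)) = \<zeta>" using \<zeta>(1) by (simp add: power_add power_mult)
  show "\<zeta> ^ (p ^ k) \<noteq> 1"
  proof
    assume "\<zeta> ^ (p ^ k) = 1"
    moreover have "coprime (p ^ k) N"
      using prime_imp_coprime[OF N(1) nd] by (simp add: coprime_commute)
    ultimately show False using root_of_unity_coprime[OF _ \<zeta>(1)] \<zeta>(2) by blast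
  qed
qed

theorem theorem1p6:
  fixes p1 p2 :: nat and f g :: "complex fps"
  assumes "mult_independent p1 p2"
    and "is_mahler p1 f"
    and "is_mahler p2 g"
    and "\<not> is_rational_fps f"
    and "\<not> is_rational_fps g"
  shows "alg_independent_fps f g"
  unfolding alg_independent_fps_def
proof
  assume "alg_dependent_fps f g"
  then obtain D c i0 j0 where ij: "i0 \<le> D" "j0 \<le> D" "c i0 j0 \<noteq> 0"
    and rel: "(\<Sum>i\<le>D. \<Sum>j\<le>D. fps_of_poly (c i j) * f ^ i * g ^ j) = 0" unfolding alg_dependent_fps_def by blast
  obtain n a b cf F H where p1: "p1 \<ge> 2" and n: "n \<ge> 1" and an: "a n \<noteq> 0"
    and feq: "(\<Sum>i\<le>n. fps_of_poly (a i) * (f oo fps_X ^ (p1 ^ i))) = 0"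
    and b: "b \<noteq> 0" and Heq: "H = fps_of_poly b * (H oo fps_X ^ p1)" and H0: "fps_nth H 0 = 1" and F: "F = H * f"
    and cf: "cf 0 \<noteq> 0" "cf n \<noteq> 0" and Feq: "(\<Sum>i\<le>n. fps_of_poly (cf i) * (F oo fps_X ^ (p1 ^ i))) = 0"
    and Fc: "fps_conv_radius F \<ge> 1" and Hc: "fps_conv_radius H \<ge> 1"
    by (rule mahler_normal_form[OF assms(2,4)]) (rule that)
  obtain n' a' b' cg G K where p2: "p2 \<ge> 2" and n': "n' \<ge> 1" and an': "a' n' \<noteq> 0"
    and geq: "(\<Sum>i\<le>n'. fps_of_poly (a' i) * (g oo fps_X ^ (p2 ^ i))) = 0"
    and b': "b' \<noteq> 0" and Keq: "K = fps_of_poly b' * (K oo fps_X ^ p2)" and K0: "fps_nth K 0 = 1" and G: "G = K * g"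
    and cg: "cg 0 \<noteq> 0" "cg n' \<noteq> 0" and Geq: "(\<Sum>i\<le>n'. fps_of_poly (cg i) * (G oo fps_X ^ (p2 ^ i))) = 0"
    and Gc: "fps_conv_radius G \<ge> 1" and Kc: "fps_conv_radius K \<ge> 1"
    by (rule mahler_normal_form[OF assms(3,5)]) (rule that)
  have Hn: "H \<noteq> 0" and Kn: "K \<noteq> 0" using H0 K0 by auto
  have Kpow: "K ^ D = K ^ j * K ^ (D - j)" and Hpow: "H ^ D = H ^ j * H ^ (D - j)" if "j \<le> D" for j
    using that by (simp_all flip: power_add)
  \<comment> \<open>Row \<open>i0\<close> of the relation is a nonzero polynomial in
    \<open>g\<close>, so by the transcendence of \<open>g\<close> the coefficient of
    \<open>f ^ i0\<close> is not zero.\<close>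
  have "(\<Sum>j\<le>D. fps_of_poly (c i0 j) * g ^ j) \<noteq> 0"
    by (rule mahler_transcendental[where d = "c i0" and ?j0.0 = j0, OF p2 n' an' geq K0 G Gc Kc assms(5) ij(2,3)])
  moreover have "(\<Sum>j\<le>D. fps_of_poly (c i0 j) * (G ^ j * K ^ (D - j))) = K ^ D * (\<Sum>j\<le>D. fps_of_poly (c i0 j) * g ^ j)"
    unfolding sum_distrib_left
    by (rule sum.cong[OF refl]) (simp only: Kpow atMost_iff G power_mult_distrib mult_ac)
  ultimately have E: "(\<Sum>j\<le>D. fps_of_poly (c i0 j) * (G ^ j * K ^ (D - j))) \<noteq> 0" using Kn by simp
  \<comment> \<open>Homogenised separately in \<open>F\<close>, \<open>H\<close> and in
    \<open>G\<close>, \<open>K\<close>, so that all series involved converge in the disc.\<close>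
  have rel_fps: "(\<Sum>i\<le>D. \<Sum>j\<le>D. fps_of_poly (c i j) * F ^ i * H ^ (D - i) * (G ^ j * K ^ (D - j))) = 0"
  proof -
    have "(\<Sum>i\<le>D. \<Sum>j\<le>D. fps_of_poly (c i j) * F ^ i * H ^ (D - i) * (G ^ j * K ^ (D - j)))
      = (H ^ D * K ^ D) * (\<Sum>i\<le>D. \<Sum>j\<le>D. fps_of_poly (c i j) * f ^ i * g ^ j)"
      unfolding sum_distrib_left
    proof (intro sum.cong refl)
      fix i j assume "i \<in> {..D}" "j \<in> {..D}"
      then have "H ^ D = H ^ i * H ^ (D - i)" "K ^ D = K ^ j * K ^ (D - j)" by (auto intro: Kpow Hpow)
      then show "fps_of_poly (c i j) * F ^ i * H ^ (D - i) * (G ^ j * K ^ (D - j)) = (H ^ D * K ^ D) * (fps_of_poly (c i j) * f ^ i * g ^ j)"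
        unfolding F G by (simp only: power_mult_distrib mult_ac)
    qed
    then show ?thesis using rel by simp
  qed
  have rel_eval: "(\<Sum>i\<le>D. \<Sum>j\<le>D. poly (c i j) x * eval_fps F x ^ i * eval_fps H x ^ (D - i) * (eval_fps G x ^ j * eval_fps K x ^ (D - j))) = 0"
    if x: "norm x < 1" for x
  proof -
    note cr = fps_conv_radius_mult_ge conv_radius_power conv_radius_fps_of_poly Fc Hc Gc Kc
    have "0 = eval_fps (\<Sum>i\<le>D. \<Sum>j\<le>D. fps_of_poly (c i j) * F ^ i * H ^ (D - i) * (G ^ j * K ^ (D - j))) x"
      unfolding rel_fps by simp
    also have "\<dots> = (\<Sum>i\<le>D. eval_fps (\<Sum>j\<le>D. fps_of_poly (c i j) * F ^ i * H ^ (D - i) * (G ^ j * K ^ (D - j))) x)"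
      by (intro eval_fps_sum_disc conv_radius_sum cr x)
    also have "\<dots> = (\<Sum>i\<le>D. \<Sum>j\<le>D. eval_fps (fps_of_poly (c i j) * F ^ i * H ^ (D - i) * (G ^ j * K ^ (D - j))) x)"
      by (intro sum.cong refl eval_fps_sum_disc cr x)
    also have "\<dots> = (\<Sum>i\<le>D. \<Sum>j\<le>D. poly (c i j) x * eval_fps F x ^ i * eval_fps H x ^ (D - i) * (eval_fps G x ^ j * eval_fps K x ^ (D - j)))"
      by (intro sum.cong refl) (simp only: eval_fps_mult_disc eval_fps_power_disc eval_fps_of_poly_disc cr x)
    finally show ?thesis by simp
  qed
  \<comment> \<open>All polynomials that must not vanish at powers of \<zeta> other than 1,
    collected in one product.\<close>
  define q where "q = b * b' * cf 0 * cf n * cg 0 * cg n'"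
  have q: "q \<noteq> 0" unfolding q_def using b b' cf cg by simp
  have "is_rational_fps f"
  proof (rule dense_extension_rational[OF p1 n an feq H0 F Fc Hc])
    fix B assume "circle_ball B"
    then obtain x0 r where x0: "B = ball x0 r" "r > 0" "norm x0 = 1" unfolding circle_ball_def by blast
    then have B: "open B" "x0 \<in> B" by auto
    obtain N \<zeta> where N: "prime N" "N > max p1 p2" "N \<notin> {N. prime N \<and> (\<exists>z. z \<noteq> 1 \<and> z ^ N = 1 \<and> poly q z = 0)}"
      and \<zeta>: "\<zeta> \<in> B" "\<zeta> ^ N = 1" "\<zeta> \<noteq> 1"
      by (rule prime_roots_dense[OF x0(3) B finite_bad_primes[OF q]]) (rule that)
    have N0: "N > 0" "N - 1 > 0" "N > p1" "N > p2" using N p1 by auto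
    have \<zeta>n: "norm \<zeta> = 1" by (rule root_of_unity_norm[OF \<zeta>(2) N0(1)])
    have qz: "poly q (\<zeta> ^ k) \<noteq> 0 \<or> \<zeta> ^ k = 1" for k
    proof -
      have "(\<zeta> ^ k) ^ N = 1" using \<zeta>(2) by (simp add: mult.commute[of k] power_mult flip: power_mult) (simp add: power_mult mult.commute \<zeta>(2))
      then show ?thesis using N(1,3) by blast
    qed
    have nz: "poly b (\<zeta> ^ k) \<noteq> 0 \<or> \<zeta> ^ k = 1" "poly b' (\<zeta> ^ k) \<noteq> 0 \<or> \<zeta> ^ k = 1"
      "poly (cf 0) (\<zeta> ^ k) \<noteq> 0 \<or> \<zeta> ^ k = 1" "poly (cf n) (\<zeta> ^ k) \<noteq> 0 \<or> \<zeta> ^ k = 1"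
      "poly (cg 0) (\<zeta> ^ k) \<noteq> 0 \<or> \<zeta> ^ k = 1" "poly (cg n') (\<zeta> ^ k) \<noteq> 0 \<or> \<zeta> ^ k = 1" for k
      using qz[of k] unfolding q_def by auto
    note f1 = fermat_root[OF N(1) N0(3) p1 \<zeta>(2,3)] and f2 = fermat_root[OF N(1) N0(4) p2 \<zeta>(2,3)]
    define L where "L = real (N - 1) * ln (real p1)"
    define L' where "L' = real (N - 1) * ln (real p2)"
    have L: "L > 0" "L' > 0" unfolding L_def L'_def using N0 p1 p2 by simp_all
    have irr: "L / L' \<notin> \<rat>" unfolding L_def L'_def using log_ratio_irrational[OF assms(1) p1 p2] N0 by simp
    have "qexp L (\<lambda>s. eval_fps F (near_root \<zeta> s))" unfolding L_def
      by (rule qexp_mahler[OF Fc p1 n Feq \<zeta>n f1(1) N0(2) nz(3,4) f1(2)])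
    then obtain \<sigma>1 nF hF lF kF mF where eF: "expansion L \<sigma>1 (\<lambda>s. eval_fps F (near_root \<zeta> s)) nF hF lF kF mF"
      using expansion_exists by blast
    have "qexp L' (\<lambda>s. eval_fps G (near_root \<zeta> s))" unfolding L'_def
      by (rule qexp_mahler[OF Gc p2 n' Geq \<zeta>n f2(1) N0(2) nz(5,6) f2(2)])
    then obtain \<sigma>2 nG hG lG kG mG where eG: "expansion L' \<sigma>2 (\<lambda>s. eval_fps G (near_root \<zeta> s)) nG hG lG kG mG"
      using expansion_exists by blast
    \<comment> \<open>Stated for a general base, since it serves \<open>H\<close> and
      \<open>K\<close> alike.\<close>
    have single: "\<exists>\<sigma> h lam l m. expansion (real (N - 1) * ln (real p)) \<sigma> (\<lambda>s. eval_fps J (near_root \<zeta> s)) 1 h lam l m"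
      if J: "fps_conv_radius J \<ge> 1" "p \<ge> 2" "J = fps_of_poly d * (J oo fps_X ^ p)" "\<zeta> ^ (p ^ (N - 1)) = \<zeta>"
        "\<And>k. poly d (\<zeta> ^ k) \<noteq> 0 \<or> \<zeta> ^ k = 1" "\<And>k. \<zeta> ^ (p ^ k) \<noteq> 1" for J p d
    proof -
      obtain u \<rho> lam m where u: "\<rho> > 0" "u holomorphic_on ball 0 \<rho>" 
        and m: "m holomorphic_on strip" "\<And>s. s \<in> strip \<Longrightarrow> m (s + of_real (real (N - 1) * ln (real p))) = m s"
        and ev: "eventually (\<lambda>s. eval_fps J (near_root \<zeta> s) = u (exp (- s)) * exp (- lam * s) * m s) strip_top"
        by (rule rank_one_mahler[OF J(1,2,3) \<zeta>n J(4) N0(2) J(5,6)]) (rule that)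
      obtain \<sigma>' where \<sigma>': "\<forall>s\<in>strip. Re s > \<sigma>' \<longrightarrow> eval_fps J (near_root \<zeta> s) = u (exp (- s)) * exp (- lam * s) * m s"
        using ev unfolding eventually_strip_top by blast
      define \<sigma> where "\<sigma> = max \<sigma>' (- ln \<rho>)"
      have "exp (- \<sigma>) \<le> exp (ln \<rho>)" unfolding \<sigma>_def by (subst exp_le_cancel_iff) linarith
      then have "ball (0::complex) (exp (- \<sigma>)) \<subseteq> ball 0 \<rho>" using u(1) by (intro subset_ball) simp
      then have "u holomorphic_on ball 0 (exp (- \<sigma>))" by (rule holomorphic_on_subset[OF u(2)])
      then have "expansion (real (N - 1) * ln (real p)) \<sigma> (\<lambda>s. eval_fps J (near_root \<zeta> s)) 1 (\<lambda>_. u) (\<lambda>_. lam) (\<lambda>_. 0) (\<lambda>_. m)"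
        unfolding expansion_def using m \<sigma>' by (auto simp: \<sigma>_def)
      then show ?thesis by blast
    qed
    obtain \<sigma>3 hH lH kH mH where eH: "expansion L \<sigma>3 (\<lambda>s. eval_fps H (near_root \<zeta> s)) 1 hH lH kH mH"
      using single[OF Hc p1 Heq f1(1) nz(1) f1(2)] unfolding L_def by (elim exE)
    obtain \<sigma>4 hK lK kK mK where eK: "expansion L' \<sigma>4 (\<lambda>s. eval_fps K (near_root \<zeta> s)) 1 hK lK kK mK"
      using single[OF Kc p2 Keq f2(1) nz(2) f2(2)] unfolding L'_def by (elim exE)
    obtain \<sigma>0 where \<sigma>0: "\<sigma>0 \<ge> 0" "\<And>s. Re s > \<sigma>0 \<Longrightarrow> near_root \<zeta> s \<in> B"
      by (rule near_root_tends[OF B(1) \<zeta>(1)]) (rule that)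
    \<comment> \<open>Beyond \<sigma> all four expansions hold and \<open>near_root\<close> stays in
      \<open>B\<close>; as \<open>\<sigma>0 \<ge> 0\<close>, it also gives the positive real part
      that \<open>extends_transfer\<close> asks for.\<close>
    define \<sigma> where "\<sigma> = Max {\<sigma>0, \<sigma>1, \<sigma>2, \<sigma>3, \<sigma>4}"
    have le: "\<sigma>0 \<le> \<sigma>" "\<sigma>1 \<le> \<sigma>" "\<sigma>2 \<le> \<sigma>" "\<sigma>3 \<le> \<sigma>" "\<sigma>4 \<le> \<sigma>" by (simp_all add: \<sigma>_def)
    obtain B0 where B0: "line_ball \<sigma> B0" using line_ball_exists by blast
    obtain B1 \<phi> where B1: "line_ball \<sigma> B1" "\<phi> holomorphic_on B1"
      "\<forall>s\<in>B1. Im s < pi / 2 \<longrightarrow> eval_fps F (near_root \<zeta> s) = eval_fps H (near_root \<zeta> s) * \<phi> s"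
    proof -
      have "\<exists>B'. line_ball \<sigma> B' \<and> B' \<subseteq> B0 \<and> (\<exists>\<phi>. \<phi> holomorphic_on B' \<and>
          (\<forall>s\<in>B'. Im s < pi / 2 \<longrightarrow> eval_fps F (near_root \<zeta> s) = eval_fps H (near_root \<zeta> s) * \<phi> s))"
        by (rule relation_extension[OF Fc Hc Gc Kc \<zeta>n L irr rel_eval expansion_mono[OF eF le(2)] expansion_mono[OF eH le(4)]
          expansion_mono[OF eG le(3)] expansion_mono[OF eK le(5)] ij(1) E Hn B0])
      then show thesis by (elim exE conjE) (rule that)
    qed
    obtain z r1 where z: "B1 = ball z r1" "0 < r1" "Im z = pi / 2" "\<forall>s\<in>B1. Re s > \<sigma>"
      using B1(1) unfolding line_ball_def by blast
    then have zR: "Re z > \<sigma>" by simp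
    then have zR0: "Re z > \<sigma>0" "Re z > 0" using le(1) \<sigma>0(1) by linarith+
    show "\<exists>B'. circle_ball B' \<and> B' \<subseteq> B \<and> extends_on F H 1 B'"
      by (rule extends_transfer[OF \<zeta>n z(3) zR0(2) z(2) _ _ B(1) \<sigma>0(2)[OF zR0(1)]]) (use B1 z(1) in auto)
  qed
  then show False using assms(4) by blast
qed

end
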